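(* Let $n\ge 2$, $m\ge 1$ be integers and $1<p<\infty$, and set $p'=\frac{p}{p-1}$. Define \[ C(n,m,p)=\begin{cases}\left(\frac{(n-1)^2}{pp'}\right)^{m/2} & \text{if } m \text{ is even},\\[2pt] \frac{n-1}{p}\left(\frac{(n-1)^2}{pp'}\right)^{(m-1)/2} & \text{if } m \text{ is odd}.\end{cases} \] Assume $1<q<\infty$ if $m$ is even, and $1<q\le p$ if $m$ is odd. Then \[ \|\nabla_g^m u\|_{p,q}^q\ \ge\ C(n,m,p)^q\,\|u\|_{p,q}^q\qquad\text{for all } u\in W^mL^{p,q}(\mathbb H^n). \] Moreover, the constant $C(n,m,p)$ is sharp, i.e. $\inf\{\|\nabla_g^m u\|_{p,q}^q/\|u\|_{p,q}^q : u\in W^mL^{p,q}(\mathbb H^n),\,u\not\equiv 0\}=C(n,m,p)^q$, and it is never attained, i.e. equality holds for no $u\not\equiv 0$.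
   Context: $\mathbb H^n$ ($n\ge2$) is the hyperbolic space realized as the Poincaré ball: the open unit ball $B_n\subset\mathbb R^n$ with metric $g=\left(\frac{2}{1-|x|^2}\right)^2dx\otimes dx$ and volume element $dV_g=\left(\frac{2}{1-|x|^2}\right)^n dx$; $\nabla_g$ and $\Delta_g$ denote its Riemannian gradient and Laplace–Beltrami operator. Higher-order derivatives: $\nabla_g^m u=\Delta_g^{m/2}u$ if $m$ is even and $\nabla_g^m u=\nabla_g(\Delta_g^{(m-1)/2}u)$ if $m$ is odd; $|\nabla_g^m u|$ denotes the absolute value of this function (m even) or its Riemannian length $|\cdot|_g$ (m odd). For a measurable $u$ on $\mathbb H^n$ with $V_g(\{|u|>t\})<\infty$ for all $t>0$, its decreasing rearrangement is $u^*(t)=\sup\{s>0: V_g(\{|u|>s\})>t\}$. For $1\le p,q<\infty$ the Lorentz quasi-norm is $\|u\|_{p,q}=\left(\int_0^\infty \big(t^{1/p}u^*(t)\big)^q\,\frac{dt}{t}\right)^{1/q}$, and $\|\nabla_g^m u\|_{p,q}:=\||\nabla_g^m u|\|_{p,q}$. The Lorentz–Sobolev space $W^mL^{p,q}(\mathbb H^n)$ is the completion of $C_0^\infty(\mathbb H^n)$ under $u\mapsto\|\nabla_g^m u\|_{p,q}$. *)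

theory Defs
  imports "HOL-Analysis.Analysis"
begin

text \<open>Hyperbolic space H^n as the Poincare ball B_n in R^n, with n = CARD('n).
  Functions on H^n are modelled as functions real^'n => real; only their
  values on the open unit ball matter (the volume measure lives on the ball).\<close>

definition conf :: "real^'n \<Rightarrow> real" where
  "conf x = 2 / (1 - (norm x)^2)"

definition hvol :: "(real^'n) measure" where
  "hvol = density lborel
     (\<lambda>x. indicator (ball 0 1) x * ennreal (conf x ^ CARD('n)))"

definition pd :: "'n \<Rightarrow> (real^'n \<Rightarrow> real) \<Rightarrow> real^'n \<Rightarrow> real" where
  "pd i f x = frechet_derivative f (at x) (axis i 1)"

definition egrad :: "(real^'n \<Rightarrow> real) \<Rightarrow> real^'n \<Rightarrow> real^'n" where
  "egrad f x = (\<chi> i. pd i f x)"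

text \<open>Riemannian gradient: g^{ij} d_j f with g_{ij} = conf^2 delta_{ij}.\<close>
definition hgrad :: "(real^'n \<Rightarrow> real) \<Rightarrow> real^'n \<Rightarrow> real^'n" where
  "hgrad f x = (inverse (conf x))^2 *\<^sub>R egrad f x"

definition gnorm :: "real^'n \<Rightarrow> real^'n \<Rightarrow> real" where
  "gnorm x v = sqrt ((conf x)^2 * (v \<bullet> v))"

text \<open>Laplace-Beltrami operator in coordinates:
  Delta_g f = |g|^{-1/2} d_i ( |g|^{1/2} g^{ij} d_j f ), with |g|^{1/2} = conf^n.\<close>
definition hlap :: "(real^'n \<Rightarrow> real) \<Rightarrow> real^'n \<Rightarrow> real" where
  "hlap f x = inverse (conf x ^ CARD('n)) *
     (\<Sum>i\<in>UNIV. pd i (\<lambda>y. conf y ^ CARD('n) * (hgrad f y $ i)) x)"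

definition hnabla :: "nat \<Rightarrow> (real^'n \<Rightarrow> real) \<Rightarrow> real^'n \<Rightarrow> real" where
  "hnabla m f x =
     (if even m then \<bar>(hlap ^^ (m div 2)) f x\<bar>
      else gnorm x (hgrad ((hlap ^^ (m div 2)) f) x))"

fun iter_pd :: "'n list \<Rightarrow> (real^'n \<Rightarrow> real) \<Rightarrow> real^'n \<Rightarrow> real" where
  "iter_pd [] f = f"
| "iter_pd (i # is) f = pd i (iter_pd is f)"

definition C0inf :: "(real^'n \<Rightarrow> real) set" where
  "C0inf = {f. (\<forall>is. \<forall>x\<in>ball 0 1. iter_pd is f differentiable (at x)) \<and>
               (\<exists>K. compact K \<and> K \<subseteq> ball 0 1 \<and> (\<forall>x. x \<notin> K \<longrightarrow> f x = 0))}"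

text \<open>Decreasing rearrangement w.r.t. V_g: u^*(t) = sup{s>0 : V_g(|u|>s) > t}
  (with the convention sup of the empty set = 0).\<close>
definition rearr :: "(real^'n \<Rightarrow> real) \<Rightarrow> real \<Rightarrow> real" where
  "rearr u t = Sup (insert 0 {s. 0 < s \<and> ennreal t < emeasure hvol {x. s < \<bar>u x\<bar>}})"

definition lorentz_qpow :: "real \<Rightarrow> real \<Rightarrow> (real^'n \<Rightarrow> real) \<Rightarrow> ennreal" where
  "lorentz_qpow p q u =
     (\<integral>\<^sup>+ t\<in>{0<..}. ennreal ((t powr (1/p) * rearr u t) powr q / t) \<partial>lborel)"

text \<open>Elements of the completion W^m L^{p,q}(H^n) of C_0^infty under
  u |-> ||nabla_g^m u||_{p,q}: a (Borel) function u together with the value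
  N = ||nabla_g^m u||_{p,q}^q, realised by a Cauchy sequence phi_k in C_0^infty
  (w.r.t. ||nabla_g^m .||_{p,q}) converging to u V_g-a.e., N being the limit of
  ||nabla_g^m phi_k||_{p,q}^q.\<close>
definition WmLpq :: "nat \<Rightarrow> real \<Rightarrow> real \<Rightarrow> (real^'n \<Rightarrow> real) \<Rightarrow> ennreal \<Rightarrow> bool" where
  "WmLpq m p q u N \<longleftrightarrow> u \<in> borel_measurable borel \<and>
     (\<exists>\<phi>::nat \<Rightarrow> real^'n \<Rightarrow> real. (\<forall>k. \<phi> k \<in> C0inf) \<and>
        (\<forall>\<epsilon>>0. \<exists>K. \<forall>k\<ge>K. \<forall>l\<ge>K.
            lorentz_qpow p q (hnabla m (\<lambda>x. \<phi> k x - \<phi> l x)) < ennreal \<epsilon>) \<and>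
        (AE x in hvol. (\<lambda>k. \<phi> k x) \<longlonglongrightarrow> u x) \<and>
        (\<lambda>k. lorentz_qpow p q (hnabla m (\<phi> k))) \<longlonglongrightarrow> N)"

definition Cnmp :: "nat \<Rightarrow> nat \<Rightarrow> real \<Rightarrow> real" where
  "Cnmp n m p = (let p' = p / (p - 1); a = (real n - 1)^2 / (p * p') in
     if even m then a ^ (m div 2) else (real n - 1) / p * a ^ ((m - 1) div 2))"

end

theory Submission
  imports Defs
begin

text \<open>The radial field \<open>tanh \<rho> \<partial>\<^sub>\<rho>\<close> has length below 1 and divergence \<open>n - 1 + sech\<^sup>2 \<rho>\<close>. Hence
  the superlevel sets of \<open>\<bar>u\<bar>\<close> satisfy a linear isoperimetric inequality with a strictly positive surplus, here in
  the integrated form \<open>\<integral> g(s) \<integral>\<^bsub>{\<bar>u\<bar> > s}\<^esub> (n - 1 + sech\<^sup>2 \<rho>) dV ds \<le> \<integral> g(\<bar>u\<bar>) \<bar>\<nabla>u\<bar> dV\<close> for every Borel \<open>g \<ge> 0\<close>.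
  Similarly \<open>\<integral> g(\<bar>u\<bar>) \<bar>\<nabla>u\<bar>\<^sup>2 dV \<le> \<integral> g(s) \<integral>\<^bsub>{\<bar>u\<bar> > s}\<^esub> \<bar>\<Delta>u\<bar> dV ds\<close>. For \<open>m = 1\<close>, a weight \<open>g\<close> adapted to the Lorentz
  functional together with the inequalities of Young and Hardy--Littlewood gives the claim. For \<open>m = 2\<close> the two
  inequalities combine to the Talenti-type bound \<open>(n - 1)\<^sup>2 u\<^sup>*(t) \<le> \<integral> f\<^sup>*(r) / max t r dr\<close> with \<open>f = \<Delta>u\<close>, and the
  kernel \<open>1 / max t r\<close> has norm \<open>p p'\<close> on the Lorentz space. Larger \<open>m\<close> follow by iteration. The surplus is bounded
  below along approximating sequences of a nonzero function, so equality never holds in the completion.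

  Sharpness is tested on \<open>v\<^sup>a exp (- 1 / (l v - 1))\<close> with \<open>v = 1 - \<bar>x\<bar>\<^sup>2\<close>, \<open>a = (n - 1) / p\<close> and \<open>l \<rightarrow> \<infinity>\<close>. Near the
  boundary \<open>\<nabla>\<^sup>m\<close> acts on \<open>v\<^sup>a\<close> as multiplication by a constant of absolute value \<open>C(n,m,p)\<close>, and the borderline exponent
  \<open>a\<close> makes the part near the boundary dominate.\<close>

section \<open>Smooth functions and the Laplacian on the ball\<close>

text \<open>The sharp constant only sees the linear isoperimetric ratio n - 1, the limit for large
  balls. One calibrating vector field therefore does the work of an isoperimetric inequality, and
  testing it against functions of |u| does the work of the coarea formula. The useful weights depend
  on the distribution function of u and are merely Borel, hence the passage from continuous tests to
  all Borel \<open>g\<close>. The hypothesis q <= p belongs to the gradient alone: Hardy-Littlewood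
  wants the weight t powr (q / p - 1) to decrease, while the Hardy kernel works for every q > 1. An
  element of the completion is only an almost everywhere limit, and its inequality comes from
  Fatou's lemma, so strictness cannot be read off from a case of equality. The surplus must be
  quantified by data that survive limits: a lower bound for a weighted volume above one level and an
  upper bound for the volume above half that level. With a = (n - 1) / p, the number a (n - 1 - a) =
  (n - 1)^2 / (p p') is, up to sign, the asymptotic eigenvalue of v powr a; this is where C(n,m,p)
  comes from.\<close>

lemma frechet_derivative_cong_open:
  assumes "open S" "x \<in> S" "\<And>y. y \<in> S \<Longrightarrow> f y = g y"
  shows "frechet_derivative f (at x) = frechet_derivative g (at x)"
proof -
  have "(f has_derivative D) (at x) \<longleftrightarrow> (g has_derivative D) (at x)" for D
    using has_derivative_transform_within_open[of f D x UNIV S g]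
      has_derivative_transform_within_open[of g D x UNIV S f] assms by auto
  then show ?thesis by (simp add: frechet_derivative_def)
qed

lemma pd_cong_open:
  assumes "open S" "x \<in> S" "\<And>y. y \<in> S \<Longrightarrow> f y = g y"
  shows "pd i f x = pd i g x"
  unfolding pd_def using frechet_derivative_cong_open[OF assms] by simp

lemma differentiable_cong_open:
  assumes "open S" "x \<in> S" "\<And>y. y \<in> S \<Longrightarrow> f y = g y" "g differentiable (at x)"
  shows "f differentiable (at x)"
  using assms has_derivative_transform_within_open[of g _ x UNIV S f]
  unfolding differentiable_def by metis

lemma pd_eqI: "(f has_derivative D) (at x) \<Longrightarrow> pd i f x = D (axis i 1)"
  unfolding pd_def using frechet_derivative_at by metis

lemma has_derivative_pd:
  fixes f :: "real^'n \<Rightarrow> real"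
  assumes "f differentiable (at x)"
  shows "(f has_derivative (\<lambda>h. \<Sum>i\<in>UNIV. h $ i * pd i f x)) (at x)"
proof -
  let ?D = "frechet_derivative f (at x)"
  have D: "(f has_derivative ?D) (at x)" using assms frechet_derivative_works by blast
  interpret linear ?D using assms linear_frechet_derivative by blast
  have "?D h = (\<Sum>i\<in>UNIV. h $ i * pd i f x)" for h
  proof -
    have "h = (\<Sum>i\<in>UNIV. h $ i *\<^sub>R axis i 1)"
      by (simp add: vec_eq_iff axis_def if_distrib cong: if_cong)
    then have "?D h = ?D (\<Sum>i\<in>UNIV. h $ i *\<^sub>R axis i 1)" by simp
    also have "\<dots> = (\<Sum>i\<in>UNIV. h $ i * pd i f x)" by (simp add: sum scale pd_def)
    finally show ?thesis .
  qed
  then have "?D = (\<lambda>h. \<Sum>i\<in>UNIV. h $ i * pd i f x)" by auto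
  then show ?thesis using D by simp
qed

lemma pd_const [simp]: "pd i (\<lambda>x. c) = (\<lambda>x. 0)"
  by (rule ext, rule pd_eqI[OF has_derivative_const, THEN trans]) simp

lemma pd_coord: "pd i (\<lambda>x. x $ j) = (\<lambda>x. if i = j then 1 else 0)"
proof
  fix x :: "real^'a"
  have "((\<lambda>x. x $ j) has_derivative (\<lambda>h. h $ j)) (at x)"
    by (rule bounded_linear_imp_has_derivative[OF bounded_linear_vec_nth])
  from pd_eqI[OF this] show "pd i (\<lambda>x. x $ j) x = (if i = j then 1 else 0)" by (auto simp: axis_def)
qed

lemma pd_add:
  assumes "f differentiable (at x)" "g differentiable (at x)"
  shows "pd i (\<lambda>x. f x + g x) x = pd i f x + pd i g x"
  using pd_eqI[OF has_derivative_add[OF has_derivative_pd[OF assms(1)] has_derivative_pd[OF assms(2)]], of i]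
  by (simp add: axis_def if_distrib if_distribR cong: if_cong)

lemma pd_mult:
  assumes "f differentiable (at x)" "g differentiable (at x)"
  shows "pd i (\<lambda>x. f x * g x) x = f x * pd i g x + pd i f x * g x"
  using pd_eqI[OF has_derivative_mult[OF has_derivative_pd[OF assms(1)] has_derivative_pd[OF assms(2)]], of i]
  by (simp add: axis_def if_distrib if_distribR cong: if_cong)

lemma pd_diff:
  assumes "f differentiable (at x)" "g differentiable (at x)"
  shows "pd i (\<lambda>x. f x - g x) x = pd i f x - pd i g x"
  using pd_eqI[OF has_derivative_diff[OF has_derivative_pd[OF assms(1)] has_derivative_pd[OF assms(2)]], of i]
  by (simp add: axis_def if_distrib if_distribR cong: if_cong)

lemma has_derivative_compose_real:
  fixes g :: "real^'n \<Rightarrow> real"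
  assumes "g differentiable (at x)" "(F has_real_derivative F') (at (g x))"
  shows "((\<lambda>x. F (g x)) has_derivative (\<lambda>h. F' * (\<Sum>i\<in>UNIV. h $ i * pd i g x))) (at x)"
  using has_derivative_compose[OF has_derivative_pd[OF assms(1)], of F "(*) F'"] assms(2)
  by (simp add: has_field_derivative_def)

lemma pd_compose:
  fixes g :: "real^'n \<Rightarrow> real"
  assumes "g differentiable (at x)" "(F has_real_derivative F') (at (g x))"
  shows "pd i (\<lambda>x. F (g x)) x = F' * pd i g x"
  using pd_eqI[OF has_derivative_compose_real[OF assms], of i]
  by (simp add: axis_def if_distrib if_distribR cong: if_cong)

section \<open>Smooth functions on the whole space\<close>

definition smooth_fn :: "(real^'n \<Rightarrow> real) \<Rightarrow> bool" where
  "smooth_fn f \<longleftrightarrow> (\<forall>is x. iter_pd is f differentiable (at x))"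

definition smooth1 :: "(real \<Rightarrow> real) \<Rightarrow> bool" where
  "smooth1 F \<longleftrightarrow> (\<forall>k x. (deriv ^^ k) F field_differentiable (at x))"

lemma smooth_fn_differentiable: "smooth_fn f \<Longrightarrow> f differentiable (at x)"
  unfolding smooth_fn_def by (metis iter_pd.simps(1))

lemma iter_pd_append: "iter_pd (is @ js) f = iter_pd is (iter_pd js f)"
  by (induction "is") auto

lemma smooth_fn_pd: "smooth_fn f \<Longrightarrow> smooth_fn (pd i f)"
  unfolding smooth_fn_def by (metis iter_pd_append iter_pd.simps)

text \<open>Smoothness is the greatest class of differentiable functions closed under partial
  derivatives, so exhibiting such a class replaces computing iterated derivatives.\<close>

lemma smooth_fn_coinduct:
  assumes "f \<in> A" "\<And>f x. f \<in> A \<Longrightarrow> f differentiable (at x)" "\<And>f i. f \<in> A \<Longrightarrow> pd i f \<in> A"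
  shows "smooth_fn f"
proof -
  have "iter_pd is f \<in> A" for "is" by (induction "is") (auto simp: assms)
  then show ?thesis unfolding smooth_fn_def using assms(2) by blast
qed

lemma smooth1_coinduct:
  assumes "f \<in> A" "\<And>f. f \<in> A \<Longrightarrow> \<exists>f'\<in>A. \<forall>x. (f has_real_derivative f' x) (at x)"
  shows "smooth1 f"
proof -
  have d: "deriv g \<in> A" if "g \<in> A" for g
  proof -
    from assms(2)[OF that] obtain f' where "f' \<in> A" "\<forall>x. (g has_real_derivative f' x) (at x)" by blast
    moreover from this have "deriv g = f'" by (auto intro: DERIV_imp_deriv)
    ultimately show ?thesis by simp
  qed
  have "(deriv ^^ k) f \<in> A" for k by (induction k) (auto simp: assms d)
  then show ?thesis unfolding smooth1_def field_differentiable_def using assms(2) by meson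
qed

lemma smooth1_deriv: "smooth1 F \<Longrightarrow> smooth1 (deriv F)"
  unfolding smooth1_def by (metis funpow_Suc_right o_apply)

lemma smooth1_has_derivative: "smooth1 F \<Longrightarrow> (F has_real_derivative deriv F x) (at x)"
  unfolding smooth1_def by (metis funpow_0 field_differentiable_derivI)

text \<open>Products and compositions alone are not closed under differentiation, but the algebra
  they generate is: the product and chain rules only create sums and products of generators.\<close>

inductive_set smooth_alg :: "(real^'n \<Rightarrow> real) set" where
  base: "smooth_fn f \<Longrightarrow> f \<in> smooth_alg"
| comp: "smooth1 F \<Longrightarrow> smooth_fn g \<Longrightarrow> (\<lambda>x. F (g x)) \<in> smooth_alg"
| add: "f \<in> smooth_alg \<Longrightarrow> g \<in> smooth_alg \<Longrightarrow> (\<lambda>x. f x + g x) \<in> smooth_alg"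
| mult: "f \<in> smooth_alg \<Longrightarrow> g \<in> smooth_alg \<Longrightarrow> (\<lambda>x. f x * g x) \<in> smooth_alg"

lemma smooth_alg_differentiable: "f \<in> smooth_alg \<Longrightarrow> f differentiable (at x)"
proof (induction rule: smooth_alg.induct)
  case (comp F g)
  then show ?case
    using has_derivative_compose_real[OF smooth_fn_differentiable smooth1_has_derivative]
    unfolding differentiable_def by blast
qed (auto intro: smooth_fn_differentiable)

lemma smooth_alg_pd: "f \<in> smooth_alg \<Longrightarrow> pd i f \<in> smooth_alg"
proof (induction rule: smooth_alg.induct)
  case (base f)
  then show ?case by (simp add: smooth_alg.base smooth_fn_pd)
next
  case (comp F g)
  then have "pd i (\<lambda>x. F (g x)) = (\<lambda>x. deriv F (g x) * pd i g x)"
    by (auto intro!: pd_compose smooth_fn_differentiable smooth1_has_derivative)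
  then show ?case using comp
    by (simp only:) (intro smooth_alg.mult smooth_alg.comp[of "deriv F"] smooth_alg.base[of "pd i g"] smooth_fn_pd smooth1_deriv)
next
  case (add f g)
  then have "pd i (\<lambda>x. f x + g x) = (\<lambda>x. pd i f x + pd i g x)"
    by (auto intro!: pd_add smooth_alg_differentiable)
  then show ?case using add by (auto intro!: smooth_alg.add)
next
  case (mult f g)
  then have "pd i (\<lambda>x. f x * g x) = (\<lambda>x. f x * pd i g x + pd i f x * g x)"
    by (auto intro!: pd_mult smooth_alg_differentiable)
  then show ?case using mult by (auto intro!: smooth_alg.add smooth_alg.mult)
qed

lemma smooth_alg_smooth_fn: "f \<in> smooth_alg \<Longrightarrow> smooth_fn f"
  by (rule smooth_fn_coinduct[of f smooth_alg]) (simp_all only: smooth_alg_pd smooth_alg_differentiable)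

lemma smooth_fn_add: "smooth_fn f \<Longrightarrow> smooth_fn g \<Longrightarrow> smooth_fn (\<lambda>x. f x + g x)"
  and smooth_fn_mult: "smooth_fn f \<Longrightarrow> smooth_fn g \<Longrightarrow> smooth_fn (\<lambda>x. f x * g x)"
  and smooth_fn_comp: "smooth1 F \<Longrightarrow> smooth_fn g \<Longrightarrow> smooth_fn (\<lambda>x. F (g x))"
proof -
  show "smooth_fn (\<lambda>x. f x + g x)" if "smooth_fn f" "smooth_fn g"
    by (rule smooth_alg_smooth_fn[OF smooth_alg.add[OF smooth_alg.base[OF that(1)] smooth_alg.base[OF that(2)]]])
  show "smooth_fn (\<lambda>x. f x * g x)" if "smooth_fn f" "smooth_fn g"
    by (rule smooth_alg_smooth_fn[OF smooth_alg.mult[OF smooth_alg.base[OF that(1)] smooth_alg.base[OF that(2)]]])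
  show "smooth_fn (\<lambda>x. F (g x))" if "smooth1 F" "smooth_fn g"
    by (rule smooth_alg_smooth_fn[OF smooth_alg.comp[OF that]])
qed

lemma smooth_fn_const: "smooth_fn (\<lambda>x. c)"
proof (rule smooth_fn_coinduct[of _ "{\<lambda>x. d |d. True}"])
  fix f :: "real^'a \<Rightarrow> real" and i assume "f \<in> {\<lambda>x. d |d. True}"
  then show "pd i f \<in> {\<lambda>x. d |d. True}" by auto
qed auto

lemma smooth_fn_coord: "smooth_fn (\<lambda>x. x $ j)"
proof (rule smooth_fn_coinduct[of _ "{\<lambda>x. x $ j} \<union> {\<lambda>x. d |d. True}"])
  fix f :: "real^'a \<Rightarrow> real" and i assume "f \<in> {\<lambda>x. x $ j} \<union> {\<lambda>x. d |d. True}"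
  then show "pd i f \<in> {\<lambda>x. x $ j} \<union> {\<lambda>x. d |d. True}" by (auto simp: pd_coord)
next
  fix f :: "real^'a \<Rightarrow> real" and x assume "f \<in> {\<lambda>x. x $ j} \<union> {\<lambda>x. d |d. True}"
  then show "f differentiable (at x)"
    using bounded_linear_imp_differentiable[OF bounded_linear_vec_nth[of j]] by auto
qed auto

lemma smooth_fn_sum: "(\<And>i. i \<in> I \<Longrightarrow> smooth_fn (f i)) \<Longrightarrow> smooth_fn (\<lambda>x. \<Sum>i\<in>I. f i x)"
  by (induction I rule: infinite_finite_induct) (auto intro: smooth_fn_const smooth_fn_add)

lemma smooth_fn_diff:
  assumes "smooth_fn f" "smooth_fn g" shows "smooth_fn (\<lambda>x. f x - g x)"
  using smooth_fn_add[OF assms(1) smooth_fn_mult[OF smooth_fn_const[of "-1"] assms(2)]] by simp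

lemma smooth_fn_continuous: "smooth_fn f \<Longrightarrow> continuous_on UNIV f"
  by (simp add: differentiable_imp_continuous_on differentiable_on_def differentiable_at_withinI smooth_fn_differentiable)

section \<open>The function 1 - |x|^2 and test functions on the ball\<close>

lemma norm_sq_coord: "(norm (x::real^'n))^2 = (\<Sum>i\<in>UNIV. x $ i * x $ i)"
  unfolding power2_norm_eq_inner inner_vec_def by simp

definition bdef :: "real^'n \<Rightarrow> real" where "bdef x = 1 - (norm x)^2"

lemma smooth_fn_bdef: "smooth_fn bdef"
  unfolding bdef_def norm_sq_coord
  by (intro smooth_fn_diff smooth_fn_const smooth_fn_sum smooth_fn_mult smooth_fn_coord)

lemma pd_bdef: "pd i bdef x = - 2 * x $ i"
proof -
  have "((\<lambda>x::real^'a. 1 - x \<bullet> x) has_derivative (\<lambda>h. 0 - (x \<bullet> h + h \<bullet> x))) (at x)"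
    by (auto intro!: derivative_eq_intros)
  then have "(bdef has_derivative (\<lambda>h. 0 - (x \<bullet> h + h \<bullet> x))) (at x)"
    by (simp add: bdef_def[abs_def] power2_norm_eq_inner)
  from pd_eqI[OF this, of i] show ?thesis by (simp add: inner_axis inner_axis')
qed

lemma bdef_pos_iff: "0 < bdef x \<longleftrightarrow> x \<in> ball 0 1"
  unfolding bdef_def by (simp add: abs_square_less_1)

lemma bdef_le_1: "bdef x \<le> 1" by (simp add: bdef_def)

lemma conf_bdef: "conf x = 2 / bdef x" by (simp add: conf_def bdef_def)

lemma conf_pos: "x \<in> ball 0 1 \<Longrightarrow> 0 < conf x"
  using bdef_pos_iff[of x] by (simp add: conf_bdef)

text \<open>\<open>C0inf\<close> asks for differentiability inside the ball only. Off the compact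
  support all iterated partials vanish on an open set, so a test function is smooth on all of R^n
  and later arguments can ignore the sphere.\<close>

lemma C0infE:
  assumes "f \<in> C0inf"
  obtains K where "smooth_fn f" "compact K" "K \<subseteq> ball 0 1" "\<And>x. x \<notin> K \<Longrightarrow> f x = 0"
proof -
  from assms obtain K where K: "compact K" "K \<subseteq> ball 0 1" "\<And>x. x \<notin> K \<Longrightarrow> f x = 0"
    and d: "\<And>is x. x\<in>ball 0 1 \<Longrightarrow> iter_pd is f differentiable (at x)"
    unfolding C0inf_def by auto
  have op: "open (-K)" using K(1) by (simp add: compact_imp_closed open_Compl)
  have z: "iter_pd is f x = 0" if "x \<in> -K" for "is" x
    using that
  proof (induction "is" arbitrary: x)
    case (Cons i js)
    then have "pd i (iter_pd js f) x = pd i (\<lambda>_. 0) x" by (intro pd_cong_open[OF op]) auto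
    then show ?case by simp
  qed (use K in auto)
  have "iter_pd is f differentiable (at x)" for "is" x
  proof (cases "x \<in> ball 0 1")
    case False
    then have "x \<in> -K" using K(2) by auto
    then show ?thesis
      by (rule differentiable_cong_open[OF op, where g = "\<lambda>_. 0"]) (auto simp: z)
  qed (use d in auto)
  then have "smooth_fn f" unfolding smooth_fn_def by blast
  then show ?thesis using that K by blast
qed

lemma C0infI: "smooth_fn f \<Longrightarrow> compact K \<Longrightarrow> K \<subseteq> ball 0 1 \<Longrightarrow> (\<And>x. x \<notin> K \<Longrightarrow> f x = 0) \<Longrightarrow> f \<in> C0inf"
  unfolding C0inf_def smooth_fn_def by blast

lemma C0inf_smooth: "f \<in> C0inf \<Longrightarrow> smooth_fn f" by (erule C0infE)

lemma C0inf_diff: assumes "f \<in> C0inf" "g \<in> C0inf" shows "(\<lambda>x. f x - g x) \<in> C0inf"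
proof -
  obtain K where K: "compact K" "K \<subseteq> ball 0 1" "\<And>x. x \<notin> K \<Longrightarrow> f x = 0" using C0infE[OF assms(1)] by metis
  obtain K' where K': "compact K'" "K' \<subseteq> ball 0 1" "\<And>x. x \<notin> K' \<Longrightarrow> g x = 0" using C0infE[OF assms(2)] by metis
  show ?thesis
    by (rule C0infI[of _ "K \<union> K'"]) (use K K' assms in \<open>auto intro: smooth_fn_diff C0inf_smooth\<close>)
qed

section \<open>The Laplacian in ball coordinates\<close>

lemma pd_outside:
  assumes "closed K" "\<And>x. x \<notin> K \<Longrightarrow> f x = 0" "x \<notin> K"
  shows "pd i f x = 0"
  using pd_cong_open[of "-K" x f "\<lambda>_. 0" i] assms by auto

text \<open>Expanding the divergence form gives coefficients that are polynomial in x. They stay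
  smooth across the sphere, where \<open>conf\<close> breaks down, so this form shows that the
  Laplacian of a test function is a test function.\<close>

definition lap0 :: "(real^'n \<Rightarrow> real) \<Rightarrow> real^'n \<Rightarrow> real" where
  "lap0 f x = (bdef x)^2 / 4 * (\<Sum>i\<in>UNIV. pd i (pd i f) x)
     + (real CARD('n) - 2) / 2 * bdef x * (\<Sum>i\<in>UNIV. x $ i * pd i f x)"

text \<open>The weight is the power n - 2 of \<open>conf\<close>, kept as a product so that no
  truncated subtraction of naturals arises when n = 1.\<close>

lemma pd_conf_weight:
  fixes x :: "real^'n"
  assumes "x \<in> ball 0 1"
  shows "(\<lambda>y. conf y ^ CARD('n) * (inverse (conf y))^2) differentiable (at x)"
    and "pd i (\<lambda>y::real^'n. conf y ^ CARD('n) * (inverse (conf y))^2) x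
      = (real CARD('n) - 2) * conf x ^ CARD('n) / conf x * x $ i"
proof -
  let ?n = "CARD('n)"
  let ?F = "\<lambda>t::real. (2 / t) ^ ?n * (inverse (2 / t))^2"
  have b: "bdef x > 0" using assms bdef_pos_iff by blast
  have F: "(?F has_real_derivative (- (real ?n - 2) / 4 * (2 / bdef x)^?n * bdef x)) (at (bdef x))"
  proof -
    obtain k where k: "?n = Suc k" using not0_implies_Suc by fastforce
    have "((\<lambda>t. 2 / t) has_real_derivative (- 2 / (bdef x)^2)) (at (bdef x))"
      using b by (auto intro!: derivative_eq_intros simp: power2_eq_square)
    moreover have d2: "((\<lambda>t. (t / 2)^2) has_real_derivative bdef x / 2) (at (bdef x))"
      by (auto intro!: derivative_eq_intros)
    ultimately have d1: "((\<lambda>t. 2 / t) has_real_derivative (- 2 / (bdef x)^2)) (at (bdef x))" by simp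
    from DERIV_power[OF this, of ?n]
    have "((\<lambda>t. (2 / t) ^ ?n) has_real_derivative (real ?n * ((2 / bdef x) ^ k * (- 2 / (bdef x)^2)))) (at (bdef x))"
      by (simp add: k field_simps)
    from DERIV_mult[OF this d2]
    have "((\<lambda>t. (2 / t) ^ ?n * (t / 2)^2) has_real_derivative
      (real ?n * ((2 / bdef x) ^ k * (- 2 / (bdef x)^2)) * (bdef x / 2)^2 + bdef x / 2 * (2 / bdef x) ^ ?n)) (at (bdef x))"
      .
    also have "(real ?n * ((2 / bdef x) ^ k * (- 2 / (bdef x)^2)) * (bdef x / 2)^2 + bdef x / 2 * (2 / bdef x) ^ ?n)
      = - (real ?n - 2) / 4 * (2 / bdef x)^?n * bdef x"
      using b by (simp add: k field_simps power2_eq_square)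
    finally show ?thesis by simp
  qed
  have e: "(\<lambda>y::real^'n. conf y ^ ?n * (inverse (conf y))^2) = (\<lambda>y. ?F (bdef y))"
    by (simp add: conf_bdef)
  show "(\<lambda>y::real^'n. conf y ^ ?n * (inverse (conf y))^2) differentiable (at x)"
    unfolding e using has_derivative_compose_real[OF smooth_fn_differentiable[OF smooth_fn_bdef] F]
    unfolding differentiable_def by blast
  show "pd i (\<lambda>y::real^'n. conf y ^ ?n * (inverse (conf y))^2) x = (real ?n - 2) * conf x ^ ?n / conf x * x $ i"
    unfolding e pd_compose[OF smooth_fn_differentiable[OF smooth_fn_bdef] F] pd_bdef
    using b by (simp add: conf_bdef field_simps)
qed

lemma hlap_eq_lap0:
  fixes f :: "real^'n \<Rightarrow> real"
  assumes "x \<in> ball 0 1" "\<And>i. pd i f differentiable (at x)"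
  shows "hlap f x = lap0 f x"
proof -
  let ?n = "CARD('n)"
  let ?w = "\<lambda>y::real^'n. conf y ^ ?n * (inverse (conf y))^2"
  have c: "conf x > 0" using assms conf_pos by blast
  have "pd i (\<lambda>y. conf y ^ ?n * (hgrad f y $ i)) x = ?w x * pd i (pd i f) x + (real ?n - 2) * conf x ^ ?n / conf x * x $ i * pd i f x" for i
  proof -
    have e: "(\<lambda>y. conf y ^ ?n * (hgrad f y $ i)) = (\<lambda>y. ?w y * pd i f y)"
      by (simp add: hgrad_def egrad_def algebra_simps)
    show ?thesis unfolding e
      by (subst pd_mult[OF pd_conf_weight(1)[OF assms(1)] assms(2)]) (simp add: pd_conf_weight(2)[OF assms(1)])
  qed
  then have "hlap f x = inverse (conf x ^ ?n) * (\<Sum>i\<in>UNIV. ?w x * pd i (pd i f) x + (real ?n - 2) * conf x ^ ?n / conf x * (x $ i * pd i f x))"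
    unfolding hlap_def by (simp add: mult.assoc)
  also have "\<dots> = inverse (conf x) ^ 2 * (\<Sum>i\<in>UNIV. pd i (pd i f) x) + (real ?n - 2) / conf x * (\<Sum>i\<in>UNIV. x $ i * pd i f x)"
  proof -
    have "(\<Sum>i\<in>UNIV. ?w x * pd i (pd i f) x + (real ?n - 2) * conf x ^ ?n / conf x * (x $ i * pd i f x))
      = ?w x * (\<Sum>i\<in>UNIV. pd i (pd i f) x) + (real ?n - 2) * conf x ^ ?n / conf x * (\<Sum>i\<in>UNIV. x $ i * pd i f x)"
      by (simp add: sum.distrib sum_distrib_left)
    moreover have "inverse (C^k) * (C^k * (inverse C)^2 * A + D * C^k / C * B) = (inverse C)^2 * A + D / C * B"
      if "C > 0" for A B C D :: real and k
      using that by (simp add: field_simps)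
    ultimately show ?thesis using c by simp
  qed
  also have "\<dots> = lap0 f x"
    using assms(1) bdef_pos_iff[of x] by (simp add: lap0_def conf_bdef power_divide)
  finally show ?thesis .
qed

lemma hlap_outside:
  assumes "closed K" "\<And>x. x \<notin> K \<Longrightarrow> f x = 0" "x \<notin> K"
  shows "hlap f x = 0"
proof -
  have "pd i (\<lambda>y. conf y ^ CARD('a) * (hgrad f y $ i)) x = 0" for i
    by (rule pd_outside[OF assms(1) _ assms(3)]) (simp add: hgrad_def egrad_def pd_outside[OF assms(1,2)])
  then show ?thesis by (simp add: hlap_def)
qed

lemma lap0_outside:
  assumes "closed K" "\<And>x. x \<notin> K \<Longrightarrow> f x = 0" "x \<notin> K"
  shows "lap0 f x = 0"
proof -
  have "pd i (pd i f) x = 0" for i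
    by (rule pd_outside[OF assms(1) _ assms(3)]) (simp add: pd_outside[OF assms(1,2)])
  then show ?thesis by (simp add: lap0_def pd_outside[OF assms])
qed

lemma hlap_C0inf_eq: assumes "f \<in> C0inf" shows "hlap f = lap0 f"
proof
  fix x
  obtain K where K: "smooth_fn f" "compact K" "K \<subseteq> ball 0 1" "\<And>x. x \<notin> K \<Longrightarrow> f x = 0" using C0infE[OF assms] by metis
  show "hlap f x = lap0 f x"
  proof (cases "x \<in> ball 0 1")
    case True
    then show ?thesis using K(1) by (intro hlap_eq_lap0) (auto intro: smooth_fn_differentiable smooth_fn_pd)
  next
    case False
    then have "x \<notin> K" using K by auto
    then show ?thesis using hlap_outside[of K f x] lap0_outside[of K f x] K compact_imp_closed[OF K(2)] by metis
  qed
qed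

lemma smooth_fn_lap0: "smooth_fn f \<Longrightarrow> smooth_fn (lap0 f)"
  unfolding lap0_def[abs_def] power2_eq_square divide_inverse
  by (intro smooth_fn_add smooth_fn_mult smooth_fn_sum smooth_fn_const smooth_fn_coord smooth_fn_pd smooth_fn_bdef)

lemma C0inf_hlap: assumes "f \<in> C0inf" shows "hlap f \<in> C0inf"
proof -
  obtain K where K: "smooth_fn f" "compact K" "K \<subseteq> ball 0 1" "\<And>x. x \<notin> K \<Longrightarrow> f x = 0" using C0infE[OF assms] by metis
  show ?thesis
    by (rule C0infI[of _ K])
      (use K smooth_fn_lap0[OF K(1)] hlap_outside[of K f] in \<open>auto simp: hlap_C0inf_eq[OF assms, symmetric] compact_imp_closed\<close>)
qed

lemma C0inf_hlap_funpow: "f \<in> C0inf \<Longrightarrow> (hlap ^^ k) f \<in> C0inf"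
  by (induction k) (auto intro: C0inf_hlap)

lemma hlap_diff: assumes "f \<in> C0inf" "g \<in> C0inf"
  shows "hlap (\<lambda>x. f x - g x) = (\<lambda>x. hlap f x - hlap g x)"
proof -
  have s: "smooth_fn f" "smooth_fn g" using assms C0inf_smooth by auto
  have p: "pd i (\<lambda>x. f x - g x) = (\<lambda>x. pd i f x - pd i g x)" for i
    using s by (auto intro!: pd_diff smooth_fn_differentiable)
  have pp: "pd i (\<lambda>x. pd i f x - pd i g x) = (\<lambda>x. pd i (pd i f) x - pd i (pd i g) x)" for i
    using s by (auto intro!: pd_diff smooth_fn_differentiable smooth_fn_pd)
  show ?thesis
    unfolding hlap_C0inf_eq[OF C0inf_diff[OF assms]] hlap_C0inf_eq[OF assms(1)] hlap_C0inf_eq[OF assms(2)] lap0_def p pp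
    by (auto simp: sum_subtractf algebra_simps)
qed

lemma hlap_funpow_diff: assumes "f \<in> C0inf" "g \<in> C0inf"
  shows "(hlap ^^ k) (\<lambda>x. f x - g x) = (\<lambda>x. (hlap ^^ k) f x - (hlap ^^ k) g x)"
  by (induction k) (auto simp: hlap_diff C0inf_hlap_funpow assms)

section \<open>The truncated isoperimetric inequality and Green identity\<close>

lemma integrable_continuous_bounded_support:
  fixes f :: "'a::euclidean_space \<Rightarrow> real"
  assumes "continuous_on UNIV f" "\<And>x. r < norm x \<Longrightarrow> f x = 0"
  shows "integrable lborel f"
proof -
  have "compact (f ` cball 0 r)"
    using assms(1) by (intro compact_continuous_image) (auto intro: continuous_on_subset)
  then obtain B where B: "\<And>x. x \<in> cball 0 r \<Longrightarrow> norm (f x) \<le> B"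
    by (metis bounded_iff compact_imp_bounded imageI)
  show ?thesis
    by (rule integrableI_bounded_set[where A = "cball 0 r" and B = B])
      (use assms B emeasure_bounded_finite[OF bounded_cball] in \<open>auto intro: borel_measurable_continuous_onI simp: not_le\<close>)
qed

text \<open>The integral of a difference quotient vanishes by translation invariance of Lebesgue
  measure; dominated convergence then passes to the partial derivative. This replaces integration
  along coordinate lines.\<close>

lemma
  fixes f :: "real^'n \<Rightarrow> real"
  assumes d: "\<And>x. f differentiable (at x)" and c: "continuous_on UNIV (pd i f)"
    and z: "\<And>x. r < norm x \<Longrightarrow> f x = 0"
  shows integrable_pd: "integrable lborel (pd i f)"
    and integral_pd_eq_0: "integral\<^sup>L lborel (pd i f) = 0"
proof -
  let ?e = "axis i 1 :: real^'n"
  have zp: "pd i f x = 0" if "r < norm x" for x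
    by (rule pd_outside[of "cball 0 r"]) (use z that in auto)
  show ip: "integrable lborel (pd i f)" by (rule integrable_continuous_bounded_support[OF c zp])
  have fc: "continuous_on UNIV f"
    using d by (simp add: differentiable_imp_continuous_on differentiable_on_def differentiable_at_withinI)
  have fi: "integrable lborel f" by (rule integrable_continuous_bounded_support[OF fc z])
  have "compact (pd i f ` cball 0 r)"
    using c by (intro compact_continuous_image) (auto intro: continuous_on_subset)
  then obtain B where B: "\<And>x. x \<in> cball 0 r \<Longrightarrow> \<bar>pd i f x\<bar> \<le> B"
    by (metis bounded_iff compact_imp_bounded imageI real_norm_def)
  have B': "\<bar>pd i f x\<bar> \<le> \<bar>B\<bar>" for x
    using B[of x] zp[of x] by (cases "r < norm x") force+
  have der: "((\<lambda>t. f (x + t *\<^sub>R ?e)) has_real_derivative pd i f (x + t *\<^sub>R ?e)) (at t)" for x t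
  proof -
    have "((\<lambda>t. x + t *\<^sub>R ?e) has_derivative (\<lambda>h. h *\<^sub>R ?e)) (at t)"
      by (auto intro!: derivative_eq_intros)
    from has_derivative_compose[OF this has_derivative_pd[OF d]]
    have "((\<lambda>t. f (x + t *\<^sub>R ?e)) has_derivative (\<lambda>h. \<Sum>j\<in>UNIV. (h *\<^sub>R ?e) $ j * pd j f (x + t *\<^sub>R ?e))) (at t)" .
    moreover have "(\<lambda>h. \<Sum>j\<in>UNIV. (h *\<^sub>R ?e) $ j * pd j f (x + t *\<^sub>R ?e)) = (*) (pd i f (x + t *\<^sub>R ?e))"
      by (auto simp: axis_def if_distrib if_distribR cong: if_cong)
    ultimately show ?thesis by (simp add: has_field_derivative_def)
  qed
  \<comment> \<open>Steps of length at most 1 keep all difference quotients supported in one ball,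
    of radius r + 1.\<close>
  define h where "h k = 1 / (real k + 1)" for k :: nat
  have h: "h k > 0" "h k \<le> 1" for k by (auto simp: h_def)
  define D where "D k x = (f (x + h k *\<^sub>R ?e) - f x) / h k" for k x
  have Dc: "(\<lambda>k. D k x) \<longlonglongrightarrow> pd i f x" for x
  proof -
    have "((\<lambda>t. (f (x + t *\<^sub>R ?e) - f x) / t) \<longlongrightarrow> pd i f x) (at 0)"
      using der[of x 0] by (simp add: DERIV_def)
    moreover have "filterlim h (at 0) sequentially"
    proof -
      have "h \<longlonglongrightarrow> 0" unfolding h_def using LIMSEQ_inverse_real_of_nat by (simp add: inverse_eq_divide add.commute)
      then show ?thesis using h by (auto simp: filterlim_at less_imp_neq[symmetric] intro!: always_eventually)
    qed
    ultimately show ?thesis unfolding D_def by (rule filterlim_compose)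
  qed
  have Db: "\<bar>D k x\<bar> \<le> \<bar>B\<bar> * indicator (cball 0 (r + 1)) x" for k x
  proof (cases "x \<in> cball 0 (r + 1)")
    case True
    obtain \<xi> where "f (x + h k *\<^sub>R ?e) - f (x + 0 *\<^sub>R ?e) = (h k - 0) * pd i f (x + \<xi> *\<^sub>R ?e)"
      using MVT2[of 0 "h k" "\<lambda>t. f (x + t *\<^sub>R ?e)" "\<lambda>t. pd i f (x + t *\<^sub>R ?e)"] h der by blast
    then have "D k x = pd i f (x + \<xi> *\<^sub>R ?e)" using h[of k] by (simp add: D_def)
    then show ?thesis using True B' by simp
  next
    case False
    have "norm x \<le> norm (x + h k *\<^sub>R ?e) + norm (h k *\<^sub>R ?e)" by (metis add_diff_cancel_right' norm_triangle_ineq4)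
    then have "norm x \<le> norm (x + h k *\<^sub>R ?e) + 1" using h[of k] by simp
    then have "f (x + h k *\<^sub>R ?e) = 0" "f x = 0" using False by (auto intro!: z)
    then show ?thesis by (simp add: D_def)
  qed
  have tr: "has_bochner_integral lborel (\<lambda>x. f (x + v)) (integral\<^sup>L lborel f)" for v
  proof -
    have "has_bochner_integral (distr lborel borel ((+) v)) f (integral\<^sup>L lborel f)"
      unfolding lborel_distr_plus using fi by (rule has_bochner_integral_integrable)
    then have "integrable (distr lborel borel ((+) v)) f" "integral\<^sup>L (distr lborel borel ((+) v)) f = integral\<^sup>L lborel f"
      by (auto simp: has_bochner_integral_iff)
    then show ?thesis using borel_measurable_continuous_onI[OF fc]
      by (simp add: has_bochner_integral_iff integrable_distr_eq integral_distr add.commute)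
  qed
  have D0: "integral\<^sup>L lborel (D k) = 0" for k
  proof -
    have "has_bochner_integral lborel (\<lambda>x. f (x + h k *\<^sub>R ?e) - f x) (integral\<^sup>L lborel f - integral\<^sup>L lborel f)"
      by (intro has_bochner_integral_diff tr has_bochner_integral_integrable fi)
    then show ?thesis by (simp add: D_def[abs_def] has_bochner_integral_iff)
  qed
  have "(\<lambda>k. integral\<^sup>L lborel (D k)) \<longlonglongrightarrow> integral\<^sup>L lborel (pd i f)"
  proof (rule integral_dominated_convergence[where w = "\<lambda>x. \<bar>B\<bar> * indicator (cball 0 (r + 1)) x"])
    show "integrable lborel (\<lambda>x::real^'n. \<bar>B\<bar> * indicator (cball 0 (r + 1)) x :: real)"
      by (auto intro!: emeasure_bounded_finite)
    show "D k \<in> borel_measurable lborel" for k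
      unfolding D_def using borel_measurable_continuous_onI[OF fc] by measurable
  qed (use Dc Db c in \<open>auto intro: borel_measurable_continuous_onI\<close>)
  then show "integral\<^sup>L lborel (pd i f) = 0" by (simp add: D0 LIMSEQ_const_iff)
qed

text \<open>Only one derivative is demanded, because the fields to be integrated contain a primitive
  of a merely continuous function evaluated at u.\<close>

definition C1c :: "(real^'n \<Rightarrow> real) \<Rightarrow> bool" where
  "C1c f \<longleftrightarrow> (\<forall>x. f differentiable (at x)) \<and> (\<forall>i. continuous_on UNIV (pd i f))
     \<and> (\<exists>K. compact K \<and> K \<subseteq> ball 0 1 \<and> (\<forall>x. x \<notin> K \<longrightarrow> f x = 0))"

lemma C1c_integral:
  assumes "C1c f"
  shows "integrable lborel (pd i f)" "integral\<^sup>L lborel (pd i f) = 0"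
proof -
  obtain K where K: "K \<subseteq> ball 0 1" "\<And>x. x \<notin> K \<Longrightarrow> f x = 0" using assms unfolding C1c_def by auto
  have z: "f x = 0" if "1 < norm x" for x using K that by force
  have d: "f differentiable (at x)" and c: "continuous_on UNIV (pd i f)" for x
    using assms unfolding C1c_def by auto
  show "integrable lborel (pd i f)" "integral\<^sup>L lborel (pd i f) = 0"
    using integrable_pd[OF d c, of 1] integral_pd_eq_0[OF d c, of 1] z by blast+
qed

text \<open>The factor w may blow up at the sphere. Continuity of the derivative is glued over two
  open sets, the ball and the complement of a compact set outside which g vanishes.\<close>

lemma C1c_mult:
  fixes w g :: "real^'n \<Rightarrow> real"
  assumes w: "\<And>x. x \<in> ball 0 1 \<Longrightarrow> w differentiable (at x)" "\<And>i. continuous_on (ball 0 1) (pd i w)"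
    and g: "C1c g"
  shows "C1c (\<lambda>x. w x * g x)"
proof -
  obtain K where K: "compact K" "K \<subseteq> ball 0 1" "\<And>x. x \<notin> K \<Longrightarrow> g x = 0" using g unfolding C1c_def by auto
  have cl: "closed K" by (rule compact_imp_closed[OF K(1)])
  then have op: "open (-K)" by auto
  have un: "(UNIV :: (real^'n) set) = ball 0 1 \<union> -K" using K by auto
  have gd: "g differentiable (at x)" and gc: "continuous_on UNIV (pd i g)" for x i using g unfolding C1c_def by auto
  have gcont: "continuous_on UNIV g"
    using gd by (simp add: differentiable_imp_continuous_on differentiable_on_def differentiable_at_withinI)
  have wcont: "continuous_on (ball 0 1) w"
    using w(1) by (simp add: differentiable_imp_continuous_on differentiable_on_def differentiable_at_withinI)
  have "(\<lambda>x. w x * g x) differentiable (at x)" for x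
  proof (cases "x \<in> ball 0 1")
    case False
    then have "x \<in> -K" using K by auto
    then show ?thesis
      by (rule differentiable_cong_open[OF op, where g = "\<lambda>_. 0"]) (auto simp: K(3))
  qed (auto intro!: differentiable_mult w gd)
  moreover have "continuous_on UNIV (pd i (\<lambda>x. w x * g x))" for i
    unfolding un
  proof (rule continuous_on_open_Un)
    have "continuous_on (ball 0 1) (\<lambda>x. w x * pd i g x + pd i w x * g x)"
      by (intro continuous_intros wcont w(2) continuous_on_subset[OF gc] continuous_on_subset[OF gcont]) auto
    then show "continuous_on (ball 0 1) (pd i (\<lambda>x. w x * g x))"
      by (rule continuous_on_eq) (simp add: pd_mult w gd)
    have "pd i (\<lambda>x. w x * g x) x = 0" if "x \<in> -K" for x
      by (rule pd_outside[OF cl]) (use K that in auto)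
    then show "continuous_on (-K) (pd i (\<lambda>x. w x * g x))"
      by (intro continuous_on_eq[OF continuous_on_const]) auto
  qed (use op in auto)
  ultimately show ?thesis unfolding C1c_def using K by (metis mult_zero_right)
qed

lemma gnorm_hgrad: "gnorm x (hgrad u x) = \<bar>bdef x\<bar> / 2 * norm (egrad u x)"
proof -
  have "(conf x)\<^sup>2 * (((inverse (conf x))^2 *\<^sub>R egrad u x) \<bullet> ((inverse (conf x))^2 *\<^sub>R egrad u x))
     = (bdef x / 2)^2 * (egrad u x \<bullet> egrad u x)"
    by (simp add: conf_bdef field_simps power2_eq_square)
  then show ?thesis unfolding gnorm_def hgrad_def
    by (simp only: real_sqrt_mult norm_eq_sqrt_inner) simp
qed

text \<open>In terms of the hyperbolic distance \<open>\<rho>\<close> to the origin, \<open>hdelta = sech\<^sup>2 \<rho>\<close>.\<close>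
definition hdelta :: "real^'n \<Rightarrow> real" where "hdelta x = (bdef x / (2 - bdef x))^2"

section \<open>Integration against the hyperbolic volume\<close>

lemma nn_integral_hvol:
  fixes f :: "real^'n \<Rightarrow> ennreal"
  assumes "f \<in> borel_measurable borel"
  shows "(\<integral>\<^sup>+x. f x \<partial>hvol) = (\<integral>\<^sup>+x. indicator (ball 0 1) x * ennreal (conf x ^ CARD('n)) * f x \<partial>lborel)"
proof -
  have [measurable]: "conf \<in> borel_measurable (borel :: (real^'n) measure)" unfolding conf_def[abs_def] by measurable
  have [measurable]: "ball 0 1 \<in> sets (borel :: (real^'n) measure)" by auto
  define g where "g x = indicator (ball 0 1) x * ennreal (conf x ^ CARD('n))" for x :: "real^'n"
  have [measurable]: "g \<in> borel_measurable borel" unfolding g_def by measurable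
  have "hvol = density lborel g" unfolding hvol_def g_def ..
  then show ?thesis using nn_integral_density[of g lborel f] assms by (simp flip: g_def)
qed

lemma sets_hvol [measurable_cong, simp]: "sets hvol = sets borel" and space_hvol [simp]: "space hvol = UNIV"
  by (auto simp: hvol_def)

lemma primitive_exists:
  fixes j :: "real \<Rightarrow> real"
  assumes "continuous_on UNIV j" "\<And>s. s \<le> 0 \<Longrightarrow> j s = 0" "\<And>s. 0 \<le> j s"
  obtains J where "\<And>s. (J has_real_derivative j s) (at s)" "\<And>s. s \<le> 0 \<Longrightarrow> J s = 0" "\<And>s. 0 \<le> J s"
    "\<And>s. ennreal (J s) = (\<integral>\<^sup>+t. ennreal (j t) * indicator {0<..<s} t \<partial>lborel)"
proof -
  \<comment> \<open>Starting at -1 makes every s >= 0 an interior point of the interval used below,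
    so differentiability at 0 requires no one-sided argument; \<open>j\<close> vanishes between -1
    and 0.\<close>
  define J where "J s = integral {-1..s} j" for s
  have int: "j integrable_on {a..b}" for a b
    by (rule integrable_continuous_real) (use assms in \<open>auto intro: continuous_on_subset\<close>)
  have J0: "J s = 0" if "s \<le> 0" for s
  proof -
    have "J s = integral {-1..s} (\<lambda>_. 0)" unfolding J_def
      by (rule integral_cong) (use that assms in auto)
    then show ?thesis by simp
  qed
  have der: "(J has_real_derivative j s) (at s)" for s
  proof (cases "s < 0")
    case True
    have "(J has_derivative (\<lambda>_. 0)) (at s)"
      by (rule has_derivative_transform_within_open[OF has_derivative_const[of 0], of "{..<0}"]) (use True J0 in auto)
    then show ?thesis using True assms(2)[of s] by (simp add: has_field_derivative_def[abs_def] lambda_zero)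
  next
    case False
    have "((\<lambda>u. integral {-1..u} j) has_real_derivative j s) (at s within {-1..s + 1})"
      by (rule integral_has_real_derivative) (use assms False in \<open>auto intro: continuous_on_subset\<close>)
    moreover have "at s within {-1..s + 1} = at s"
      by (rule at_within_interior) (use False in auto)
    ultimately show ?thesis unfolding J_def by simp
  qed
  have Jp: "0 \<le> J s" for s unfolding J_def by (rule integral_nonneg) (use int assms in auto)
  have "ennreal (J s) = (\<integral>\<^sup>+t. ennreal (j t) * indicator {0<..<s} t \<partial>lborel)" for s
  proof (cases "s \<le> 0")
    case True then show ?thesis by (simp add: J0)
  next
    case False
    have "(\<integral>\<^sup>+t. ennreal (j t) * indicator {0..s} t \<partial>lborel) = ennreal (J s - J 0)"
      by (rule nn_integral_FTC_Icc) (use assms der False in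
        \<open>auto intro: borel_measurable_continuous_onI has_field_derivative_at_within\<close>)
    moreover have "(\<integral>\<^sup>+t. ennreal (j t) * indicator {0..s} t \<partial>lborel) = (\<integral>\<^sup>+t. ennreal (j t) * indicator {0<..<s} t \<partial>lborel)"
      by (rule nn_integral_cong_AE) (use AE_lborel_singleton[of 0] AE_lborel_singleton[of s] in
        \<open>eventually_elim, auto simp: indicator_def\<close>)
    ultimately show ?thesis by (simp add: J0)
  qed
  then show ?thesis using that der J0 Jp by blast
qed

lemma borel_measurable_conf [measurable]: "conf \<in> borel_measurable borel"
  and borel_measurable_bdef [measurable]: "bdef \<in> borel_measurable borel"
  and borel_measurable_hdelta [measurable]: "hdelta \<in> borel_measurable borel"
  unfolding conf_def[abs_def] bdef_def[abs_def] hdelta_def[abs_def] by measurable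

lemma borel_ball [measurable]: "ball x r \<in> sets borel" by auto

lemma continuous_bdef: "continuous_on S bdef"
  unfolding bdef_def[abs_def] by (intro continuous_intros)

lemma nn_integral_hvol_real:
  fixes f :: "real^'n \<Rightarrow> real"
  assumes [measurable]: "f \<in> borel_measurable borel"
  shows "(\<integral>\<^sup>+x. ennreal (f x) \<partial>hvol) = (\<integral>\<^sup>+x. ennreal (indicator (ball 0 1) x * conf x ^ CARD('n) * f x) \<partial>lborel)"
proof (subst nn_integral_hvol)
  show "(\<integral>\<^sup>+x. indicator (ball 0 1) x * ennreal (conf x ^ CARD('n)) * ennreal (f x) \<partial>lborel)
    = (\<integral>\<^sup>+x. ennreal (indicator (ball 0 1) x * conf x ^ CARD('n) * f x) \<partial>lborel)"
  proof (rule nn_integral_cong)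
    fix x :: "real^'n"
    show "indicator (ball 0 1) x * ennreal (conf x ^ CARD('n)) * ennreal (f x) = ennreal (indicator (ball 0 1) x * conf x ^ CARD('n) * f x)"
    proof (cases "x \<in> ball 0 1")
      case True
      then have "0 \<le> conf x ^ CARD('n)" using conf_pos[of x] by simp
      then show ?thesis using True ennreal_mult'[of "conf x ^ CARD('n)" "f x"] by (simp add: indicator_def)
    qed simp
  qed
qed simp

text \<open>In the applications S is a divergence. If R has infinite integral the claim is trivial;
  otherwise A is dominated by S + R, hence integrable, and the pointwise inequality can be
  integrated.\<close>

lemma nn_integral_le_of_integral_0:
  fixes A R S :: "'a \<Rightarrow> real"
  assumes [measurable]: "A \<in> borel_measurable M" "R \<in> borel_measurable M"
    and S: "integrable M S" "integral\<^sup>L M S = 0"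
    and le: "\<And>x. 0 \<le> A x" "\<And>x. 0 \<le> R x" "\<And>x. A x \<le> S x + R x"
  shows "(\<integral>\<^sup>+x. ennreal (A x) \<partial>M) \<le> (\<integral>\<^sup>+x. ennreal (R x) \<partial>M)"
proof (cases "(\<integral>\<^sup>+x. ennreal (R x) \<partial>M) = \<infinity>")
  case False
  then have R: "integrable M R"
    using le(2) by (intro integrableI_nonneg) (auto simp: top.not_eq_extremum)
  have A: "integrable M A"
    by (rule Bochner_Integration.integrable_bound[OF Bochner_Integration.integrable_add[OF S(1) R]])
      (use le in \<open>auto simp: abs_of_nonneg intro!: AE_I2 order_trans[OF le(3)] abs_ge_self\<close>)
  have "integral\<^sup>L M A \<le> integral\<^sup>L M (\<lambda>x. S x + R x)"
    by (intro integral_mono A Bochner_Integration.integrable_add S R le)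
  then show ?thesis
    using A R S le by (simp add: nn_integral_eq_integral ennreal_leI)
qed simp

lemma DERIV_two_div_power:
  fixes b :: real
  assumes "b > 0"
  shows "((\<lambda>t. (2 / t) ^ n) has_real_derivative (- real n * (2 / b) ^ n / b)) (at b)"
proof (cases n)
  case (Suc k)
  have "((\<lambda>t. 2 / t) has_real_derivative (- 2 / b^2)) (at b)"
    using assms by (auto intro!: derivative_eq_intros simp: power2_eq_square)
  from DERIV_power[OF this, of n] show ?thesis
    by (rule DERIV_cong) (use assms in \<open>simp add: Suc field_simps power2_eq_square\<close>)
qed simp

lemma norm_le_bdef: "2 * norm x \<le> 2 - bdef x"
  using zero_le_power2[of "norm x - 1"] by (simp add: bdef_def power2_diff)

text \<open>The field \<open>X = tanh \<rho> \<partial>\<^sub>\<rho>\<close> has length below 1 and divergence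
  \<open>n - 1 + sech\<^sup>2 \<rho>\<close>; integrate \<open>div (J \<bar>u\<bar> X)\<close> by parts.\<close>
lemma truncated_isoperimetric:
  fixes u :: "real^'n \<Rightarrow> real"
  assumes u: "u \<in> C0inf" and j: "continuous_on UNIV j" "\<And>s. s \<le> 0 \<Longrightarrow> j s = 0" "\<And>s. 0 \<le> j s"
    and J: "\<And>s. (J has_real_derivative j s) (at s)" "\<And>s. s \<le> 0 \<Longrightarrow> J s = 0" "\<And>s. 0 \<le> J s"
  shows "(\<integral>\<^sup>+x. ennreal ((real CARD('n) - 1 + hdelta x) * J \<bar>u x\<bar>) \<partial>hvol)
    \<le> (\<integral>\<^sup>+x. ennreal (j \<bar>u x\<bar> * gnorm x (hgrad u x)) \<partial>hvol)"
proof -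
  let ?n = "CARD('n)"
  obtain K where K: "smooth_fn u" "compact K" "K \<subseteq> ball 0 1" "\<And>x. x \<notin> K \<Longrightarrow> u x = 0" using C0infE[OF u] by metis
  have cl: "closed K" by (rule compact_imp_closed[OF K(2)])
  have ud: "u differentiable (at x)" and uc: "continuous_on UNIV (pd i u)" "continuous_on UNIV u" for i x
    using K(1) by (auto intro: smooth_fn_differentiable smooth_fn_pd smooth_fn_continuous)
  \<comment> \<open>The even extension of \<open>J\<close>: it equals J |s| but is visibly
    differentiable at 0, so composing with u avoids the corner of the absolute value.\<close>
  define H where "H s = J s + J (- s)" for s
  define k where "k s = j s - j (- s)" for s
  have Hd: "(H has_real_derivative k s) (at s)" for s
  proof -
    have "((\<lambda>s. J (- s)) has_real_derivative j (- s) * (-1)) (at s)"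
      by (rule DERIV_chain2[where f = J and g = uminus, OF J(1)]) (auto intro!: derivative_eq_intros)
    from DERIV_add[OF J(1)[of s] this] show ?thesis unfolding H_def[abs_def] k_def by simp
  qed
  have Hs: "H s = J \<bar>s\<bar>" for s unfolding H_def using J(2)[of s] J(2)[of "-s"] by (cases "s \<ge> 0") auto
  have ks: "\<bar>k s\<bar> = j \<bar>s\<bar>" for s unfolding k_def using j(2)[of s] j(2)[of "-s"] j(3) by (cases "s \<ge> 0") auto
  have kc: "continuous_on UNIV k" unfolding k_def
    by (intro continuous_intros continuous_on_compose2[OF j(1)]) auto
  have Jc: "continuous_on UNIV J" by (intro continuous_at_imp_continuous_on ballI DERIV_isCont[OF J(1)])
  define h where "h x = H (u x)" for x
  have hd: "h differentiable (at x)" for x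
    using has_derivative_compose_real[OF ud Hd] unfolding h_def[abs_def] differentiable_def by blast
  have hp: "pd i h = (\<lambda>x. k (u x) * pd i u x)" for i
    unfolding h_def[abs_def] by (rule ext, rule pd_compose[OF ud Hd])
  have h0: "h x = 0" if "x \<notin> K" for x using K(4)[OF that] J(2)[of 0] by (simp add: h_def H_def)
  have hC: "C1c h" unfolding C1c_def hp
    using hd h0 K by (auto intro!: continuous_intros uc continuous_on_compose2[OF kc])
  \<comment> \<open>In Euclidean coordinates the field is b / (2 - b) times x, with b =
    \<open>bdef x\<close>. The factor (2 / b)^n is the volume density, which turns the Riemannian
    divergence into a Euclidean one.\<close>
  define \<Psi> where "\<Psi> b = (2 / b) ^ ?n * (b / (2 - b))" for b :: real
  define w where "w i x = \<Psi> (bdef x) * x $ i" for i and x :: "real^'n"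
  have b: "0 < bdef x" "bdef x < 2" if "x \<in> ball 0 1" for x :: "real^'n"
    using that bdef_pos_iff[of x] bdef_le_1[of x] by linarith+
  have \<Psi>d: "(\<Psi> has_real_derivative (\<Psi> b * (1 / (2 - b) - (real ?n - 1) / b))) (at b)" if "0 < b" "b < 2" for b
  proof -
    have "((\<lambda>b. b / (2 - b)) has_real_derivative (2 / (2 - b)^2)) (at b)"
      using that by (auto intro!: derivative_eq_intros simp: power2_eq_square)
    from DERIV_mult[OF DERIV_two_div_power[OF that(1), of ?n] this]
    have "(\<Psi> has_real_derivative (- real ?n * (2 / b) ^ ?n / b * (b / (2 - b)) + 2 / (2 - b)\<^sup>2 * (2 / b) ^ ?n)) (at b)"
      unfolding \<Psi>_def[abs_def] .
    moreover have "- real ?n * T / b * (b / (2 - b)) + 2 / (2 - b)\<^sup>2 * T = T * (b / (2 - b)) * (1 / (2 - b) - (real ?n - 1) / b)" for T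
    proof -
      define c where "c = 2 - b"
      have "c > 0" "b = 2 - c" using that by (auto simp: c_def)
      have "2 / c^2 = (b / c) * (1/c) + 1/c"
      proof -
        have "(b / c) * (1/c) + 1/c = (b + c) / c^2" using \<open>c > 0\<close> by (simp add: field_simps power2_eq_square)
        then show ?thesis using \<open>b = 2 - c\<close> by simp
      qed
      then have "- real ?n * T / b * (b / c) + 2 / c\<^sup>2 * T = T * (b / c) * (1 / c - (real ?n - 1) / b)"
        using that \<open>c > 0\<close> by (simp add: field_simps)
      then show ?thesis by (simp add: c_def)
    qed
    ultimately show ?thesis unfolding \<Psi>_def by simp
  qed
  have bd: "bdef differentiable (at x)" for x :: "real^'n" by (intro smooth_fn_differentiable smooth_fn_bdef)
  have cd: "(\<lambda>x::real^'n. x $ i) differentiable (at x)" for i x by (intro smooth_fn_differentiable smooth_fn_coord)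
  have \<Psi>bd: "(\<lambda>x. \<Psi> (bdef x)) differentiable (at x)" if "x \<in> ball 0 1" for x :: "real^'n"
    using has_derivative_compose_real[OF bd \<Psi>d[OF b[OF that]]] unfolding differentiable_def by blast
  have wd: "w i differentiable (at x)" if "x \<in> ball 0 1" for x i
    unfolding w_def[abs_def] using \<Psi>bd[OF that] cd by (rule differentiable_mult)
  have wp: "pd l (w i) x = \<Psi> (bdef x) * (if l = i then 1 else 0) + \<Psi> (bdef x) * (1 / (2 - bdef x) - (real ?n - 1) / bdef x) * (-2 * x $ l) * x $ i"
    if "x \<in> ball 0 1" for x i l
    unfolding w_def[abs_def] using pd_mult[OF \<Psi>bd[OF that] cd, of l i] pd_compose[OF bd \<Psi>d[OF b[OF that]], of l]
    by (simp add: pd_bdef pd_coord)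
  have wc: "continuous_on (ball 0 1) (pd l (w i))" for l i
  proof (rule continuous_on_eq[OF _ wp[symmetric]])
    show "continuous_on (ball 0 1) (\<lambda>x::real^'n. \<Psi> (bdef x) * (if l = i then 1 else 0) + \<Psi> (bdef x) * (1 / (2 - bdef x) - (real ?n - 1) / bdef x) * (-2 * x $ l) * x $ i)"
      unfolding \<Psi>_def using b by (auto intro!: continuous_intros continuous_bdef simp: less_imp_neq[symmetric]) 
  qed
  define S where "S x = (\<Sum>i\<in>UNIV. pd i (\<lambda>x. w i x * h x) x)" for x
  have C: "C1c (\<lambda>x. w i x * h x)" for i by (rule C1c_mult[OF wd wc hC])
  have Si: "integrable lborel S" unfolding S_def by (intro Bochner_Integration.integrable_sum C1c_integral C)
  have S0: "integral\<^sup>L lborel S = 0" unfolding S_def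
    by (subst Bochner_Integration.integral_sum) (auto simp: C1c_integral[OF C])
  have S_out: "S x = 0" if "x \<notin> ball 0 1" for x
  proof -
    have "x \<notin> K" using that K by auto
    then show ?thesis unfolding S_def by (intro sum.neutral ballI pd_outside[OF cl]) (auto simp: h0)
  qed
  have S_in: "S x = conf x ^ ?n * ((real ?n - 1 + hdelta x) * h x) + \<Psi> (bdef x) * k (u x) * (x \<bullet> egrad u x)" if x: "x \<in> ball 0 1" for x
  proof -
    let ?b = "bdef x"
    let ?D = "\<Psi> ?b * (1 / (2 - ?b) - (real ?n - 1) / ?b)"
    have "S x = (\<Sum>i\<in>UNIV. \<Psi> ?b * k (u x) * (x $ i * pd i u x) + (\<Psi> ?b + ?D * (-2) * (x $ i * x $ i)) * h x)"
      unfolding S_def by (rule sum.cong[OF refl], subst pd_mult[OF wd[OF x] hd]) (simp add: wp[OF x] hp w_def algebra_simps)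
    also have "\<dots> = \<Psi> ?b * k (u x) * (\<Sum>i\<in>UNIV. x $ i * pd i u x) + (real ?n * \<Psi> ?b + ?D * (-2) * (\<Sum>i\<in>UNIV. x $ i * x $ i)) * h x"
      by (simp only: sum.distrib distrib_right sum_distrib_left[symmetric] sum_distrib_right[symmetric] sum_constant) (simp add: mult_ac)
    also have "(\<Sum>i\<in>UNIV. x $ i * x $ i) = 1 - ?b" using norm_sq_coord[of x] by (simp add: bdef_def)
    also have "(\<Sum>i\<in>UNIV. x $ i * pd i u x) = x \<bullet> egrad u x" by (simp add: inner_vec_def egrad_def)
    also have "real ?n * \<Psi> ?b + ?D * (-2) * (1 - ?b) = conf x ^ ?n * (real ?n - 1 + hdelta x)"
    proof -
      define c where "c = 2 - ?b"
      have c: "c > 0" "?b > 0" "?b = 2 - c" using b[OF x] by (auto simp: c_def)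
      have "real ?n * (?b / c) + ?b / c * (1 / c - (real ?n - 1) / ?b) * (-2) * (1 - ?b) = real ?n - 1 + (?b / c)^2"
        using c(1,2) unfolding c(3) by (simp add: field_simps power2_eq_square)
      then have "conf x ^ ?n * (real ?n * (?b / c) + ?b / c * (1 / c - (real ?n - 1) / ?b) * (-2) * (1 - ?b)) = conf x ^ ?n * (real ?n - 1 + (?b / c)^2)"
        by simp
      moreover have "N * (P * \<beta>) + P * \<beta> * \<gamma> * (-2) * \<delta> = P * (N * \<beta> + \<beta> * \<gamma> * (-2) * \<delta>)" for N P \<beta> \<gamma> \<delta> :: real
        by (simp add: algebra_simps)
      moreover have "\<Psi> ?b = conf x ^ ?n * (?b / c)" by (simp add: \<Psi>_def conf_bdef c_def)
      moreover have "hdelta x = (?b / c)^2" by (simp add: hdelta_def c_def)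
      ultimately show ?thesis by (simp only: c_def)
    qed
    finally show ?thesis by (simp add: algebra_simps)
  qed
  define A where "A x = indicator (ball 0 1) x * conf x ^ ?n * ((real ?n - 1 + hdelta x) * J \<bar>u x\<bar>)" for x
  define R where "R x = indicator (ball 0 1) x * conf x ^ ?n * (j \<bar>u x\<bar> * gnorm x (hgrad u x))" for x
  have n1: "real ?n \<ge> 1" using zero_less_card_finite[where 'a='n] by linarith
  have eg: "continuous_on UNIV (egrad u)" unfolding egrad_def[abs_def] by (intro continuous_on_vec_lambda uc)
  have [measurable]: "j \<in> borel_measurable borel" "u \<in> borel_measurable borel" "egrad u \<in> borel_measurable borel"
    "J \<in> borel_measurable borel"
    using j(1) uc eg Jc by (auto intro!: borel_measurable_continuous_onI)
  have [measurable]: "A \<in> borel_measurable borel" "R \<in> borel_measurable borel"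
    unfolding A_def R_def gnorm_hgrad by measurable
  have A0: "0 \<le> A x" and R0: "0 \<le> R x" for x
    using conf_pos[of x] n1 J(3) j(3) by (auto simp: A_def R_def indicator_def gnorm_hgrad hdelta_def)
  have "(\<integral>\<^sup>+x. ennreal (A x) \<partial>lborel) \<le> (\<integral>\<^sup>+x. ennreal (R x) \<partial>lborel)"
  proof (rule nn_integral_le_of_integral_0[OF _ _ Si S0 A0 R0])
    fix x show "A x \<le> S x + R x"
    proof (cases "x \<in> ball 0 1")
      case True
      let ?b = "bdef x"
      have bb: "0 < ?b" "?b < 2" by (rule b[OF True])+
      have "\<bar>\<Psi> ?b * k (u x) * (x \<bullet> egrad u x)\<bar> \<le> \<Psi> ?b * j \<bar>u x\<bar> * (norm x * norm (egrad u x))"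
      proof -
        have "0 \<le> \<Psi> ?b" using bb by (simp add: \<Psi>_def)
        then have "\<bar>\<Psi> ?b * k (u x) * (x \<bullet> egrad u x)\<bar> = \<Psi> ?b * j \<bar>u x\<bar> * \<bar>x \<bullet> egrad u x\<bar>"
          by (simp add: abs_mult ks)
        also have "\<dots> \<le> \<Psi> ?b * j \<bar>u x\<bar> * (norm x * norm (egrad u x))"
          using \<open>0 \<le> \<Psi> ?b\<close> j(3) Cauchy_Schwarz_ineq2[of x "egrad u x"] by (intro mult_left_mono) auto
        finally show ?thesis .
      qed
      also have "\<dots> = conf x ^ ?n * j \<bar>u x\<bar> * norm (egrad u x) * ?b * (norm x / (2 - ?b))"
        by (simp add: \<Psi>_def conf_bdef)
      \<comment> \<open>This is the bound on the length of the field: |x| / (2 - b) <= 1 / 2 says 2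
        |x| <= 1 + |x|^2.\<close>
      also have "\<dots> \<le> conf x ^ ?n * j \<bar>u x\<bar> * norm (egrad u x) * ?b * (1 / 2)"
        using bb j(3) conf_pos[OF True] norm_le_bdef[of x] by (intro mult_left_mono) (auto simp: field_simps)
      also have "\<dots> = R x" using True bb by (simp add: R_def gnorm_hgrad)
      finally show ?thesis using True S_in[OF True] Hs by (simp add: A_def h_def)
    qed (simp add: S_out A_def R_def)
  qed auto
  moreover have "(\<integral>\<^sup>+x. ennreal ((real ?n - 1 + hdelta x) * J \<bar>u x\<bar>) \<partial>hvol) = (\<integral>\<^sup>+x. ennreal (A x) \<partial>lborel)"
    unfolding A_def by (rule nn_integral_hvol_real) ((unfold gnorm_hgrad)?, measurable)
  moreover have "(\<integral>\<^sup>+x. ennreal (j \<bar>u x\<bar> * gnorm x (hgrad u x)) \<partial>hvol) = (\<integral>\<^sup>+x. ennreal (R x) \<partial>lborel)"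
    unfolding R_def by (rule nn_integral_hvol_real) ((unfold gnorm_hgrad)?, measurable)
  ultimately show ?thesis by simp
qed

text \<open>Integrate the divergence of H(u) grad u, where H is the odd extension of
  \<open>J\<close>. The integral of j |u| |grad u|^2 is then minus that of H(u)
  \<open>hlap u\<close>, and |H(u)| = J |u|.\<close>

lemma truncated_Green:
  fixes u :: "real^'n \<Rightarrow> real"
  assumes u: "u \<in> C0inf" and j: "continuous_on UNIV j" "\<And>s. s \<le> 0 \<Longrightarrow> j s = 0" "\<And>s. 0 \<le> j s"
    and J: "\<And>s. (J has_real_derivative j s) (at s)" "\<And>s. s \<le> 0 \<Longrightarrow> J s = 0" "\<And>s. 0 \<le> J s"
  shows "(\<integral>\<^sup>+x. ennreal (j \<bar>u x\<bar> * (gnorm x (hgrad u x))^2) \<partial>hvol)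
    \<le> (\<integral>\<^sup>+x. ennreal (\<bar>hlap u x\<bar> * J \<bar>u x\<bar>) \<partial>hvol)"
proof -
  let ?n = "CARD('n)"
  obtain K where K: "smooth_fn u" "compact K" "K \<subseteq> ball 0 1" "\<And>x. x \<notin> K \<Longrightarrow> u x = 0" using C0infE[OF u] by metis
  have cl: "closed K" by (rule compact_imp_closed[OF K(2)])
  have ud: "u differentiable (at x)" "pd i u differentiable (at x)" and uc: "continuous_on UNIV (pd i u)" "continuous_on UNIV u"
     "continuous_on UNIV (pd l (pd i u))" for i l x
    using K(1) by (auto intro: smooth_fn_differentiable smooth_fn_pd smooth_fn_continuous)
  define H where "H s = J s - J (- s)" for s
  define k where "k s = j s + j (- s)" for s
  have Hd: "(H has_real_derivative k s) (at s)" for s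
  proof -
    have "((\<lambda>s. J (- s)) has_real_derivative j (- s) * (-1)) (at s)"
      by (rule DERIV_chain2[where f = J and g = uminus, OF J(1)]) (auto intro!: derivative_eq_intros)
    from DERIV_diff[OF J(1)[of s] this] show ?thesis unfolding H_def[abs_def] k_def by simp
  qed
  have Hs: "\<bar>H s\<bar> = J \<bar>s\<bar>" for s unfolding H_def using J(2)[of s] J(2)[of "-s"] J(3) by (cases "s \<ge> 0") auto
  have ks: "k s = j \<bar>s\<bar>" for s unfolding k_def using j(2)[of s] j(2)[of "-s"] j(3) by (cases "s \<ge> 0") auto
  have kc: "continuous_on UNIV k" unfolding k_def
    by (intro continuous_intros continuous_on_compose2[OF j(1)]) auto
  have Hc: "continuous_on UNIV H" by (intro continuous_at_imp_continuous_on ballI DERIV_isCont[OF Hd])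
  have Jc: "continuous_on UNIV J" by (intro continuous_at_imp_continuous_on ballI DERIV_isCont[OF J(1)])
  define h where "h x = H (u x)" for x
  have hd: "h differentiable (at x)" for x
    using has_derivative_compose_real[OF ud(1) Hd] unfolding h_def[abs_def] differentiable_def by blast
  have hp: "pd i h = (\<lambda>x. k (u x) * pd i u x)" for i
    unfolding h_def[abs_def] by (rule ext, rule pd_compose[OF ud(1) Hd])
  have h0: "h x = 0" if "x \<notin> K" for x using K(4)[OF that] J(2)[of 0] by (simp add: h_def H_def)
  have hc: "continuous_on UNIV h" unfolding h_def by (intro continuous_on_compose2[OF Hc] uc) auto
  define g where "g i x = pd i u x * h x" for i x
  have gp: "pd l (g i) = (\<lambda>x. pd i u x * (k (u x) * pd l u x) + pd l (pd i u) x * h x)" for l i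
    unfolding g_def[abs_def] using pd_mult[OF ud(2) hd] by (auto simp: hp)
  have gC: "C1c (g i)" for i unfolding C1c_def gp
  proof (intro conjI allI exI[of _ K])
    show "g i differentiable (at x)" for x unfolding g_def[abs_def] by (intro differentiable_mult ud hd)
    show "continuous_on UNIV (\<lambda>x. pd i u x * (k (u x) * pd l u x) + pd l (pd i u) x * h x)" for l
      by (intro continuous_intros uc hc continuous_on_compose2[OF kc]) auto
    show "x \<notin> K \<longrightarrow> g i x = 0" for x by (simp add: g_def h0)
  qed (use K in auto)
  define w where "w y = conf y ^ ?n * (inverse (conf y))^2" for y :: "real^'n"
  have b: "0 < bdef x" "bdef x < 2" if "x \<in> ball 0 1" for x :: "real^'n"
    using that bdef_pos_iff[of x] bdef_le_1[of x] by linarith+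
  have wd: "w differentiable (at x)" if "x \<in> ball 0 1" for x
    unfolding w_def[abs_def] by (rule pd_conf_weight(1)[OF that])
  have wp: "pd l w x = (real ?n - 2) * conf x ^ ?n / conf x * x $ l" if "x \<in> ball 0 1" for x l
    unfolding w_def[abs_def] by (rule pd_conf_weight(2)[OF that])
  have wc: "continuous_on (ball 0 1) (pd l w)" for l
  proof (rule continuous_on_eq[OF _ wp[symmetric]])
    show "continuous_on (ball 0 1) (\<lambda>x::real^'n. (real ?n - 2) * conf x ^ ?n / conf x * x $ l)"
      unfolding conf_bdef using b by (auto intro!: continuous_intros continuous_bdef simp: less_imp_neq[symmetric]) 
  qed
  define S where "S x = (\<Sum>i\<in>UNIV. pd i (\<lambda>x. w x * g i x) x)" for x
  have C: "C1c (\<lambda>x. w x * g i x)" for i by (rule C1c_mult[OF wd wc gC])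
  have Si: "integrable lborel S" unfolding S_def by (intro Bochner_Integration.integrable_sum C1c_integral C)
  have S0: "integral\<^sup>L lborel S = 0" unfolding S_def
    by (subst Bochner_Integration.integral_sum) (auto simp: C1c_integral[OF C])
  have S_out: "S x = 0" if "x \<notin> ball 0 1" for x
  proof -
    have "x \<notin> K" using that K by auto
    then show ?thesis unfolding S_def by (intro sum.neutral ballI pd_outside[OF cl]) (auto simp: g_def h0)
  qed
  have S_in: "S x = conf x ^ ?n * (hlap u x * h x) + conf x ^ ?n * (j \<bar>u x\<bar> * (gnorm x (hgrad u x))^2)" if x: "x \<in> ball 0 1" for x
  proof -
    have e: "(\<lambda>y. conf y ^ ?n * (hgrad u y $ i)) = (\<lambda>y. w y * pd i u y)" for i
      by (simp add: hgrad_def egrad_def w_def algebra_simps)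
    have "(\<lambda>x. w x * g i x) = (\<lambda>x. (w x * pd i u x) * h x)" for i by (simp add: g_def mult.assoc)
    then have "S x = (\<Sum>i\<in>UNIV. pd i (\<lambda>y. w y * pd i u y) x * h x + w x * j \<bar>u x\<bar> * (pd i u x * pd i u x))"
      unfolding S_def using pd_mult[OF differentiable_mult[OF wd[OF x] ud(2)] hd]
      by (simp add: hp ks algebra_simps)
    also have "\<dots> = (\<Sum>i\<in>UNIV. pd i (\<lambda>y. w y * pd i u y) x) * h x + w x * j \<bar>u x\<bar> * (egrad u x \<bullet> egrad u x)"
      by (simp add: sum.distrib sum_distrib_left sum_distrib_right inner_vec_def egrad_def)
    also have "(\<Sum>i\<in>UNIV. pd i (\<lambda>y. w y * pd i u y) x) = conf x ^ ?n * hlap u x"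
      unfolding hlap_def e using conf_pos[OF x] by simp
    also have "w x * j \<bar>u x\<bar> * (egrad u x \<bullet> egrad u x) = conf x ^ ?n * (j \<bar>u x\<bar> * (gnorm x (hgrad u x))^2)"
      using b[OF x] by (simp add: w_def gnorm_hgrad conf_bdef power_mult_distrib power_divide power2_norm_eq_inner)
    finally show ?thesis by simp
  qed
  define A where "A x = indicator (ball 0 1) x * conf x ^ ?n * (j \<bar>u x\<bar> * (gnorm x (hgrad u x))^2)" for x
  define R where "R x = indicator (ball 0 1) x * conf x ^ ?n * (\<bar>hlap u x\<bar> * J \<bar>u x\<bar>)" for x
  have eg: "continuous_on UNIV (egrad u)" unfolding egrad_def[abs_def] by (intro continuous_on_vec_lambda uc)
  have hl: "continuous_on UNIV (hlap u)" by (intro smooth_fn_continuous C0inf_smooth C0inf_hlap u)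
  have [measurable]: "j \<in> borel_measurable borel" "u \<in> borel_measurable borel" "egrad u \<in> borel_measurable borel"
    "J \<in> borel_measurable borel" "hlap u \<in> borel_measurable borel"
    using j(1) uc eg Jc hl by (auto intro!: borel_measurable_continuous_onI)
  have [measurable]: "A \<in> borel_measurable borel" "R \<in> borel_measurable borel"
    unfolding A_def R_def gnorm_hgrad by measurable
  have A0: "0 \<le> A x" and R0: "0 \<le> R x" for x
    using conf_pos[of x] J(3) j(3) by (auto simp: A_def R_def indicator_def gnorm_hgrad)
  have "(\<integral>\<^sup>+x. ennreal (A x) \<partial>lborel) \<le> (\<integral>\<^sup>+x. ennreal (R x) \<partial>lborel)"
  proof (rule nn_integral_le_of_integral_0[OF _ _ Si S0 A0 R0])
    fix x show "A x \<le> S x + R x"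
    proof (cases "x \<in> ball 0 1")
      case True
      have "\<bar>hlap u x * h x\<bar> = \<bar>hlap u x\<bar> * J \<bar>u x\<bar>" by (simp add: abs_mult h_def Hs)
      then have "0 \<le> hlap u x * h x + \<bar>hlap u x\<bar> * J \<bar>u x\<bar>" by linarith
      then have "0 \<le> conf x ^ ?n * (hlap u x * h x + \<bar>hlap u x\<bar> * J \<bar>u x\<bar>)"
        using conf_pos[OF True] by simp
      then show ?thesis using True by (simp add: A_def R_def S_in[OF True] algebra_simps)
    qed (simp add: S_out A_def R_def)
  qed auto
  moreover have "(\<integral>\<^sup>+x. ennreal (j \<bar>u x\<bar> * (gnorm x (hgrad u x))^2) \<partial>hvol) = (\<integral>\<^sup>+x. ennreal (A x) \<partial>lborel)"
    unfolding A_def by (rule nn_integral_hvol_real) ((unfold gnorm_hgrad)?, measurable)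
  moreover have "(\<integral>\<^sup>+x. ennreal (\<bar>hlap u x\<bar> * J \<bar>u x\<bar>) \<partial>hvol) = (\<integral>\<^sup>+x. ennreal (R x) \<partial>lborel)"
    unfolding R_def by (rule nn_integral_hvol_real) ((unfold gnorm_hgrad)?, measurable)
  ultimately show ?thesis by simp
qed

section \<open>Weighted distribution functions\<close>

text \<open>Continuous tests reach indicators of open sets by monotone limits, outer regularity
  reaches Borel sets, and comparison of measures reaches every Borel \<open>g\<close>.\<close>

lemma nn_integral_mono_continuous_tests:
  fixes M N :: "real measure"
  assumes M [measurable_cong, simp]: "sets M = sets borel" and N [measurable_cong, simp]: "sets N = sets borel"
    and fin: "emeasure N (space N) \<noteq> \<infinity>"
    and le: "\<And>j. continuous_on UNIV j \<Longrightarrow> (\<And>s. s \<le> 0 \<Longrightarrow> j s = 0) \<Longrightarrow> (\<And>s. 0 \<le> j s) \<Longrightarrow>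
       (\<integral>\<^sup>+s. ennreal (j s) \<partial>M) \<le> (\<integral>\<^sup>+s. ennreal (j s) \<partial>N)"
    and g [measurable]: "g \<in> borel_measurable borel"
  shows "(\<integral>\<^sup>+s. g s * indicator {0<..} s \<partial>M) \<le> (\<integral>\<^sup>+s. g s * indicator {0<..} s \<partial>N)"
proof -
  have op: "emeasure M U \<le> emeasure N U" if U: "open U" "U \<subseteq> {0<..}" for U
  proof -
    have ne: "- U \<noteq> {}" using U by (auto intro!: exI[of _ 0])
    have cl: "closed (- U)" using U by auto
    \<comment> \<open>These increase to the indicator of U and vanish for s <= 0, because U lies in
      the open half line.\<close>
    define j where "j k s = min 1 (real k * infdist s (- U))" for k s
    have jc: "continuous_on UNIV (j k)" for k unfolding j_def by (intro continuous_intros)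
    have [measurable]: "j k \<in> borel_measurable borel" for k by (intro borel_measurable_continuous_onI jc)
    have j0: "0 \<le> j k s" for k s by (simp add: j_def infdist_nonneg)
    have jz: "j k s = 0" if "s \<le> 0" for k s
    proof -
      have "s \<in> - U" using U that by auto
      then show ?thesis by (simp add: j_def)
    qed
    have sup: "(SUP k. ennreal (j k s)) = indicator U s" for s
    proof (cases "s \<in> U")
      case True
      then have "infdist s (- U) > 0" using cl ne in_closed_iff_infdist_zero[of "- U" s] infdist_nonneg[of s "- U"] by auto
      then obtain k where "1 \<le> real k * infdist s (- U)" using reals_Archimedean3 less_imp_le by metis
      then have "ennreal (j k s) = 1" by (simp add: j_def)
      moreover have "ennreal (j k s) \<le> 1" for k by (simp add: j_def)
      ultimately have "(SUP k. ennreal (j k s)) = 1"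
        using SUP_upper[of k UNIV "\<lambda>k. ennreal (j k s)"] by (intro antisym SUP_least) auto
      then show ?thesis using True by simp
    next
      case False
      then have "s \<in> - U" by simp
      then show ?thesis by (simp add: j_def)
    qed
    have inc: "incseq (\<lambda>k s. ennreal (j k s))"
    proof -
      have "j m s \<le> j n s" if "m \<le> n" for m n s
        unfolding j_def using mult_right_mono[of "real m" "real n" "infdist s (- U)"] infdist_nonneg[of s "- U"] that
        by (auto simp: min_def)
      then show ?thesis by (auto simp: incseq_def le_fun_def intro!: ennreal_leI)
    qed
    have [measurable]: "U \<in> sets borel" using U by auto
    have "emeasure M U = (SUP k. \<integral>\<^sup>+s. ennreal (j k s) \<partial>M)"
      by (subst nn_integral_monotone_convergence_SUP[OF inc, symmetric]) (auto simp: sup)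
    also have "\<dots> \<le> (SUP k. \<integral>\<^sup>+s. ennreal (j k s) \<partial>N)"
      by (intro SUP_mono' le jc jz j0)
    also have "\<dots> = emeasure N U"
      by (subst nn_integral_monotone_convergence_SUP[OF inc, symmetric]) (auto simp: sup)
    finally show ?thesis .
  qed
  have all: "emeasure M (A \<inter> {0<..}) \<le> emeasure N (A \<inter> {0<..})" if A: "A \<in> sets borel" for A
  proof -
    have "emeasure M (A \<inter> {0<..}) \<le> emeasure N U" if "A \<inter> {0<..} \<subseteq> U" "open U" for U
    proof -
      have "emeasure M (A \<inter> {0<..}) \<le> emeasure M (U \<inter> {0<..})"
        by (rule emeasure_mono) (use that in auto)
      also have "\<dots> \<le> emeasure N (U \<inter> {0<..})" by (rule op) (use that in auto)
      also have "\<dots> \<le> emeasure N U" by (rule emeasure_mono) (use that in auto)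
      finally show ?thesis .
    qed
    \<comment> \<open>Regularity is applied to N, the finite and larger measure: an open set that is
      tight around A for N also bounds the M-measure of A.\<close>
    then show ?thesis
      by (subst outer_regular[OF N fin]) (use A in \<open>auto intro!: INF_greatest\<close>)
  qed
  define M' where "M' = density M (indicator {0<..})"
  define N' where "N' = density N (indicator {0<..})"
  have em: "emeasure M' A = emeasure M (A \<inter> {0<..})" "emeasure N' A = emeasure N (A \<inter> {0<..})" if "A \<in> sets borel" for A
  proof -
    have "emeasure (density K (indicator {0<..})) A = emeasure K (A \<inter> {0<..})" if [measurable_cong, simp]: "sets K = sets borel" for K :: "real measure"
    proof -
      have "emeasure (density K (indicator {0<..})) A = (\<integral>\<^sup>+x. indicator {0<..} x * indicator A x \<partial>K)"
        by (rule emeasure_density) (use \<open>A \<in> sets borel\<close> in auto)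
      also have "\<dots> = (\<integral>\<^sup>+x. indicator (A \<inter> {0<..}) x \<partial>K)"
        by (intro nn_integral_cong) (auto simp: indicator_def)
      also have "\<dots> = emeasure K (A \<inter> {0<..})" by (rule nn_integral_indicator) (use \<open>A \<in> sets borel\<close> in auto)
      finally show ?thesis .
    qed
    then show "emeasure M' A = emeasure M (A \<inter> {0<..})" "emeasure N' A = emeasure N (A \<inter> {0<..})"
      by (simp_all add: M'_def N'_def)
  qed
  have s: "sets M' = sets borel" "sets N' = sets borel" by (auto simp: M'_def N'_def)
  have "emeasure M' A \<le> emeasure N' A" for A
    using all em by (cases "A \<in> sets borel") (auto simp: emeasure_notin_sets s)
  then have "M' \<le> N'" using s sets_eq_imp_space_eq[OF s(1)] sets_eq_imp_space_eq[OF s(2)]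
    by (auto simp: le_measure_iff le_fun_def)
  then have "integral\<^sup>N M' g \<le> integral\<^sup>N N' g"
    by (intro nn_integral_mono_measure) (use s in \<open>auto cong: measurable_cong_sets\<close>)
  then show ?thesis unfolding M'_def N'_def
    by (simp add: nn_integral_density mult.commute)
qed

lemma sigma_finite_hvol: "sigma_finite_measure (hvol :: (real^'n) measure)"
proof -
  have "(\<lambda>x::real^'n. indicator (ball 0 1) x * ennreal (conf x ^ CARD('n))) \<in> borel_measurable lborel" by measurable
  from sigma_finite_measure.sigma_finite_iff_density_finite[OF lborel.sigma_finite_measure_axioms this]
  show ?thesis unfolding hvol_def by (simp add: ennreal_mult_eq_top_iff indicator_def)
qed

interpretation hvol: sigma_finite_measure hvol by (rule sigma_finite_hvol)
interpretation lh: pair_sigma_finite lborel hvol by unfold_locales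
interpretation hl: pair_sigma_finite hvol lborel by unfold_locales

lemma emeasure_hvol_compact:
  fixes K :: "(real^'n) set"
  assumes "compact K" "K \<subseteq> ball 0 1"
  shows "emeasure hvol K < \<infinity>"
proof -
  have [measurable]: "K \<in> sets borel" using assms by (auto intro: borel_closed compact_imp_closed)
  have ne: "bdef x \<noteq> 0" if "x \<in> K" for x using that assms bdef_pos_iff[of x] by auto
  have "compact ((\<lambda>x. conf x ^ CARD('n)) ` K)" unfolding conf_bdef
    by (intro compact_continuous_image continuous_intros continuous_bdef assms) (use ne in auto)
  then obtain B where B: "\<And>x. x \<in> K \<Longrightarrow> \<bar>conf x ^ CARD('n)\<bar> \<le> B"
    by (metis bounded_iff compact_imp_bounded imageI real_norm_def)
  have "emeasure hvol K = (\<integral>\<^sup>+x. indicator K x \<partial>hvol)" by simp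
  also have "\<dots> = (\<integral>\<^sup>+x. indicator (ball 0 1) x * ennreal (conf x ^ CARD('n)) * indicator K x \<partial>lborel)"
    by (rule nn_integral_hvol) measurable
  also have "\<dots> \<le> (\<integral>\<^sup>+x. ennreal B * indicator K x \<partial>lborel)"
  proof (rule nn_integral_mono)
    fix x show "indicator (ball 0 1) x * ennreal (conf x ^ CARD('n)) * indicator K x \<le> ennreal B * indicator K x"
      using B[of x] assms(2) by (cases "x \<in> K") (auto simp: indicator_def intro!: ennreal_leI)
  qed
  also have "\<dots> = ennreal B * emeasure lborel K" by (simp add: nn_integral_cmult)
  also have "\<dots> < \<infinity>" using emeasure_bounded_finite[OF compact_imp_bounded[OF assms(1)]]
    by (simp add: ennreal_mult_less_top)
  finally show ?thesis .
qed

lemma continuous_support_bounded: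
  fixes f :: "'a::real_normed_vector \<Rightarrow> real"
  assumes "compact K" "continuous_on UNIV f" "\<And>x. x \<notin> K \<Longrightarrow> f x = 0"
  obtains C where "0 \<le> C" "\<And>x. \<bar>f x\<bar> \<le> C * indicator K x"
proof -
  have "compact (f ` K)" using assms by (intro compact_continuous_image) (auto intro: continuous_on_subset)
  then obtain B where B: "\<And>x. x \<in> K \<Longrightarrow> \<bar>f x\<bar> \<le> B"
    by (metis bounded_iff compact_imp_bounded imageI real_norm_def)
  have "\<bar>f x\<bar> \<le> \<bar>B\<bar> * indicator K x" for x using B[of x] assms(3)[of x] by (auto simp: indicator_def)
  then show ?thesis using that[of "\<bar>B\<bar>"] by auto
qed

lemma nn_integral_hvol_finite:
  fixes f :: "real^'n \<Rightarrow> real"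
  assumes "compact K" "K \<subseteq> ball 0 1" "continuous_on UNIV f" "\<And>x. x \<notin> K \<Longrightarrow> f x = 0"
  shows "(\<integral>\<^sup>+x. ennreal (f x) \<partial>hvol) < \<infinity>"
proof -
  obtain C where C: "0 \<le> C" "\<And>x. \<bar>f x\<bar> \<le> C * indicator K x"
    using continuous_support_bounded[OF assms(1,3,4)] by blast
  have [measurable]: "K \<in> sets borel" using assms by (auto intro: borel_closed compact_imp_closed)
  have "(\<integral>\<^sup>+x. ennreal (f x) \<partial>hvol) \<le> (\<integral>\<^sup>+x. ennreal C * indicator K x \<partial>hvol)"
  proof (rule nn_integral_mono)
    fix x show "ennreal (f x) \<le> ennreal C * indicator K x"
      using C(2)[of x] by (auto simp: indicator_def ennreal_leI ennreal_neg split: if_splits)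
  qed
  also have "\<dots> = ennreal C * emeasure hvol K" by (simp add: nn_integral_cmult)
  also have "\<dots> < \<infinity>" using emeasure_hvol_compact[OF assms(1,2)] by (simp add: ennreal_mult_less_top)
  finally show ?thesis .
qed

definition wdfun :: "(real^'n \<Rightarrow> real) \<Rightarrow> (real^'n \<Rightarrow> real) \<Rightarrow> real \<Rightarrow> ennreal" where
  "wdfun c u s = (\<integral>\<^sup>+x. ennreal (c x) * indicator {x. s < \<bar>u x\<bar>} x \<partial>hvol)"

lemma borel_measurable_wdfun [measurable]:
  assumes [measurable]: "c \<in> borel_measurable borel" "u \<in> borel_measurable borel"
  shows "wdfun c u \<in> borel_measurable borel"
  unfolding wdfun_def by measurable

text \<open>Layer cake: the primitive at |u| is an integral over the levels below |u|, and Fubini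
  collects the points above each level.\<close>

lemma nn_integral_primitive_eq_wdfun:
  fixes u c :: "real^'n \<Rightarrow> real"
  assumes [measurable]: "c \<in> borel_measurable borel" "u \<in> borel_measurable borel" "j \<in> borel_measurable borel"
    and J: "\<And>s. J s = (\<integral>\<^sup>+t. j t * indicator {0<..<s} t \<partial>lborel)"
  shows "(\<integral>\<^sup>+x. ennreal (c x) * J \<bar>u x\<bar> \<partial>hvol) = (\<integral>\<^sup>+s. j s * indicator {0<..} s * wdfun c u s \<partial>lborel)"
proof -
  have "(\<integral>\<^sup>+x. ennreal (c x) * J \<bar>u x\<bar> \<partial>hvol)
    = (\<integral>\<^sup>+x. (\<integral>\<^sup>+t. ennreal (c x) * (j t * (indicator {0<..} t * indicator {x. t < \<bar>u x\<bar>} x)) \<partial>lborel) \<partial>hvol)"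
    unfolding J
    by (intro nn_integral_cong, subst nn_integral_cmult[symmetric]) (auto intro!: nn_integral_cong simp: indicator_def)
  also have "\<dots> = (\<integral>\<^sup>+t. (\<integral>\<^sup>+x. ennreal (c x) * (j t * (indicator {0<..} t * indicator {x. t < \<bar>u x\<bar>} x)) \<partial>hvol) \<partial>lborel)"
    by (rule lh.Fubini') measurable
  also have "\<dots> = (\<integral>\<^sup>+s. j s * indicator {0<..} s * wdfun c u s \<partial>lborel)"
    unfolding wdfun_def by (intro nn_integral_cong, subst nn_integral_cmult[symmetric]) (auto intro!: nn_integral_cong simp: ac_simps)
  finally show ?thesis .
qed

context
  fixes u :: "real^'n \<Rightarrow> real"
  assumes u: "u \<in> C0inf"
begin

lemma C0inf_measurable [measurable]: "u \<in> borel_measurable borel" "hlap u \<in> borel_measurable borel"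
  "(\<lambda>x. gnorm x (hgrad u x)) \<in> borel_measurable borel"
proof -
  show [measurable]: "u \<in> borel_measurable borel" "hlap u \<in> borel_measurable borel"
    using u C0inf_hlap[OF u] by (auto intro!: borel_measurable_continuous_onI smooth_fn_continuous C0inf_smooth)
  have "continuous_on UNIV (egrad u)" unfolding egrad_def[abs_def]
    by (intro continuous_on_vec_lambda smooth_fn_continuous smooth_fn_pd C0inf_smooth u)
  then have [measurable]: "egrad u \<in> borel_measurable borel" by (rule borel_measurable_continuous_onI)
  show "(\<lambda>x. gnorm x (hgrad u x)) \<in> borel_measurable borel" unfolding gnorm_hgrad by measurable
qed

lemma continuous_gnorm_hgrad: "continuous_on UNIV (\<lambda>x. gnorm x (hgrad u x))"
  unfolding gnorm_hgrad egrad_def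
  by (intro continuous_intros continuous_bdef continuous_on_vec_lambda smooth_fn_continuous smooth_fn_pd C0inf_smooth u) simp

lemma gnorm_hgrad_outside:
  assumes "closed K" "\<And>x. x \<notin> K \<Longrightarrow> u x = 0" "x \<notin> K"
  shows "gnorm x (hgrad u x) = 0"
  using pd_outside[OF assms] by (simp add: gnorm_hgrad egrad_def vec_eq_iff)

text \<open>Both sides integrate \<open>g\<close> against measures on the half line of levels: one
  has a density, the other is the image of |grad u| dV under |u|. On continuous tests the comparison
  is \<open>truncated_isoperimetric\<close> after Fubini.\<close>

lemma weighted_isoperimetric:
  assumes [measurable]: "g \<in> borel_measurable borel"
  shows "(\<integral>\<^sup>+s. g s * indicator {0<..} s * wdfun (\<lambda>x. real CARD('n) - 1 + hdelta x) u s \<partial>lborel)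
    \<le> (\<integral>\<^sup>+x. g \<bar>u x\<bar> * indicator {0<..} \<bar>u x\<bar> * ennreal (gnorm x (hgrad u x)) \<partial>hvol)"
proof -
  let ?c = "\<lambda>x::real^'n. real CARD('n) - 1 + hdelta x"
  obtain K where K: "smooth_fn u" "compact K" "K \<subseteq> ball 0 1" "\<And>x. x \<notin> K \<Longrightarrow> u x = 0" using C0infE[OF u] by metis
  define M where "M = density lborel (\<lambda>s. indicator {0<..} s * wdfun ?c u s)"
  define N where "N = distr (density hvol (\<lambda>x. ennreal (gnorm x (hgrad u x)))) borel (\<lambda>x. \<bar>u x\<bar>)"
  have c: "?c x \<ge> 0" for x using zero_less_card_finite[where 'a='n] by (simp add: hdelta_def)
  have fin: "emeasure N (space N) \<noteq> \<infinity>"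
    using nn_integral_hvol_finite[OF K(2,3) continuous_gnorm_hgrad gnorm_hgrad_outside[OF compact_imp_closed[OF K(2)] K(4)]]
    unfolding N_def by (subst emeasure_distr) (auto simp: emeasure_density)
  have Mi: "integral\<^sup>N M f = (\<integral>\<^sup>+s. f s * indicator {0<..} s * wdfun ?c u s \<partial>lborel)" if [measurable]: "f \<in> borel_measurable borel" for f
    unfolding M_def by (subst nn_integral_density) (auto simp: mult_ac)
  have Ni: "integral\<^sup>N N f = (\<integral>\<^sup>+x. f \<bar>u x\<bar> * ennreal (gnorm x (hgrad u x)) \<partial>hvol)" if [measurable]: "f \<in> borel_measurable borel" for f
    unfolding N_def by (subst nn_integral_distr; (subst nn_integral_density)?) (auto simp: mult_ac)
  have "(\<integral>\<^sup>+s. g s * indicator {0<..} s \<partial>M) \<le> (\<integral>\<^sup>+s. g s * indicator {0<..} s \<partial>N)"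
  proof (rule nn_integral_mono_continuous_tests[OF _ _ fin])
    fix j :: "real \<Rightarrow> real"
    assume j: "continuous_on UNIV j" "\<And>s. s \<le> 0 \<Longrightarrow> j s = 0" "\<And>s. 0 \<le> j s"
    have [measurable]: "j \<in> borel_measurable borel" by (rule borel_measurable_continuous_onI[OF j(1)])
    obtain J where J: "\<And>s. (J has_real_derivative j s) (at s)" "\<And>s. s \<le> 0 \<Longrightarrow> J s = 0" "\<And>s. 0 \<le> J s"
      "\<And>s. ennreal (J s) = (\<integral>\<^sup>+t. ennreal (j t) * indicator {0<..<s} t \<partial>lborel)"
      using primitive_exists[OF j] by metis
    have "(\<integral>\<^sup>+s. ennreal (j s) \<partial>M) = (\<integral>\<^sup>+x. ennreal (?c x) * ennreal (J \<bar>u x\<bar>) \<partial>hvol)"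
      by (subst Mi, simp, rule nn_integral_primitive_eq_wdfun[symmetric]) (auto simp: J(4))
    also have "\<dots> = (\<integral>\<^sup>+x. ennreal (?c x * J \<bar>u x\<bar>) \<partial>hvol)" using c by (simp add: ennreal_mult')
    also have "\<dots> \<le> (\<integral>\<^sup>+x. ennreal (j \<bar>u x\<bar> * gnorm x (hgrad u x)) \<partial>hvol)"
      by (rule truncated_isoperimetric[OF u j J(1,2,3)])
    also have "\<dots> = (\<integral>\<^sup>+s. ennreal (j s) \<partial>N)" using j(3) by (simp add: Ni ennreal_mult')
    finally show "(\<integral>\<^sup>+s. ennreal (j s) \<partial>M) \<le> (\<integral>\<^sup>+s. ennreal (j s) \<partial>N)" .
  qed (auto simp: M_def N_def)
  moreover have "(\<integral>\<^sup>+s. g s * indicator {0<..} s \<partial>M) = (\<integral>\<^sup>+s. g s * indicator {0<..} s * wdfun ?c u s \<partial>lborel)"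
    by (subst Mi, measurable) (auto intro!: nn_integral_cong simp: indicator_def)
  moreover have "(\<integral>\<^sup>+s. g s * indicator {0<..} s \<partial>N) = (\<integral>\<^sup>+x. g \<bar>u x\<bar> * indicator {0<..} \<bar>u x\<bar> * ennreal (gnorm x (hgrad u x)) \<partial>hvol)"
    by (rule Ni) measurable
  ultimately show ?thesis by simp
qed

text \<open>Here the gradient measure is the smaller one, so it is the measure with a density in s
  that has to be finite. Its mass is the integral of |hlap u| |u|, finite by compact
  support.\<close>

lemma weighted_Green:
  assumes [measurable]: "g \<in> borel_measurable borel"
  shows "(\<integral>\<^sup>+x. g \<bar>u x\<bar> * indicator {0<..} \<bar>u x\<bar> * ennreal ((gnorm x (hgrad u x))^2) \<partial>hvol)
    \<le> (\<integral>\<^sup>+s. g s * indicator {0<..} s * wdfun (\<lambda>x. \<bar>hlap u x\<bar>) u s \<partial>lborel)"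
proof -
  let ?c = "\<lambda>x::real^'n. \<bar>hlap u x\<bar>"
  obtain K where K: "smooth_fn u" "compact K" "K \<subseteq> ball 0 1" "\<And>x. x \<notin> K \<Longrightarrow> u x = 0" using C0infE[OF u] by metis
  define M where "M = density lborel (\<lambda>s. indicator {0<..} s * wdfun ?c u s)"
  define N where "N = distr (density hvol (\<lambda>x. ennreal ((gnorm x (hgrad u x))^2))) borel (\<lambda>x. \<bar>u x\<bar>)"
  have Mi: "integral\<^sup>N M f = (\<integral>\<^sup>+s. f s * indicator {0<..} s * wdfun ?c u s \<partial>lborel)" if [measurable]: "f \<in> borel_measurable borel" for f
    unfolding M_def by (subst nn_integral_density) (auto simp: mult_ac)
  have Ni: "integral\<^sup>N N f = (\<integral>\<^sup>+x. f \<bar>u x\<bar> * ennreal ((gnorm x (hgrad u x))^2) \<partial>hvol)" if [measurable]: "f \<in> borel_measurable borel" for f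
    unfolding N_def by (subst nn_integral_distr; (subst nn_integral_density)?) (auto simp: mult_ac)
  have fin: "emeasure M (space M) \<noteq> \<infinity>"
  proof -
    have "emeasure M (space M) = integral\<^sup>N M (\<lambda>_. 1)" by simp
    also have "\<dots> = (\<integral>\<^sup>+x. ennreal (?c x) * ennreal \<bar>u x\<bar> \<partial>hvol)"
    proof (subst Mi, simp, rule nn_integral_primitive_eq_wdfun[symmetric])
      show "ennreal s = (\<integral>\<^sup>+t. 1 * indicator {0<..<s} t \<partial>lborel)" for s
        by (cases "0 \<le> s") (auto simp: ennreal_neg)
    qed auto
    also have "\<dots> = (\<integral>\<^sup>+x. ennreal (?c x * \<bar>u x\<bar>) \<partial>hvol)" by (simp add: ennreal_mult')
    also have "\<dots> < \<infinity>"
    proof (rule nn_integral_hvol_finite[OF K(2,3)])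
      have "continuous_on UNIV u" "continuous_on UNIV (hlap u)"
        using u C0inf_hlap[OF u] by (auto intro!: smooth_fn_continuous C0inf_smooth)
      then show "continuous_on UNIV (\<lambda>x. \<bar>hlap u x\<bar> * \<bar>u x\<bar>)" by (intro continuous_intros)
    qed (use K in auto)
    finally show ?thesis by simp
  qed
  have "(\<integral>\<^sup>+s. g s * indicator {0<..} s \<partial>N) \<le> (\<integral>\<^sup>+s. g s * indicator {0<..} s \<partial>M)"
  proof (rule nn_integral_mono_continuous_tests[OF _ _ fin])
    fix j :: "real \<Rightarrow> real"
    assume j: "continuous_on UNIV j" "\<And>s. s \<le> 0 \<Longrightarrow> j s = 0" "\<And>s. 0 \<le> j s"
    have [measurable]: "j \<in> borel_measurable borel" by (rule borel_measurable_continuous_onI[OF j(1)])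
    obtain J where J: "\<And>s. (J has_real_derivative j s) (at s)" "\<And>s. s \<le> 0 \<Longrightarrow> J s = 0" "\<And>s. 0 \<le> J s"
      "\<And>s. ennreal (J s) = (\<integral>\<^sup>+t. ennreal (j t) * indicator {0<..<s} t \<partial>lborel)"
      using primitive_exists[OF j] by metis
    have "(\<integral>\<^sup>+s. ennreal (j s) \<partial>N) = (\<integral>\<^sup>+x. ennreal (j \<bar>u x\<bar> * (gnorm x (hgrad u x))^2) \<partial>hvol)"
      using j(3) by (simp add: Ni ennreal_mult')
    also have "\<dots> \<le> (\<integral>\<^sup>+x. ennreal (\<bar>hlap u x\<bar> * J \<bar>u x\<bar>) \<partial>hvol)"
      by (rule truncated_Green[OF u j J(1,2,3)])
    also have "\<dots> = (\<integral>\<^sup>+x. ennreal (?c x) * ennreal (J \<bar>u x\<bar>) \<partial>hvol)" by (simp add: ennreal_mult')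
    also have "\<dots> = (\<integral>\<^sup>+s. ennreal (j s) \<partial>M)"
      by (subst Mi, simp, rule nn_integral_primitive_eq_wdfun) (auto simp: J(4))
    finally show "(\<integral>\<^sup>+s. ennreal (j s) \<partial>N) \<le> (\<integral>\<^sup>+s. ennreal (j s) \<partial>M)" .
  qed (auto simp: M_def N_def)
  moreover have "(\<integral>\<^sup>+s. g s * indicator {0<..} s \<partial>M) = (\<integral>\<^sup>+s. g s * indicator {0<..} s * wdfun ?c u s \<partial>lborel)"
    by (subst Mi, measurable) (auto intro!: nn_integral_cong simp: indicator_def)
  moreover have "(\<integral>\<^sup>+s. g s * indicator {0<..} s \<partial>N) = (\<integral>\<^sup>+x. g \<bar>u x\<bar> * indicator {0<..} \<bar>u x\<bar> * ennreal ((gnorm x (hgrad u x))^2) \<partial>hvol)"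
    by (rule Ni) measurable
  ultimately show ?thesis by simp
qed

end

section \<open>Rearrangements and the Lorentz functional\<close>

lemma nn_integral_powr:
  assumes "0 < a" "0 \<le> r"
  shows "(\<integral>\<^sup>+s. ennreal (a * s powr (a - 1)) * indicator {0<..<r} s \<partial>lborel) = ennreal (r powr a)"
proof -
  have "((\<lambda>x. a * x powr (a - 1)) has_integral a * (r powr (a - 1 + 1) / (a - 1 + 1))) {0..r}"
    by (intro has_integral_mult_right has_integral_powr_from_0) (use assms in auto)
  then have "(\<integral>\<^sup>+s. ennreal (a * s powr (a - 1)) * indicator {0..r} s \<partial>lborel) = ennreal (r powr a)"
    using assms nn_integral_has_integral_lebesgue'[of "{0..r}" "\<lambda>x. a * x powr (a - 1)"] by simp
  moreover have "(\<integral>\<^sup>+s. ennreal (a * s powr (a - 1)) * indicator {0..r} s \<partial>lborel) = (\<integral>\<^sup>+s. ennreal (a * s powr (a - 1)) * indicator {0<..<r} s \<partial>lborel)"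
    by (rule nn_integral_cong_AE) (use AE_lborel_singleton[of 0] AE_lborel_singleton[of r] in
        \<open>eventually_elim, auto simp: indicator_def\<close>)
  ultimately show ?thesis by simp
qed

lemma nn_integral_less_ennreal: "(\<integral>\<^sup>+t. indicator {t. 0 < t \<and> ennreal t < c} t \<partial>lborel) = c"
proof (cases c)
  case (real r)
  have "{t. 0 < t \<and> ennreal t < c} = {0<..<r}" using real by (auto simp: ennreal_less_iff)
  then show ?thesis using real by simp
next
  case top
  then have "{t. 0 < t \<and> ennreal t < c} = {0<..}" by (auto simp: less_top)
  have "of_nat n \<le> emeasure lborel {0::real<..}" for n :: nat
  proof -
    have "of_nat n = emeasure lborel {0<..<real n}" by (simp add: ennreal_of_nat_eq_real_of_nat)
    also have "\<dots> \<le> emeasure lborel {0::real<..}" by (rule emeasure_mono) auto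
    finally show ?thesis .
  qed
  then have "(SUP n. of_nat n :: ennreal) \<le> emeasure lborel {0::real<..}" by (rule SUP_least)
  then have "emeasure lborel {0::real<..} = top" by (simp add: ennreal_SUP_of_nat_eq_top top_unique)
  then show ?thesis using top \<open>{t. 0 < t \<and> ennreal t < c} = {0<..}\<close> by simp
qed

definition dfun :: "(real^'n \<Rightarrow> real) \<Rightarrow> real \<Rightarrow> ennreal" where
  "dfun u s = emeasure hvol {x. s < \<bar>u x\<bar>}"

text \<open>Evaluated at the level |u x|, this is the rank of the point x: the volume where |u| is
  at least as large as at x. For almost every level it agrees with \<open>dfun\<close>.\<close>

definition mbar :: "(real^'n \<Rightarrow> real) \<Rightarrow> real \<Rightarrow> ennreal" where
  "mbar u s = emeasure hvol {x. s \<le> \<bar>u x\<bar>}"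

text \<open>The primitive of a weight on volumes, with an upper limit that may be infinite, as
  superlevel sets of a measurable function may have infinite volume.\<close>

definition Wint :: "(real \<Rightarrow> ennreal) \<Rightarrow> ennreal \<Rightarrow> ennreal" where
  "Wint w m = (\<integral>\<^sup>+t. w t * indicator {t. 0 < t \<and> ennreal t < m} t \<partial>lborel)"

definition lorw :: "real \<Rightarrow> real \<Rightarrow> real \<Rightarrow> ennreal" where
  "lorw p q t = ennreal (t powr (q / p - 1))"

text \<open>The Tonelli form of \<open>lorentz_qpow\<close>, integrating over levels instead of volumes. Only distribution
  functions enter, which makes monotonicity and Fatou arguments immediate.\<close>
definition lor :: "real \<Rightarrow> real \<Rightarrow> (real^'n \<Rightarrow> real) \<Rightarrow> ennreal" where
  "lor p q u = (\<integral>\<^sup>+s. ennreal (q * s powr (q - 1)) * indicator {0<..} s * Wint (lorw p q) (dfun u s) \<partial>lborel)"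

lemma dfun_wdfun: "u \<in> borel_measurable borel \<Longrightarrow> dfun u s = wdfun (\<lambda>_. 1) u s"
proof -
  assume [measurable]: "u \<in> borel_measurable borel"
  have "(\<integral>\<^sup>+x. ennreal 1 * indicator {x. s < \<bar>u x\<bar>} x \<partial>hvol) = (\<integral>\<^sup>+x. indicator {x. s < \<bar>u x\<bar>} x \<partial>hvol)" by simp
  also have "\<dots> = dfun u s" unfolding dfun_def by (rule nn_integral_indicator) measurable
  finally show ?thesis by (simp add: wdfun_def)
qed

lemma borel_measurable_dfun [measurable]: "u \<in> borel_measurable borel \<Longrightarrow> dfun u \<in> borel_measurable borel"
  by (subst measurable_cong[OF dfun_wdfun]) auto

lemma borel_measurable_mbar [measurable]:
  assumes [measurable]: "u \<in> borel_measurable borel" shows "mbar u \<in> borel_measurable borel"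
proof -
  have "mbar u = (\<lambda>s. \<integral>\<^sup>+x. indicator {x. s \<le> \<bar>u x\<bar>} x \<partial>hvol)"
    unfolding mbar_def[abs_def] by (subst nn_integral_indicator) auto
  then show ?thesis by simp
qed

lemma borel_measurable_lorw [measurable]: "lorw p q \<in> borel_measurable borel"
  unfolding lorw_def[abs_def] by measurable

lemma Wint_mono: "m \<le> m' \<Longrightarrow> Wint w m \<le> Wint w m'"
  unfolding Wint_def by (intro nn_integral_mono) (auto simp: indicator_def)

lemma dfun_antimono: "u \<in> borel_measurable borel \<Longrightarrow> s \<le> s' \<Longrightarrow> dfun u s' \<le> dfun u s"
  unfolding dfun_def by (intro emeasure_mono) auto

lemma borel_measurable_Wint [measurable]:
  assumes [measurable]: "w \<in> borel_measurable borel" shows "Wint w \<in> borel_measurable borel"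
  unfolding Wint_def by measurable

lemma Wint_lorw:
  assumes "0 < p" "0 < q" "0 \<le> m"
  shows "Wint (lorw p q) (ennreal m) = ennreal (p / q * m powr (q / p))"
proof -
  have "Wint (lorw p q) (ennreal m) = (\<integral>\<^sup>+t. ennreal (p / q) * (ennreal (q / p * t powr (q / p - 1)) * indicator {0<..<m} t) \<partial>lborel)"
    unfolding Wint_def lorw_def using assms
    by (intro nn_integral_cong) (auto simp: indicator_def ennreal_less_iff ennreal_mult[symmetric])
  also have "\<dots> = ennreal (p / q) * ennreal (m powr (q / p))"
    using assms by (subst nn_integral_cmult, measurable, subst nn_integral_powr) auto
  also have "\<dots> = ennreal (p / q * m powr (q / p))" using assms by (intro ennreal_mult'[symmetric]) auto
  finally show ?thesis .
qed

lemma dfun_right_continuous: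
  assumes [measurable]: "u \<in> borel_measurable borel" and "t < dfun u s"
  obtains s' where "s < s'" "t < dfun u s'"
proof -
  let ?A = "\<lambda>n::nat. {x. s + 1 / (real n + 1) < \<bar>u x\<bar>}"
  have "{x. s < \<bar>u x\<bar>} = (\<Union>n. ?A n)"
  proof safe
    fix x assume "s < \<bar>u x\<bar>"
    then obtain n :: nat where "inverse (real (Suc n)) < \<bar>u x\<bar> - s" using reals_Archimedean[of "\<bar>u x\<bar> - s"] by auto
    then show "x \<in> (\<Union>n. ?A n)" by (auto simp: field_simps intro!: exI[of _ n])
  next
    fix x n assume "s + 1 / (real n + 1) < \<bar>u x\<bar>"
    moreover have "0 < 1 / (real n + 1)" by simp
    ultimately show "s < \<bar>u x\<bar>" by linarith
  qed
  moreover have "(SUP n. emeasure hvol (?A n)) = emeasure hvol (\<Union>n. ?A n)"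
  proof (rule SUP_emeasure_incseq)
    show "incseq ?A"
    proof (rule incseq_SucI, safe)
      fix n x assume "s + 1 / (real n + 1) < \<bar>u x\<bar>"
      moreover have "1 / (real (Suc n) + 1) \<le> 1 / (real n + 1)" by (simp add: frac_le)
      ultimately show "s + 1 / (real (Suc n) + 1) < \<bar>u x\<bar>" by linarith
    qed
  qed auto
  ultimately have "t < (SUP n. emeasure hvol (?A n))" using assms(2) by (simp add: dfun_def)
  then obtain n where "t < emeasure hvol (?A n)" by (auto simp: less_SUP_iff)
  then show ?thesis using that[of "s + 1 / (real n + 1)"] by (simp add: dfun_def)
qed

text \<open>Right continuity of the distribution function makes both inequalities strict, so the two
  functions can be exchanged without exceptional values. The boundedness hypothesis guards against
  the unspecified \<open>Sup\<close> of an unbounded set.\<close>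

lemma rearr_iff:
  assumes [measurable]: "u \<in> borel_measurable borel"
    and bdd: "bdd_above {s. 0 < s \<and> ennreal t < dfun u s}" and s: "0 \<le> s"
  shows "s < rearr u t \<longleftrightarrow> ennreal t < dfun u s"
proof
  have bdd': "bdd_above (insert 0 {s. 0 < s \<and> ennreal t < dfun u s})" using bdd by simp
  assume "s < rearr u t"
  then obtain s' where "s' \<in> insert 0 {s. 0 < s \<and> ennreal t < dfun u s}" "s < s'"
    unfolding rearr_def dfun_def[symmetric] using less_cSup_iff[OF _ bdd'] by blast
  then have "ennreal t < dfun u s'" "s \<le> s'" using s by auto
  then show "ennreal t < dfun u s" using dfun_antimono[OF assms(1)] by (meson less_le_trans)
next
  have bdd': "bdd_above (insert 0 {s. 0 < s \<and> ennreal t < dfun u s})" using bdd by simp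
  assume "ennreal t < dfun u s"
  then obtain s' where "s < s'" "ennreal t < dfun u s'" using dfun_right_continuous[OF assms(1)] by metis
  then have "s' \<le> rearr u t" unfolding rearr_def dfun_def[symmetric] using s by (intro cSup_upper bdd') auto
  then show "s < rearr u t" using \<open>s < s'\<close> by linarith
qed

lemma rearr_nonneg:
  assumes "bdd_above {s. 0 < s \<and> ennreal t < dfun u s}"
  shows "0 \<le> rearr u t"
  unfolding rearr_def dfun_def[symmetric] by (intro cSup_upper) (use assms in auto)

lemma lorentz_qpow_rearr:
  assumes "\<And>t. 0 < t \<Longrightarrow> 0 \<le> rearr u t"
  shows "lorentz_qpow p q u = (\<integral>\<^sup>+t. lorw p q t * ennreal (rearr u t powr q) * indicator {0<..} t \<partial>lborel)"
  unfolding lorentz_qpow_def lorw_def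
proof (intro nn_integral_cong)
  fix t :: real
  show "ennreal ((t powr (1/p) * rearr u t) powr q / t) * indicator {0<..} t
    = ennreal (t powr (q / p - 1)) * ennreal (rearr u t powr q) * indicator {0<..} t"
  proof (cases "0 < t")
    case True
    then have "(t powr (1/p) * rearr u t) powr q / t = t powr (q / p - 1) * rearr u t powr q"
      using assms[of t] by (simp add: powr_mult powr_powr powr_diff)
    then show ?thesis by (simp add: ennreal_mult'[symmetric])
  qed simp
qed

text \<open>By \<open>rearr_iff\<close> both functionals integrate the same product over the region
  t < dfun u s, in the two possible orders.\<close>

lemma lorentz_qpow_eq_lor:
  assumes [measurable]: "u \<in> borel_measurable borel" and q: "0 < q"
    and bdd: "\<And>t. 0 < t \<Longrightarrow> bdd_above {s. 0 < s \<and> ennreal t < dfun u s}"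
  shows "lorentz_qpow p q u = lor p q u"
proof -
  let ?W = "\<lambda>t s. lorw p q t * ennreal (q * s powr (q - 1)) * indicator {0<..} t * indicator {0<..} s * indicator {p. ennreal (fst p) < dfun u (snd p)} (t, s)"
  have "lorentz_qpow p q u = (\<integral>\<^sup>+t. lorw p q t * ennreal (rearr u t powr q) * indicator {0<..} t \<partial>lborel)"
    by (rule lorentz_qpow_rearr) (simp add: bdd rearr_nonneg)
  also have "\<dots> = (\<integral>\<^sup>+t. (\<integral>\<^sup>+s. ?W t s \<partial>lborel) \<partial>lborel)"
  proof (rule nn_integral_cong)
    fix t :: real
    show "lorw p q t * ennreal (rearr u t powr q) * indicator {0<..} t = (\<integral>\<^sup>+s. ?W t s \<partial>lborel)"
    proof (cases "0 < t")
      case True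
      have "(\<integral>\<^sup>+s. ?W t s \<partial>lborel) = (\<integral>\<^sup>+s. lorw p q t * (ennreal (q * s powr (q - 1)) * indicator {0<..<rearr u t} s) \<partial>lborel)"
        using True rearr_iff[OF assms(1) bdd[OF True]]
        by (intro nn_integral_cong) (auto simp: indicator_def)
      then show ?thesis using True q rearr_nonneg[OF bdd[OF True]]
        by (simp add: nn_integral_cmult nn_integral_powr)
    qed simp
  qed
  also have "\<dots> = (\<integral>\<^sup>+s. (\<integral>\<^sup>+t. ?W t s \<partial>lborel) \<partial>lborel)"
    by (rule lborel_pair.Fubini') measurable
  also have "\<dots> = lor p q u" unfolding lor_def Wint_def
    by (intro nn_integral_cong, subst nn_integral_cmult[symmetric]) (auto intro!: nn_integral_cong simp: indicator_def mult_ac)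
  finally show ?thesis .
qed

lemma lor_mono:
  assumes "\<And>s. 0 < s \<Longrightarrow> dfun u s \<le> dfun v s"
  shows "lor p q u \<le> lor p q v"
  unfolding lor_def by (intro nn_integral_mono) (auto simp: indicator_def intro!: mult_left_mono Wint_mono assms)

text \<open>Each point of rank at most t bounds a superlevel set of mass at most t. If the infimum
  of u over these points is attained, the set at the minimum contains them all; otherwise they form
  an increasing union of parts, each inside one such set.\<close>

lemma emeasure_level_le:
  fixes M :: "'a measure" and u :: "'a \<Rightarrow> real"
  assumes "sigma_finite_measure M" and [measurable]: "u \<in> borel_measurable M"
    and mb: "\<And>s. mb s = emeasure M {x \<in> space M. s \<le> u x}"
  shows "emeasure M {x \<in> space M. 0 < u x \<and> mb (u x) \<le> t} \<le> t"
proof -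
  interpret sigma_finite_measure M by fact
  have "mb = (\<lambda>s. \<integral>\<^sup>+x. indicator {x. s \<le> u x} x \<partial>M)"
  proof
    fix s
    have "(\<integral>\<^sup>+x. indicator {x. s \<le> u x} x \<partial>M) = (\<integral>\<^sup>+x. indicator {x \<in> space M. s \<le> u x} x \<partial>M)"
      by (intro nn_integral_cong) (auto simp: indicator_def)
    also have "\<dots> = emeasure M {x \<in> space M. s \<le> u x}" by (rule nn_integral_indicator) (rule borel_measurable_le[OF borel_measurable_const assms(2)])
    finally show "mb s = (\<integral>\<^sup>+x. indicator {x. s \<le> u x} x \<partial>M)" by (simp add: mb)
  qed
  then have [measurable]: "mb \<in> borel_measurable borel" by simp
  define S where "S = {x \<in> space M. 0 < u x \<and> mb (u x) \<le> t}"
  have [measurable]: "S \<in> sets M" unfolding S_def by measurable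
  show ?thesis
  proof (cases "S = {}")
    case False
    define i where "i = Inf (u ` S)"
    have bb: "bdd_below (u ` S)" by (rule bdd_belowI[of _ 0]) (auto simp: S_def)
    have lower: "i \<le> u x" if "x \<in> S" for x unfolding i_def using bb that by (intro cInf_lower) auto
    have up: "emeasure M {x \<in> space M. u y \<le> u x} \<le> t" if "y \<in> S" for y
      using that mb[of "u y"] by (auto simp: S_def)
    show ?thesis
    proof (cases "\<exists>y\<in>S. u y = i")
      case True
      then obtain y where y: "y \<in> S" "u y = i" by auto
      have "emeasure M S \<le> emeasure M {x \<in> space M. u y \<le> u x}"
        by (intro emeasure_mono) (use lower y in \<open>auto simp: S_def\<close>)
      then show ?thesis using up[OF y(1)] by (simp flip: S_def)
    next
      case False
      let ?A = "\<lambda>n::nat. S \<inter> {x \<in> space M. i + 1 / (real n + 1) \<le> u x}"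
      have "S = (\<Union>n. ?A n)"
      proof safe
        fix x assume x: "x \<in> S"
        then have "i < u x" using lower[OF x] False by force
        then obtain n :: nat where "inverse (real (Suc n)) < u x - i" using reals_Archimedean[of "u x - i"] by auto
        then show "x \<in> (\<Union>n. ?A n)" using x by (auto simp: field_simps S_def intro!: exI[of _ n])
      qed
      moreover have "(SUP n. emeasure M (?A n)) = emeasure M (\<Union>n. ?A n)"
      proof (rule SUP_emeasure_incseq)
        show "incseq ?A"
        proof (rule incseq_SucI, safe)
          fix n x assume "i + 1 / (real n + 1) \<le> u x"
          moreover have "1 / (real (Suc n) + 1) \<le> 1 / (real n + 1)" by (simp add: frac_le)
          ultimately show "i + 1 / (real (Suc n) + 1) \<le> u x" by linarith
        qed
      qed auto
      moreover have "emeasure M (?A n) \<le> t" for n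
      proof -
        have "Inf (u ` S) < i + 1 / (real n + 1)" by (simp add: i_def)
        then obtain y where y: "y \<in> S" "u y < i + 1 / (real n + 1)"
          using \<open>S \<noteq> {}\<close> bb by (subst (asm) cInf_less_iff) auto
        have "emeasure M (?A n) \<le> emeasure M {x \<in> space M. u y \<le> u x}"
          by (intro emeasure_mono) (use y in auto)
        then show ?thesis using up[OF y(1)] by simp
      qed
      ultimately have "emeasure M S \<le> t" by (metis (no_types, lifting) SUP_least)
      then show ?thesis by (simp flip: S_def)
    qed
  qed (simp flip: S_def)
qed

lemma nn_integral_layer: "(\<integral>\<^sup>+l. indicator {l. 0 < l \<and> ennreal l < c} l * b \<partial>lborel) = c * (b::ennreal)"
  by (subst nn_integral_multc) (auto simp: nn_integral_less_ennreal)

text \<open>A decreasing function of the rank has rearrangement at most \<open>w\<close>: by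
  \<open>emeasure_level_le\<close>, the set where it exceeds l has mass at most t whenever w t <= l.
  Intersecting with E and integrating over l and t gives the bound.\<close>

lemma Hardy_Littlewood_level:
  fixes M :: "'a measure" and u :: "'a \<Rightarrow> real"
  assumes sf: "sigma_finite_measure M" and [measurable]: "u \<in> borel_measurable M" "E \<in> sets M" "w \<in> borel_measurable borel"
    and w: "\<And>s t. 0 < s \<Longrightarrow> s \<le> t \<Longrightarrow> w t \<le> w s"
    and mb: "\<And>s. mb s = emeasure M {x \<in> space M. s \<le> u x}"
    and fin: "\<And>s. 0 < s \<Longrightarrow> mb s < \<infinity>"
  shows "(\<integral>\<^sup>+x. (if 0 < u x then w (enn2real (mb (u x))) else 0) * indicator E x \<partial>M) \<le> Wint w (emeasure M E)"
proof -
  interpret sigma_finite_measure M by fact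
  interpret lM: pair_sigma_finite lborel M by unfold_locales
  have "mb = (\<lambda>s. \<integral>\<^sup>+x. indicator {x. s \<le> u x} x \<partial>M)"
  proof
    fix s
    have "(\<integral>\<^sup>+x. indicator {x. s \<le> u x} x \<partial>M) = (\<integral>\<^sup>+x. indicator {x \<in> space M. s \<le> u x} x \<partial>M)"
      by (intro nn_integral_cong) (auto simp: indicator_def)
    also have "\<dots> = emeasure M {x \<in> space M. s \<le> u x}" by (rule nn_integral_indicator) (rule borel_measurable_le[OF borel_measurable_const assms(2)])
    finally show "mb s = (\<integral>\<^sup>+x. indicator {x. s \<le> u x} x \<partial>M)" by (simp add: mb)
  qed
  then have [measurable]: "mb \<in> borel_measurable borel" by simp
  define h where "h x = (if 0 < u x then w (enn2real (mb (u x))) else 0)" for x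
  have [measurable]: "h \<in> borel_measurable M" unfolding h_def[abs_def] by measurable
  define S where "S l = {x \<in> space M. x \<in> E \<and> ennreal l < h x}" for l
  have [measurable]: "S l \<in> sets M" for l unfolding S_def by measurable
  have key: "ennreal l < w t" "ennreal t < emeasure M E" if "0 < l" "0 < t" "ennreal t < emeasure M (S l)" for l t
  proof -
    have "emeasure M (S l) \<le> emeasure M E" by (intro emeasure_mono) (auto simp: S_def)
    then show "ennreal t < emeasure M E" using that by simp
    show "ennreal l < w t"
    proof (rule ccontr)
      assume "\<not> ennreal l < w t"
      then have wl: "w t \<le> ennreal l" by simp
      have "S l \<subseteq> {x \<in> space M. 0 < u x \<and> mb (u x) \<le> ennreal t}"
      proof
        fix x assume x: "x \<in> S l"
        then have ux: "0 < u x" and lt: "ennreal l < w (enn2real (mb (u x)))" by (auto simp: S_def h_def split: if_splits)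
        have "enn2real (mb (u x)) < t"
        proof (rule ccontr)
          assume "\<not> enn2real (mb (u x)) < t"
          then have "w (enn2real (mb (u x))) \<le> w t" using w[of t] that by auto
          then show False using lt wl by simp
        qed
        then have "mb (u x) \<le> ennreal t" using fin[OF ux] by (metis enn2real_le_iff ennreal_enn2real infinity_ennreal_def less_imp_le that(2) ennreal_leI)
        then show "x \<in> {x \<in> space M. 0 < u x \<and> mb (u x) \<le> ennreal t}" using x ux by (simp add: S_def)
      qed
      then have "emeasure M (S l) \<le> emeasure M {x \<in> space M. 0 < u x \<and> mb (u x) \<le> ennreal t}"
        by (intro emeasure_mono) auto
      also have "\<dots> \<le> ennreal t" by (rule emeasure_level_le[OF sf _ mb]) auto
      finally show False using that by simp
    qed
  qed
  have "(\<integral>\<^sup>+x. h x * indicator E x \<partial>M) = (\<integral>\<^sup>+x. (\<integral>\<^sup>+l. indicator {l. 0 < l \<and> ennreal l < h x} l * indicator E x \<partial>lborel) \<partial>M)"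
    by (simp add: nn_integral_layer)
  also have "\<dots> = (\<integral>\<^sup>+l. (\<integral>\<^sup>+x. indicator {l. 0 < l \<and> ennreal l < h x} l * indicator E x \<partial>M) \<partial>lborel)"
    by (rule lM.Fubini') measurable
  also have "\<dots> = (\<integral>\<^sup>+l. indicator {0<..} l * emeasure M (S l) \<partial>lborel)"
  proof (rule nn_integral_cong)
    fix l :: real
    have "(\<integral>\<^sup>+x. indicator {l. 0 < l \<and> ennreal l < h x} l * indicator E x \<partial>M) = (\<integral>\<^sup>+x. indicator {0<..} l * indicator (S l) x \<partial>M)"
      by (intro nn_integral_cong) (auto simp: indicator_def S_def)
    then show "(\<integral>\<^sup>+x. indicator {l. 0 < l \<and> ennreal l < h x} l * indicator E x \<partial>M) = indicator {0<..} l * emeasure M (S l)"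
      by (simp add: nn_integral_cmult)
  qed
  also have "\<dots> = (\<integral>\<^sup>+l. (\<integral>\<^sup>+t. indicator {t. 0 < t \<and> ennreal t < emeasure M (S l)} t * indicator {0<..} l \<partial>lborel) \<partial>lborel)"
    by (simp only: nn_integral_layer mult.commute[of "emeasure M _"])
  also have "\<dots> \<le> (\<integral>\<^sup>+l. (\<integral>\<^sup>+t. indicator {l. 0 < l \<and> ennreal l < w t} l * indicator {t. 0 < t \<and> ennreal t < emeasure M E} t \<partial>lborel) \<partial>lborel)"
    by (intro nn_integral_mono) (auto simp: indicator_def dest: key)
  also have "\<dots> = (\<integral>\<^sup>+t. (\<integral>\<^sup>+l. indicator {l. 0 < l \<and> ennreal l < w t} l * indicator {t. 0 < t \<and> ennreal t < emeasure M E} t \<partial>lborel) \<partial>lborel)"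
    by (rule lborel_pair.Fubini') measurable
  also have "\<dots> = Wint w (emeasure M E)" by (simp add: nn_integral_layer Wint_def)
  finally show ?thesis by (simp add: h_def)
qed

text \<open>Control of h on superlevel sets suffices, as |f| powr q is a superposition of their
  indicators.\<close>

lemma nn_integral_powr_level:
  fixes f :: "real^'n \<Rightarrow> real" and h :: "real^'n \<Rightarrow> ennreal"
  assumes [measurable]: "f \<in> borel_measurable borel" "h \<in> borel_measurable borel" and q: "0 < q"
    and h: "\<And>s. 0 < s \<Longrightarrow> (\<integral>\<^sup>+x. h x * indicator {x. s < \<bar>f x\<bar>} x \<partial>hvol) \<le> Wint w (dfun f s)"
  shows "(\<integral>\<^sup>+x. ennreal (\<bar>f x\<bar> powr q) * h x \<partial>hvol)
    \<le> (\<integral>\<^sup>+s. ennreal (q * s powr (q - 1)) * indicator {0<..} s * Wint w (dfun f s) \<partial>lborel)"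
proof -
  have "(\<integral>\<^sup>+x. ennreal (\<bar>f x\<bar> powr q) * h x \<partial>hvol)
    = (\<integral>\<^sup>+x. (\<integral>\<^sup>+s. ennreal (q * s powr (q - 1)) * indicator {0<..} s * (h x * indicator {x. s < \<bar>f x\<bar>} x) \<partial>lborel) \<partial>hvol)"
  proof (rule nn_integral_cong)
    fix x
    have "(\<integral>\<^sup>+s. ennreal (q * s powr (q - 1)) * indicator {0<..} s * (h x * indicator {x. s < \<bar>f x\<bar>} x) \<partial>lborel)
      = (\<integral>\<^sup>+s. ennreal (q * s powr (q - 1)) * indicator {0<..<\<bar>f x\<bar>} s * h x \<partial>lborel)"
      by (intro nn_integral_cong) (auto simp: indicator_def)
    then show "ennreal (\<bar>f x\<bar> powr q) * h x = (\<integral>\<^sup>+s. ennreal (q * s powr (q - 1)) * indicator {0<..} s * (h x * indicator {x. s < \<bar>f x\<bar>} x) \<partial>lborel)"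
      using q by (simp add: nn_integral_multc nn_integral_powr)
  qed
  also have "\<dots> = (\<integral>\<^sup>+s. (\<integral>\<^sup>+x. ennreal (q * s powr (q - 1)) * indicator {0<..} s * (h x * indicator {x. s < \<bar>f x\<bar>} x) \<partial>hvol) \<partial>lborel)"
    by (rule lh.Fubini') measurable
  also have "\<dots> = (\<integral>\<^sup>+s. ennreal (q * s powr (q - 1)) * indicator {0<..} s * (\<integral>\<^sup>+x. h x * indicator {x. s < \<bar>f x\<bar>} x \<partial>hvol) \<partial>lborel)"
    by (intro nn_integral_cong nn_integral_cmult) measurable
  also have "\<dots> \<le> (\<integral>\<^sup>+s. ennreal (q * s powr (q - 1)) * indicator {0<..} s * Wint w (dfun f s) \<partial>lborel)"
  proof (rule nn_integral_mono)
    fix s show "ennreal (q * s powr (q - 1)) * indicator {0<..} s * (\<integral>\<^sup>+x. h x * indicator {x. s < \<bar>f x\<bar>} x \<partial>hvol)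
      \<le> ennreal (q * s powr (q - 1)) * indicator {0<..} s * Wint w (dfun f s)"
      by (cases "0 < s") (intro mult_left_mono h, auto)
  qed
  finally show ?thesis .
qed

text \<open>By Fubini the graph of |u| is null for the product measure, so almost every level is
  taken on a null set only.\<close>

lemma AE_mbar_eq_dfun:
  fixes u :: "real^'n \<Rightarrow> real"
  assumes [measurable]: "u \<in> borel_measurable borel"
  shows "AE s in lborel. mbar u s = dfun u s"
proof -
  have "(\<integral>\<^sup>+s. (\<integral>\<^sup>+x. indicator {x. \<bar>u x\<bar> = s} x \<partial>hvol) \<partial>lborel) = (\<integral>\<^sup>+x. (\<integral>\<^sup>+s. indicator {x. \<bar>u x\<bar> = s} x \<partial>lborel) \<partial>hvol)"
    by (rule lh.Fubini'[symmetric]) measurable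
  also have "\<dots> = (\<integral>\<^sup>+x. (\<integral>\<^sup>+s. indicator {\<bar>u x\<bar>} s \<partial>lborel) \<partial>(hvol :: (real^'n) measure))"
    by (intro nn_integral_cong) (auto simp: indicator_def)
  also have "\<dots> = 0" by simp
  finally have "AE s in lborel. (\<integral>\<^sup>+x. indicator {x. \<bar>u x\<bar> = s} x \<partial>hvol) = 0"
    by (subst (asm) nn_integral_0_iff_AE) auto
  then show ?thesis
  proof eventually_elim
    case (elim s)
    then have "emeasure hvol {x. \<bar>u x\<bar> = s} = 0" by (subst (asm) nn_integral_indicator) auto
    moreover have "{x. s \<le> \<bar>u x\<bar>} = {x. s < \<bar>u x\<bar>} \<union> {x. \<bar>u x\<bar> = s}" by auto
    ultimately show ?case unfolding mbar_def dfun_def by (simp add: emeasure_Un_null_set null_setsI)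
  qed
qed

text \<open>In this normalization equality holds at b = x, which is what keeps the constants derived
  from it sharp.\<close>

lemma Young_powr:
  assumes "1 < q" "0 \<le> x" "0 \<le> (b::real)"
  shows "q * x powr (q - 1) * b \<le> (q - 1) * x powr q + b powr q"
proof -
  have "x powr (q - 1) * b \<le> (x powr (q - 1)) powr (q / (q - 1)) / (q / (q - 1)) + b powr q / q"
    by (rule Youngs_inequality) (use assms in \<open>auto simp: field_simps\<close>)
  also have "(x powr (q - 1)) powr (q / (q - 1)) = x powr q" using assms by (simp add: powr_powr)
  finally show ?thesis using assms by (simp add: field_simps)
qed

section \<open>The gradient estimate\<close>

text \<open>For odd m, \<open>hnabla m u\<close> is a length and in general not smooth, so it leaves
  \<open>C0inf\<close>. Boundedness and compact support remain, and they make distribution functions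
  finite at positive levels and rearrangements well defined.\<close>

definition bsupp :: "(real^'n \<Rightarrow> real) \<Rightarrow> bool" where
  "bsupp u \<longleftrightarrow> u \<in> borel_measurable borel \<and>
     (\<exists>C K. 0 \<le> C \<and> compact K \<and> K \<subseteq> ball 0 1 \<and> (\<forall>x. \<bar>u x\<bar> \<le> C * indicator K x))"

lemma bsupp_C0inf: assumes "u \<in> C0inf" shows "bsupp u"
proof -
  obtain K where K: "smooth_fn u" "compact K" "K \<subseteq> ball 0 1" "\<And>x. x \<notin> K \<Longrightarrow> u x = 0" using C0infE[OF assms] by metis
  obtain C where "0 \<le> C" "\<And>x. \<bar>u x\<bar> \<le> C * indicator K x"
    using continuous_support_bounded[OF K(2) smooth_fn_continuous[OF K(1)] K(4)] by blast
  then show ?thesis unfolding bsupp_def using K C0inf_measurable(1)[OF assms] by metis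
qed

lemma bsupp_gnorm: assumes "u \<in> C0inf" shows "bsupp (\<lambda>x. gnorm x (hgrad u x))"
proof -
  obtain K where K: "smooth_fn u" "compact K" "K \<subseteq> ball 0 1" "\<And>x. x \<notin> K \<Longrightarrow> u x = 0" using C0infE[OF assms] by metis
  obtain C where "0 \<le> C" "\<And>x. \<bar>gnorm x (hgrad u x)\<bar> \<le> C * indicator K x"
    using continuous_support_bounded[OF K(2) continuous_gnorm_hgrad[OF assms] gnorm_hgrad_outside[OF assms compact_imp_closed[OF K(2)] K(4)]] by blast
  then show ?thesis unfolding bsupp_def using K C0inf_measurable(3)[OF assms] by metis
qed

context
  fixes u :: "real^'n \<Rightarrow> real"
  assumes u: "bsupp u"
begin

lemma bsupp_measurable [measurable]: "u \<in> borel_measurable borel"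
  using u unfolding bsupp_def by blast

lemma bsuppE: obtains C V where "0 \<le> C" "\<And>s. s \<ge> C \<Longrightarrow> dfun u s = 0" "0 \<le> V" "\<And>s. 0 < s \<Longrightarrow> mbar u s \<le> ennreal V"
proof -
  obtain C K where K: "0 \<le> C" "compact K" "K \<subseteq> ball 0 1" "\<And>x. \<bar>u x\<bar> \<le> C * indicator K x"
    using u unfolding bsupp_def by blast
  have le: "\<bar>u x\<bar> \<le> C" for x using K(4)[of x] K(1) by (cases "x \<in> K") auto
  have [measurable]: "K \<in> sets borel" using K by (auto intro: borel_closed compact_imp_closed)
  have fin: "emeasure hvol K < \<infinity>" by (rule emeasure_hvol_compact[OF K(2,3)])
  have "dfun u s = 0" if "s \<ge> C" for s
  proof -
    have e: "{x. s < \<bar>u x\<bar>} = {}" using le that by (auto simp: not_less intro: order_trans)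
    show ?thesis unfolding dfun_def e by simp
  qed
  moreover have "mbar u s \<le> ennreal (enn2real (emeasure hvol K))" if "0 < s" for s
  proof -
    have "{x. s \<le> \<bar>u x\<bar>} \<subseteq> K"
    proof safe
      fix x assume "s \<le> \<bar>u x\<bar>" then show "x \<in> K" using K(4)[of x] that by (cases "x \<in> K") auto
    qed
    then have "mbar u s \<le> emeasure hvol K" unfolding mbar_def by (rule emeasure_mono) simp
    then show ?thesis using fin by simp
  qed
  ultimately show ?thesis using that K(1) enn2real_nonneg by metis
qed

lemma dfun_le_mbar: "dfun u s \<le> mbar u s"
  unfolding dfun_def mbar_def by (rule emeasure_mono) auto

lemma mbar_antimono: "s \<le> s' \<Longrightarrow> mbar u s' \<le> mbar u s"
  unfolding mbar_def by (rule emeasure_mono) auto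

lemma mbar_fin: "0 < s \<Longrightarrow> mbar u s < \<infinity>"
  by (rule bsuppE) (metis ennreal_less_top infinity_ennreal_def le_less_trans)

lemma dfun_fin: "0 < s \<Longrightarrow> dfun u s < \<infinity>"
  using mbar_fin dfun_le_mbar le_less_trans by blast

lemma bsupp_bdd: "bdd_above {s. 0 < s \<and> ennreal t < dfun u s}"
proof (rule bsuppE)
  fix C V assume "\<And>s. s \<ge> C \<Longrightarrow> dfun u s = 0"
  then show ?thesis by (intro bdd_aboveI[of _ C]) (metis (mono_tags, lifting) linear mem_Collect_eq not_less_zero)
qed

lemma bsupp_lorentz: "0 < q \<Longrightarrow> lorentz_qpow p q u = lor p q u"
  by (rule lorentz_qpow_eq_lor) (auto simp: bsupp_bdd)

lemma bsupp_lor_rearr: "0 < q \<Longrightarrow> lor p q u = (\<integral>\<^sup>+t. lorw p q t * ennreal (rearr u t powr q) * indicator {0<..} t \<partial>lborel)"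
  by (subst bsupp_lorentz[symmetric], simp, rule lorentz_qpow_rearr) (simp add: bsupp_bdd rearr_nonneg)

lemma bsupp_rearr_iff: "0 \<le> s \<Longrightarrow> s < rearr u t \<longleftrightarrow> ennreal t < dfun u s"
  by (rule rearr_iff) (auto simp: bsupp_bdd)

lemma bsupp_rearr_nonneg: "0 \<le> rearr u t"
  by (rule rearr_nonneg[OF bsupp_bdd])

lemma bsupp_lor_fin: assumes "0 < p" "0 < q" shows "lor p q u < \<infinity>"
proof (rule bsuppE)
  fix C V assume C: "0 \<le> C" "\<And>s. s \<ge> C \<Longrightarrow> dfun u s = 0" "0 \<le> V" "\<And>s. 0 < s \<Longrightarrow> mbar u s \<le> ennreal V"
  have W0: "Wint w 0 = 0" for w unfolding Wint_def by (simp add: indicator_def)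
  have "lor p q u \<le> (\<integral>\<^sup>+s. (ennreal (q * s powr (q - 1)) * indicator {0<..<C} s) * Wint (lorw p q) (ennreal V) \<partial>lborel)"
    unfolding lor_def
  proof (rule nn_integral_mono)
    fix s show "ennreal (q * s powr (q - 1)) * indicator {0<..} s * Wint (lorw p q) (dfun u s)
       \<le> (ennreal (q * s powr (q - 1)) * indicator {0<..<C} s) * Wint (lorw p q) (ennreal V)"
    proof (cases "0 < s \<and> s < C")
      case True
      then have "dfun u s \<le> ennreal V" using C(4) dfun_le_mbar order_trans by blast
      then show ?thesis using True by (auto intro!: mult_left_mono Wint_mono)
    qed (use C(2)[of s] in \<open>auto simp: W0 not_less\<close>)
  qed
  also have "\<dots> = ennreal (C powr q) * Wint (lorw p q) (ennreal V)"
    using assms C by (subst nn_integral_multc) (auto simp: nn_integral_powr)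
  also have "\<dots> < \<infinity>" using assms C by (simp add: Wint_lorw ennreal_mult_less_top)
  finally show ?thesis .
qed

end

lemma powr_superadd:
  fixes a b q :: real assumes "0 \<le> a" "0 \<le> b" "1 \<le> q"
  shows "a powr q + b powr q \<le> (a + b) powr q"
proof -
  have s: "x powr q = x powr (q - 1) * x" if "0 \<le> x" for x :: real
    using that powr_mult_base[of x "q - 1"] by (simp add: mult.commute)
  have "a powr q + b powr q = a powr (q - 1) * a + b powr (q - 1) * b" using s assms by simp
  also have "\<dots> \<le> (a + b) powr (q - 1) * a + (a + b) powr (q - 1) * b"
    using assms by (intro add_mono mult_right_mono powr_mono2) auto
  also have "\<dots> = (a + b) powr q" using s[of "a + b"] assms by (simp add: algebra_simps)
  finally show ?thesis .
qed

lemma lorw_antimono: "q \<le> p \<Longrightarrow> 0 < p \<Longrightarrow> 0 < s \<Longrightarrow> s \<le> t \<Longrightarrow> lorw p q t \<le> lorw p q s"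
  unfolding lorw_def by (intro ennreal_leI powr_mono2') auto

lemma wdfun_add:
  assumes [measurable]: "c \<in> borel_measurable borel" "u \<in> borel_measurable borel"
    and "0 \<le> k" "\<And>x. 0 \<le> c x"
  shows "wdfun (\<lambda>x. k + c x) u s = ennreal k * dfun u s + wdfun c u s"
proof -
  have "wdfun (\<lambda>x. k + c x) u s = (\<integral>\<^sup>+x. ennreal k * indicator {x. s < \<bar>u x\<bar>} x + ennreal (c x) * indicator {x. s < \<bar>u x\<bar>} x \<partial>hvol)"
    unfolding wdfun_def using assms(3,4) by (intro nn_integral_cong) (auto simp: distrib_right)
  also have "\<dots> = (\<integral>\<^sup>+x. ennreal k * indicator {x. s < \<bar>u x\<bar>} x \<partial>hvol) + wdfun c u s"
    unfolding wdfun_def by (rule nn_integral_add) measurable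
  also have "(\<integral>\<^sup>+x. ennreal k * indicator {x. s < \<bar>u x\<bar>} x \<partial>hvol) = ennreal k * dfun u s"
    unfolding dfun_def by (rule nn_integral_cmult_indicator) measurable
  finally show ?thesis .
qed

lemma hdelta_bounds: "0 \<le> hdelta x" "x \<in> ball 0 1 \<Longrightarrow> 0 < hdelta x" "x \<in> ball 0 1 \<Longrightarrow> hdelta x \<le> 1"
proof -
  show "0 \<le> hdelta x" by (simp add: hdelta_def)
  assume "x \<in> ball 0 1"
  then have b: "0 < bdef x" "bdef x \<le> 1" using bdef_pos_iff bdef_le_1 by auto
  then show "0 < hdelta x" by (simp add: hdelta_def)
  have "bdef x / (2 - bdef x) \<le> 1" "0 \<le> bdef x / (2 - bdef x)" using b by auto
  then show "hdelta x \<le> 1" unfolding hdelta_def by (simp add: power_le_one)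
qed

text \<open>The isoperimetric inequality is weighted by \<open>q s\<^sup>q\<^sup>-\<^sup>1 w(V{\<bar>u\<bar> \<ge> s})\<close>, with \<open>w t = t powr (q / p - 1)\<close>
  decreasing because \<open>q \<le> p\<close>. Young's inequality splits off \<open>\<bar>\<nabla>u\<bar>\<^sup>q\<close>, and Hardy--Littlewood bounds its
  weighted integral by the Lorentz functional. With the optimal constant in Young's inequality,
  no Hoelder inequality for rearrangements is needed.\<close>
lemma gradient_Lorentz:
  fixes u :: "real^'n \<Rightarrow> real"
  assumes u: "u \<in> C0inf" and n: "CARD('n) \<ge> 2" and p: "1 < q" "q \<le> p"
  defines "\<theta> \<equiv> (real CARD('n) - 1) / p"
  shows "ennreal (\<theta> powr q) * lor p q u
     + ennreal (\<theta> powr (q - 1)) * (\<integral>\<^sup>+s. ennreal (q * s powr (q - 1)) * lorw p q (enn2real (mbar u s)) * indicator {0<..} s * wdfun hdelta u s \<partial>lborel)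
    \<le> lor p q (\<lambda>x. gnorm x (hgrad u x))"
proof -
  note bu = bsupp_C0inf[OF u]
  note [measurable] = C0inf_measurable[OF u]
  let ?n = "real CARD('n) - 1"
  have n1: "?n > 0" using n by simp
  have \<theta>: "\<theta> > 0" using n1 p by (simp add: \<theta>_def)
  define g where "g s = ennreal (q * s powr (q - 1)) * lorw p q (enn2real (mbar u s))" for s
  have [measurable]: "g \<in> borel_measurable borel" unfolding g_def by measurable
  define gn where "gn x = gnorm x (hgrad u x)" for x
  have gn0: "0 \<le> gn x" for x by (simp add: gn_def gnorm_hgrad)
  have [measurable]: "gn \<in> borel_measurable borel" unfolding gn_def by measurable
  define h where "h x = (if 0 < \<bar>u x\<bar> then lorw p q (enn2real (mbar u \<bar>u x\<bar>)) else 0)" for x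
  have [measurable]: "h \<in> borel_measurable borel" unfolding h_def by measurable
  define L where "L = lor p q u"
  have Lf: "L < \<infinity>" unfolding L_def by (rule bsupp_lor_fin[OF bu]) (use p in auto)
  define R where "R = (\<integral>\<^sup>+s. g s * indicator {0<..} s * wdfun hdelta u s \<partial>lborel)"
  have lhs: "(\<integral>\<^sup>+s. g s * indicator {0<..} s * wdfun (\<lambda>x. ?n + hdelta x) u s \<partial>lborel) = ennreal (?n * (q / p)) * L + R"
  proof -
    have "(\<integral>\<^sup>+s. g s * indicator {0<..} s * wdfun (\<lambda>x. ?n + hdelta x) u s \<partial>lborel)
      = (\<integral>\<^sup>+s. ennreal ?n * (g s * indicator {0<..} s * dfun u s) + g s * indicator {0<..} s * wdfun hdelta u s \<partial>lborel)"
      using n1 hdelta_bounds(1) by (intro nn_integral_cong, subst wdfun_add) (auto simp: distrib_left mult_ac)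
    also have "\<dots> = ennreal ?n * (\<integral>\<^sup>+s. g s * indicator {0<..} s * dfun u s \<partial>lborel) + R"
      unfolding R_def by (subst nn_integral_add) (auto simp: nn_integral_cmult)
    also have "(\<integral>\<^sup>+s. g s * indicator {0<..} s * dfun u s \<partial>lborel)
      = (\<integral>\<^sup>+s. ennreal (q / p) * (ennreal (q * s powr (q - 1)) * indicator {0<..} s * Wint (lorw p q) (dfun u s)) \<partial>lborel)"
    proof (rule nn_integral_cong_AE)
      show "AE s in lborel. g s * indicator {0<..} s * dfun u s =
        ennreal (q / p) * (ennreal (q * s powr (q - 1)) * indicator {0<..} s * Wint (lorw p q) (dfun u s))"
        using AE_mbar_eq_dfun[OF C0inf_measurable(1)[OF u]]
      proof (eventually_elim)
        case (elim s)
        show ?case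
        proof (cases "0 < s")
          case True
          obtain m where m: "0 \<le> m" "dfun u s = ennreal m"
            using dfun_fin[OF bu True] by (cases "dfun u s") auto
          \<comment> \<open>For a power weight, w(m) m is a multiple of the primitive at m, so the
            isoperimetric side reproduces the Lorentz functional of u itself.\<close>
          have W: "lorw p q m * ennreal m = ennreal (q / p) * Wint (lorw p q) (ennreal m)"
          proof -
            have "m powr (q / p - 1) * m = m powr (q / p)"
              using m powr_mult_base[of m "q / p - 1"] by (simp add: mult.commute)
            then have "lorw p q m * ennreal m = ennreal (m powr (q / p))"
              unfolding lorw_def using m by (simp add: ennreal_mult'[symmetric])
            then show ?thesis using p m by (simp add: Wint_lorw ennreal_mult'[symmetric])
          qed
          have "ennreal (q * s powr (q - 1)) * lorw p q m * ennreal m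
            = ennreal (q / p) * (ennreal (q * s powr (q - 1)) * Wint (lorw p q) (ennreal m))"
            by (simp only: mult.assoc W) (simp only: mult.left_commute)
          then show ?thesis using True m elim by (simp add: g_def)
        qed simp
      qed
    qed
    also have "\<dots> = ennreal (q / p) * L" unfolding L_def lor_def by (rule nn_integral_cmult) measurable
    also have "ennreal ?n * (ennreal (q / p) * L) = ennreal (?n * (q / p)) * L"
    proof -
      have "ennreal (?n * (q / p)) = ennreal ?n * ennreal (q / p)" by (rule ennreal_mult') (use n1 in auto)
      then show ?thesis by (simp only: mult.assoc)
    qed
    finally show ?thesis .
  qed
  have HL: "(\<integral>\<^sup>+x. h x * indicator E x \<partial>hvol) \<le> Wint (lorw p q) (emeasure hvol E)" if "E \<in> sets borel" for E
    unfolding h_def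
    by (rule Hardy_Littlewood_level[OF sigma_finite_hvol])
      (use that p mbar_fin[OF bu] in \<open>auto simp: mbar_def intro!: lorw_antimono\<close>)
  have HLf: "(\<integral>\<^sup>+x. ennreal (\<bar>f x\<bar> powr q) * h x \<partial>hvol) \<le> lor p q f" if [measurable]: "f \<in> borel_measurable borel" for f
    unfolding lor_def by (rule nn_integral_powr_level) (use p in \<open>auto simp: dfun_def intro!: HL\<close>)
  have "ennreal (\<theta> powr (q - 1)) * (ennreal (?n * (q / p)) * L + R)
    \<le> ennreal (\<theta> powr (q - 1)) * (\<integral>\<^sup>+x. g \<bar>u x\<bar> * indicator {0<..} \<bar>u x\<bar> * ennreal (gn x) \<partial>hvol)"
    unfolding lhs[symmetric] gn_def by (intro mult_left_mono weighted_isoperimetric[OF u]) auto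
  also have "\<dots> = (\<integral>\<^sup>+x. ennreal (\<theta> powr (q - 1)) * (g \<bar>u x\<bar> * indicator {0<..} \<bar>u x\<bar> * ennreal (gn x)) \<partial>hvol)"
    by (rule nn_integral_cmult[symmetric]) measurable
  also have "\<dots> \<le> (\<integral>\<^sup>+x. ennreal ((q - 1) * \<theta> powr q) * (ennreal (\<bar>u x\<bar> powr q) * h x) + ennreal (\<bar>gn x\<bar> powr q) * h x \<partial>hvol)"
  proof (rule nn_integral_mono)
    fix x
    show "ennreal (\<theta> powr (q - 1)) * (g \<bar>u x\<bar> * indicator {0<..} \<bar>u x\<bar> * ennreal (gn x))
      \<le> ennreal ((q - 1) * \<theta> powr q) * (ennreal (\<bar>u x\<bar> powr q) * h x) + ennreal (\<bar>gn x\<bar> powr q) * h x"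
    proof (cases "0 < \<bar>u x\<bar>")
      case True
      \<comment> \<open>Young's inequality is balanced at |grad u| = \<theta> |u|, the relation that
        v powr a satisfies asymptotically at the boundary.\<close>
      have "q * (\<theta> * \<bar>u x\<bar>) powr (q - 1) * gn x \<le> (q - 1) * (\<theta> * \<bar>u x\<bar>) powr q + gn x powr q"
        by (rule Young_powr) (use p \<theta> gn0 in auto)
      then have Y: "\<theta> powr (q - 1) * (q * \<bar>u x\<bar> powr (q - 1)) * gn x \<le> (q - 1) * \<theta> powr q * \<bar>u x\<bar> powr q + gn x powr q"
        using \<theta> by (simp add: powr_mult mult_ac)
      have "ennreal (\<theta> powr (q - 1)) * (g \<bar>u x\<bar> * indicator {0<..} \<bar>u x\<bar> * ennreal (gn x))
        = ennreal (\<theta> powr (q - 1) * (q * \<bar>u x\<bar> powr (q - 1)) * gn x) * h x"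
        using True p gn0 by (simp add: g_def h_def ennreal_mult mult_ac)
      also have "\<dots> \<le> ennreal ((q - 1) * \<theta> powr q * \<bar>u x\<bar> powr q + gn x powr q) * h x"
        by (intro mult_right_mono ennreal_leI Y) auto
      also have "\<dots> = ennreal ((q - 1) * \<theta> powr q) * (ennreal (\<bar>u x\<bar> powr q) * h x) + ennreal (\<bar>gn x\<bar> powr q) * h x"
        using p gn0 by (simp add: ennreal_plus ennreal_mult distrib_left distrib_right mult_ac)
      finally show ?thesis .
    qed simp
  qed
  also have "\<dots> = ennreal ((q - 1) * \<theta> powr q) * (\<integral>\<^sup>+x. ennreal (\<bar>u x\<bar> powr q) * h x \<partial>hvol) + (\<integral>\<^sup>+x. ennreal (\<bar>gn x\<bar> powr q) * h x \<partial>hvol)"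
    by (subst nn_integral_add) (auto simp: nn_integral_cmult)
  also have "\<dots> \<le> ennreal ((q - 1) * \<theta> powr q) * L + lor p q gn"
    unfolding L_def by (intro add_mono mult_left_mono HLf) auto
  finally have "ennreal (\<theta> powr (q - 1)) * (ennreal (?n * (q / p)) * L + R) \<le> ennreal ((q - 1) * \<theta> powr q) * L + lor p q gn" .
  moreover have "ennreal (\<theta> powr (q - 1)) * (ennreal (?n * (q / p)) * L + R)
    = ennreal ((q - 1) * \<theta> powr q) * L + (ennreal (\<theta> powr q) * L + ennreal (\<theta> powr (q - 1)) * R)"
  proof -
    have "\<theta> powr (q - 1) * (?n * (q / p)) = (q - 1) * \<theta> powr q + \<theta> powr q"
    proof -
      have "\<theta> powr q = \<theta> * \<theta> powr (q - 1)" using \<theta> powr_mult_base[of \<theta> "q - 1"] by simp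
      moreover have "?n * (q / p) = q * \<theta>" by (simp add: \<theta>_def)
      ultimately show ?thesis by (simp add: algebra_simps)
    qed
    then have "ennreal (\<theta> powr (q - 1)) * ennreal (?n * (q / p)) = ennreal ((q - 1) * \<theta> powr q) + ennreal (\<theta> powr q)"
      using p \<theta> by (simp add: ennreal_mult'[symmetric] ennreal_plus[symmetric] del: ennreal_plus)
    then show ?thesis by (simp add: distrib_left distrib_right mult.assoc[symmetric] add.assoc)
  qed
  ultimately have "ennreal ((q - 1) * \<theta> powr q) * L + (ennreal (\<theta> powr q) * L + ennreal (\<theta> powr (q - 1)) * R)
    \<le> ennreal ((q - 1) * \<theta> powr q) * L + lor p q gn" by simp
  \<comment> \<open>Finiteness of L permits cancelling the u-term of Young's inequality from both
    sides.\<close>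
  moreover have "ennreal ((q - 1) * \<theta> powr q) * L \<noteq> \<infinity>" using Lf by (simp add: ennreal_mult_eq_top_iff)
  ultimately have "ennreal (\<theta> powr q) * L + ennreal (\<theta> powr (q - 1)) * R \<le> lor p q gn"
    by (simp add: ennreal_add_left_cancel_le)
  then show ?thesis by (simp add: L_def R_def g_def gn_def[abs_def])
qed

section \<open>Hardy's inequality for the kernel 1 / max t r\<close>

lemma Hardy_kernel_integral:
  assumes "1 < p"
  shows "(\<integral>\<^sup>+s. ennreal (s powr (- 1 / p) / max 1 s) * indicator {0<..} s \<partial>lborel) = ennreal (p * (p / (p - 1)))"
proof -
  let ?k = "\<lambda>s. s powr (- 1 / p) / max 1 s"
  have "(\<integral>\<^sup>+s. ennreal (?k s) * indicator {0<..} s \<partial>lborel)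
    = (\<integral>\<^sup>+s. ennreal (p / (p - 1)) * (ennreal ((1 - 1 / p) * s powr ((1 - 1 / p) - 1)) * indicator {0<..<1} s)
        + ennreal (s powr (- 1 / p - 1)) * indicator {1..} s \<partial>lborel)"
  proof (rule nn_integral_cong)
    fix s :: real
    have "p / (p - 1) * ((1 - 1 / p) * s powr (- 1 / p)) = s powr (- 1 / p)" using assms by (simp add: field_simps)
    then show "ennreal (?k s) * indicator {0<..} s = ennreal (p / (p - 1)) * (ennreal ((1 - 1 / p) * s powr ((1 - 1 / p) - 1)) * indicator {0<..<1} s)
        + ennreal (s powr (- 1 / p - 1)) * indicator {1..} s"
      using assms by (cases "s < 1") (auto simp: indicator_def ennreal_mult[symmetric] powr_diff)
  qed
  also have "\<dots> = (\<integral>\<^sup>+s. ennreal (p / (p - 1)) * (ennreal ((1 - 1 / p) * s powr ((1 - 1 / p) - 1)) * indicator {0<..<1} s) \<partial>lborel)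
      + (\<integral>\<^sup>+s. ennreal (s powr (- 1 / p - 1)) * indicator {1..} s \<partial>lborel)"
    by (rule nn_integral_add) measurable
  also have "(\<integral>\<^sup>+s. ennreal (p / (p - 1)) * (ennreal ((1 - 1 / p) * s powr ((1 - 1 / p) - 1)) * indicator {0<..<1} s) \<partial>lborel) = ennreal (p / (p - 1))"
    using assms by (subst nn_integral_cmult, measurable, subst nn_integral_powr) auto
  also have "(\<integral>\<^sup>+s. ennreal (s powr (- 1 / p - 1)) * indicator {1..} s \<partial>lborel) = ennreal p"
    using nn_integral_has_integral_lebesgue'[OF _ has_integral_powr_to_inf[of "- 1 / p - 1" 1]] assms by simp
  also have "ennreal (p / (p - 1)) + ennreal p = ennreal (p / (p - 1) + p)" using assms by (simp add: ennreal_plus)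
  \<comment> \<open>The part over s < 1 contributes p' and the part over s >= 1 contributes p;
    conjugate exponents satisfy p + p' = p p'.\<close>
  also have "p / (p - 1) + p = p * (p / (p - 1))" using assms by (simp add: field_simps)
  finally show ?thesis .
qed

text \<open>The substitution r = t s writes \<Phi> as a superposition of dilates of \<phi> with
  density 1 / max 1 s. Multiplying each dilate by s powr (1 / p) makes its Lorentz norm independent
  of s, so Jensen's inequality for the remaining density \<open>k\<close>, of total mass p p', gives
  the constant.\<close>

lemma Hardy_convolution:
  fixes \<phi> :: "real \<Rightarrow> real"
  assumes [measurable]: "\<phi> \<in> borel_measurable borel" and \<phi>0: "\<And>t. 0 \<le> \<phi> t" and p: "1 < p" "1 < q"
    and \<Phi>: "\<And>t. 0 < t \<Longrightarrow> 0 \<le> \<Phi> t"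
      "\<And>t. 0 < t \<Longrightarrow> ennreal (\<Phi> t) = (\<integral>\<^sup>+r. ennreal (\<phi> r / max t r) * indicator {0<..} r \<partial>lborel)"
  shows "(\<integral>\<^sup>+t. lorw p q t * ennreal (\<Phi> t powr q) * indicator {0<..} t \<partial>lborel)
    \<le> ennreal ((p * (p / (p - 1))) powr q) * (\<integral>\<^sup>+t. lorw p q t * ennreal (\<phi> t powr q) * indicator {0<..} t \<partial>lborel)"
proof -
  define A where "A = p * (p / (p - 1))"
  have A: "A > 0" using p by (simp add: A_def)
  define k where "k s = s powr (- 1 / p) / max 1 s" for s :: real
  have k0: "0 \<le> k s" for s by (simp add: k_def)
  have [measurable]: "k \<in> borel_measurable borel" unfolding k_def by measurable
  have kA: "(\<integral>\<^sup>+s. ennreal (k s) * indicator {0<..} s \<partial>lborel) = ennreal A"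
    unfolding k_def A_def by (rule Hardy_kernel_integral[OF p(1)])
  define Y where "Y = (\<integral>\<^sup>+t. lorw p q t * ennreal (\<phi> t powr q) * indicator {0<..} t \<partial>lborel)"
  have conv: "ennreal (\<Phi> t) = (\<integral>\<^sup>+s. ennreal (\<phi> (t * s) * s powr (1 / p) * k s) * indicator {0<..} s \<partial>lborel)" if t: "0 < t" for t
  proof -
    have "ennreal (\<Phi> t) = ennreal \<bar>t\<bar> * (\<integral>\<^sup>+s. ennreal (\<phi> (0 + t * s) / max t (0 + t * s)) * indicator {0<..} (0 + t * s) \<partial>lborel)"
      unfolding \<Phi>(2)[OF t] by (rule nn_integral_real_affine) (use t in auto)
    also have "\<dots> = (\<integral>\<^sup>+s. ennreal t * (ennreal (\<phi> (t * s) / max t (t * s)) * indicator {0<..} (t * s)) \<partial>lborel)"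
      using t by (simp add: nn_integral_cmult)
    also have "\<dots> = (\<integral>\<^sup>+s. ennreal (\<phi> (t * s) * s powr (1 / p) * k s) * indicator {0<..} s \<partial>lborel)"
    proof (rule nn_integral_cong)
      fix s :: real
      show "ennreal t * (ennreal (\<phi> (t * s) / max t (t * s)) * indicator {0<..} (t * s)) = ennreal (\<phi> (t * s) * s powr (1 / p) * k s) * indicator {0<..} s"
      proof (cases "0 < s")
        case True
        have "max t (t * s) = t * max 1 s" using t by (simp add: max_mult_distrib_left)
        then have "t * (\<phi> (t * s) / max t (t * s)) = \<phi> (t * s) / max 1 s" using t by simp
        moreover have "s powr (1 / p) * k s = 1 / max 1 s"
        proof -
          have "s powr (1 / p) * s powr (- 1 / p) = 1" using True by (simp add: powr_add[symmetric])
          then show ?thesis by (simp add: k_def)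
        qed
        ultimately have "t * (\<phi> (t * s) / max t (t * s)) = \<phi> (t * s) * s powr (1 / p) * k s" by (simp add: mult.assoc)
        then show ?thesis using True t by (simp add: ennreal_mult'[symmetric])
      qed (use t in \<open>simp add: zero_less_mult_iff\<close>)
    qed
    finally show ?thesis .
  qed
  define X where "X t = (\<integral>\<^sup>+s. ennreal ((\<phi> (t * s) * s powr (1 / p)) powr q * k s) * indicator {0<..} s \<partial>lborel)" for t
  have jensen: "ennreal (\<Phi> t powr q) \<le> ennreal (A powr (q - 1)) * X t" if t: "0 < t" for t
  proof -
    \<comment> \<open>The mean value with respect to \<open>k\<close>. Jensen's inequality results
      from integrating Young's inequality at this point.\<close>
    define y where "y = \<Phi> t / A"
    have y: "0 \<le> y" using \<Phi>(1)[OF t] A by (simp add: y_def)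
    have yq: "y powr (q - 1) * \<Phi> t = A * y powr q"
      using y A powr_mult_base[of y "q - 1"] by (simp add: y_def field_simps)
    have "ennreal (q * y powr (q - 1)) * ennreal (\<Phi> t) = (\<integral>\<^sup>+s. ennreal (q * y powr (q - 1)) * (ennreal (\<phi> (t * s) * s powr (1 / p) * k s) * indicator {0<..} s) \<partial>lborel)"
      unfolding conv[OF t] by (rule nn_integral_cmult[symmetric]) measurable
    also have "\<dots> \<le> (\<integral>\<^sup>+s. ennreal ((q - 1) * y powr q) * (ennreal (k s) * indicator {0<..} s) + ennreal ((\<phi> (t * s) * s powr (1 / p)) powr q * k s) * indicator {0<..} s \<partial>lborel)"
    proof (rule nn_integral_mono)
      fix s :: real
      have "q * y powr (q - 1) * (\<phi> (t * s) * s powr (1 / p)) \<le> (q - 1) * y powr q + (\<phi> (t * s) * s powr (1 / p)) powr q"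
        by (rule Young_powr) (use p y \<phi>0 in auto)
      then have "q * y powr (q - 1) * (\<phi> (t * s) * s powr (1 / p)) * k s \<le> ((q - 1) * y powr q + (\<phi> (t * s) * s powr (1 / p)) powr q) * k s"
        using k0 by (intro mult_right_mono)
      then have "ennreal (q * y powr (q - 1) * (\<phi> (t * s) * s powr (1 / p) * k s)) \<le> ennreal ((q - 1) * y powr q * k s + (\<phi> (t * s) * s powr (1 / p)) powr q * k s)"
        by (intro ennreal_leI) (simp add: algebra_simps)
      then show "ennreal (q * y powr (q - 1)) * (ennreal (\<phi> (t * s) * s powr (1 / p) * k s) * indicator {0<..} s)
        \<le> ennreal ((q - 1) * y powr q) * (ennreal (k s) * indicator {0<..} s) + ennreal ((\<phi> (t * s) * s powr (1 / p)) powr q * k s) * indicator {0<..} s"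
        using p y k0 by (cases "0 < s") (simp_all add: ennreal_mult'[symmetric] ennreal_plus)
    qed
    also have "\<dots> = ennreal ((q - 1) * y powr q) * ennreal A + X t"
      unfolding X_def by (subst nn_integral_add) (auto simp: nn_integral_cmult kA)
    also have "ennreal ((q - 1) * y powr q) * ennreal A = ennreal ((q - 1) * y powr q * A)"
      using p y by (intro ennreal_mult'[symmetric]) auto
    also have "ennreal (q * y powr (q - 1)) * ennreal (\<Phi> t) = ennreal (q * (y powr (q - 1) * \<Phi> t))"
      using p y by (subst ennreal_mult'[symmetric]) (auto simp: mult.assoc)
    also have "q * (y powr (q - 1) * \<Phi> t) = (q - 1) * y powr q * A + A * y powr q"
      unfolding yq by (simp add: algebra_simps)
    also have "ennreal ((q - 1) * y powr q * A + A * y powr q) = ennreal ((q - 1) * y powr q * A) + ennreal (A * y powr q)"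
      using p y A by (intro ennreal_plus) auto
    finally have "ennreal ((q - 1) * y powr q * A) + ennreal (A * y powr q) \<le> ennreal ((q - 1) * y powr q * A) + X t" .
    then have le: "ennreal (A * y powr q) \<le> X t" by (simp add: ennreal_add_left_cancel_le)
    have "\<Phi> t powr q = A powr (q - 1) * (A * y powr q)"
    proof -
      have "\<Phi> t = A * y" using A by (simp add: y_def)
      then have "\<Phi> t powr q = A powr q * y powr q" using A y by (simp add: powr_mult)
      then show ?thesis using powr_mult_base[of A "q - 1"] A by (simp add: mult_ac)
    qed
    then have "ennreal (\<Phi> t powr q) = ennreal (A powr (q - 1)) * ennreal (A * y powr q)" by (simp add: ennreal_mult')
    also have "\<dots> \<le> ennreal (A powr (q - 1)) * X t" by (intro mult_left_mono le) auto
    finally show ?thesis .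
  qed
  have "(\<integral>\<^sup>+t. lorw p q t * ennreal (\<Phi> t powr q) * indicator {0<..} t \<partial>lborel)
    \<le> (\<integral>\<^sup>+t. (\<integral>\<^sup>+s. ennreal (A powr (q - 1)) * (lorw p q t * indicator {0<..} t * (ennreal ((\<phi> (t * s) * s powr (1 / p)) powr q * k s) * indicator {0<..} s)) \<partial>lborel) \<partial>lborel)"
  proof (rule nn_integral_mono)
    fix t :: real
    have "(\<integral>\<^sup>+s. ennreal (A powr (q - 1)) * (lorw p q t * indicator {0<..} t * (ennreal ((\<phi> (t * s) * s powr (1 / p)) powr q * k s) * indicator {0<..} s)) \<partial>lborel)
      = ennreal (A powr (q - 1)) * (lorw p q t * indicator {0<..} t * X t)"
      unfolding X_def by (simp add: nn_integral_cmult)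
    moreover have "lorw p q t * ennreal (\<Phi> t powr q) * indicator {0<..} t \<le> ennreal (A powr (q - 1)) * (lorw p q t * indicator {0<..} t * X t)"
    proof (cases "0 < t")
      case True
      then show ?thesis using mult_left_mono[OF jensen[OF True], of "lorw p q t"] by (simp add: mult_ac)
    qed simp
    ultimately show "lorw p q t * ennreal (\<Phi> t powr q) * indicator {0<..} t
      \<le> (\<integral>\<^sup>+s. ennreal (A powr (q - 1)) * (lorw p q t * indicator {0<..} t * (ennreal ((\<phi> (t * s) * s powr (1 / p)) powr q * k s) * indicator {0<..} s)) \<partial>lborel)"
      by simp
  qed
  also have "\<dots> = (\<integral>\<^sup>+s. (\<integral>\<^sup>+t. ennreal (A powr (q - 1)) * (lorw p q t * indicator {0<..} t * (ennreal ((\<phi> (t * s) * s powr (1 / p)) powr q * k s) * indicator {0<..} s)) \<partial>lborel) \<partial>lborel)"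
    by (rule lborel_pair.Fubini') measurable
  also have "\<dots> = (\<integral>\<^sup>+s. ennreal (A powr (q - 1)) * Y * (ennreal (k s) * indicator {0<..} s) \<partial>lborel)"
  proof (rule nn_integral_cong)
    fix s :: real
    show "(\<integral>\<^sup>+t. ennreal (A powr (q - 1)) * (lorw p q t * indicator {0<..} t * (ennreal ((\<phi> (t * s) * s powr (1 / p)) powr q * k s) * indicator {0<..} s)) \<partial>lborel)
      = ennreal (A powr (q - 1)) * Y * (ennreal (k s) * indicator {0<..} s)"
    proof (cases "0 < s")
      case True
      have "Y = ennreal \<bar>s\<bar> * (\<integral>\<^sup>+t. lorw p q (0 + s * t) * ennreal (\<phi> (0 + s * t) powr q) * indicator {0<..} (0 + s * t) \<partial>lborel)"
        unfolding Y_def by (rule nn_integral_real_affine) (use True in auto)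
      also have "\<dots> = (\<integral>\<^sup>+t. ennreal s * (lorw p q (s * t) * ennreal (\<phi> (s * t) powr q) * indicator {0<..} (s * t)) \<partial>lborel)"
        using True by (simp add: nn_integral_cmult)
      finally have Y: "Y = (\<integral>\<^sup>+t. ennreal s * (lorw p q (s * t) * ennreal (\<phi> (s * t) powr q) * indicator {0<..} (s * t)) \<partial>lborel)" .
      have "(\<integral>\<^sup>+t. ennreal (A powr (q - 1)) * (lorw p q t * indicator {0<..} t * (ennreal ((\<phi> (t * s) * s powr (1 / p)) powr q * k s) * indicator {0<..} s)) \<partial>lborel)
        = (\<integral>\<^sup>+t. ennreal (A powr (q - 1)) * ennreal (k s) * (ennreal s * (lorw p q (s * t) * ennreal (\<phi> (s * t) powr q) * indicator {0<..} (s * t))) \<partial>lborel)"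
      proof (rule nn_integral_cong)
        fix t :: real
        show "ennreal (A powr (q - 1)) * (lorw p q t * indicator {0<..} t * (ennreal ((\<phi> (t * s) * s powr (1 / p)) powr q * k s) * indicator {0<..} s))
          = ennreal (A powr (q - 1)) * ennreal (k s) * (ennreal s * (lorw p q (s * t) * ennreal (\<phi> (s * t) powr q) * indicator {0<..} (s * t)))"
        proof (cases "0 < t")
          case t: True
          have e: "s * (s * t) powr (q / p - 1) = s powr (q / p) * t powr (q / p - 1)"
            using True t powr_mult_base[of s "q / p - 1"] by (simp add: powr_mult)
          have "t powr (q / p - 1) * ((\<phi> (t * s) * s powr (1 / p)) powr q * k s) = k s * (s * ((s * t) powr (q / p - 1) * \<phi> (s * t) powr q))"
            using True t \<phi>0 p e by (simp add: powr_mult powr_powr mult_ac)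
          then have "lorw p q t * ennreal ((\<phi> (t * s) * s powr (1 / p)) powr q * k s) = ennreal (k s) * (ennreal s * (lorw p q (s * t) * ennreal (\<phi> (s * t) powr q)))"
            unfolding lorw_def using True t k0 by (simp add: ennreal_mult'[symmetric])
          then show ?thesis using True t by (simp add: mult.assoc)
        qed (use True in \<open>simp add: zero_less_mult_iff\<close>)
      qed
      also have "\<dots> = ennreal (A powr (q - 1)) * ennreal (k s) * Y" unfolding Y by (rule nn_integral_cmult) measurable
      finally show ?thesis using True by (simp add: mult_ac)
    qed simp
  qed
  also have "\<dots> = ennreal (A powr (q - 1)) * Y * ennreal A" by (subst nn_integral_cmult) (auto simp: kA)
  also have "\<dots> = ennreal (A powr q) * Y"
    using A powr_mult_base[of A "q - 1"] by (simp add: ennreal_mult'[symmetric] mult_ac)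
  finally show ?thesis by (simp add: A_def Y_def)
qed

section \<open>The Laplacian estimate\<close>

text \<open>For finite m this is the integral of the rearrangement of f over (0, m), written through
  the distribution function so that it makes sense for m = \<infinity> too.\<close>

definition level_mass :: "(real^'n \<Rightarrow> real) \<Rightarrow> ennreal \<Rightarrow> ennreal" where
  "level_mass f m = (\<integral>\<^sup>+s. indicator {0<..} s * min m (dfun f s) \<partial>lborel)"

text \<open>As \<open>Phi f t = t\<^sup>-\<^sup>1 \<integral>\<^bsub>0\<^esub>\<^bsup>t\<^esup> f\<^sup>* + \<integral>\<^bsub>t\<^esub>\<^bsup>\<infinity>\<^esup> f\<^sup>* / r\<close>, this is the Talenti majorant of \<open>u\<^sup>*\<close> when \<open>f = \<Delta>u\<close>.\<close>
definition Phi :: "(real^'n \<Rightarrow> real) \<Rightarrow> real \<Rightarrow> ennreal" where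
  "Phi f t = (\<integral>\<^sup>+r. ennreal (rearr f r / max t r) * indicator {0<..} r \<partial>lborel)"

lemma level_mass_mono: "m \<le> m' \<Longrightarrow> level_mass f m \<le> level_mass f m'"
  unfolding level_mass_def by (intro nn_integral_mono mult_left_mono min.mono) auto

lemma borel_measurable_level_mass [measurable]:
  assumes [measurable]: "f \<in> borel_measurable borel" shows "level_mass f \<in> borel_measurable borel"
  unfolding level_mass_def by measurable

text \<open>The volume where both |f| > t and |u| > s is at most the smaller of the two distribution
  functions; integrate over t.\<close>

lemma wdfun_le_level_mass:
  assumes [measurable]: "f \<in> borel_measurable borel" "u \<in> borel_measurable borel"
  shows "wdfun (\<lambda>x. \<bar>f x\<bar>) u s \<le> level_mass f (dfun u s)"
proof -
  have "wdfun (\<lambda>x. \<bar>f x\<bar>) u s = (\<integral>\<^sup>+x. (\<integral>\<^sup>+t. indicator {0<..} t * indicator {x. t < \<bar>f x\<bar> \<and> s < \<bar>u x\<bar>} x \<partial>lborel) \<partial>hvol)"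
    unfolding wdfun_def
  proof (rule nn_integral_cong)
    fix x
    have "(\<integral>\<^sup>+t. indicator {0<..} t * indicator {x. t < \<bar>f x\<bar> \<and> s < \<bar>u x\<bar>} x \<partial>lborel)
      = (\<integral>\<^sup>+t. indicator {0<..<\<bar>f x\<bar>} t * indicator {x. s < \<bar>u x\<bar>} x \<partial>lborel)"
      by (intro nn_integral_cong) (auto simp: indicator_def)
    then show "ennreal \<bar>f x\<bar> * indicator {x. s < \<bar>u x\<bar>} x = (\<integral>\<^sup>+t. indicator {0<..} t * indicator {x. t < \<bar>f x\<bar> \<and> s < \<bar>u x\<bar>} x \<partial>lborel)"
      by (simp add: nn_integral_multc)
  qed
  also have "\<dots> = (\<integral>\<^sup>+t. (\<integral>\<^sup>+x. indicator {0<..} t * indicator {x. t < \<bar>f x\<bar> \<and> s < \<bar>u x\<bar>} x \<partial>hvol) \<partial>lborel)"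
    by (rule lh.Fubini') measurable
  also have "\<dots> = (\<integral>\<^sup>+t. indicator {0<..} t * emeasure hvol {x. t < \<bar>f x\<bar> \<and> s < \<bar>u x\<bar>} \<partial>lborel)"
    by (intro nn_integral_cong nn_integral_cmult_indicator) measurable
  also have "\<dots> \<le> level_mass f (dfun u s)"
    unfolding level_mass_def dfun_def by (intro nn_integral_mono mult_left_mono min.boundedI emeasure_mono) auto
  finally show ?thesis .
qed

text \<open>The average of a decreasing function over (0, t) decreases in t. Level by level this is
  the monotonicity of (min t m) / t.\<close>

lemma level_mass_div_antimono:
  fixes f :: "real^'n \<Rightarrow> real"
  assumes [measurable]: "f \<in> borel_measurable borel" and st: "0 < s" "s \<le> t"
  shows "level_mass f (ennreal t) * ennreal (1 / t) \<le> level_mass f (ennreal s) * ennreal (1 / s)"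
proof -
  have "min (ennreal t) m * ennreal (1 / t) \<le> min (ennreal s) m * ennreal (1 / s)" for m
  proof (cases "m \<le> ennreal s")
    case True
    moreover have "ennreal s \<le> ennreal t" using st by (intro ennreal_leI)
    ultimately have "min (ennreal t) m = m" "min (ennreal s) m = m" by (auto intro!: min_absorb2)
    then show ?thesis using st by (auto intro!: mult_left_mono ennreal_leI simp: frac_le)
  next
    case False
    then have "min (ennreal s) m = ennreal s" by (intro min_absorb1) (simp add: not_le less_imp_le)
    then have "min (ennreal s) m * ennreal (1 / s) = 1" using st by (simp add: ennreal_mult'[symmetric])
    moreover have "min (ennreal t) m * ennreal (1 / t) \<le> ennreal t * ennreal (1 / t)" by (intro mult_right_mono) auto
    moreover have "ennreal t * ennreal (1 / t) = 1" using st by (simp add: ennreal_mult'[symmetric])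
    ultimately show ?thesis by simp
  qed
  then have "(\<integral>\<^sup>+r. (indicator {0<..} r * min (ennreal t) (dfun f r)) * ennreal (1 / t) \<partial>lborel)
    \<le> (\<integral>\<^sup>+r. (indicator {0<..} r * min (ennreal s) (dfun f r)) * ennreal (1 / s) \<partial>lborel)"
    by (intro nn_integral_mono) (simp add: mult.assoc mult_left_mono)
  then show ?thesis unfolding level_mass_def by (simp add: nn_integral_multc)
qed

context
  fixes f :: "real^'n \<Rightarrow> real"
  assumes f: "bsupp f"
begin

lemma bsupp_measurable' [measurable]: "f \<in> borel_measurable borel" by (rule bsupp_measurable[OF f])

lemma rearr_eq_nn_integral: "ennreal (rearr f r) = (\<integral>\<^sup>+s. indicator {0<..} s * indicator {r. ennreal r < dfun f s} r \<partial>lborel)"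
proof -
  have "(\<integral>\<^sup>+s. indicator {0<..} s * indicator {r. ennreal r < dfun f s} r \<partial>lborel) = (\<integral>\<^sup>+s. indicator {0<..<rearr f r} s \<partial>lborel)"
    by (intro nn_integral_cong) (auto simp: indicator_def bsupp_rearr_iff[OF f])
  then show ?thesis using bsupp_rearr_nonneg[OF f] by simp
qed

lemma borel_measurable_rearr [measurable]: "rearr f \<in> borel_measurable borel"
proof -
  have "(\<lambda>r. ennreal (rearr f r)) \<in> borel_measurable borel"
    unfolding rearr_eq_nn_integral by measurable
  then have "(\<lambda>r. enn2real (ennreal (rearr f r))) \<in> borel_measurable borel" by measurable
  then show ?thesis using bsupp_rearr_nonneg[OF f] by simp
qed

lemma level_mass_eq_rearr: "level_mass f (ennreal t) = (\<integral>\<^sup>+r. ennreal (rearr f r) * indicator {0<..<t} r \<partial>lborel)"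
proof -
  have "level_mass f (ennreal t) = (\<integral>\<^sup>+s. (\<integral>\<^sup>+r. indicator {0<..} s * indicator {r. ennreal r < dfun f s} r * indicator {0<..<t} r \<partial>lborel) \<partial>lborel)"
    unfolding level_mass_def
  proof (rule nn_integral_cong)
    fix s :: real
    have "(\<integral>\<^sup>+r. indicator {0<..} s * indicator {r. ennreal r < dfun f s} r * indicator {0<..<t} r \<partial>lborel)
      = (\<integral>\<^sup>+r. indicator {0<..} s * indicator {r. 0 < r \<and> ennreal r < min (ennreal t) (dfun f s)} r \<partial>lborel)"
      by (intro nn_integral_cong) (auto simp: indicator_def ennreal_less_iff)
    also have "\<dots> = indicator {0<..} s * min (ennreal t) (dfun f s)"
      by (subst nn_integral_cmult, measurable, simp only: nn_integral_less_ennreal)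
    finally show "indicator {0<..} s * min (ennreal t) (dfun f s)
      = (\<integral>\<^sup>+r. indicator {0<..} s * indicator {r. ennreal r < dfun f s} r * indicator {0<..<t} r \<partial>lborel)" by simp
  qed
  also have "\<dots> = (\<integral>\<^sup>+r. (\<integral>\<^sup>+s. indicator {0<..} s * indicator {r. ennreal r < dfun f s} r * indicator {0<..<t} r \<partial>lborel) \<partial>lborel)"
    by (rule lborel_pair.Fubini') measurable
  also have "\<dots> = (\<integral>\<^sup>+r. ennreal (rearr f r) * indicator {0<..<t} r \<partial>lborel)"
    by (simp add: rearr_eq_nn_integral nn_integral_multc)
  finally show ?thesis .
qed

lemma level_mass_fin: obtains B where "0 \<le> B" "\<And>m. level_mass f m \<le> ennreal B"
proof (rule bsuppE[OF f])
  fix C V assume C: "0 \<le> C" "\<And>s. s \<ge> C \<Longrightarrow> dfun f s = 0" "0 \<le> V" "\<And>s. 0 < s \<Longrightarrow> mbar f s \<le> ennreal V"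
  have "level_mass f m \<le> ennreal (V * C)" for m
  proof -
    have "level_mass f m \<le> (\<integral>\<^sup>+s. ennreal V * indicator {0<..<C} s \<partial>lborel)"
      unfolding level_mass_def
    proof (rule nn_integral_mono)
      fix s show "indicator {0<..} s * min m (dfun f s) \<le> ennreal V * indicator {0<..<C} s"
      proof (cases "0 < s \<and> s < C")
        case True
        then have "dfun f s \<le> ennreal V" using C(4) dfun_le_mbar[OF f] order_trans by blast
        then show ?thesis using True by (auto intro: order_trans[OF min.cobounded2])
      qed (use C(2)[of s] in \<open>auto simp: not_less\<close>)
    qed
    also have "\<dots> = ennreal (V * C)" using C by (simp add: nn_integral_cmult ennreal_mult)
    finally show ?thesis .
  qed
  then show ?thesis using that C by (meson mult_nonneg_nonneg)
qed

lemma nn_integral_inverse_square: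
  assumes "0 < (a::real)"
  shows "(\<integral>\<^sup>+t. ennreal (1 / t^2) * indicator {a<..} t \<partial>lborel) = ennreal (1 / a)"
proof -
  have "(\<integral>\<^sup>+t. ennreal (t powr (-2)) * indicator {a..} t \<partial>lborel) = ennreal (1 / a)"
    using nn_integral_has_integral_lebesgue'[OF _ has_integral_powr_to_inf[of "-2" a]] assms
    by (simp add: powr_minus_divide)
  moreover have "(\<integral>\<^sup>+t. ennreal (t powr (-2)) * indicator {a..} t \<partial>lborel) = (\<integral>\<^sup>+t. ennreal (1 / t^2) * indicator {a<..} t \<partial>lborel)"
  proof (rule nn_integral_cong_AE)
    show "AE t in lborel. ennreal (t powr (-2)) * indicator {a..} t = ennreal (1 / t^2) * indicator {a<..} t"
      using AE_lborel_singleton[of a] by eventually_elim (use assms in \<open>auto simp: indicator_def powr_minus_divide\<close>)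
  qed
  ultimately show ?thesis by simp
qed

text \<open>By Fubini, the value of the rearrangement at r is counted for t > max T r, where the
  tail of 1 / t^2 has integral 1 / max T r.\<close>

lemma tail_integral_level_mass:
  assumes T: "0 < T" and \<epsilon>: "0 \<le> \<epsilon>"
  shows "(\<integral>\<^sup>+t. (level_mass f (ennreal t) + ennreal \<epsilon>) * ennreal (1 / t^2) * indicator {T<..} t \<partial>lborel) = Phi f T + ennreal (\<epsilon> / T)"
proof -
  have "(\<integral>\<^sup>+t. (level_mass f (ennreal t) + ennreal \<epsilon>) * ennreal (1 / t^2) * indicator {T<..} t \<partial>lborel)
    = (\<integral>\<^sup>+t. level_mass f (ennreal t) * (ennreal (1 / t^2) * indicator {T<..} t) + ennreal \<epsilon> * (ennreal (1 / t^2) * indicator {T<..} t) \<partial>lborel)"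
    by (intro nn_integral_cong) (simp add: distrib_right mult.assoc)
  also have "\<dots> = (\<integral>\<^sup>+t. level_mass f (ennreal t) * (ennreal (1 / t^2) * indicator {T<..} t) \<partial>lborel) + (\<integral>\<^sup>+t. ennreal \<epsilon> * (ennreal (1 / t^2) * indicator {T<..} t) \<partial>lborel)"
    by (rule nn_integral_add) measurable
  also have "(\<integral>\<^sup>+t. ennreal \<epsilon> * (ennreal (1 / t^2) * indicator {T<..} t) \<partial>lborel) = ennreal \<epsilon> * ennreal (1 / T)"
    by (subst nn_integral_cmult, measurable, subst nn_integral_inverse_square[OF T], rule refl)
  also have "ennreal \<epsilon> * ennreal (1 / T) = ennreal (\<epsilon> / T)" using ennreal_mult'[OF \<epsilon>, of "1 / T"] by simp
  also have "(\<integral>\<^sup>+t. level_mass f (ennreal t) * (ennreal (1 / t^2) * indicator {T<..} t) \<partial>lborel)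
    = (\<integral>\<^sup>+t. (\<integral>\<^sup>+r. ennreal (rearr f r) * (if 0 < r \<and> r < t then 1 else 0) * (ennreal (1 / t^2) * indicator {T<..} t) \<partial>lborel) \<partial>lborel)"
  proof (rule nn_integral_cong)
    fix t :: real
    have "(\<integral>\<^sup>+r. ennreal (rearr f r) * (if 0 < r \<and> r < t then 1 else 0) * (ennreal (1 / t^2) * indicator {T<..} t) \<partial>lborel)
      = (\<integral>\<^sup>+r. ennreal (rearr f r) * indicator {0<..<t} r * (ennreal (1 / t^2) * indicator {T<..} t) \<partial>lborel)"
      by (intro nn_integral_cong) (auto simp: indicator_def)
    then show "level_mass f (ennreal t) * (ennreal (1 / t^2) * indicator {T<..} t) =
      (\<integral>\<^sup>+r. ennreal (rearr f r) * (if 0 < r \<and> r < t then 1 else 0) * (ennreal (1 / t^2) * indicator {T<..} t) \<partial>lborel)"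
      by (simp add: level_mass_eq_rearr nn_integral_multc)
  qed
  also have "\<dots> = (\<integral>\<^sup>+r. (\<integral>\<^sup>+t. ennreal (rearr f r) * (if 0 < r \<and> r < t then 1 else 0) * (ennreal (1 / t^2) * indicator {T<..} t) \<partial>lborel) \<partial>lborel)"
    by (rule lborel_pair.Fubini') measurable
  also have "\<dots> = Phi f T" unfolding Phi_def
  proof (rule nn_integral_cong)
    fix r :: real
    have "(\<integral>\<^sup>+t. ennreal (rearr f r) * (if 0 < r \<and> r < t then 1 else 0) * (ennreal (1 / t^2) * indicator {T<..} t) \<partial>lborel)
      = (\<integral>\<^sup>+t. ennreal (rearr f r) * indicator {0<..} r * (ennreal (1 / t^2) * indicator {max T r<..} t) \<partial>lborel)"
      by (intro nn_integral_cong) (auto simp: indicator_def)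
    also have "\<dots> = ennreal (rearr f r) * indicator {0<..} r * ennreal (1 / max T r)"
      by (subst nn_integral_cmult, measurable, subst nn_integral_inverse_square) (use T in auto)
    also have "\<dots> = ennreal (rearr f r / max T r) * indicator {0<..} r"
      using ennreal_mult'[OF bsupp_rearr_nonneg[OF f], of r "1 / max T r"] by (simp add: mult_ac)
    finally show "(\<integral>\<^sup>+t. ennreal (rearr f r) * (if 0 < r \<and> r < t then 1 else 0) * (ennreal (1 / t^2) * indicator {T<..} t) \<partial>lborel)
      = ennreal (rearr f r / max T r) * indicator {0<..} r" .
  qed
  finally show ?thesis .
qed

lemma Phi_antimono: assumes "0 < s" "s \<le> t" shows "Phi f t \<le> Phi f s"
  unfolding Phi_def
  by (intro nn_integral_mono mult_right_mono ennreal_leI divide_left_mono)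
    (use assms bsupp_rearr_nonneg[OF f] in \<open>auto simp: max_def\<close>)

lemma Phi_fin: assumes "0 < t" shows "Phi f t < \<infinity>"
proof (rule level_mass_fin)
  fix B assume B: "0 \<le> B" "\<And>m. level_mass f m \<le> ennreal B"
  have "Phi f t \<le> (\<integral>\<^sup>+r. ennreal (1 / t) * (ennreal (rearr f r) * indicator {0<..} r) \<partial>lborel)"
    unfolding Phi_def
  proof (rule nn_integral_mono)
    fix r :: real
    have "rearr f r / max t r \<le> rearr f r / t"
      using assms bsupp_rearr_nonneg[OF f] by (intro divide_left_mono) (auto simp: max_def)
    then have "ennreal (rearr f r / max t r) \<le> ennreal (1 / t * rearr f r)" by (intro ennreal_leI) simp
    also have "\<dots> = ennreal (1 / t) * ennreal (rearr f r)" by (rule ennreal_mult') (use assms in auto)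
    finally show "ennreal (rearr f r / max t r) * indicator {0<..} r \<le> ennreal (1 / t) * (ennreal (rearr f r) * indicator {0<..} r)"
      by (simp add: mult.assoc[symmetric] mult_right_mono)
  qed
  also have "\<dots> = ennreal (1 / t) * (\<integral>\<^sup>+r. ennreal (rearr f r) * indicator {0<..} r \<partial>lborel)"
    by (rule nn_integral_cmult) measurable
  also have "(\<integral>\<^sup>+r. ennreal (rearr f r) * indicator {0<..} r \<partial>lborel) = level_mass f top"
  proof -
    have "(\<integral>\<^sup>+r. ennreal (rearr f r) * indicator {0<..} r \<partial>lborel)
      = (\<integral>\<^sup>+r. (\<integral>\<^sup>+s. indicator {0<..} s * indicator {r. ennreal r < dfun f s} r * indicator {0<..} r \<partial>lborel) \<partial>lborel)"
      by (simp add: rearr_eq_nn_integral nn_integral_multc)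
    also have "\<dots> = (\<integral>\<^sup>+s. (\<integral>\<^sup>+r. indicator {0<..} s * indicator {r. ennreal r < dfun f s} r * indicator {0<..} r \<partial>lborel) \<partial>lborel)"
      by (rule lborel_pair.Fubini') measurable
    also have "\<dots> = level_mass f top" unfolding level_mass_def
    proof (rule nn_integral_cong)
      fix s :: real
      have "(\<integral>\<^sup>+r. indicator {0<..} s * indicator {r. ennreal r < dfun f s} r * indicator {0<..} r \<partial>lborel)
        = (\<integral>\<^sup>+r. indicator {0<..} s * indicator {r. 0 < r \<and> ennreal r < dfun f s} r \<partial>lborel)"
        by (intro nn_integral_cong) (auto simp: indicator_def)
      also have "\<dots> = indicator {0<..} s * dfun f s"
        by (subst nn_integral_cmult) (auto simp: nn_integral_less_ennreal)
      finally show "(\<integral>\<^sup>+r. indicator {0<..} s * indicator {r. ennreal r < dfun f s} r * indicator {0<..} r \<partial>lborel)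
        = indicator {0<..} s * min top (dfun f s)" by simp
    qed
    finally show ?thesis .
  qed
  also have "ennreal (1 / t) * level_mass f top < \<infinity>" using B(2)[of top] by (simp add: ennreal_mult_less_top less_top le_less_trans)
  finally show ?thesis .
qed

end

text \<open>Points with 0 < |u| < s0 have rank at least T. With respect to the measure restricted to
  |u| < s0, their rank drops by exactly T, so Hardy-Littlewood with the shifted weight, tested on
  the whole space, yields the tail of H.\<close>

lemma level_integral_above:
  fixes u :: "real^'n \<Rightarrow> real" and H :: "real \<Rightarrow> ennreal"
  assumes u: "bsupp u" and [measurable]: "H \<in> borel_measurable borel"
    and H: "\<And>s t. 0 < s \<Longrightarrow> s \<le> t \<Longrightarrow> H t \<le> H s" and s0: "0 < s0" and T: "T = enn2real (mbar u s0)" "0 < T"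
  shows "(\<integral>\<^sup>+x. H (enn2real (mbar u \<bar>u x\<bar>)) * indicator {x. 0 < \<bar>u x\<bar> \<and> \<bar>u x\<bar> < s0} x \<partial>hvol)
    \<le> (\<integral>\<^sup>+t. H t * indicator {T<..} t \<partial>lborel)"
proof -
  note [measurable] = bsupp_measurable[OF u]
  define A where "A = {x. \<bar>u x\<bar> < s0}"
  have [measurable]: "A \<in> sets borel" unfolding A_def by measurable
  define M where "M = density hvol (indicator A)"
  have [measurable_cong, simp]: "sets M = sets borel" and [simp]: "space M = UNIV" by (auto simp: M_def)
  have sf: "sigma_finite_measure M" unfolding M_def
    by (subst hvol.sigma_finite_iff_density_finite) (auto simp: indicator_def)
  define mb where "mb s = emeasure M {x. s \<le> \<bar>u x\<bar>}" for s
  have mb: "mb s + mbar u s0 = mbar u s" if "s \<le> s0" for s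
  proof -
    have "mb s = emeasure hvol ({x. s \<le> \<bar>u x\<bar>} \<inter> A)"
    proof -
      have "mb s = (\<integral>\<^sup>+x. indicator A x * indicator {x. s \<le> \<bar>u x\<bar>} x \<partial>hvol)"
        unfolding mb_def M_def by (rule emeasure_density) measurable
      also have "\<dots> = (\<integral>\<^sup>+x. indicator ({x. s \<le> \<bar>u x\<bar>} \<inter> A) x \<partial>hvol)" by (intro nn_integral_cong) (auto simp: indicator_def)
      also have "\<dots> = emeasure hvol ({x. s \<le> \<bar>u x\<bar>} \<inter> A)" by (rule nn_integral_indicator) measurable
      finally show ?thesis .
    qed
    moreover have "emeasure hvol ({x. s \<le> \<bar>u x\<bar>} \<inter> A) + emeasure hvol {x. s0 \<le> \<bar>u x\<bar>}
      = emeasure hvol (({x. s \<le> \<bar>u x\<bar>} \<inter> A) \<union> {x. s0 \<le> \<bar>u x\<bar>})"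
      by (rule plus_emeasure) (auto simp: A_def)
    moreover have "({x. s \<le> \<bar>u x\<bar>} \<inter> A) \<union> {x. s0 \<le> \<bar>u x\<bar>} = {x. s \<le> \<bar>u x\<bar>}" using that by (auto simp: A_def)
    ultimately show ?thesis by (simp add: mbar_def)
  qed
  have mbf: "mb s < \<infinity>" if "0 < s" for s
  proof (cases "s \<le> s0")
    case True
    then have "mb s \<le> mbar u s" using mb[OF True] by (metis le_iff_add)
    then show ?thesis using mbar_fin[OF u that] by simp
  next
    case False
    have "mb s \<le> mb s0" unfolding mb_def by (rule emeasure_mono) (use False in auto)
    also have "mb s0 \<le> mbar u s0" using mb[of s0] by (metis le_iff_add order_refl)
    finally show ?thesis using mbar_fin[OF u s0] by simp
  qed
  have "(\<integral>\<^sup>+x. (if 0 < \<bar>u x\<bar> then (\<lambda>t. H (t + T)) (enn2real (mb \<bar>u x\<bar>)) else 0) * indicator UNIV x \<partial>M) \<le> Wint (\<lambda>t. H (t + T)) (emeasure M UNIV)"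
    by (rule Hardy_Littlewood_level[OF sf]) (use T H mbf in \<open>auto simp: mb_def\<close>)
  also have "\<dots> \<le> (\<integral>\<^sup>+t. H (T + 1 * t) * indicator {T<..} (T + 1 * t) \<partial>lborel)"
    unfolding Wint_def by (intro nn_integral_mono) (auto simp: indicator_def add.commute)
  also have "\<dots> = (\<integral>\<^sup>+t. H t * indicator {T<..} t \<partial>lborel)"
    using nn_integral_real_affine[of "\<lambda>t. H t * indicator {T<..} t" 1 T] by simp
  also have "(\<integral>\<^sup>+x. (if 0 < \<bar>u x\<bar> then (\<lambda>t. H (t + T)) (enn2real (mb \<bar>u x\<bar>)) else 0) * indicator UNIV x \<partial>M)
    = (\<integral>\<^sup>+x. H (enn2real (mbar u \<bar>u x\<bar>)) * indicator {x. 0 < \<bar>u x\<bar> \<and> \<bar>u x\<bar> < s0} x \<partial>hvol)"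
  proof -
    have [measurable]: "mb \<in> borel_measurable borel"
    proof -
      interpret M: sigma_finite_measure M by (rule sf)
      have "mb = (\<lambda>s. \<integral>\<^sup>+x. indicator {x. s \<le> \<bar>u x\<bar>} x \<partial>M)" unfolding mb_def[abs_def] by (subst nn_integral_indicator) auto
      then show ?thesis by simp
    qed
    have "(\<integral>\<^sup>+x. (if 0 < \<bar>u x\<bar> then H (enn2real (mb \<bar>u x\<bar>) + T) else 0) \<partial>M) =
      (\<integral>\<^sup>+x. indicator A x * (if 0 < \<bar>u x\<bar> then H (enn2real (mb \<bar>u x\<bar>) + T) else 0) \<partial>hvol)"
      unfolding M_def by (rule nn_integral_density) measurable
    also have "\<dots> = (\<integral>\<^sup>+x. H (enn2real (mbar u \<bar>u x\<bar>)) * indicator {x. 0 < \<bar>u x\<bar> \<and> \<bar>u x\<bar> < s0} x \<partial>hvol)"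
    proof (rule nn_integral_cong)
      fix x
      show "indicator A x * (if 0 < \<bar>u x\<bar> then H (enn2real (mb \<bar>u x\<bar>) + T) else 0) = H (enn2real (mbar u \<bar>u x\<bar>)) * indicator {x. 0 < \<bar>u x\<bar> \<and> \<bar>u x\<bar> < s0} x"
      proof (cases "0 < \<bar>u x\<bar> \<and> \<bar>u x\<bar> < s0")
        case True
        have "enn2real (mbar u \<bar>u x\<bar>) = enn2real (mb \<bar>u x\<bar>) + T"
          using mb[of "\<bar>u x\<bar>"] True mbf[of "\<bar>u x\<bar>"] mbar_fin[OF u s0] unfolding T
          by (metis enn2real_plus infinity_ennreal_def less_imp_le)
        then show ?thesis using True by (simp add: A_def)
      qed (auto simp: A_def)
    qed
    finally show ?thesis by simp
  qed
  finally show ?thesis .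
qed

lemma Young_square:
  fixes N g D M :: real
  assumes "0 < D" "0 < M"
  shows "2 * N / M * g \<le> N^2 / D * g^2 + D / M^2"
proof -
  have "0 \<le> (N * g * M - D)^2 / (D * M^2)" using assms by auto
  also have "\<dots> = N^2 / D * g^2 + D / M^2 - 2 * N / M * g"
    using assms by (simp add: field_simps power2_eq_square)
  finally show ?thesis by simp
qed

text \<open>With \<open>M s = V{\<bar>u\<bar> \<ge> s}\<close> and \<open>D s = \<integral>\<^bsub>0\<^esub>\<^bsup>M s\<^esup> f\<^sup>*\<close>, \<open>f = \<Delta>u\<close>, weight the isoperimetric inequality by \<open>2N / M\<close> and use
  \<open>2N g / M \<le> N\<^sup>2 g\<^sup>2 / D + D / M\<^sup>2\<close> for \<open>g = \<bar>\<nabla>u\<bar>\<close>. By Green's identity the first term costs at most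
  \<open>N\<^sup>2 s0\<close>, half of the left-hand side, while the integral of \<open>D / M\<^sup>2\<close> is bounded by \<open>Phi\<close>. The additional
  \<open>\<epsilon>\<close> in \<open>D\<close> only serves to avoid division by 0.\<close>
lemma Laplacian_pointwise:
  fixes u :: "real^'n \<Rightarrow> real"
  assumes u: "u \<in> C0inf" and n: "CARD('n) \<ge> 2" and s0: "0 < s0" and T: "T = enn2real (mbar u s0)" "0 < T"
  defines "N \<equiv> real CARD('n) - 1"
  shows "ennreal (N^2 * s0) + ennreal (2 * N) * (\<integral>\<^sup>+s. ennreal (1 / enn2real (mbar u s)) * indicator {0<..<s0} s * wdfun hdelta u s \<partial>lborel)
    \<le> Phi (hlap u) T"
proof (rule ennreal_le_epsilon)
  fix e :: real assume e: "0 < e"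
  \<comment> \<open>The regularization costs \<epsilon> / T in the tail integral, which is then
    exactly e.\<close>
  define \<epsilon> where "\<epsilon> = e * T"
  have \<epsilon>: "0 < \<epsilon>" using e T by (simp add: \<epsilon>_def)
  have N: "N > 0" using n by (simp add: N_def)
  define f where "f = hlap u"
  note bu = bsupp_C0inf[OF u] and bf = bsupp_C0inf[OF C0inf_hlap[OF u], folded f_def]
  note [measurable] = C0inf_measurable[OF u] bsupp_measurable[OF bf]
  obtain B where B: "0 \<le> B" "\<And>m. level_mass f m \<le> ennreal B" using level_mass_fin[OF bf] by blast
  define M where "M s = enn2real (mbar u s)" for s
  have Mpos: "T \<le> M s" "mbar u s = ennreal (M s)" if "0 < s" "s \<le> s0" for s
  proof -
    have fin: "mbar u s < \<infinity>" by (rule mbar_fin[OF bu that(1)])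
    then show "mbar u s = ennreal (M s)" by (simp add: M_def)
    show "T \<le> M s" unfolding T M_def using fin mbar_antimono[OF bu that(2)] by (intro enn2real_mono) auto
  qed
  define D where "D s = enn2real (level_mass f (mbar u s)) + \<epsilon>" for s
  have D: "0 < D s" for s using \<epsilon> by (simp add: D_def add_nonneg_pos)
  have [measurable]: "M \<in> borel_measurable borel" "D \<in> borel_measurable borel" unfolding M_def D_def by measurable
  have FD: "ennreal (D s) = level_mass f (mbar u s) + ennreal \<epsilon>" for s
  proof -
    have "level_mass f (mbar u s) < top" using B(2)[of "mbar u s"] by (simp add: le_less_trans)
    then show ?thesis unfolding D_def using \<epsilon> by (simp add: ennreal_plus)
  qed
  define g1 where "g1 s = ennreal (2 * N / M s) * indicator {..<s0} s" for s
  define g2 where "g2 s = ennreal (N^2 / D s) * indicator {..<s0} s" for s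
  have [measurable]: "g1 \<in> borel_measurable borel" "g2 \<in> borel_measurable borel" unfolding g1_def g2_def by measurable
  define R where "R = (\<integral>\<^sup>+s. ennreal (1 / M s) * indicator {0<..<s0} s * wdfun hdelta u s \<partial>lborel)"
  define gn where "gn x = gnorm x (hgrad u x)" for x
  have gn0: "0 \<le> gn x" for x by (simp add: gn_def gnorm_hgrad)
  have [measurable]: "gn \<in> borel_measurable borel" unfolding gn_def by measurable
  have lhs: "(\<integral>\<^sup>+s. g1 s * indicator {0<..} s * wdfun (\<lambda>x. N + hdelta x) u s \<partial>lborel) = ennreal (2 * (N^2 * s0)) + ennreal (2 * N) * R"
  proof -
    have "(\<integral>\<^sup>+s. g1 s * indicator {0<..} s * wdfun (\<lambda>x. N + hdelta x) u s \<partial>lborel)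
      = (\<integral>\<^sup>+s. ennreal (2 * N^2) * indicator {0<..<s0} s + ennreal (2 * N) * (ennreal (1 / M s) * indicator {0<..<s0} s * wdfun hdelta u s) \<partial>lborel)"
    proof (rule nn_integral_cong_AE)
      show "AE s in lborel. g1 s * indicator {0<..} s * wdfun (\<lambda>x. N + hdelta x) u s
        = ennreal (2 * N^2) * indicator {0<..<s0} s + ennreal (2 * N) * (ennreal (1 / M s) * indicator {0<..<s0} s * wdfun hdelta u s)"
        using AE_mbar_eq_dfun[OF C0inf_measurable(1)[OF u]]
      proof eventually_elim
        case (elim s)
        show ?case
        proof (cases "0 < s \<and> s < s0")
          case True
          then have Ms: "T \<le> M s" "dfun u s = ennreal (M s)" using Mpos[of s] elim by auto
          then have M0: "0 < M s" using T by simp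
          have k: "wdfun (\<lambda>x. N + hdelta x) u s = ennreal N * ennreal (M s) + wdfun hdelta u s"
            using N hdelta_bounds(1) Ms by (subst wdfun_add) auto
          have "ennreal (2 * N / M s) * (ennreal N * ennreal (M s)) = ennreal (2 * N^2)"
            using M0 N by (simp add: ennreal_mult'[symmetric] power2_eq_square)
          moreover have "ennreal (2 * N / M s) = ennreal (2 * N) * ennreal (1 / M s)"
            using ennreal_mult'[of "2 * N" "1 / M s"] N by simp
          ultimately show ?thesis using True unfolding k by (simp add: g1_def distrib_left mult.assoc)
        qed (auto simp: g1_def indicator_def)
      qed
    qed
    also have "\<dots> = (\<integral>\<^sup>+s. ennreal (2 * N^2) * indicator {0<..<s0} s \<partial>lborel) + ennreal (2 * N) * R"
      unfolding R_def by (subst nn_integral_add) (auto simp: nn_integral_cmult)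
    also have "(\<integral>\<^sup>+s. ennreal (2 * N^2) * indicator {0<..<s0} s \<partial>lborel) = ennreal (2 * (N^2 * s0))"
      using s0 by (simp add: nn_integral_cmult ennreal_mult'[symmetric] mult.assoc)
    finally show ?thesis .
  qed
  define H where "H t = (level_mass f (ennreal t) + ennreal \<epsilon>) * ennreal (1 / t^2)" for t
  have [measurable]: "H \<in> borel_measurable borel" unfolding H_def by measurable
  \<comment> \<open>H t is 1 / t times the sum of \<epsilon> / t and an average of the rearrangement
    over (0, t), a product of decreasing factors.\<close>
  have Hanti: "H t \<le> H s" if st: "0 < s" "s \<le> t" for s t
  proof -
    have i: "ennreal (1 / r^2) = ennreal (1 / r) * ennreal (1 / r)" if "0 < r" for r :: real
      using that ennreal_mult'[of "1 / r" "1 / r"] by (simp add: power2_eq_square)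
    have a: "ennreal (1 / t) \<le> ennreal (1 / s)" using st by (intro ennreal_leI) (simp add: frac_le)
    have "level_mass f (ennreal t) * ennreal (1 / t^2) \<le> level_mass f (ennreal s) * ennreal (1 / s^2)"
      using mult_mono[OF level_mass_div_antimono[OF bsupp_measurable[OF bf] st] a] st by (simp add: i mult.assoc)
    moreover have "ennreal \<epsilon> * ennreal (1 / t^2) \<le> ennreal \<epsilon> * ennreal (1 / s^2)"
      using mult_mono[OF a a] st by (intro mult_left_mono) (simp_all add: i)
    ultimately show ?thesis unfolding H_def distrib_right by (rule add_mono)
  qed
  have "ennreal (2 * (N^2 * s0)) + ennreal (2 * N) * R
    \<le> (\<integral>\<^sup>+x. g1 \<bar>u x\<bar> * indicator {0<..} \<bar>u x\<bar> * ennreal (gn x) \<partial>hvol)"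
  proof -
    have "(\<integral>\<^sup>+s. g1 s * indicator {0<..} s * wdfun (\<lambda>x. N + hdelta x) u s \<partial>lborel)
      \<le> (\<integral>\<^sup>+x. g1 \<bar>u x\<bar> * indicator {0<..} \<bar>u x\<bar> * ennreal (gn x) \<partial>hvol)"
      unfolding gn_def N_def by (rule weighted_isoperimetric[OF u]) measurable
    then show ?thesis unfolding lhs .
  qed
  also have "\<dots> \<le> (\<integral>\<^sup>+x. g2 \<bar>u x\<bar> * indicator {0<..} \<bar>u x\<bar> * ennreal ((gn x)^2)
     + H (enn2real (mbar u \<bar>u x\<bar>)) * indicator {x. 0 < \<bar>u x\<bar> \<and> \<bar>u x\<bar> < s0} x \<partial>hvol)"
  proof (rule nn_integral_mono)
    fix x
    let ?s = "\<bar>u x\<bar>"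
    show "g1 ?s * indicator {0<..} ?s * ennreal (gn x) \<le> g2 ?s * indicator {0<..} ?s * ennreal ((gn x)^2)
     + H (enn2real (mbar u ?s)) * indicator {x. 0 < \<bar>u x\<bar> \<and> \<bar>u x\<bar> < s0} x"
    proof (cases "0 < ?s \<and> ?s < s0")
      case True
      then have Ms: "T \<le> M ?s" "mbar u ?s = ennreal (M ?s)" using Mpos[of ?s] by auto
      then have M0: "0 < M ?s" using T by simp
      have Hs: "H (enn2real (mbar u ?s)) = ennreal (D ?s / (M ?s)^2)"
      proof -
        have "H (enn2real (mbar u ?s)) = ennreal (D ?s) * ennreal (1 / (M ?s)^2)"
          unfolding H_def FD using Ms(2) by (simp add: M_def)
        then show ?thesis using ennreal_mult'[of "D ?s" "1 / (M ?s)^2"] D[of ?s] by simp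
      qed
      have "ennreal (2 * N / M ?s) * ennreal (gn x) = ennreal (2 * N / M ?s * gn x)"
        using M0 N by (intro ennreal_mult'[symmetric]) auto
      also have "\<dots> \<le> ennreal (N^2 / D ?s * (gn x)^2 + D ?s / (M ?s)^2)"
        by (intro ennreal_leI Young_square D M0)
      also have "\<dots> = ennreal (N^2 / D ?s * (gn x)^2) + ennreal (D ?s / (M ?s)^2)"
        using D[of ?s] M0 by (intro ennreal_plus) auto
      also have "ennreal (N^2 / D ?s * (gn x)^2) = ennreal (N^2 / D ?s) * ennreal ((gn x)^2)"
        using D[of ?s] by (intro ennreal_mult') auto
      finally show ?thesis using True by (simp add: g1_def g2_def Hs)
    qed (auto simp: g1_def indicator_def)
  qed
  also have "\<dots> = (\<integral>\<^sup>+x. g2 \<bar>u x\<bar> * indicator {0<..} \<bar>u x\<bar> * ennreal ((gn x)^2) \<partial>hvol)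
     + (\<integral>\<^sup>+x. H (enn2real (mbar u \<bar>u x\<bar>)) * indicator {x. 0 < \<bar>u x\<bar> \<and> \<bar>u x\<bar> < s0} x \<partial>hvol)"
    by (rule nn_integral_add) measurable
  also have "\<dots> \<le> ennreal (N^2 * s0) + (Phi f T + ennreal (\<epsilon> / T))"
  proof (rule add_mono)
    have "(\<integral>\<^sup>+x. g2 \<bar>u x\<bar> * indicator {0<..} \<bar>u x\<bar> * ennreal ((gn x)^2) \<partial>hvol)
      \<le> (\<integral>\<^sup>+s. g2 s * indicator {0<..} s * wdfun (\<lambda>x. \<bar>f x\<bar>) u s \<partial>lborel)"
      unfolding gn_def f_def by (rule weighted_Green[OF u]) measurable
    also have "\<dots> \<le> (\<integral>\<^sup>+s. ennreal (N^2) * indicator {0<..<s0} s \<partial>lborel)"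
    proof (rule nn_integral_mono)
      fix s :: real
      show "g2 s * indicator {0<..} s * wdfun (\<lambda>x. \<bar>f x\<bar>) u s \<le> ennreal (N^2) * indicator {0<..<s0} s"
      proof (cases "0 < s \<and> s < s0")
        case True
        have "wdfun (\<lambda>x. \<bar>f x\<bar>) u s \<le> level_mass f (dfun u s)" by (rule wdfun_le_level_mass) measurable
        also have "\<dots> \<le> level_mass f (mbar u s)" by (intro level_mass_mono dfun_le_mbar[OF bu])
        also have "\<dots> \<le> ennreal (D s)" unfolding FD by simp
        finally have "ennreal (N^2 / D s) * wdfun (\<lambda>x. \<bar>f x\<bar>) u s \<le> ennreal (N^2 / D s) * ennreal (D s)"
          by (intro mult_left_mono) auto
        also have "\<dots> = ennreal (N^2)" using D[of s] by (simp add: ennreal_mult'[symmetric])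
        finally show ?thesis using True by (simp add: g2_def)
      qed (auto simp: g2_def indicator_def)
    qed
    also have "\<dots> = ennreal (N^2 * s0)" using s0 by (simp add: nn_integral_cmult ennreal_mult'[symmetric])
    finally show "(\<integral>\<^sup>+x. g2 \<bar>u x\<bar> * indicator {0<..} \<bar>u x\<bar> * ennreal ((gn x)^2) \<partial>hvol) \<le> ennreal (N^2 * s0)" .
    have "(\<integral>\<^sup>+x. H (enn2real (mbar u \<bar>u x\<bar>)) * indicator {x. 0 < \<bar>u x\<bar> \<and> \<bar>u x\<bar> < s0} x \<partial>hvol)
      \<le> (\<integral>\<^sup>+t. H t * indicator {T<..} t \<partial>lborel)"
      by (rule level_integral_above[OF bu _ Hanti s0 T]) measurable
    also have "\<dots> = Phi f T + ennreal (\<epsilon> / T)"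
      unfolding H_def by (rule tail_integral_level_mass[OF bf T(2)]) (use \<epsilon> in simp)
    finally show "(\<integral>\<^sup>+x. H (enn2real (mbar u \<bar>u x\<bar>)) * indicator {x. 0 < \<bar>u x\<bar> \<and> \<bar>u x\<bar> < s0} x \<partial>hvol)
      \<le> Phi f T + ennreal (\<epsilon> / T)" .
  qed
  finally have "ennreal (2 * (N^2 * s0)) + ennreal (2 * N) * R \<le> ennreal (N^2 * s0) + (Phi f T + ennreal (\<epsilon> / T))" .
  moreover have "ennreal (2 * (N^2 * s0)) = ennreal (N^2 * s0) + ennreal (N^2 * s0)"
    using s0 by (simp add: ennreal_plus[symmetric] del: ennreal_plus)
  moreover have "\<epsilon> / T = e" using T by (simp add: \<epsilon>_def)
  ultimately have "ennreal (N^2 * s0) + ennreal (2 * N) * R \<le> Phi f T + ennreal e"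
    by (simp add: add.assoc ennreal_add_left_cancel_le)
  then show "ennreal (N^2 * s0) + ennreal (2 * N) * (\<integral>\<^sup>+s. ennreal (1 / enn2real (mbar u s)) * indicator {0<..<s0} s * wdfun hdelta u s \<partial>lborel)
    \<le> Phi (hlap u) T + ennreal e" by (simp add: R_def M_def f_def)
qed

text \<open>The pointwise bound by \<open>Phi\<close> is integrated with Hardy's inequality. On
  volumes t with rearr u t > \<sigma> the surplus adds b, and superadditivity of the power q turns
  this into a separate term. With b = 0 the plain inequality remains.\<close>

lemma Laplacian_Lorentz:
  fixes u :: "real^'n \<Rightarrow> real"
  assumes u: "u \<in> C0inf" and n: "CARD('n) \<ge> 2" and p: "1 < p" "1 < q" and b: "0 \<le> b" "0 \<le> \<sigma>"
  defines "N \<equiv> real CARD('n) - 1"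
  assumes gap: "\<And>s0. \<sigma> < s0 \<Longrightarrow> 0 < dfun u s0 \<Longrightarrow> ennreal b \<le>
      ennreal (2 * N) * (\<integral>\<^sup>+s. ennreal (1 / enn2real (mbar u s)) * indicator {0<..<s0} s * wdfun hdelta u s \<partial>lborel)"
  shows "ennreal ((N^2) powr q) * lor p q u + ennreal (b powr q) * Wint (lorw p q) (dfun u \<sigma>)
    \<le> ennreal ((p * (p / (p - 1))) powr q) * lor p q (hlap u)"
proof -
  define f where "f = hlap u"
  note bu = bsupp_C0inf[OF u] and bf = bsupp_C0inf[OF C0inf_hlap[OF u], folded f_def]
  note [measurable] = bsupp_measurable[OF bu] bsupp_measurable[OF bf] borel_measurable_rearr[OF bu] borel_measurable_rearr[OF bf]
  define P where "P t = enn2real (Phi f t)" for t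
  have P: "ennreal (P t) = Phi f t" if "0 < t" for t using Phi_fin[OF bf that] by (simp add: P_def)
  have P0: "0 \<le> P t" for t by (simp add: P_def)
  \<comment> \<open>If s0 < rearr u t, the volume T at level s0 exceeds t; as \<open>Phi\<close>
    decreases, the bound at T passes to t.\<close>
  have step: "N^2 * s0 + (if \<sigma> < s0 then b else 0) \<le> P t" if t: "0 < t" and s0: "0 < s0" "s0 < rearr u t" for t s0
  proof -
    have d: "ennreal t < dfun u s0" using bsupp_rearr_iff[OF bu, of s0 t] s0 by simp
    define T where "T = enn2real (mbar u s0)"
    have "ennreal t < mbar u s0" using d dfun_le_mbar[OF bu] less_le_trans by blast
    then have tT: "t < T" unfolding T_def using mbar_fin[OF bu s0(1)] t
      by (cases "mbar u s0") (auto simp: ennreal_less_iff)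
    have "ennreal (N^2 * s0 + (if \<sigma> < s0 then b else 0)) = ennreal (N^2 * s0) + ennreal (if \<sigma> < s0 then b else 0)"
      using s0 b by (intro ennreal_plus) auto
    also have "\<dots> \<le> ennreal (N^2 * s0) + ennreal (2 * N) * (\<integral>\<^sup>+s. ennreal (1 / enn2real (mbar u s)) * indicator {0<..<s0} s * wdfun hdelta u s \<partial>lborel)"
    proof (rule add_left_mono)
      have "0 < dfun u s0" using d by (metis gr_zeroI not_less_zero)
      then show "ennreal (if \<sigma> < s0 then b else 0) \<le> ennreal (2 * N) * (\<integral>\<^sup>+s. ennreal (1 / enn2real (mbar u s)) * indicator {0<..<s0} s * wdfun hdelta u s \<partial>lborel)"
        using gap[of s0] by auto
    qed
    also have "\<dots> \<le> Phi f T" unfolding N_def f_def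
      by (rule Laplacian_pointwise[OF u n s0(1) T_def]) (use tT t in simp)
    also have "\<dots> \<le> Phi f t" by (rule Phi_antimono[OF bf t]) (use tT in simp)
    finally show ?thesis using P[OF t] P0 by (metis ennreal_le_iff)
  qed
  have bound: "N^2 * rearr u t + b * indicator {t. ennreal t < dfun u \<sigma>} t \<le> P t" if t: "0 < t" for t
  proof (cases "rearr u t = 0")
    case True
    then have "\<not> ennreal t < dfun u \<sigma>" using bsupp_rearr_iff[OF bu b(2), of t] b by simp
    then show ?thesis using True P0 by simp
  next
    case False
    then have pos: "0 < rearr u t" using bsupp_rearr_nonneg[OF bu, of t] by simp
    define a where "a = (if \<sigma> < rearr u t then \<sigma> else 0)"
    define c where "c = (if \<sigma> < rearr u t then b else 0)"
    \<comment> \<open>The bound is known for levels s0 strictly below rearr u t, and s0 can be taken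
      arbitrarily close to it. Staying above \<open>a\<close> keeps s0 beyond \<sigma> whenever the
      surplus counts.\<close>
    have "N^2 * rearr u t \<le> P t - c"
    proof (rule ccontr)
      assume neg: "\<not> N^2 * rearr u t \<le> P t - c"
      have "N > 0" using n by (simp add: N_def)
      then have N2: "N^2 > 0" by simp
      then have "(P t - c) / N^2 < rearr u t" using neg by (simp add: field_simps)
      then have "max a ((P t - c) / N^2) < rearr u t" using pos by (simp add: a_def)
      then obtain s0 where s0: "max a ((P t - c) / N^2) < s0" "s0 < rearr u t" using dense by blast
      then have "0 < s0" using b by (auto simp: a_def split: if_splits)
      from step[OF t this s0(2)] have "N^2 * s0 + c \<le> P t" using s0 b by (auto simp: a_def c_def split: if_splits)
      moreover have "P t - c < N^2 * s0" using s0(1) N2 by (simp add: field_simps)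
      ultimately show False by simp
    qed
    moreover have "b * indicator {t. ennreal t < dfun u \<sigma>} t = c"
      using bsupp_rearr_iff[OF bu b(2), of t] by (simp add: c_def)
    ultimately show ?thesis by simp
  qed
  have "ennreal ((N^2) powr q) * lor p q u + ennreal (b powr q) * Wint (lorw p q) (dfun u \<sigma>)
    = (\<integral>\<^sup>+t. ennreal ((N^2) powr q) * (lorw p q t * ennreal (rearr u t powr q) * indicator {0<..} t) \<partial>lborel)
      + (\<integral>\<^sup>+t. ennreal (b powr q) * (lorw p q t * indicator {t. 0 < t \<and> ennreal t < dfun u \<sigma>} t) \<partial>lborel)"
    using p unfolding Wint_def by (subst bsupp_lor_rearr[OF bu]) (auto simp: nn_integral_cmult)
  also have "\<dots> = (\<integral>\<^sup>+t. ennreal ((N^2) powr q) * (lorw p q t * ennreal (rearr u t powr q) * indicator {0<..} t)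
      + ennreal (b powr q) * (lorw p q t * indicator {t. 0 < t \<and> ennreal t < dfun u \<sigma>} t) \<partial>lborel)"
    by (rule nn_integral_add[symmetric]) measurable
  also have "\<dots> \<le> (\<integral>\<^sup>+t. lorw p q t * ennreal (P t powr q) * indicator {0<..} t \<partial>lborel)"
  proof (rule nn_integral_mono)
    fix t :: real
    show "ennreal ((N^2) powr q) * (lorw p q t * ennreal (rearr u t powr q) * indicator {0<..} t)
      + ennreal (b powr q) * (lorw p q t * indicator {t. 0 < t \<and> ennreal t < dfun u \<sigma>} t)
      \<le> lorw p q t * ennreal (P t powr q) * indicator {0<..} t"
    proof (cases "0 < t")
      case True
      let ?i = "indicator {t. ennreal t < dfun u \<sigma>} t :: real"
      have r0: "0 \<le> rearr u t" by (rule bsupp_rearr_nonneg[OF bu])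
      have "(N^2 * rearr u t) powr q + (b * ?i) powr q \<le> (N^2 * rearr u t + b * ?i) powr q"
        using r0 b p by (intro powr_superadd) auto
      also have "\<dots> \<le> P t powr q" using bound[OF True] r0 b p by (intro powr_mono2) auto
      finally have "ennreal ((N^2 * rearr u t) powr q + (b * ?i) powr q) \<le> ennreal (P t powr q)" by (rule ennreal_leI)
      moreover have "ennreal ((N^2 * rearr u t) powr q + (b * ?i) powr q) = ennreal ((N^2) powr q) * ennreal (rearr u t powr q) + ennreal (b powr q) * indicator {t. ennreal t < dfun u \<sigma>} t"
        using r0 by (simp add: powr_mult ennreal_mult'[symmetric] indicator_def)
      ultimately have "lorw p q t * (ennreal ((N^2) powr q) * ennreal (rearr u t powr q) + ennreal (b powr q) * indicator {t. ennreal t < dfun u \<sigma>} t) \<le> lorw p q t * ennreal (P t powr q)"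
        by (intro mult_left_mono) auto
      then show ?thesis using True by (simp add: distrib_left mult_ac indicator_def)
    qed simp
  qed
  also have "\<dots> \<le> ennreal ((p * (p / (p - 1))) powr q) * (\<integral>\<^sup>+t. lorw p q t * ennreal (rearr f t powr q) * indicator {0<..} t \<partial>lborel)"
    by (rule Hardy_convolution) (use bsupp_rearr_nonneg[OF bf] p P P0 in \<open>auto simp: Phi_def\<close>)
  also have "\<dots> = ennreal ((p * (p / (p - 1))) powr q) * lor p q f"
    using p by (subst bsupp_lor_rearr[OF bf]) auto
  finally show ?thesis by (simp add: f_def)
qed

section \<open>The inequality for test functions, with a gap\<close>

lemma hdelta_le_1: "hdelta x \<le> 1"
proof -
  have "\<bar>bdef x / (2 - bdef x)\<bar> \<le> 1" using bdef_le_1[of x] by (auto simp: abs_if field_simps)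
  then show ?thesis unfolding hdelta_def by (simp add: abs_square_le_1)
qed

lemma wdfun_antimono:
  assumes "s \<le> s'" shows "wdfun c u s' \<le> wdfun c u s"
  unfolding wdfun_def using assms by (intro nn_integral_mono mult_left_mono) (auto simp: indicator_def)

lemma wdfun_hdelta_le_dfun:
  assumes "u \<in> borel_measurable borel" shows "wdfun hdelta u s \<le> dfun u s"
  unfolding dfun_wdfun[OF assms] wdfun_def by (intro nn_integral_mono mult_right_mono) (auto intro!: ennreal_leI hdelta_le_1)

section \<open>Iterated derivatives and their constants\<close>

lemma hnabla_0: "hnabla 0 u = (\<lambda>x. \<bar>u x\<bar>)" by (auto simp: hnabla_def)
lemma hnabla_1: "hnabla (Suc 0) u = (\<lambda>x. gnorm x (hgrad u x))" by (auto simp: hnabla_def)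
lemma hnabla_Suc_Suc: "hnabla (Suc (Suc m)) u = hnabla m (hlap u)"
  by (auto simp: hnabla_def funpow_swap1)

lemma bsupp_abs: assumes "bsupp u" shows "bsupp (\<lambda>x. \<bar>u x\<bar>)"
  using assms unfolding bsupp_def by auto

lemma bsupp_hnabla: "u \<in> C0inf \<Longrightarrow> bsupp (hnabla m u)"
proof (induction m arbitrary: u rule: induct_nat_012)
  case 0 then show ?case by (simp add: hnabla_0 bsupp_abs bsupp_C0inf)
next
  case 1 then show ?case by (simp add: hnabla_1 bsupp_gnorm)
next
  case (ge2 n) then show ?case by (simp add: hnabla_Suc_Suc C0inf_hlap)
qed

lemma hnabla_nonneg: "0 \<le> hnabla m u x"
  by (simp add: hnabla_def gnorm_hgrad)

lemma egrad_diff: assumes "u \<in> C0inf" "v \<in> C0inf" shows "egrad (\<lambda>x. u x - v x) x = egrad u x - egrad v x"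
proof -
  have "u differentiable (at x)" "v differentiable (at x)"
    using assms by (auto intro: smooth_fn_differentiable C0inf_smooth)
  then show ?thesis by (simp add: egrad_def vec_eq_iff pd_diff)
qed

lemma hnabla_triangle:
  assumes "u \<in> C0inf" "v \<in> C0inf"
  shows "hnabla m u x \<le> hnabla m (\<lambda>x. u x - v x) x + hnabla m v x"
proof (cases "even m")
  case True
  then show ?thesis by (simp add: hnabla_def hlap_funpow_diff assms)
next
  case False
  let ?u = "(hlap ^^ (m div 2)) u" and ?v = "(hlap ^^ (m div 2)) v"
  have e: "egrad (\<lambda>x. ?u x - ?v x) x = egrad ?u x - egrad ?v x"
    by (intro egrad_diff C0inf_hlap_funpow assms)
  have "norm (egrad ?u x) \<le> norm (egrad ?u x - egrad ?v x) + norm (egrad ?v x)"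
    by (metis add.commute norm_triangle_sub)
  then have "\<bar>bdef x\<bar> / 2 * norm (egrad ?u x) \<le> \<bar>bdef x\<bar> / 2 * (norm (egrad ?u x - egrad ?v x) + norm (egrad ?v x))"
    by (intro mult_left_mono) auto
  then show ?thesis using False by (simp add: hnabla_def hlap_funpow_diff assms gnorm_hgrad e algebra_simps)
qed

lemma Cnmp_Suc_Suc: "Cnmp n (Suc (Suc m)) p = (real n - 1)^2 / (p * (p / (p - 1))) * Cnmp n m p"
proof (cases "even m")
  case False
  then have "(Suc (Suc m) - 1) div 2 = Suc ((m - 1) div 2)" by (auto elim!: oddE)
  then show ?thesis using False by (simp add: Cnmp_def Let_def)
qed (simp add: Cnmp_def Let_def)

lemma Cnmp_pos: assumes "2 \<le> n" "1 < p" shows "0 < Cnmp n m p"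
proof -
  have "0 < (real n - 1)^2 / (p * (p / (p - 1)))" "0 < (real n - 1) / p" using assms by auto
  then show ?thesis unfolding Cnmp_def Let_def by (cases "even m") (simp_all only: if_True if_False mult_pos_pos zero_less_power)
qed

lemma Cnmp_powr_Suc_Suc:
  assumes "2 \<le> n" "1 < p"
  shows "ennreal (Cnmp n (Suc (Suc m)) p powr q) = ennreal (Cnmp n m p powr q) * ennreal (((real n - 1)^2 / (p * (p / (p - 1)))) powr q)"
proof -
  define a where "a = (real n - 1)^2 / (p * (p / (p - 1)))"
  have "0 \<le> a" using assms by (simp add: a_def)
  then have "Cnmp n (Suc (Suc m)) p powr q = Cnmp n m p powr q * a powr q"
  proof -
    have "Cnmp n (Suc (Suc m)) p = a * Cnmp n m p" by (simp only: Cnmp_Suc_Suc a_def)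
    then show ?thesis using \<open>0 \<le> a\<close> Cnmp_pos[OF assms, of m] by (simp add: powr_mult)
  qed
  then show ?thesis by (simp only: ennreal_mult'[OF powr_ge_zero] a_def[symmetric])
qed

lemma ennreal_mult_le_cancel_real:
  assumes "0 < c" "ennreal (c * a) * x + ennreal (c * b) * y \<le> ennreal c * z"
  shows "ennreal a * x + ennreal b * y \<le> z"
proof -
  have "ennreal c * (ennreal a * x + ennreal b * y) \<le> ennreal c * z"
    using assms ennreal_mult'[of c a] ennreal_mult'[of c b] by (simp add: distrib_left mult.assoc)
  then show ?thesis using assms(1) by (subst (asm) ennreal_mult_le_mult_iff) auto
qed

context
  fixes p q :: real
  assumes pq: "1 < p" "1 < q"
begin

lemma Laplacian_Lorentz_gap:
  fixes u :: "real^'n \<Rightarrow> real"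
  assumes u: "u \<in> C0inf" and n: "CARD('n) \<ge> 2" and b: "0 \<le> b" "0 \<le> \<sigma>"
    and gap: "\<And>s0. \<sigma> < s0 \<Longrightarrow> 0 < dfun u s0 \<Longrightarrow> ennreal b \<le>
      ennreal (2 * (real CARD('n) - 1)) * (\<integral>\<^sup>+s. ennreal (1 / enn2real (mbar u s)) * indicator {0<..<s0} s * wdfun hdelta u s \<partial>lborel)"
  shows "ennreal (((real CARD('n) - 1)^2 / (p * (p / (p - 1)))) powr q) * lor p q u + ennreal ((b / (p * (p / (p - 1)))) powr q) * Wint (lorw p q) (dfun u \<sigma>)
    \<le> lor p q (hlap u)"
proof -
  define A where "A = p * (p / (p - 1))"
  have A: "0 < A" using pq by (simp add: A_def)
  have *: "c powr q = A powr q * (c / A) powr q" if "0 \<le> c" for c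
    using that A by (simp add: powr_divide)
  show ?thesis unfolding A_def[symmetric]
    by (rule ennreal_mult_le_cancel_real[of "A powr q"])
      (use A Laplacian_Lorentz[OF u n pq b gap, folded A_def] b in \<open>simp_all add: *[symmetric]\<close>)
qed

lemma lor_abs: "lor p q (\<lambda>x. \<bar>u x\<bar>) = lor p q u"
  by (simp add: lor_def dfun_def[abs_def])

text \<open>Induction in steps of two strips the innermost Laplacian, and \<open>hlap u\<close> is
  again a test function. Odd m ends at a gradient, where q <= p enters.\<close>

lemma Poincare_base:
  fixes u :: "real^'n \<Rightarrow> real"
  assumes "u \<in> C0inf" and n: "CARD('n) \<ge> 2" and "odd m \<Longrightarrow> q \<le> p"
  shows "ennreal (Cnmp CARD('n) m p powr q) * lor p q u \<le> lor p q (hnabla m u)"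
  using assms(1,3)
proof (induction m arbitrary: u rule: induct_nat_012)
  case 0
  have "Cnmp CARD('n) 0 p = 1" by (simp add: Cnmp_def Let_def)
  then show ?case by (simp add: hnabla_0 lor_abs)
next
  case 1
  have "Cnmp CARD('n) (Suc 0) p = (real CARD('n) - 1) / p" by (simp add: Cnmp_def Let_def)
  then show ?case using gradient_Lorentz[OF 1(1) n pq(2), of p] 1
    unfolding hnabla_1 by (metis (no_types, lifting) One_nat_def add_increasing2 le_iff_add order_trans zero_le odd_one)
next
  case (ge2 m)
  let ?a = "(real CARD('n) - 1)^2 / (p * (p / (p - 1)))"
  have "ennreal (?a powr q) * lor p q u \<le> lor p q (hlap u)"
    using Laplacian_Lorentz_gap[OF ge2(3) n, of 0 0] by simp
  then have "ennreal (Cnmp CARD('n) m p powr q) * (ennreal (?a powr q) * lor p q u) \<le> ennreal (Cnmp CARD('n) m p powr q) * lor p q (hlap u)"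
    by (intro mult_left_mono) auto
  also have "\<dots> \<le> lor p q (hnabla m (hlap u))" using ge2 C0inf_hlap by auto
  finally show ?case
    by (simp only: hnabla_Suc_Suc Cnmp_powr_Suc_Suc[OF n pq(1)] mult.assoc)
qed

text \<open>For levels between \<sigma> / 2 and \<sigma> the weighted volume is at least \<eta> and
  the volume at most B, so the surplus integral is at least \<eta> / B times the length \<sigma> /
  2.\<close>

lemma Poincare_gap_Laplacian:
  assumes "2 \<le> CARD('n)" and pos: "0 < \<sigma>" "0 < \<eta>" "0 < B"
  shows "\<exists>\<epsilon>>0. \<forall>u::real^'n \<Rightarrow> real. u \<in> C0inf \<longrightarrow> ennreal \<eta> \<le> wdfun hdelta u \<sigma> \<longrightarrow> mbar u (\<sigma> / 2) \<le> ennreal B \<longrightarrow>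
    ennreal (((real CARD('n) - 1)^2 / (p * (p / (p - 1)))) powr q) * lor p q u + ennreal \<epsilon> \<le> lor p q (hlap u)"
proof -
  let ?N = "real CARD('n) - 1"
  let ?A = "p * (p / (p - 1))"
  have N: "0 < ?N" and A: "0 < ?A" using assms pq by auto
  define b where "b = 2 * ?N * (1 / B * \<eta> * (\<sigma> / 2))"
  have b: "0 < b" using N pos by (simp add: b_def)
  \<comment> \<open>The last factor is \<open>Wint\<close> at \<eta>, and dfun u \<sigma> is at
    least \<eta> because hdelta <= 1.\<close>
  define \<epsilon> where "\<epsilon> = (b / ?A) powr q * (p / q * \<eta> powr (q / p))"
  have "0 < \<epsilon>" unfolding \<epsilon>_def using b A pos pq by (intro mult_pos_pos) auto
  moreover have "ennreal ((?N^2 / ?A) powr q) * lor p q u + ennreal \<epsilon> \<le> lor p q (hlap u)"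
    if u: "u \<in> C0inf" and k: "ennreal \<eta> \<le> wdfun hdelta u \<sigma>" and m: "mbar u (\<sigma> / 2) \<le> ennreal B" for u :: "real^'n \<Rightarrow> real"
  proof -
    note bu = bsupp_C0inf[OF u]
    note [measurable] = bsupp_measurable[OF bu]
    have gap: "ennreal b \<le> ennreal (2 * ?N) * (\<integral>\<^sup>+s. ennreal (1 / enn2real (mbar u s)) * indicator {0<..<s0} s * wdfun hdelta u s \<partial>lborel)"
      if s0: "\<sigma> < s0" "0 < dfun u s0" for s0
    proof -
      have "ennreal (1 / B * \<eta> * (\<sigma> / 2)) = (\<integral>\<^sup>+s. ennreal (1 / B) * ennreal \<eta> * indicator {\<sigma> / 2<..<\<sigma>} s \<partial>lborel)"
        using pos by (simp add: nn_integral_cmult ennreal_mult'[symmetric])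
      also have "\<dots> \<le> (\<integral>\<^sup>+s. ennreal (1 / enn2real (mbar u s)) * indicator {0<..<s0} s * wdfun hdelta u s \<partial>lborel)"
      proof (rule nn_integral_mono)
        fix s :: real
        show "ennreal (1 / B) * ennreal \<eta> * indicator {\<sigma> / 2<..<\<sigma>} s \<le> ennreal (1 / enn2real (mbar u s)) * indicator {0<..<s0} s * wdfun hdelta u s"
        proof (cases "\<sigma> / 2 < s \<and> s < \<sigma>")
          case True
          then have s: "0 < s" "s < s0" using pos s0 by auto
          have fin: "mbar u s < top" using mbar_fin[OF bu s(1)] by simp
          have le: "mbar u s \<le> ennreal B" using mbar_antimono[OF bu, of "\<sigma> / 2" s] True m by (auto intro: order_trans)
          have "dfun u s0 \<le> mbar u s"
            using dfun_antimono[OF bsupp_measurable[OF bu], of s s0] s dfun_le_mbar[OF bu, of s] by auto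
          then have "0 < mbar u s" using s0 by (auto intro: less_le_trans)
          then have "0 < enn2real (mbar u s)" using fin by (simp add: enn2real_positive_iff)
          moreover have "enn2real (mbar u s) \<le> B" using le pos by (metis enn2real_ennreal enn2real_mono ennreal_less_top less_imp_le)
          ultimately have "1 / B \<le> 1 / enn2real (mbar u s)" by (simp add: frac_le)
          then have "ennreal (1 / B) * ennreal \<eta> \<le> ennreal (1 / enn2real (mbar u s)) * wdfun hdelta u s"
            using k wdfun_antimono[of s \<sigma> hdelta u] True by (intro mult_mono ennreal_leI) (auto intro: order_trans)
          then show ?thesis using True s by simp
        qed simp
      qed
      finally have "ennreal (2 * ?N) * ennreal (1 / B * \<eta> * (\<sigma> / 2)) \<le> ennreal (2 * ?N) * (\<integral>\<^sup>+s. ennreal (1 / enn2real (mbar u s)) * indicator {0<..<s0} s * wdfun hdelta u s \<partial>lborel)"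
        by (intro mult_left_mono) auto
      moreover have "ennreal b = ennreal (2 * ?N) * ennreal (1 / B * \<eta> * (\<sigma> / 2))"
        unfolding b_def by (intro ennreal_mult') (use N in auto)
      ultimately show ?thesis by simp
    qed
    have "Wint (lorw p q) (ennreal \<eta>) \<le> Wint (lorw p q) (dfun u \<sigma>)"
      using k wdfun_hdelta_le_dfun[OF bsupp_measurable[OF bu]] order_trans by (blast intro: Wint_mono)
    moreover have "Wint (lorw p q) (ennreal \<eta>) = ennreal (p / q * \<eta> powr (q / p))"
      by (rule Wint_lorw) (use pq pos in auto)
    ultimately have "ennreal \<epsilon> \<le> ennreal ((b / ?A) powr q) * Wint (lorw p q) (dfun u \<sigma>)"
      unfolding \<epsilon>_def by (subst ennreal_mult') (auto intro: mult_left_mono)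
    then show ?thesis
      using Laplacian_Lorentz_gap[OF u assms(1) less_imp_le[OF b] less_imp_le[OF pos(1)] gap]
      by (meson add_left_mono order_trans)
  qed
  ultimately show ?thesis by blast
qed

lemma Poincare_gap_gradient:
  assumes "2 \<le> CARD('n)" and qp: "q \<le> p" and pos: "0 < \<sigma>" "0 < \<eta>" "0 < B"
  shows "\<exists>\<epsilon>>0. \<forall>u::real^'n \<Rightarrow> real. u \<in> C0inf \<longrightarrow> ennreal \<eta> \<le> wdfun hdelta u \<sigma> \<longrightarrow> mbar u (\<sigma> / 2) \<le> ennreal B \<longrightarrow>
    ennreal (((real CARD('n) - 1) / p) powr q) * lor p q u + ennreal \<epsilon> \<le> lor p q (\<lambda>x. gnorm x (hgrad u x))"
proof -
  let ?\<theta> = "(real CARD('n) - 1) / p"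
  have \<theta>: "0 < ?\<theta>" using assms pq by auto
  \<comment> \<open>A lower bound for the surplus integrand on levels between \<sigma> / 2 and
    \<sigma>: the power of s is at least that of \<sigma> / 2, the weight, decreasing by q <= p, is
    at least its value at B, and the weighted volume is at least \<eta>.\<close>
  define c where "c = q * (\<sigma> / 2) powr (q - 1) * B powr (q / p - 1) * \<eta>"
  have c: "0 < c" unfolding c_def using pq pos by (intro mult_pos_pos) auto
  define \<epsilon> where "\<epsilon> = ?\<theta> powr (q - 1) * (c * (\<sigma> / 2))"
  have "0 < \<epsilon>" unfolding \<epsilon>_def using c \<theta> pos by (intro mult_pos_pos) auto
  moreover have "ennreal (?\<theta> powr q) * lor p q u + ennreal \<epsilon> \<le> lor p q (\<lambda>x. gnorm x (hgrad u x))"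
    if u: "u \<in> C0inf" and k: "ennreal \<eta> \<le> wdfun hdelta u \<sigma>" and m: "mbar u (\<sigma> / 2) \<le> ennreal B" for u :: "real^'n \<Rightarrow> real"
  proof -
    note bu = bsupp_C0inf[OF u]
    note [measurable] = bsupp_measurable[OF bu]
    define R where "R = (\<integral>\<^sup>+s. ennreal (q * s powr (q - 1)) * lorw p q (enn2real (mbar u s)) * indicator {0<..} s * wdfun hdelta u s \<partial>lborel)"
    have "ennreal (c * (\<sigma> / 2)) = (\<integral>\<^sup>+s. ennreal c * indicator {\<sigma> / 2<..<\<sigma>} s \<partial>lborel)"
      using pos c by (simp add: nn_integral_cmult ennreal_mult'[symmetric])
    also have "\<dots> \<le> R" unfolding R_def
    proof (rule nn_integral_mono)
      fix s :: real
      show "ennreal c * indicator {\<sigma> / 2<..<\<sigma>} s \<le> ennreal (q * s powr (q - 1)) * lorw p q (enn2real (mbar u s)) * indicator {0<..} s * wdfun hdelta u s"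
      proof (cases "\<sigma> / 2 < s \<and> s < \<sigma>")
        case True
        then have s: "0 < s" using pos by auto
        have fin: "mbar u s < top" using mbar_fin[OF bu s(1)] by simp
        have le: "mbar u s \<le> ennreal B" using mbar_antimono[OF bu, of "\<sigma> / 2" s] True m by (auto intro: order_trans)
        have "ennreal \<eta> \<le> wdfun hdelta u s" using k wdfun_antimono[of s \<sigma> hdelta u] True by (auto intro: order_trans)
        moreover have "0 < enn2real (mbar u s)"
        proof -
          have "0 < ennreal \<eta>" using pos by simp
          also have "ennreal \<eta> \<le> wdfun hdelta u s" by fact
          also have "\<dots> \<le> dfun u s" by (rule wdfun_hdelta_le_dfun[OF bsupp_measurable[OF bu]])
          also have "\<dots> \<le> mbar u s" by (rule dfun_le_mbar[OF bu])
          finally show ?thesis using fin by (simp add: enn2real_positive_iff)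
        qed
        moreover have "enn2real (mbar u s) \<le> B" using le pos by (metis enn2real_ennreal enn2real_mono ennreal_less_top less_imp_le)
        ultimately have "ennreal (q * (\<sigma> / 2) powr (q - 1)) * lorw p q B * ennreal \<eta>
          \<le> ennreal (q * s powr (q - 1)) * lorw p q (enn2real (mbar u s)) * wdfun hdelta u s"
          using True pq pos qp
          by (intro mult_mono ennreal_leI lorw_antimono mult_left_mono powr_mono2) auto
        moreover have "ennreal c = ennreal (q * (\<sigma> / 2) powr (q - 1)) * lorw p q B * ennreal \<eta>"
          unfolding c_def lorw_def using pq pos by (simp add: ennreal_mult')
        ultimately show ?thesis using True s by simp
      qed simp
    qed
    finally have "ennreal \<epsilon> \<le> ennreal (?\<theta> powr (q - 1)) * R"
      unfolding \<epsilon>_def by (subst ennreal_mult') (auto intro: mult_left_mono)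
    then show ?thesis
      using gradient_Lorentz[OF u assms(1) pq(2) qp, folded R_def] by (meson add_left_mono order_trans)
  qed
  ultimately show ?thesis by blast
qed

text \<open>The gap \<open>\<epsilon>\<close> depends on \<open>u\<close> only through \<open>\<sigma>\<close>, \<open>\<eta>\<close> and \<open>B\<close>, so it survives passage to the limit along a
  sequence converging almost everywhere to a nonzero function.\<close>
lemma Poincare_gap:
  assumes n: "2 \<le> CARD('n)" and m: "1 \<le> m" and qp: "odd m \<Longrightarrow> q \<le> p" and pos: "0 < \<sigma>" "0 < \<eta>" "0 < B"
  shows "\<exists>\<epsilon>>0. \<forall>u::real^'n \<Rightarrow> real. u \<in> C0inf \<longrightarrow> ennreal \<eta> \<le> wdfun hdelta u \<sigma> \<longrightarrow> mbar u (\<sigma> / 2) \<le> ennreal B \<longrightarrow>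
    ennreal (Cnmp CARD('n) m p powr q) * lor p q u + ennreal \<epsilon> \<le> lor p q (hnabla m u)"
proof (cases "m = 1")
  case True
  have "Cnmp CARD('n) (Suc 0) p = (real CARD('n) - 1) / p" by (simp add: Cnmp_def Let_def)
  then show ?thesis using Poincare_gap_gradient[where 'n='n, OF n _ pos] qp True by (simp add: hnabla_1)
next
  case False
  then obtain k where k: "m = Suc (Suc k)" using m by (metis One_nat_def Suc_le_D not0_implies_Suc)
  let ?a = "(real CARD('n) - 1)^2 / (p * (p / (p - 1)))"
  \<comment> \<open>Only the innermost Laplacian is taken with a gap; the remaining k derivatives
    multiply it by ?c powr q.\<close>
  let ?c = "Cnmp CARD('n) k p"
  have c: "0 < ?c" by (rule Cnmp_pos[OF n pq(1)])
  obtain \<epsilon> where \<epsilon>: "0 < \<epsilon>" "\<And>u::real^'n \<Rightarrow> real. u \<in> C0inf \<Longrightarrow> ennreal \<eta> \<le> wdfun hdelta u \<sigma> \<Longrightarrow> mbar u (\<sigma> / 2) \<le> ennreal B \<Longrightarrow>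
    ennreal (?a powr q) * lor p q u + ennreal \<epsilon> \<le> lor p q (hlap u)"
    using Poincare_gap_Laplacian[where 'n='n, OF n pos] by blast
  have "ennreal (Cnmp CARD('n) m p powr q) * lor p q u + ennreal (?c powr q * \<epsilon>) \<le> lor p q (hnabla m u)"
    if u: "u \<in> C0inf" "ennreal \<eta> \<le> wdfun hdelta u \<sigma>" "mbar u (\<sigma> / 2) \<le> ennreal B" for u :: "real^'n \<Rightarrow> real"
  proof -
    have "ennreal (Cnmp CARD('n) m p powr q) * lor p q u + ennreal (?c powr q * \<epsilon>)
      = ennreal (?c powr q) * (ennreal (?a powr q) * lor p q u + ennreal \<epsilon>)"
      unfolding k Cnmp_powr_Suc_Suc[OF n pq(1)] distrib_left by (subst ennreal_mult') (simp_all only: mult.assoc powr_ge_zero)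
    also have "\<dots> \<le> ennreal (?c powr q) * lor p q (hlap u)" by (intro mult_left_mono \<epsilon> u) auto
    also have "\<dots> \<le> lor p q (hnabla m u)"
      unfolding k hnabla_Suc_Suc by (rule Poincare_base[OF C0inf_hlap[OF u(1)] n]) (use qp k in auto)
    finally show ?thesis .
  qed
  then show ?thesis using \<epsilon>(1) c by (intro exI[of _ "?c powr q * \<epsilon>"]) auto
qed

section \<open>Chebyshev bound, definiteness and quasi-triangle inequality\<close>

lemma lor_Chebyshev:
  assumes [measurable]: "u \<in> borel_measurable borel" and s: "0 \<le> s"
  shows "ennreal (s powr q) * Wint (lorw p q) (dfun u s) \<le> lor p q u"
proof -
  have "ennreal (s powr q) * Wint (lorw p q) (dfun u s) = (\<integral>\<^sup>+t. ennreal (q * t powr (q - 1)) * indicator {0<..<s} t * Wint (lorw p q) (dfun u s) \<partial>lborel)"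
    using s pq by (subst nn_integral_multc) (auto simp: nn_integral_powr)
  also have "\<dots> \<le> lor p q u" unfolding lor_def
    by (intro nn_integral_mono) (auto simp: indicator_def intro!: mult_left_mono Wint_mono dfun_antimono)
  finally show ?thesis .
qed

lemma Wint_lorw_pos: assumes "0 < m" shows "0 < Wint (lorw p q) m"
proof -
  obtain r where r: "0 < r" "ennreal r \<le> m"
  proof (cases m)
    case (real r) then show ?thesis using assms that[of r] by auto
  next
    case top then show ?thesis using that[of 1] by simp
  qed
  have "0 < Wint (lorw p q) (ennreal r)" using r pq by (subst Wint_lorw) auto
  also have "\<dots> \<le> Wint (lorw p q) m" by (rule Wint_mono[OF r(2)])
  finally show ?thesis .
qed

text \<open>This makes \<open>rearr\<close> meaningful for a limit u in the completion: arbitrarily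
  high levels with volume above t would contradict Chebyshev's bound.\<close>

lemma lor_finite_bdd:
  assumes [measurable]: "u \<in> borel_measurable borel" and fin: "lor p q u < \<infinity>" and t: "0 < t"
  shows "bdd_above {s. 0 < s \<and> ennreal t < dfun u s}"
proof (rule ccontr)
  assume nb: "\<not> bdd_above {s. 0 < s \<and> ennreal t < dfun u s}"
  obtain L where L: "lor p q u = ennreal L" "0 \<le> L" using fin by (cases "lor p q u") auto
  define W where "W = p / q * t powr (q / p)"
  have W: "0 < W" using t pq by (simp add: W_def)
  \<comment> \<open>Chosen so that s0 powr q times W is L + W, which exceeds L.\<close>
  define s0 where "s0 = (L / W + 1) powr (1 / q)"
  obtain s where s: "s0 < s" "0 < s" "ennreal t < dfun u s"
    using nb unfolding bdd_above_def by (metis (mono_tags, lifting) mem_Collect_eq not_le)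
  have "ennreal (s powr q * W) = ennreal (s powr q) * Wint (lorw p q) (ennreal t)"
  proof -
    have "Wint (lorw p q) (ennreal t) = ennreal W" unfolding W_def by (rule Wint_lorw) (use t pq in auto)
    then show ?thesis by (simp only: ennreal_mult'[OF powr_ge_zero])
  qed
  also have "\<dots> \<le> ennreal (s powr q) * Wint (lorw p q) (dfun u s)" using s by (intro mult_left_mono Wint_mono) auto
  also have "\<dots> \<le> ennreal L" using lor_Chebyshev[of u s] s by (simp add: L)
  finally have "s powr q * W \<le> L" using L by (simp add: ennreal_le_iff)
  moreover have "L / W + 1 = s0 powr q" using L W pq by (simp add: s0_def powr_powr)
  moreover have "s0 powr q \<le> s powr q" using s pq by (intro powr_mono2) (auto simp: s0_def)
  ultimately have "(L / W + 1) * W \<le> L" using W by (smt (verit) mult_right_mono)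
  moreover have "(L / W + 1) * W = L + W" using W by (simp add: field_simps)
  ultimately show False using W by linarith
qed

lemma lor_eq_0:
  assumes [measurable]: "u \<in> borel_measurable borel" and "lor p q u = 0"
  shows "AE x in hvol. u x = 0"
proof -
  have "dfun u s = 0" if "0 < s" for s
  proof (rule ccontr)
    assume "dfun u s \<noteq> 0"
    then have "0 < ennreal (s powr q) * Wint (lorw p q) (dfun u s)"
      using Wint_lorw_pos[of "dfun u s"] that by (simp add: ennreal_zero_less_mult_iff zero_less_iff_neq_zero)
    then show False using lor_Chebyshev[of u s] that assms(2) by simp
  qed
  then have "AE x in hvol. \<bar>u x\<bar> \<le> 1 / real (Suc k)" for k
    unfolding dfun_def by (intro AE_I[of _ _ "{x. 1 / real (Suc k) < \<bar>u x\<bar>}"]) auto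
  then have "AE x in hvol. \<forall>k. \<bar>u x\<bar> \<le> 1 / real (Suc k)" by (simp add: AE_all_countable)
  then show ?thesis
  proof eventually_elim
    case (elim x)
    show ?case
    proof (rule ccontr)
      assume "u x \<noteq> 0"
      then obtain k :: nat where "inverse (real (Suc k)) < \<bar>u x\<bar>" using reals_Archimedean[of "\<bar>u x\<bar>"] by auto
      then show False using elim[rule_format, of k] by (simp add: inverse_eq_divide)
    qed
  qed
qed

text \<open>If |f| > 2 s then |g| > s or |h| > s. Rescaling the levels costs 2 powr q, and splitting
  the power q / p of a sum of volumes costs 2 powr (q / p).\<close>

lemma lor_quasi_triangle:
  assumes f: "bsupp f" and g: "bsupp g" and h: "bsupp h" and le: "\<And>x. \<bar>f x\<bar> \<le> \<bar>g x\<bar> + \<bar>h x\<bar>"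
  shows "lor p q f \<le> ennreal (2 powr q * 2 powr (q / p)) * (lor p q g + lor p q h)"
proof -
  note [measurable] = bsupp_measurable[OF f] bsupp_measurable[OF g] bsupp_measurable[OF h]
  have W: "Wint (lorw p q) (dfun f (2 * s)) \<le> ennreal (2 powr (q / p)) * (Wint (lorw p q) (dfun g s) + Wint (lorw p q) (dfun h s))" if s: "0 < s" for s
  proof -
    obtain a where a: "dfun g s = ennreal a" "0 \<le> a" using dfun_fin[OF g s] by (cases "dfun g s") auto
    obtain b where b: "dfun h s = ennreal b" "0 \<le> b" using dfun_fin[OF h s] by (cases "dfun h s") auto
    have "dfun f (2 * s) \<le> emeasure hvol ({x. s < \<bar>g x\<bar>} \<union> {x. s < \<bar>h x\<bar>})"
      unfolding dfun_def
    proof (intro emeasure_mono subsetI)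
      fix x assume "x \<in> {x. 2 * s < \<bar>f x\<bar>}"
      then have "s < \<bar>g x\<bar> \<or> s < \<bar>h x\<bar>" using le[of x] by auto
      then show "x \<in> {x. s < \<bar>g x\<bar>} \<union> {x. s < \<bar>h x\<bar>}" by auto
    qed auto
    also have "\<dots> \<le> dfun g s + dfun h s" unfolding dfun_def by (rule emeasure_subadditive) auto
    also have "\<dots> = ennreal (a + b)" using a b by (simp add: ennreal_plus)
    finally have "Wint (lorw p q) (dfun f (2 * s)) \<le> Wint (lorw p q) (ennreal (a + b))" by (rule Wint_mono)
    also have "\<dots> = ennreal (p / q * (a + b) powr (q / p))" using a b pq by (subst Wint_lorw) auto
    also have "\<dots> \<le> ennreal (2 powr (q / p) * (p / q * a powr (q / p) + p / q * b powr (q / p)))"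
    proof (rule ennreal_leI)
      have "(a + b) powr (q / p) \<le> (2 * max a b) powr (q / p)" using a b pq by (intro powr_mono2) auto
      also have "\<dots> = 2 powr (q / p) * max a b powr (q / p)" using a b by (simp add: powr_mult)
      also have "max a b powr (q / p) \<le> a powr (q / p) + b powr (q / p)" by (auto simp: max_def)
      finally have "(a + b) powr (q / p) \<le> 2 powr (q / p) * (a powr (q / p) + b powr (q / p))" by simp
      then have "p / q * (a + b) powr (q / p) \<le> p / q * (2 powr (q / p) * (a powr (q / p) + b powr (q / p)))"
        using pq by (intro mult_left_mono) auto
      then show "p / q * (a + b) powr (q / p) \<le> 2 powr (q / p) * (p / q * a powr (q / p) + p / q * b powr (q / p))"
        by (simp add: algebra_simps)
    qed
    also have "\<dots> = ennreal (2 powr (q / p)) * (ennreal (p / q * a powr (q / p)) + ennreal (p / q * b powr (q / p)))"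
      using a b pq by (subst ennreal_mult') (auto simp: ennreal_plus)
    also have "\<dots> = ennreal (2 powr (q / p)) * (Wint (lorw p q) (dfun g s) + Wint (lorw p q) (dfun h s))"
      using a b pq by (simp add: Wint_lorw)
    finally show ?thesis .
  qed
  have "lor p q f = ennreal \<bar>2\<bar> * (\<integral>\<^sup>+s. ennreal (q * (0 + 2 * s) powr (q - 1)) * indicator {0<..} (0 + 2 * s) * Wint (lorw p q) (dfun f (0 + 2 * s)) \<partial>lborel)"
    unfolding lor_def by (rule nn_integral_real_affine) auto
  also have "\<dots> = (\<integral>\<^sup>+s. ennreal 2 * (ennreal (q * (2 * s) powr (q - 1)) * indicator {0<..} s * Wint (lorw p q) (dfun f (2 * s))) \<partial>lborel)"
    by (subst nn_integral_cmult[symmetric]) (auto simp: indicator_def intro!: nn_integral_cong)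
  also have "\<dots> \<le> (\<integral>\<^sup>+s. ennreal (2 powr q * 2 powr (q / p)) * (ennreal (q * s powr (q - 1)) * indicator {0<..} s * Wint (lorw p q) (dfun g s)
      + ennreal (q * s powr (q - 1)) * indicator {0<..} s * Wint (lorw p q) (dfun h s)) \<partial>lborel)"
  proof (rule nn_integral_mono)
    fix s :: real
    let ?G = "Wint (lorw p q) (dfun g s)" and ?H = "Wint (lorw p q) (dfun h s)"
    show "ennreal 2 * (ennreal (q * (2 * s) powr (q - 1)) * indicator {0<..} s * Wint (lorw p q) (dfun f (2 * s)))
      \<le> ennreal (2 powr q * 2 powr (q / p)) * (ennreal (q * s powr (q - 1)) * indicator {0<..} s * ?G + ennreal (q * s powr (q - 1)) * indicator {0<..} s * ?H)"
    proof (cases "0 < s")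
      case True
      have "2 * (q * (2 * s) powr (q - 1)) = 2 powr q * (q * s powr (q - 1))"
        using True powr_mult_base[of 2 "q - 1"] by (simp add: powr_mult)
      then have e: "ennreal 2 * ennreal (q * (2 * s) powr (q - 1)) = ennreal (2 powr q) * ennreal (q * s powr (q - 1))"
        by (simp only: ennreal_mult'[symmetric] zero_le_numeral powr_ge_zero)
      have "ennreal 2 * (ennreal (q * (2 * s) powr (q - 1)) * Wint (lorw p q) (dfun f (2 * s)))
        = ennreal (2 powr q) * ennreal (q * s powr (q - 1)) * Wint (lorw p q) (dfun f (2 * s))"
        by (simp only: e mult.assoc[symmetric])
      also have "\<dots> \<le> ennreal (2 powr q) * ennreal (q * s powr (q - 1)) * (ennreal (2 powr (q / p)) * (?G + ?H))"
        by (intro mult_left_mono W True) auto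
      also have "\<dots> = ennreal (2 powr q * 2 powr (q / p)) * (ennreal (q * s powr (q - 1)) * ?G + ennreal (q * s powr (q - 1)) * ?H)"
        by (subst ennreal_mult') (auto simp: distrib_left mult_ac)
      finally show ?thesis using True by simp
    qed simp
  qed
  also have "\<dots> = ennreal (2 powr q * 2 powr (q / p)) * (lor p q g + lor p q h)"
    unfolding lor_def by (subst nn_integral_cmult, measurable, subst nn_integral_add) auto
  finally show ?thesis .
qed

end

section \<open>Passage to the completion\<close>

text \<open>Fatou's lemma applies because a strict inequality s < |u x| persists for all late
  members of the sequence.\<close>

lemma wdfun_liminf:
  fixes u :: "real^'n \<Rightarrow> real"
  assumes [measurable]: "c \<in> borel_measurable borel" "u \<in> borel_measurable borel" "\<And>k. \<phi> k \<in> borel_measurable borel"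
    and conv: "AE x in hvol. (\<lambda>k. \<phi> k x) \<longlonglongrightarrow> u x"
  shows "wdfun c u s \<le> liminf (\<lambda>k. wdfun c (\<phi> k) s)"
proof -
  have "wdfun c u s \<le> (\<integral>\<^sup>+x. liminf (\<lambda>k. ennreal (c x) * indicator {x. s < \<bar>\<phi> k x\<bar>} x) \<partial>hvol)"
    unfolding wdfun_def
  proof (rule nn_integral_mono_AE)
    show "AE x in hvol. ennreal (c x) * indicator {x. s < \<bar>u x\<bar>} x \<le> liminf (\<lambda>k. ennreal (c x) * indicator {x. s < \<bar>\<phi> k x\<bar>} x)"
      using conv
    proof eventually_elim
      case (elim x)
      show ?case
      proof (cases "s < \<bar>u x\<bar>")
        case True
        have "(\<lambda>k. \<bar>\<phi> k x\<bar>) \<longlonglongrightarrow> \<bar>u x\<bar>" using elim by (rule tendsto_rabs)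
        then have "\<forall>\<^sub>F k in sequentially. s < \<bar>\<phi> k x\<bar>" using True by (rule order_tendstoD)
        then have "\<forall>\<^sub>F k in sequentially. ennreal (c x) * indicator {x. s < \<bar>u x\<bar>} x \<le> ennreal (c x) * indicator {x. s < \<bar>\<phi> k x\<bar>} x"
          by eventually_elim (use True in simp)
        then show ?thesis by (rule Liminf_bounded)
      qed simp
    qed
  qed
  also have "\<dots> \<le> liminf (\<lambda>k. wdfun c (\<phi> k) s)" unfolding wdfun_def by (rule nn_integral_liminf) measurable
  finally show ?thesis .
qed

lemma dfun_liminf:
  fixes u :: "real^'n \<Rightarrow> real"
  assumes "u \<in> borel_measurable borel" "\<And>k. \<phi> k \<in> borel_measurable borel"
    and "AE x in hvol. (\<lambda>k. \<phi> k x) \<longlonglongrightarrow> u x"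
  shows "dfun u s \<le> liminf (\<lambda>k. dfun (\<phi> k) s)"
  using wdfun_liminf[OF _ assms, of "\<lambda>_. 1" s] by (simp add: dfun_wdfun assms)

text \<open>Fatou's lemma is applied twice, over volumes t and over levels s; by
  \<open>dfun_liminf\<close>, t < dfun u s persists along the sequence.\<close>

lemma lor_liminf:
  fixes u :: "real^'n \<Rightarrow> real"
  assumes [measurable]: "u \<in> borel_measurable borel" "\<And>k. \<phi> k \<in> borel_measurable borel"
    and conv: "AE x in hvol. (\<lambda>k. \<phi> k x) \<longlonglongrightarrow> u x"
  shows "lor p q u \<le> liminf (\<lambda>k. lor p q (\<phi> k))"
proof -
  let ?w = "\<lambda>v s t. ennreal (q * s powr (q - 1)) * indicator {0<..} s * (lorw p q t * indicator {t. 0 < t \<and> ennreal t < dfun v s} t)"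
  have W: "ennreal (q * s powr (q - 1)) * indicator {0<..} s * Wint (lorw p q) (dfun v s) = (\<integral>\<^sup>+t. ?w v s t \<partial>lborel)"
    if [measurable]: "v \<in> borel_measurable borel" for v :: "real^'n \<Rightarrow> real" and s
    unfolding Wint_def by (rule nn_integral_cmult[symmetric]) measurable
  have pt: "ennreal (q * s powr (q - 1)) * indicator {0<..} s * Wint (lorw p q) (dfun u s)
    \<le> liminf (\<lambda>k. ennreal (q * s powr (q - 1)) * indicator {0<..} s * Wint (lorw p q) (dfun (\<phi> k) s))" for s
  proof -
    have "(\<integral>\<^sup>+t. ?w u s t \<partial>lborel) \<le> (\<integral>\<^sup>+t. liminf (\<lambda>k. ?w (\<phi> k) s t) \<partial>lborel)"
    proof (rule nn_integral_mono)
      fix t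
      show "?w u s t \<le> liminf (\<lambda>k. ?w (\<phi> k) s t)"
      proof (cases "0 < t \<and> ennreal t < dfun u s")
        case True
        then have "ennreal t < liminf (\<lambda>k. dfun (\<phi> k) s)" using dfun_liminf[OF assms, of s] by (auto intro: less_le_trans)
        then have "\<forall>\<^sub>F k in sequentially. ennreal t < dfun (\<phi> k) s" by (rule less_LiminfD)
        then have "\<forall>\<^sub>F k in sequentially. ?w u s t \<le> ?w (\<phi> k) s t" by eventually_elim (use True in simp)
        then show ?thesis by (rule Liminf_bounded)
      qed simp
    qed
    also have "\<dots> \<le> liminf (\<lambda>k. \<integral>\<^sup>+t. ?w (\<phi> k) s t \<partial>lborel)" by (rule nn_integral_liminf) measurable
    finally show ?thesis by (simp add: W)
  qed
  have "lor p q u \<le> (\<integral>\<^sup>+s. liminf (\<lambda>k. ennreal (q * s powr (q - 1)) * indicator {0<..} s * Wint (lorw p q) (dfun (\<phi> k) s)) \<partial>lborel)"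
    unfolding lor_def by (intro nn_integral_mono pt)
  also have "\<dots> \<le> liminf (\<lambda>k. lor p q (\<phi> k))" unfolding lor_def by (rule nn_integral_liminf) measurable
  finally show ?thesis .
qed

lemma add_const_le_of_liminf:
  fixes a L :: "nat \<Rightarrow> ennreal"
  assumes A: "A \<le> liminf a" and ev: "\<forall>\<^sub>F k in sequentially. ennreal c * a k + e \<le> L k" and c: "0 < c" and L: "L \<longlonglongrightarrow> N"
  shows "ennreal c * A + e \<le> N"
proof -
  have inv: "ennreal c * ennreal (1 / c) = 1" using c by (simp add: ennreal_mult'[symmetric])
  have "\<forall>\<^sub>F k in sequentially. a k + ennreal (1 / c) * e \<le> ennreal (1 / c) * L k"
    using ev
  proof eventually_elim
    case (elim k)
    have "a k + ennreal (1 / c) * e = ennreal (1 / c) * (ennreal c * a k + e)"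
      using inv by (simp add: distrib_left mult.assoc[symmetric] mult.commute)
    also have "\<dots> \<le> ennreal (1 / c) * L k" using elim by (intro mult_left_mono) auto
    finally show ?case .
  qed
  then have "liminf (\<lambda>k. a k + ennreal (1 / c) * e) \<le> liminf (\<lambda>k. ennreal (1 / c) * L k)" by (rule Liminf_mono)
  moreover have "liminf (\<lambda>k. ennreal (1 / c) * L k) = ennreal (1 / c) * N"
    by (intro lim_imp_Liminf ennreal_tendsto_cmult L) auto
  ultimately have "A + ennreal (1 / c) * e \<le> ennreal (1 / c) * N"
    using A by (simp add: Liminf_add_const) (meson add_right_mono order_trans)
  then have "ennreal c * (A + ennreal (1 / c) * e) \<le> ennreal c * (ennreal (1 / c) * N)" by (rule mult_left_mono) simp
  then show ?thesis using inv by (simp add: distrib_left mult.assoc[symmetric])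
qed

text \<open>The Cauchy condition and the quasi-triangle inequality bound the functionals of the
  approximants. With the inequality for test functions and Chebyshev this bounds their volumes above
  a fixed level, while Fatou bounds a weighted volume from below. So \<open>Poincare_gap\<close>
  applies to all late members with one common gap.\<close>

lemma WmLpq_Poincare:
  fixes u :: "real^'n \<Rightarrow> real"
  assumes W: "WmLpq m p q u N" and n: "2 \<le> CARD('n)" and m: "1 \<le> m" and pq: "1 < p" "1 < q" and qp: "odd m \<Longrightarrow> q \<le> p"
  shows "N < \<infinity>" "lor p q u < \<infinity>" "lorentz_qpow p q u = lor p q u"
    "ennreal (Cnmp CARD('n) m p powr q) * lor p q u \<le> N"
    "\<not> (AE x in hvol. u x = 0) \<Longrightarrow> \<exists>\<epsilon>>0. ennreal (Cnmp CARD('n) m p powr q) * lor p q u + ennreal \<epsilon> \<le> N"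
proof -
  define C where "C = Cnmp CARD('n) m p powr q"
  have C: "0 < C" using Cnmp_pos[OF n pq(1), of m] by (simp add: C_def)
  have [measurable]: "u \<in> borel_measurable borel" using W by (simp add: WmLpq_def)
  obtain \<phi> where \<phi>: "\<And>k. \<phi> k \<in> C0inf"
    and cauchy: "\<And>\<epsilon>. \<epsilon> > 0 \<Longrightarrow> \<exists>K. \<forall>k\<ge>K. \<forall>l\<ge>K. lorentz_qpow p q (hnabla m (\<lambda>x. \<phi> k x - \<phi> l x)) < ennreal \<epsilon>"
    and conv: "AE x in hvol. (\<lambda>k. \<phi> k x) \<longlonglongrightarrow> u x"
    and lim: "(\<lambda>k. lorentz_qpow p q (hnabla m (\<phi> k))) \<longlonglongrightarrow> N"
    using W unfolding WmLpq_def by blast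
  have [measurable]: "\<phi> k \<in> borel_measurable borel" for k by (rule C0inf_measurable[OF \<phi>])
  define L where "L k = lor p q (hnabla m (\<phi> k))" for k
  have L: "L \<longlonglongrightarrow> N" using lim pq by (simp add: L_def[abs_def] bsupp_lorentz[OF bsupp_hnabla[OF \<phi>]])
  obtain K where K: "\<And>k. k \<ge> K \<Longrightarrow> lor p q (hnabla m (\<lambda>x. \<phi> k x - \<phi> K x)) < 1"
  proof -
    obtain K where "\<And>k l. k \<ge> K \<Longrightarrow> l \<ge> K \<Longrightarrow> lorentz_qpow p q (hnabla m (\<lambda>x. \<phi> k x - \<phi> l x)) < ennreal 1"
      using cauchy[of 1] by auto
    then have "lor p q (hnabla m (\<lambda>x. \<phi> k x - \<phi> K x)) < 1" if "k \<ge> K" for k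
      using that pq by (simp add: bsupp_lorentz[OF bsupp_hnabla[OF C0inf_diff[OF \<phi> \<phi>]]])
    then show ?thesis using that by blast
  qed
  define B where "B = ennreal (2 powr q * 2 powr (q / p)) * (1 + L K)"
  have LB: "L k \<le> B" if "k \<ge> K" for k
  proof -
    have "L k \<le> ennreal (2 powr q * 2 powr (q / p)) * (lor p q (hnabla m (\<lambda>x. \<phi> k x - \<phi> K x)) + L K)"
      unfolding L_def
      by (rule lor_quasi_triangle[OF pq bsupp_hnabla[OF \<phi>] bsupp_hnabla[OF C0inf_diff[OF \<phi> \<phi>]] bsupp_hnabla[OF \<phi>]])
        (simp add: hnabla_nonneg hnabla_triangle \<phi>)
    also have "\<dots> \<le> B" unfolding B_def using K[OF that] by (intro mult_left_mono add_right_mono) auto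
    finally show ?thesis .
  qed
  have Bfin: "B < \<infinity>"
    unfolding B_def L_def using bsupp_lor_fin[OF bsupp_hnabla[OF \<phi>], of p q m K] pq
    by (simp add: ennreal_mult_less_top)
  have "N \<le> B" by (rule LIMSEQ_le_const2[OF L]) (use LB in auto)
  then show Nfin: "N < \<infinity>" using Bfin by simp
  have base: "ennreal C * lor p q (\<phi> k) \<le> L k" for k
    unfolding C_def L_def by (rule Poincare_base[OF pq \<phi> n qp])
  have lsc: "lor p q u \<le> liminf (\<lambda>k. lor p q (\<phi> k))" by (rule lor_liminf[OF _ _ conv]) measurable
  have main: "ennreal C * lor p q u \<le> N"
    using add_const_le_of_liminf[OF lsc _ C L, of 0] base by simp
  then show "ennreal (Cnmp CARD('n) m p powr q) * lor p q u \<le> N" by (simp add: C_def)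
  show fin: "lor p q u < \<infinity>"
  proof (rule ccontr)
    assume "\<not> lor p q u < \<infinity>"
    then have "lor p q u = top" by (metis infinity_ennreal_def top.not_eq_extremum)
    then show False using main C Nfin by (simp add: ennreal_mult_top)
  qed
  show "lorentz_qpow p q u = lor p q u"
    by (rule lorentz_qpow_eq_lor) (use pq lor_finite_bdd[OF pq _ fin] in auto)
  assume nz: "\<not> (AE x in hvol. u x = 0)"
  \<comment> \<open>As hdelta is positive in the ball, vanishing of all these weighted volumes would
    force u = 0 almost everywhere.\<close>
  have "\<exists>\<sigma>>0. wdfun hdelta u \<sigma> > 0"
  proof (rule ccontr)
    assume "\<not> (\<exists>\<sigma>>0. wdfun hdelta u \<sigma> > 0)"
    then have z: "wdfun hdelta u (1 / real (Suc k)) = 0" for k by (simp add: zero_less_iff_neq_zero)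
    have ball: "AE x in hvol. x \<in> ball (0 :: real^'n) 1"
    proof (rule AE_I[of _ _ "- ball 0 1"])
      have "emeasure hvol (- ball 0 1 :: (real^'n) set) = (\<integral>\<^sup>+x. indicator (- ball 0 1) x \<partial>(hvol :: (real^'n) measure))"
        by (rule nn_integral_indicator[symmetric]) simp
      also have "\<dots> = (\<integral>\<^sup>+x. indicator (ball 0 1) x * ennreal (conf x ^ CARD('n)) * indicator (- ball 0 1) x \<partial>(lborel :: (real^'n) measure))"
        by (rule nn_integral_hvol) measurable
      also have "\<dots> = (\<integral>\<^sup>+x. 0 \<partial>(lborel :: (real^'n) measure))" by (intro nn_integral_cong) (auto simp: indicator_def)
      finally show "emeasure hvol (- ball 0 1 :: (real^'n) set) = 0" by simp
    qed auto
    have "AE x in hvol. ennreal (hdelta x) * indicator {x. 1 / real (Suc k) < \<bar>u x\<bar>} x = 0" for k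
      using z[of k] unfolding wdfun_def by (subst (asm) nn_integral_0_iff_AE) auto
    then have "AE x in hvol. \<forall>k. ennreal (hdelta x) * indicator {x. 1 / real (Suc k) < \<bar>u x\<bar>} x = 0"
      unfolding AE_all_countable by blast
    then have "AE x in hvol. u x = 0" using ball
    proof eventually_elim
      case (elim x)
      show ?case
      proof (rule ccontr)
        assume "u x \<noteq> 0"
        then obtain k :: nat where "inverse (real (Suc k)) < \<bar>u x\<bar>" using reals_Archimedean[of "\<bar>u x\<bar>"] by auto
        then have "ennreal (hdelta x) = 0" using elim(1)[rule_format, of k] by (simp add: inverse_eq_divide)
        then show False using hdelta_bounds(2)[OF elim(2)] by simp
      qed
    qed
    then show False using nz by simp
  qed
  then obtain \<sigma> where \<sigma>: "0 < \<sigma>" "0 < wdfun hdelta u \<sigma>" by blast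
  obtain e where e: "0 < e" "e < wdfun hdelta u \<sigma>" using dense[OF \<sigma>(2)] by blast
  have "e < top" using e(2) by (auto intro: less_le_trans)
  then obtain \<eta> where \<eta>: "e = ennreal \<eta>" "0 < \<eta>" using e(1) by (cases e) auto
  have ev1: "\<forall>\<^sub>F k in sequentially. ennreal \<eta> < wdfun hdelta (\<phi> k) \<sigma>"
  proof -
    have "wdfun hdelta u \<sigma> \<le> liminf (\<lambda>k. wdfun hdelta (\<phi> k) \<sigma>)" by (rule wdfun_liminf[OF _ _ _ conv]) measurable
    then show ?thesis using e(2) \<eta> by (intro less_LiminfD) auto
  qed
  obtain X where X: "B = ennreal X" "0 \<le> X" using Bfin by (cases B) auto
  \<comment> \<open>Y and M solve Chebyshev's inequality at level \<sigma> / 4 for the volume. Going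
    from \<sigma> / 4 to \<sigma> / 2 exchanges open for closed superlevel sets, and the added 1
    makes M positive.\<close>
  define Y where "Y = X / C / (\<sigma> / 4) powr q"
  have Y: "0 \<le> Y" using X C by (simp add: Y_def)
  define M where "M = (Y * q / p) powr (p / q) + 1"
  have M: "0 < M" by (simp add: M_def add_nonneg_pos)
  have mb: "mbar (\<phi> k) (\<sigma> / 2) \<le> ennreal M" if "k \<ge> K" for k
  proof -
    note bk = bsupp_C0inf[OF \<phi>[of k]]
    obtain d where d: "dfun (\<phi> k) (\<sigma> / 4) = ennreal d" "0 \<le> d" using dfun_fin[OF bk, of "\<sigma> / 4"] \<sigma> by (cases "dfun (\<phi> k) (\<sigma> / 4)") auto
    have "ennreal C * (ennreal ((\<sigma> / 4) powr q) * Wint (lorw p q) (dfun (\<phi> k) (\<sigma> / 4))) \<le> ennreal C * lor p q (\<phi> k)"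
      using \<sigma> by (intro mult_left_mono lor_Chebyshev[OF pq]) auto
    also have "\<dots> \<le> ennreal X" using base[of k] LB[OF that] X by (auto intro: order_trans)
    finally have fin0: "ennreal C * (ennreal ((\<sigma> / 4) powr q) * Wint (lorw p q) (dfun (\<phi> k) (\<sigma> / 4))) \<le> ennreal X" .
    have "ennreal (C * ((\<sigma> / 4) powr q * (p / q * d powr (q / p)))) \<le> ennreal X"
    proof -
      have "Wint (lorw p q) (ennreal d) = ennreal (p / q * d powr (q / p))" by (rule Wint_lorw) (use d pq in auto)
      moreover have "ennreal (C * ((\<sigma> / 4) powr q * (p / q * d powr (q / p)))) = ennreal C * (ennreal ((\<sigma> / 4) powr q) * ennreal (p / q * d powr (q / p)))"
        using C by (simp only: ennreal_mult'[OF less_imp_le] ennreal_mult'[OF powr_ge_zero])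
      ultimately show ?thesis using fin0 by (simp only: d(1))
    qed
    then have "C * ((\<sigma> / 4) powr q * (p / q * d powr (q / p))) \<le> X" using X by (simp add: ennreal_le_iff)
    moreover have "0 < (\<sigma> / 4) powr q" using \<sigma> by simp
    ultimately have "d powr (q / p) \<le> Y * q / p" using C pq by (simp add: Y_def field_simps)
    then have "(d powr (q / p)) powr (p / q) \<le> (Y * q / p) powr (p / q)" using pq by (intro powr_mono2) auto
    then have "d \<le> M" using d pq by (simp add: powr_powr M_def)
    have "mbar (\<phi> k) (\<sigma> / 2) \<le> dfun (\<phi> k) (\<sigma> / 4)"
      unfolding mbar_def dfun_def using \<sigma> by (intro emeasure_mono) auto
    also have "\<dots> \<le> ennreal M" unfolding d using \<open>d \<le> M\<close> by (rule ennreal_leI)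
    finally show ?thesis .
  qed
  obtain \<epsilon> where \<epsilon>: "0 < \<epsilon>" "\<And>v::real^'n \<Rightarrow> real. v \<in> C0inf \<Longrightarrow> ennreal \<eta> \<le> wdfun hdelta v \<sigma> \<Longrightarrow> mbar v (\<sigma> / 2) \<le> ennreal M \<Longrightarrow>
    ennreal C * lor p q v + ennreal \<epsilon> \<le> lor p q (hnabla m v)"
    using Poincare_gap[where 'n='n, OF pq n m qp \<sigma>(1) \<eta>(2) M] unfolding C_def by blast
  have "\<forall>\<^sub>F k in sequentially. ennreal C * lor p q (\<phi> k) + ennreal \<epsilon> \<le> L k"
    using ev1 eventually_ge_at_top[of K] unfolding L_def by eventually_elim (use \<epsilon>(2) \<phi> mb in auto)
  from add_const_le_of_liminf[OF lsc this C L] show "\<exists>\<epsilon>>0. ennreal (Cnmp CARD('n) m p powr q) * lor p q u + ennreal \<epsilon> \<le> N"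
    using \<epsilon>(1) by (auto simp: C_def)
qed

lemma WmLpq_C0inf:
  assumes u: "u \<in> C0inf" and pq: "1 < p" "1 < q"
  shows "WmLpq m p q u (lor p q (hnabla m u))"
proof -
  have z: "lorentz_qpow p q (hnabla m (\<lambda>x. u x - u x)) = 0"
  proof -
    have "hnabla m (\<lambda>x. u x - u x) x = 0" for x
    proof (cases "even m")
      case True then show ?thesis by (simp only: hnabla_def hlap_funpow_diff[OF u u]) simp
    next
      case False
      then show ?thesis by (simp only: hnabla_def hlap_funpow_diff[OF u u]) (simp add: gnorm_hgrad egrad_def vec_eq_iff)
    qed
    then have d0: "dfun (hnabla m (\<lambda>x. u x - u x)) s = 0" if "0 < s" for s using that unfolding dfun_def by simp
    have W0: "Wint w 0 = 0" for w by (simp add: Wint_def)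
    have "lor p q (hnabla m (\<lambda>x. u x - u x)) = (\<integral>\<^sup>+s. 0 \<partial>(lborel :: real measure))" unfolding lor_def
    proof (rule nn_integral_cong)
      fix s show "ennreal (q * s powr (q - 1)) * indicator {0<..} s * Wint (lorw p q) (dfun (hnabla m (\<lambda>x. u x - u x)) s) = 0"
        by (cases "0 < s") (simp_all only: d0 W0, simp_all)
    qed
    then show ?thesis using bsupp_lorentz[OF bsupp_hnabla[OF C0inf_diff[OF u u]], of q p m] pq by (simp only: nn_integral_const) simp
  qed
  show ?thesis unfolding WmLpq_def
  proof (intro conjI exI[of _ "\<lambda>_. u"])
    show "u \<in> borel_measurable borel" by (rule C0inf_measurable[OF u])
    show "\<forall>\<epsilon>>0. \<exists>K. \<forall>k\<ge>K. \<forall>l\<ge>K. lorentz_qpow p q (hnabla m (\<lambda>x. u x - u x)) < ennreal \<epsilon>"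
      unfolding z by simp
    show "(\<lambda>k. lorentz_qpow p q (hnabla m u)) \<longlonglongrightarrow> lor p q (hnabla m u)"
      using bsupp_lorentz[OF bsupp_hnabla[OF u], of q p m] pq by simp
  qed (use u in auto)
qed

section \<open>Volume growth and test profiles\<close>

lemma emeasure_hvol:
  fixes S :: "(real^'n) set"
  assumes [measurable]: "S \<in> sets borel"
  shows "emeasure hvol S = (\<integral>\<^sup>+x. ennreal (indicator (ball 0 1) x * conf x ^ CARD('n) * indicator S x) \<partial>lborel)"
proof -
  have "emeasure hvol S = (\<integral>\<^sup>+x. ennreal (indicator S x) \<partial>hvol)" by (simp add: ennreal_indicator)
  also have "\<dots> = (\<integral>\<^sup>+x. ennreal (indicator (ball 0 1) x * conf x ^ CARD('n) * indicator S x) \<partial>lborel)"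
    by (rule nn_integral_hvol_real) measurable
  finally show ?thesis .
qed

lemma emeasure_hvol_upper:
  fixes S :: "(real^'n) set"
  assumes [measurable]: "S \<in> sets borel" and w: "0 < w" "\<And>x. x \<in> S \<Longrightarrow> w \<le> bdef x"
  shows "emeasure hvol S \<le> ennreal ((2 / w) ^ CARD('n)) * emeasure lborel S"
proof -
  have "emeasure hvol S \<le> (\<integral>\<^sup>+x. ennreal ((2 / w) ^ CARD('n)) * indicator S x \<partial>lborel)"
    unfolding emeasure_hvol[OF assms(1)]
  proof (rule nn_integral_mono)
    fix x :: "real^'n"
    show "ennreal (indicator (ball 0 1) x * conf x ^ CARD('n) * indicator S x) \<le> ennreal ((2 / w) ^ CARD('n)) * indicator S x"
    proof (cases "x \<in> S")
      case True
      then have b: "w \<le> bdef x" "0 < bdef x" using w by (auto intro: less_le_trans)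
      then have "conf x \<le> 2 / w" "0 \<le> conf x" unfolding conf_bdef using w by (auto intro!: divide_left_mono)
      then have "conf x ^ CARD('n) \<le> (2 / w) ^ CARD('n)" by (rule power_mono)
      then show ?thesis using True b bdef_pos_iff[of x] by (auto intro!: ennreal_leI)
    qed simp
  qed
  also have "\<dots> = ennreal ((2 / w) ^ CARD('n)) * emeasure lborel S" by (rule nn_integral_cmult_indicator) simp
  finally show ?thesis .
qed

lemma emeasure_hvol_lower:
  fixes S :: "(real^'n) set"
  assumes [measurable]: "S \<in> sets borel" and w: "0 < w" "\<And>x. x \<in> S \<Longrightarrow> 0 < bdef x \<and> bdef x \<le> w"
  shows "ennreal ((2 / w) ^ CARD('n)) * emeasure lborel S \<le> emeasure hvol S"
proof -
  have "ennreal ((2 / w) ^ CARD('n)) * emeasure lborel S = (\<integral>\<^sup>+x. ennreal ((2 / w) ^ CARD('n)) * indicator S x \<partial>lborel)"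
    by (rule nn_integral_cmult_indicator[symmetric]) simp
  also have "\<dots> \<le> emeasure hvol S"
    unfolding emeasure_hvol[OF assms(1)]
  proof (rule nn_integral_mono)
    fix x :: "real^'n"
    show "ennreal ((2 / w) ^ CARD('n)) * indicator S x \<le> ennreal (indicator (ball 0 1) x * conf x ^ CARD('n) * indicator S x)"
    proof (cases "x \<in> S")
      case True
      then have b: "bdef x \<le> w" "0 < bdef x" using w by auto
      then have "2 / w \<le> conf x" "0 \<le> 2 / w" unfolding conf_bdef using w by (auto intro!: divide_left_mono)
      then have "(2 / w) ^ CARD('n) \<le> conf x ^ CARD('n)" by (rule power_mono)
      then show ?thesis using True b bdef_pos_iff[of x] by (auto intro!: ennreal_leI)
    qed simp
  qed
  finally show ?thesis .
qed

lemma emeasure_annulus: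
  fixes r s :: real
  assumes "0 \<le> r" "r \<le> s"
  shows "emeasure lborel (ball (0::real^'n) s - ball 0 r) = ennreal (unit_ball_vol (real CARD('n)) * (s ^ CARD('n) - r ^ CARD('n)))"
proof -
  have b: "emeasure lborel (ball (0::real^'n) t) = ennreal (unit_ball_vol (real CARD('n)) * t ^ CARD('n))" if "0 \<le> t" for t
    using emeasure_ball[OF that, of "0::real^'n"] by simp
  have "emeasure lborel (ball (0::real^'n) s - ball 0 r) = emeasure lborel (ball (0::real^'n) s) - emeasure lborel (ball (0::real^'n) r)"
    by (rule emeasure_Diff) (use assms in \<open>auto simp: b\<close>)
  also have "\<dots> = ennreal (unit_ball_vol (real CARD('n)) * s ^ CARD('n) - unit_ball_vol (real CARD('n)) * r ^ CARD('n))"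
    using assms by (subst (1 2) b) (auto intro!: ennreal_minus)
  finally show ?thesis by (simp add: algebra_simps)
qed

text \<open>The dummy argument carries the dimension, which the type of w does not
  determine.\<close>

definition Vol :: "'n::finite itself \<Rightarrow> real \<Rightarrow> ennreal" where
  "Vol _ w = emeasure hvol {x::real^'n. w < bdef x}"

text \<open>The shell between v = w / 2 and v = w has Euclidean volume at most a multiple of w and
  density at most (4 / w)^n, hence hyperbolic volume at most a multiple of (1 / w)^(n - 1). From one
  dyadic step to the next this at least doubles, as n >= 2, so the last shell controls the
  sum.\<close>

lemma Vol_dyadic:
  assumes "2 \<le> CARD('n::finite)"
  shows "\<exists>K>0. \<forall>k. Vol TYPE('n) (1 / 2 ^ k) \<le> ennreal (K * (2 ^ k) ^ (CARD('n) - 1))"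
proof -
  let ?n = "CARD('n)"
  define \<omega> where "\<omega> = unit_ball_vol (real ?n)"
  have \<omega>: "0 < \<omega>" by (simp add: \<omega>_def)
  define K where "K = 4 ^ ?n * \<omega> * real ?n"
  have K: "0 < K" using \<omega> by (simp add: K_def)
  have "Vol TYPE('n) (1 / 2 ^ k) \<le> ennreal (K * (2 ^ k) ^ (?n - 1))" for k
  proof (induction k)
    case 0
    have e: "{x::real^'n. 1 < bdef x} = {}" using bdef_le_1 by (auto simp: not_less)
    show ?case by (simp add: Vol_def e)
  next
    case (Suc k)
    define w where "w = (1 / 2 ^ k :: real)"
    have w: "0 < w" "w \<le> 1" by (auto simp: w_def)
    let ?S = "{x::real^'n. w / 2 < bdef x \<and> bdef x \<le> w}"
    have "?S \<subseteq> ball 0 1 - ball 0 (sqrt (1 - w))"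
    proof safe
      fix x :: "real^'n" assume x: "w / 2 < bdef x" "bdef x \<le> w"
      then show "x \<in> ball 0 1" using w bdef_pos_iff[of x] by auto
      assume "x \<in> ball 0 (sqrt (1 - w))"
      then have "(norm x)^2 < (sqrt (1 - w))^2" by (intro power_strict_mono) auto
      then show False using x w by (simp add: bdef_def)
    qed
    then have "emeasure lborel ?S \<le> emeasure lborel (ball (0::real^'n) 1 - ball 0 (sqrt (1 - w)))" by (intro emeasure_mono) auto
    also have "\<dots> = ennreal (\<omega> * (1 ^ ?n - sqrt (1 - w) ^ ?n))"
      unfolding \<omega>_def by (rule emeasure_annulus) (use w in auto)
    also have "\<dots> \<le> ennreal (\<omega> * (real ?n * w))"
    proof (intro ennreal_leI mult_left_mono)
      have "1 - real ?n * w \<le> (1 - w) ^ ?n" using Bernoulli_inequality[of "- w" ?n] w by simp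
      also have "\<dots> = sqrt (1 - w) ^ (2 * ?n)" using w by (simp add: power_mult)
      also have "\<dots> \<le> sqrt (1 - w) ^ ?n" using w by (intro power_decreasing) auto
      finally show "1 ^ ?n - sqrt (1 - w) ^ ?n \<le> real ?n * w" by simp
    qed (use \<omega> in auto)
    finally have S: "emeasure lborel ?S \<le> ennreal (\<omega> * (real ?n * w))" .
    have [measurable]: "?S \<in> sets borel" by measurable
    have "emeasure hvol ?S \<le> ennreal ((2 / (w / 2)) ^ ?n) * emeasure lborel ?S"
      by (rule emeasure_hvol_upper) (use w in auto)
    also have "\<dots> \<le> ennreal ((2 / (w / 2)) ^ ?n) * ennreal (\<omega> * (real ?n * w))" by (intro mult_left_mono S) auto
    also have "\<dots> = ennreal ((2 / (w / 2)) ^ ?n * (\<omega> * (real ?n * w)))" using w by (intro ennreal_mult'[symmetric]) auto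
    also have "(2 / (w / 2)) ^ ?n * (\<omega> * (real ?n * w)) = K * (2 ^ k) ^ (?n - 1)"
    proof -
      have "(2 / (w / 2)) ^ ?n = 4 ^ ?n * (2 ^ k) ^ ?n" by (simp add: w_def power_mult_distrib)
      moreover have "(2 ^ k) ^ ?n * w = (2 ^ k) ^ (?n - 1)"
        using assms by (simp add: w_def power_eq_if[of _ ?n])
      ultimately show ?thesis by (simp add: K_def mult_ac)
    qed
    finally have h: "emeasure hvol ?S \<le> ennreal (K * (2 ^ k) ^ (?n - 1))" .
    have "Vol TYPE('n) (1 / 2 ^ Suc k) \<le> emeasure hvol ({x::real^'n. w < bdef x} \<union> ?S)"
      unfolding Vol_def by (intro emeasure_mono) (auto simp: w_def)
    also have "\<dots> \<le> Vol TYPE('n) w + emeasure hvol ?S" unfolding Vol_def by (rule emeasure_subadditive) auto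
    also have "\<dots> \<le> ennreal (K * (2 ^ k) ^ (?n - 1)) + ennreal (K * (2 ^ k) ^ (?n - 1))"
      using Suc h by (intro add_mono) (auto simp: w_def)
    also have "\<dots> = ennreal (2 * (K * (2 ^ k) ^ (?n - 1)))" using K by (simp add: ennreal_plus[symmetric] del: ennreal_plus)
    also have "\<dots> \<le> ennreal (K * (2 ^ Suc k) ^ (?n - 1))"
    proof (rule ennreal_leI)
      have "(2::real) ^ 1 \<le> 2 ^ (?n - 1)" using assms by (intro power_increasing) auto
      then have "2 * (K * (2 ^ k) ^ (?n - 1)) \<le> 2 ^ (?n - 1) * (K * (2 ^ k) ^ (?n - 1))" using K by (intro mult_right_mono) auto
      then show "2 * (K * (2 ^ k) ^ (?n - 1)) \<le> K * (2 ^ Suc k) ^ (?n - 1)" by (simp add: power_mult_distrib mult_ac)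
    qed
    finally show ?case .
  qed
  then show ?thesis using K by blast
qed

text \<open>One shell suffices: for w < v <= 2 w the density is at least (1 / w)^n, and the
  Euclidean volume is at least a multiple of w. The bound w <= 1 / 4 keeps the outer radius at least
  1 / 2.\<close>

lemma Vol_lower:
  assumes "2 \<le> CARD('n::finite)"
  shows "\<exists>\<kappa>>0. \<forall>w. 0 < w \<longrightarrow> w \<le> 1 / 4 \<longrightarrow> ennreal (\<kappa> * (1 / w) ^ (CARD('n) - 1)) \<le> Vol TYPE('n) w"
proof -
  let ?n = "CARD('n)"
  define \<omega> where "\<omega> = unit_ball_vol (real ?n)"
  have \<omega>: "0 < \<omega>" by (simp add: \<omega>_def)
  define \<kappa> where "\<kappa> = \<omega> * (1 / 2) ^ (?n - 2)"
  have "ennreal (\<kappa> * (1 / w) ^ (?n - 1)) \<le> Vol TYPE('n) w" if w: "0 < w" "w \<le> 1 / 4" for w :: real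
  proof -
    define r where "r = sqrt (1 - 2 * w)"
    define s where "s = sqrt (1 - w)"
    have rs: "0 \<le> r" "r \<le> s" "1 / 2 \<le> s" "s\<^sup>2 = 1 - w" "r\<^sup>2 = 1 - 2 * w"
    proof -
      show "1 / 2 \<le> s" unfolding s_def by (rule real_le_rsqrt) (use w in \<open>simp add: power2_eq_square\<close>)
    qed (use w in \<open>auto simp: r_def s_def\<close>)
    let ?S = "ball (0::real^'n) s - ball 0 r"
    have [measurable]: "?S \<in> sets borel" by measurable
    have Sb: "w < bdef x \<and> bdef x \<le> 2 * w" if "x \<in> ?S" for x
    proof -
      have "r \<le> norm x" "norm x < s" using that by auto
      then have "r^2 \<le> (norm x)^2" "(norm x)^2 < s^2" using rs(1) by (simp_all only: power_mono power_strict_mono norm_ge_zero pos2)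
      then show ?thesis by (simp add: bdef_def rs)
    qed
    obtain k where k: "?n = Suc (Suc k)"
    proof
      show "?n = Suc (Suc (?n - 2))" using assms by simp
    qed
    have "s ^ ?n - r ^ ?n \<ge> w * (1 / 2) ^ (?n - 2)"
    proof -
      have "r^2 * r ^ k \<le> r^2 * s ^ k" using rs(1,2) by (intro mult_left_mono power_mono) auto
      then have "s ^ ?n - r ^ ?n \<ge> (s^2 - r^2) * s ^ k" by (simp add: k power2_eq_square algebra_simps)
      moreover have "s^2 - r^2 = w" using rs by simp
      moreover have "w * (1 / 2) ^ k \<le> w * s ^ k" using rs(3) w by (intro mult_left_mono power_mono) auto
      ultimately show ?thesis by (simp add: k)
    qed
    then have a: "\<omega> * (w * (1 / 2) ^ (?n - 2)) \<le> \<omega> * (s ^ ?n - r ^ ?n)" using \<omega> by (intro mult_left_mono) auto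
    have "ennreal ((1 / w) ^ ?n * (\<omega> * (w * (1 / 2) ^ (?n - 2)))) \<le> ennreal ((2 / (2 * w)) ^ ?n * (\<omega> * (s ^ ?n - r ^ ?n)))"
    proof (intro ennreal_leI)
      have "2 / (2 * w) = 1 / w" by simp
      then show "(1 / w) ^ ?n * (\<omega> * (w * (1 / 2) ^ (?n - 2))) \<le> (2 / (2 * w)) ^ ?n * (\<omega> * (s ^ ?n - r ^ ?n))"
        using mult_left_mono[OF a, of "(1 / w) ^ ?n"] w by (metis zero_le_power zero_le_divide_iff less_imp_le zero_le_one)
    qed
    also have "\<dots> = ennreal ((2 / (2 * w)) ^ ?n) * emeasure lborel ?S"
      unfolding emeasure_annulus[OF rs(1,2)] \<omega>_def[symmetric] using w by (intro ennreal_mult') auto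
    also have "\<dots> \<le> emeasure hvol ?S" by (rule emeasure_hvol_lower) (use Sb w in \<open>force+\<close>)
    also have "\<dots> \<le> Vol TYPE('n) w" unfolding Vol_def using Sb by (intro emeasure_mono) auto
    finally have "ennreal ((1 / w) ^ ?n * (\<omega> * (w * (1 / 2) ^ (?n - 2)))) \<le> Vol TYPE('n) w" .
    moreover have "(1 / w) ^ ?n * (\<omega> * (w * (1 / 2) ^ (?n - 2))) = \<kappa> * (1 / w) ^ (?n - 1)"
      using w by (simp add: \<kappa>_def k)
    ultimately show ?thesis by simp
  qed
  moreover have "0 < \<kappa>" using \<omega> by (simp add: \<kappa>_def)
  ultimately show ?thesis by blast
qed

text \<open>Polynomials in \<open>v\<close> and \<open>y = 1 / (l v - 1)\<close>; the second argument is the value at \<open>v = y = 0\<close>. The class is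
  closed under the derivatives produced by \<open>profile\<close>, as \<open>dy/dv = - y (1 + y) / v\<close>.\<close>
inductive amplitude :: "(real \<Rightarrow> real \<Rightarrow> real) \<Rightarrow> real \<Rightarrow> bool" where
  const: "amplitude (\<lambda>l v. c) c"
| var: "amplitude (\<lambda>l v. v) 0"
| rec: "amplitude (\<lambda>l v. 1 / (l * v - 1)) 0"
| add: "amplitude g c \<Longrightarrow> amplitude h d \<Longrightarrow> amplitude (\<lambda>l v. g l v + h l v) (c + d)"
| mult: "amplitude g c \<Longrightarrow> amplitude h d \<Longrightarrow> amplitude (\<lambda>l v. g l v * h l v) (c * d)"

lemma DERIV_rec:
  fixes l v :: real
  assumes "0 < v" "1 < l * v"
  defines "y \<equiv> 1 / (l * v - 1)"
  shows "((\<lambda>v. 1 / (l * v - 1)) has_real_derivative - 1 * (y * y + y) / v) (at v)"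
proof -
  have d: "((\<lambda>v. 1 / (l * v - 1)) has_real_derivative - l / (l * v - 1)^2) (at v)"
    using assms(2) by (auto intro!: derivative_eq_intros simp: power2_eq_square)
  define z where "z = l * v - 1"
  have z: "0 < z" using assms(2) by (simp add: z_def)
  have l: "(z + 1) / v = l" using assms(1) by (simp add: z_def)
  have "- ((z + 1) / v) / z^2 = - 1 * (1 / z * (1 / z) + 1 / z) / v"
    using assms(1) z by (simp add: field_simps power2_eq_square)
  then show ?thesis using d unfolding l unfolding y_def z_def by metis
qed

text \<open>The derivation v d/dv maps both generators v and y to polynomials vanishing at v = y =
  0, and hence every polynomial in them.\<close>

lemma amplitude_deriv:
  assumes "amplitude g c"
  shows "\<exists>g'. amplitude g' 0 \<and> (\<forall>l v. 0 < v \<longrightarrow> 1 < l * v \<longrightarrow> ((\<lambda>v. g l v) has_real_derivative g' l v / v) (at v))"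
  using assms
proof induction
  case (const c)
  show ?case by (intro exI[of _ "\<lambda>l v. 0"] conjI amplitude.const) auto
next
  case var
  show ?case by (intro exI[of _ "\<lambda>l v. v"] conjI amplitude.var) (auto intro!: derivative_eq_intros)
next
  case rec
  let ?y = "\<lambda>l v::real. 1 / (l * v - 1)"
  have "amplitude (\<lambda>l v. - 1 * (?y l v * ?y l v + ?y l v)) (- 1 * (0 * 0 + 0))" by (intro amplitude.intros)
  moreover have "(?y l has_real_derivative - 1 * (?y l v * ?y l v + ?y l v) / v) (at v)" if "0 < v" "1 < l * v" for l v
    by (rule DERIV_rec[OF that])
  ultimately show ?case by (intro exI[of _ "\<lambda>l v. - 1 * (?y l v * ?y l v + ?y l v)"]) simp
next
  case (add g c h d)
  obtain g' where g': "amplitude g' 0" "\<forall>l v. 0 < v \<longrightarrow> 1 < l * v \<longrightarrow> ((\<lambda>v. g l v) has_real_derivative g' l v / v) (at v)"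
    using add.IH(1) by (elim exE conjE)
  obtain h' where h': "amplitude h' 0" "\<forall>l v. 0 < v \<longrightarrow> 1 < l * v \<longrightarrow> ((\<lambda>v. h l v) has_real_derivative h' l v / v) (at v)"
    using add.IH(2) by (elim exE conjE)
  have "amplitude (\<lambda>l v. g' l v + h' l v) (0 + 0)" by (rule amplitude.add[OF g'(1) h'(1)])
  moreover have "((\<lambda>v. g l v + h l v) has_real_derivative (g' l v + h' l v) / v) (at v)" if "0 < v" "1 < l * v" for l v
    using DERIV_add[OF g'(2)[rule_format, OF that] h'(2)[rule_format, OF that]] by (simp add: add_divide_distrib)
  ultimately show ?case by (intro exI[of _ "\<lambda>l v. g' l v + h' l v"]) simp
next
  case (mult g c h d)
  obtain g' where g': "amplitude g' 0" "\<forall>l v. 0 < v \<longrightarrow> 1 < l * v \<longrightarrow> ((\<lambda>v. g l v) has_real_derivative g' l v / v) (at v)"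
    using mult.IH(1) by (elim exE conjE)
  obtain h' where h': "amplitude h' 0" "\<forall>l v. 0 < v \<longrightarrow> 1 < l * v \<longrightarrow> ((\<lambda>v. h l v) has_real_derivative h' l v / v) (at v)"
    using mult.IH(2) by (elim exE conjE)
  have "amplitude (\<lambda>l v. g' l v * h l v + h' l v * g l v) (0 * d + 0 * c)"
    by (rule amplitude.add[OF amplitude.mult[OF g'(1) mult.hyps(2)] amplitude.mult[OF h'(1) mult.hyps(1)]])
  moreover have "((\<lambda>v. g l v * h l v) has_real_derivative (g' l v * h l v + h' l v * g l v) / v) (at v)" if "0 < v" "1 < l * v" for l v
    using DERIV_mult[OF g'(2)[rule_format, OF that] h'(2)[rule_format, OF that]] by (simp add: add_divide_distrib)
  ultimately show ?case by (intro exI[of _ "\<lambda>l v. g' l v * h l v + h' l v * g l v"]) simp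
qed

text \<open>Near the cutoff y is unbounded and only polynomial growth in y can be expected; the
  exponential in \<open>profile\<close> will absorb it.\<close>

lemma amplitude_bound:
  assumes "amplitude g c"
  shows "\<exists>K j. 0 \<le> K \<and> (\<forall>l v. 0 < v \<longrightarrow> v \<le> 1 \<longrightarrow> 1 < l * v \<longrightarrow> \<bar>g l v\<bar> \<le> K * (1 + 1 / (l * v - 1)) ^ j)"
  using assms
proof induction
  case (const c)
  show ?case by (intro exI[of _ "\<bar>c\<bar>"] exI[of _ 0]) auto
next
  case var
  show ?case by (intro exI[of _ 1] exI[of _ 0]) auto
next
  case rec
  show ?case by (intro exI[of _ 1] exI[of _ 1]) auto
next
  case (add g c h d)
  obtain K j where K0: "0 \<le> K \<and> (\<forall>l v. 0 < v \<longrightarrow> v \<le> 1 \<longrightarrow> 1 < l * v \<longrightarrow> \<bar>g l v\<bar> \<le> K * (1 + 1 / (l * v - 1)) ^ j)" using add.IH(1) by (elim exE)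
  obtain K' j' where K0': "0 \<le> K' \<and> (\<forall>l v. 0 < v \<longrightarrow> v \<le> 1 \<longrightarrow> 1 < l * v \<longrightarrow> \<bar>h l v\<bar> \<le> K' * (1 + 1 / (l * v - 1)) ^ j')" using add.IH(2) by (elim exE)
  note K = K0[THEN conjunct1] K0[THEN conjunct2, rule_format] and K' = K0'[THEN conjunct1] K0'[THEN conjunct2, rule_format]
  have "\<bar>g l v + h l v\<bar> \<le> (K + K') * (1 + 1 / (l * v - 1)) ^ (j + j')" if "0 < v" "v \<le> 1" "1 < l * v" for l v
  proof -
    let ?y = "1 + 1 / (l * v - 1)"
    have y: "1 \<le> ?y" using that by auto
    have "K * ?y ^ j \<le> K * ?y ^ (j + j')" "K' * ?y ^ j' \<le> K' * ?y ^ (j + j')"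
      using y K K' by (auto intro!: mult_left_mono power_increasing)
    then have "\<bar>g l v\<bar> + \<bar>h l v\<bar> \<le> K * ?y ^ (j + j') + K' * ?y ^ (j + j')"
      using K(2)[OF that] K'(2)[OF that] by linarith
    also have "\<dots> = (K + K') * ?y ^ (j + j')" by (rule distrib_right[symmetric])
    finally show ?thesis using abs_triangle_ineq[of "g l v" "h l v"] by linarith
  qed
  then show ?case using K(1) K'(1) by (intro exI[of _ "K + K'"] exI[of _ "j + j'"]) auto
next
  case (mult g c h d)
  obtain K j where K0: "0 \<le> K \<and> (\<forall>l v. 0 < v \<longrightarrow> v \<le> 1 \<longrightarrow> 1 < l * v \<longrightarrow> \<bar>g l v\<bar> \<le> K * (1 + 1 / (l * v - 1)) ^ j)" using mult.IH(1) by (elim exE)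
  obtain K' j' where K0': "0 \<le> K' \<and> (\<forall>l v. 0 < v \<longrightarrow> v \<le> 1 \<longrightarrow> 1 < l * v \<longrightarrow> \<bar>h l v\<bar> \<le> K' * (1 + 1 / (l * v - 1)) ^ j')" using mult.IH(2) by (elim exE)
  note K = K0[THEN conjunct1] K0[THEN conjunct2, rule_format] and K' = K0'[THEN conjunct1] K0'[THEN conjunct2, rule_format]
  have "\<bar>g l v * h l v\<bar> \<le> (K * K') * (1 + 1 / (l * v - 1)) ^ (j + j')" if "0 < v" "v \<le> 1" "1 < l * v" for l v
  proof -
    have "\<bar>g l v\<bar> * \<bar>h l v\<bar> \<le> (K * (1 + 1 / (l * v - 1)) ^ j) * (K' * (1 + 1 / (l * v - 1)) ^ j')"
      using K(2)[OF that] K'(2)[OF that] by (intro mult_mono) (auto intro: order_trans[OF abs_ge_zero])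
    then show ?thesis by (simp add: abs_mult power_add mult_ac)
  qed
  then show ?case using K(1) K'(1) by (intro exI[of _ "K * K'"] exI[of _ "j + j'"]) auto
qed

text \<open>Where v and y are at most 1, a polynomial in them differs from its value at the origin
  by at most a multiple of v + y.\<close>

lemma amplitude_asymptotic:
  assumes "amplitude g c"
  shows "\<exists>K. 0 \<le> K \<and> (\<forall>l v. 0 < v \<longrightarrow> v \<le> 1 \<longrightarrow> 1 < l * v \<longrightarrow> 1 / (l * v - 1) \<le> 1 \<longrightarrow> \<bar>g l v - c\<bar> \<le> K * (v + 1 / (l * v - 1)))"
  using assms
proof induction
  case (const c)
  show ?case by (intro exI[of _ 0]) auto
next
  case var
  show ?case by (intro exI[of _ 1]) auto
next
  case rec
  show ?case by (intro exI[of _ 1]) auto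
next
  case (add g c h d)
  obtain K where K0: "0 \<le> K \<and> (\<forall>l v. 0 < v \<longrightarrow> v \<le> 1 \<longrightarrow> 1 < l * v \<longrightarrow> 1 / (l * v - 1) \<le> 1 \<longrightarrow> \<bar>g l v - c\<bar> \<le> K * (v + 1 / (l * v - 1)))" using add.IH(1) by (elim exE)
  obtain K' where K0': "0 \<le> K' \<and> (\<forall>l v. 0 < v \<longrightarrow> v \<le> 1 \<longrightarrow> 1 < l * v \<longrightarrow> 1 / (l * v - 1) \<le> 1 \<longrightarrow> \<bar>h l v - d\<bar> \<le> K' * (v + 1 / (l * v - 1)))" using add.IH(2) by (elim exE)
  note K = K0[THEN conjunct1] K0[THEN conjunct2, rule_format] and K' = K0'[THEN conjunct1] K0'[THEN conjunct2, rule_format]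
  have "\<bar>g l v + h l v - (c + d)\<bar> \<le> (K + K') * (v + 1 / (l * v - 1))" if "0 < v" "v \<le> 1" "1 < l * v" "1 / (l * v - 1) \<le> 1" for l v
  proof -
    have "g l v + h l v - (c + d) = (g l v - c) + (h l v - d)" by simp
    then have "\<bar>g l v + h l v - (c + d)\<bar> \<le> \<bar>g l v - c\<bar> + \<bar>h l v - d\<bar>" by (metis abs_triangle_ineq)
    then show ?thesis using K(2)[OF that] K'(2)[OF that] unfolding distrib_right by linarith
  qed
  then show ?case using K(1) K'(1) by (intro exI[of _ "K + K'"]) auto
next
  case (mult g c h d)
  obtain K where K0: "0 \<le> K \<and> (\<forall>l v. 0 < v \<longrightarrow> v \<le> 1 \<longrightarrow> 1 < l * v \<longrightarrow> 1 / (l * v - 1) \<le> 1 \<longrightarrow> \<bar>g l v - c\<bar> \<le> K * (v + 1 / (l * v - 1)))" using mult.IH(1) by (elim exE)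
  obtain K' where K0': "0 \<le> K' \<and> (\<forall>l v. 0 < v \<longrightarrow> v \<le> 1 \<longrightarrow> 1 < l * v \<longrightarrow> 1 / (l * v - 1) \<le> 1 \<longrightarrow> \<bar>h l v - d\<bar> \<le> K' * (v + 1 / (l * v - 1)))" using mult.IH(2) by (elim exE)
  note K = K0[THEN conjunct1] K0[THEN conjunct2, rule_format] and K' = K0'[THEN conjunct1] K0'[THEN conjunct2, rule_format]
  have "\<bar>g l v * h l v - c * d\<bar> \<le> ((\<bar>c\<bar> + 2 * K) * K' + \<bar>d\<bar> * K) * (v + 1 / (l * v - 1))" if v: "0 < v" "v \<le> 1" "1 < l * v" "1 / (l * v - 1) \<le> 1" for l v
  proof -
    define t where "t = v + 1 / (l * v - 1)"
    have t: "0 \<le> t" "t \<le> 2" unfolding t_def using v by (auto intro: add_nonneg_nonneg) (use v(2,4) in linarith)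
    have a: "\<bar>g l v - c\<bar> \<le> K * t" "\<bar>h l v - d\<bar> \<le> K' * t" using K(2)[OF v] K'(2)[OF v] by (auto simp: t_def)
    have "K * t \<le> K * 2" using K t by (intro mult_left_mono) auto
    then have gb: "\<bar>g l v\<bar> \<le> \<bar>c\<bar> + 2 * K" using a(1) by linarith
    have "g l v * h l v - c * d = g l v * (h l v - d) + d * (g l v - c)" by (simp add: algebra_simps)
    then have "\<bar>g l v * h l v - c * d\<bar> \<le> \<bar>g l v\<bar> * \<bar>h l v - d\<bar> + \<bar>d\<bar> * \<bar>g l v - c\<bar>"
      using abs_triangle_ineq[of "g l v * (h l v - d)" "d * (g l v - c)"] by (simp add: abs_mult)
    also have "\<dots> \<le> (\<bar>c\<bar> + 2 * K) * (K' * t) + \<bar>d\<bar> * (K * t)"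
      using a gb K K' by (intro add_mono mult_mono) auto
    also have "\<dots> = ((\<bar>c\<bar> + 2 * K) * K' + \<bar>d\<bar> * K) * t" by (simp add: algebra_simps)
    finally show ?thesis by (simp add: t_def)
  qed
  then show ?case using K(1) K'(1) by (intro exI[of _ "(\<bar>c\<bar> + 2 * K) * K' + \<bar>d\<bar> * K"]) auto
qed

section \<open>Derivatives of smoothly truncated powers\<close>

lemma exp_power_bound:
  fixes y :: real
  assumes "0 \<le> y" "0 < k"
  shows "exp (- y) * (1 + y) ^ k \<le> real k ^ k"
proof -
  have "1 + y \<le> real k * (1 + y / real k)" using assms by (simp add: field_simps)
  also have "\<dots> \<le> real k * exp (y / real k)" using exp_ge_add_one_self[of "y / real k"] assms by (intro mult_left_mono) auto
  finally have "(1 + y) ^ k \<le> (real k * exp (y / real k)) ^ k" using assms by (intro power_mono) auto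
  also have "\<dots> = real k ^ k * exp y" using assms by (simp add: power_mult_distrib exp_of_nat_mult[symmetric])
  finally have "exp (- y) * (1 + y) ^ k \<le> exp (- y) * (real k ^ k * exp y)" by (intro mult_left_mono) auto
  also have "\<dots> = real k ^ k" by (simp add: exp_minus)
  finally show ?thesis .
qed

text \<open>The factor \<open>exp (- y)\<close> cuts \<open>v powr b\<close> off smoothly at \<open>v = 1 / l\<close>.\<close>
definition profile :: "real \<Rightarrow> (real \<Rightarrow> real \<Rightarrow> real) \<Rightarrow> real \<Rightarrow> real \<Rightarrow> real" where
  "profile b g l v = (if 1 < l * v then v powr b * exp (- (1 / (l * v - 1))) * g l v else 0)"

text \<open>Differentiating v powr b multiplies the limit by b; the derivatives of the cutoff and of
  g only contribute terms that vanish at v = y = 0. At l v = 1 the exponential beats every power of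
  y and the derivative is 0.\<close>

lemma profile_deriv:
  assumes "amplitude g c"
  shows "\<exists>h. amplitude h (b * c) \<and> (\<forall>l>1. \<forall>v. (profile b g l has_real_derivative profile (b - 1) h l v) (at v))"
proof -
  let ?y = "\<lambda>l v::real. 1 / (l * v - 1)"
  obtain g' where g0: "amplitude g' 0" "\<forall>l v. 0 < v \<longrightarrow> 1 < l * v \<longrightarrow> ((\<lambda>v. g l v) has_real_derivative g' l v / v) (at v)"
    using amplitude_deriv[OF assms] by (elim exE conjE)
  note g' = g0(1) g0(2)[rule_format]
  define h where "h l v = b * g l v + (g' l v + (?y l v * ?y l v + ?y l v) * g l v)" for l v
  have "amplitude h (b * c + (0 + (0 * 0 + 0) * c))" unfolding h_def[abs_def] using assms g'(1) by (intro amplitude.intros)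
  moreover have "(profile b g l has_real_derivative profile (b - 1) h l v) (at v)" if l: "1 < l" for l v
  proof -
    consider "1 < l * v" | "l * v < 1" | "l * v = 1" by linarith
    then show ?thesis
    proof cases
      case 1
      have v: "0 < v" using 1 l by (metis less_trans zero_less_mult_pos zero_less_one)
      have y: "((\<lambda>v. ?y l v) has_real_derivative - (?y l v * ?y l v + ?y l v) / v) (at v)"
        using DERIV_rec[OF v 1] by simp
      have e: "((\<lambda>v. exp (- ?y l v)) has_real_derivative exp (- ?y l v) * ((?y l v * ?y l v + ?y l v) / v)) (at v)"
        by (rule DERIV_cong[OF DERIV_fun_exp[OF DERIV_minus[OF y]]]) (simp only: minus_divide_left minus_minus)
      have pw: "((\<lambda>v. v powr b) has_real_derivative b * v powr (b - 1)) (at v)"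
        using has_real_derivative_powr[OF v] .
      have vb: "v powr b = v * v powr (b - 1)" using v powr_mult_base[of v "b - 1"] by simp
      have "((\<lambda>v. v powr b * exp (- ?y l v) * g l v) has_real_derivative v powr (b - 1) * exp (- ?y l v) * h l v) (at v)"
        by (rule DERIV_cong[OF DERIV_mult[OF DERIV_mult[OF pw e] g'(2)[OF v 1]]])
          (use v in \<open>simp add: h_def vb field_simps\<close>)
      then have "(profile b g l has_real_derivative v powr (b - 1) * exp (- ?y l v) * h l v) (at v)"
      proof (rule has_field_derivative_transform_within_open[where S = "{v. 1 < l * v}"])
        show "open {v. 1 < l * v}" by (intro open_Collect_less continuous_intros)
      qed (use 1 in \<open>auto simp: profile_def\<close>)
      then show ?thesis using 1 by (simp add: profile_def)
    next
      case 2
      have "((\<lambda>_. 0) has_real_derivative 0) (at v)" by simp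
      then have "(profile b g l has_real_derivative 0) (at v)"
      proof (rule has_field_derivative_transform_within_open[where S = "{v. l * v < 1}"])
        show "open {v. l * v < 1}" by (intro open_Collect_less continuous_intros)
      qed (use 2 in \<open>auto simp: profile_def\<close>)
      then show ?thesis using 2 by (simp add: profile_def)
    next
      case 3
      have "v = 1 / l" using 3 l by (simp add: field_simps)
      then have v: "0 < v" "v < 1" using l by simp_all
      obtain K j where K0: "0 \<le> K \<and> (\<forall>l v. 0 < v \<longrightarrow> v \<le> 1 \<longrightarrow> 1 < l * v \<longrightarrow> \<bar>g l v\<bar> \<le> K * (1 + ?y l v) ^ j)"
        using amplitude_bound[OF assms] by (elim exE)
      note K = K0[THEN conjunct1] K0[THEN conjunct2, rule_format]
      define P where "P = max 1 (v powr b)"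
      \<comment> \<open>Two powers of 1 + y beyond the growth j of g are traded for 1 / y^2 = (l (w
        - v))^2, which gives a quadratic bound at the cutoff.\<close>
      define Q where "Q = P * (K * real (j + 2) ^ (j + 2)) * l^2"
      \<comment> \<open>Within distance 1 - v of v, the point w stays at most 1, as the bound on g
        requires.\<close>
      have bnd: "\<bar>profile b g l w\<bar> \<le> Q * (w - v)^2" if w: "\<bar>w - v\<bar> < 1 - v" for w
      proof (cases "1 < l * w")
        case True
        have "l * v < l * w" using True 3 by simp
        then have wv: "v < w" using l by simp
        have w1: "w \<le> 1" "0 < w" using w wv v by auto
        have y0: "0 < ?y l w" using True by simp
        have lw: "l * w - 1 = l * (w - v)" using 3 by (simp add: algebra_simps)
        have "w powr b \<le> P"
        proof (cases "0 \<le> b")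
          case True
          then have "w powr b \<le> 1 powr b" using w1 by (intro powr_mono2) auto
          then show ?thesis by (simp add: P_def)
        next
          case False
          then have "w powr b \<le> v powr b" using wv v by (intro powr_mono2') auto
          then show ?thesis by (simp add: P_def)
        qed
        have "exp (- ?y l w) * \<bar>g l w\<bar> \<le> exp (- ?y l w) * (K * (1 + ?y l w) ^ j)"
          using K(2)[OF w1(2,1) True] by (intro mult_left_mono) auto
        also have "\<dots> \<le> K * real (j + 2) ^ (j + 2) * (l * (w - v))^2"
        proof -
          have "exp (- ?y l w) * (1 + ?y l w) ^ (j + 2) \<le> real (j + 2) ^ (j + 2)"
            by (rule exp_power_bound[OF less_imp_le[OF y0]]) simp
          then have "exp (- ?y l w) * (1 + ?y l w) ^ j \<le> real (j + 2) ^ (j + 2) / (1 + ?y l w)^2"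
          proof -
            have "E * b ^ j \<le> R / b^2" if "E * b ^ (j + 2) \<le> R" "0 < b" for E b R :: real
            proof -
              have "E * b ^ j * b^2 \<le> R" using that(1) by (simp only: power_add mult.assoc)
              then show ?thesis using that(2) by (simp only: pos_le_divide_eq zero_less_power)
            qed
            moreover have "0 < 1 + ?y l w" by (rule add_pos_pos[OF zero_less_one y0])
            ultimately show ?thesis using \<open>exp (- ?y l w) * (1 + ?y l w) ^ (j + 2) \<le> real (j + 2) ^ (j + 2)\<close> by blast
          qed
          also have "\<dots> \<le> real (j + 2) ^ (j + 2) / (?y l w)^2"
          proof -
            have "R / (1 + b)^2 \<le> R / b^2" if "0 < b" "0 \<le> R" for b R :: real
              using that by (intro divide_left_mono power_mono mult_pos_pos zero_less_power) auto
            then show ?thesis using y0 by (simp only: zero_le_power of_nat_0_le_iff)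
          qed
          also have "\<dots> = real (j + 2) ^ (j + 2) * (l * (w - v))^2" by (simp add: lw power_divide)
          finally have "K * (exp (- ?y l w) * (1 + ?y l w) ^ j) \<le> K * (real (j + 2) ^ (j + 2) * (l * (w - v))^2)"
            using K(1) by (intro mult_left_mono)
          then show ?thesis by (simp add: mult_ac)
        qed
        finally have fb: "exp (- ?y l w) * \<bar>g l w\<bar> \<le> K * real (j + 2) ^ (j + 2) * (l * (w - v))^2" .
        have "w powr b * (exp (- ?y l w) * \<bar>g l w\<bar>) \<le> P * (K * real (j + 2) ^ (j + 2) * (l * (w - v))^2)"
          by (rule mult_mono'[OF \<open>w powr b \<le> P\<close> fb]) auto
        then show ?thesis using True by (simp add: profile_def abs_mult Q_def power_mult_distrib mult_ac)
      next
        case False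
        have "0 \<le> Q" using K(1) by (simp add: Q_def P_def)
        then show ?thesis using False by (simp add: profile_def)
      qed
      have EEv: "profile b g l v = 0" "profile (b - 1) h l v = 0" using 3 by (auto simp: profile_def)
      have "((\<lambda>w. (profile b g l w - profile b g l v) / (w - v)) \<longlongrightarrow> 0) (at v)"
      proof (rule Lim_null_comparison)
        show "((\<lambda>w. Q * \<bar>w - v\<bar>) \<longlongrightarrow> 0) (at v)"
          by (auto intro!: tendsto_eq_intros)
        have "\<forall>\<^sub>F w in at v. dist w v < 1 - v" using v by (auto simp: eventually_at intro!: exI[of _ "1 - v"])
        then show "\<forall>\<^sub>F w in at v. norm ((profile b g l w - profile b g l v) / (w - v)) \<le> Q * \<bar>w - v\<bar>"
        proof eventually_elim
          case (elim w)
          then have "\<bar>profile b g l w\<bar> \<le> Q * \<bar>w - v\<bar> * \<bar>w - v\<bar>"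
            using bnd[of w] by (simp add: dist_real_def power2_eq_square mult.assoc flip: abs_mult)
          then show ?case by (cases "w = v") (auto simp: EEv abs_divide divide_le_eq)
        qed
      qed
      then show ?thesis unfolding EEv(2) by (simp add: has_field_derivative_iff)
    qed
  qed
  ultimately show ?thesis by (intro exI[of _ h]) auto
qed

lemma smooth1_profile:
  assumes "amplitude g c" "1 < l" shows "smooth1 (profile b g l)"
proof (rule smooth1_coinduct[of _ "{profile b g l |b g c. amplitude g c}"])
  show "profile b g l \<in> {profile b g l |b g c. amplitude g c}" using assms by blast
  fix f assume "f \<in> {profile b g l |b g c. amplitude g c}"
  then obtain b g c where f: "f = profile b g l" "amplitude g c" by blast
  then show "\<exists>f'\<in>{profile b g l |b g c. amplitude g c}. \<forall>x. (f has_real_derivative f' x) (at x)"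
    using profile_deriv[OF f(2), of b] assms(2) by blast
qed

section \<open>Sharpness\<close>

definition test_fn :: "real \<Rightarrow> (real \<Rightarrow> real \<Rightarrow> real) \<Rightarrow> real \<Rightarrow> real^'n \<Rightarrow> real" where
  "test_fn a g l x = profile a g l (bdef x)"

lemma profile_pos: "1 < l * v \<Longrightarrow> 1 < l \<Longrightarrow> 0 < (v::real)"
  by (metis less_trans zero_less_mult_pos zero_less_one)

lemma test_fn_C0inf:
  assumes "amplitude g c" "1 < l" shows "test_fn a g l \<in> C0inf"
proof (rule C0infI[of _ "cball 0 (sqrt (1 - 1 / l))"])
  show "smooth_fn (test_fn a g l :: real^'n \<Rightarrow> real)"
    unfolding test_fn_def[abs_def] by (rule smooth_fn_comp[OF smooth1_profile[OF assms] smooth_fn_bdef])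
  have "1 - 1 / l < 1" using assms(2) by simp
  then have sl: "sqrt (1 - 1 / l) < 1" by (simp only: real_sqrt_lt_1_iff)
  show "cball 0 (sqrt (1 - 1 / l)) \<subseteq> ball (0 :: real^'n) 1"
  proof
    fix x :: "real^'n" assume "x \<in> cball 0 (sqrt (1 - 1 / l))"
    then have "norm x \<le> sqrt (1 - 1 / l)" by simp
    also note sl
    finally show "x \<in> ball 0 1" by simp
  qed
next
  fix x :: "real^'n" assume "x \<notin> cball 0 (sqrt (1 - 1 / l))"
  then have "sqrt (1 - 1 / l) < norm x" by auto
  then have "(sqrt (1 - 1 / l))^2 < (norm x)^2" using assms(2) by (intro power_strict_mono) auto
  then have "bdef x < 1 / l" using assms(2) by (simp add: bdef_def)
  then have "\<not> 1 < l * bdef x" using assms(2) by (simp add: field_simps)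
  then show "test_fn a g l x = 0" by (simp add: test_fn_def profile_def)
qed auto

lemma profile_shift: "1 < l \<Longrightarrow> v * profile (b - 1) h l v = profile b h l v"
  using profile_pos[of l v] powr_mult_base[of v "b - 1"] by (auto simp: profile_def)

lemma pd_profile:
  fixes x :: "real^'n"
  assumes "(profile b g l has_real_derivative profile (b - 1) h l (bdef x)) (at (bdef x))"
  shows "pd i (\<lambda>x::real^'n. profile b g l (bdef x)) x = profile (b - 1) h l (bdef x) * (- 2 * x $ i)"
  by (subst pd_compose[OF smooth_fn_differentiable[OF smooth_fn_bdef] assms]) (simp add: pd_bdef)

lemma sum_coord_sq: "(\<Sum>i\<in>UNIV. x $ i * x $ i) = 1 - bdef (x :: real^'n)"
  using norm_sq_coord[of x] by (simp add: bdef_def)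

text \<open>At the boundary the second derivative contributes a (a - 1) and the first-order term -(n
  - 2) a, together -a (n - 1 - a). All other terms carry a factor v and leave the limit
  unchanged.\<close>

lemma hlap_test_fn:
  assumes g: "amplitude g c"
  shows "\<exists>h. amplitude h (- (a * (real CARD('n) - 1 - a)) * c) \<and> (\<forall>l>1. hlap (test_fn a g l :: real^'n \<Rightarrow> real) = test_fn a h l)"
proof -
  let ?n = "real CARD('n)"
  obtain h1 where h1: "amplitude h1 (a * c)" "\<forall>l>1. \<forall>v. (profile a g l has_real_derivative profile (a - 1) h1 l v) (at v)"
    using profile_deriv[OF g, of a] by (elim exE conjE)
  obtain h2 where h2: "amplitude h2 ((a - 1) * (a * c))" "\<forall>l>1. \<forall>v. (profile (a - 1) h1 l has_real_derivative profile (a - 1 - 1) h2 l v) (at v)"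
    using profile_deriv[OF h1(1), of "a - 1"] by (elim exE conjE)
  \<comment> \<open>For F(v) the Laplacian is (1 - v) v^2 F'' - (n / 2) v^2 F' - (n - 2) (1 - v) v
    F', where v F' and v^2 F'' have the amplitudes h1 and h2.\<close>
  define h where "h = (\<lambda>l v. (1 + (- 1) * v) * h2 l v + ((- ?n / 2) * v * h1 l v + (- (?n - 2)) * (1 + (- 1) * v) * h1 l v))"
  have "amplitude h ((1 + (- 1) * 0) * ((a - 1) * (a * c)) + ((- ?n / 2) * 0 * (a * c) + (- (?n - 2)) * (1 + (- 1) * 0) * (a * c)))"
    unfolding h_def
    by (rule amplitude.add[OF amplitude.mult[OF amplitude.add[OF amplitude.const amplitude.mult[OF amplitude.const amplitude.var]] h2(1)]
      amplitude.add[OF amplitude.mult[OF amplitude.mult[OF amplitude.const amplitude.var] h1(1)] amplitude.mult[OF amplitude.mult[OF amplitude.const amplitude.add[OF amplitude.const amplitude.mult[OF amplitude.const amplitude.var]]] h1(1)]]])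
  moreover have "(1 + (- 1) * 0) * ((a - 1) * (a * c)) + ((- ?n / 2) * 0 * (a * c) + (- (?n - 2)) * (1 + (- 1) * 0) * (a * c)) = - (a * (?n - 1 - a)) * c"
    by (simp add: algebra_simps)
  moreover have "hlap (test_fn a g l :: real^'n \<Rightarrow> real) = test_fn a h l" if l: "1 < l" for l
  proof
    fix x :: "real^'n"
    let ?b = "bdef x"
    let ?E1 = "profile (a - 1) h1 l ?b" and ?E2 = "profile (a - 1 - 1) h2 l ?b"
    have p1: "pd i (test_fn a g l) = (\<lambda>x::real^'n. profile (a - 1) h1 l (bdef x) * (- 2 * x $ i))" for i
      unfolding test_fn_def[abs_def] by (rule ext, rule pd_profile) (use h1(2) l in blast)
    have dE: "(\<lambda>x::real^'n. profile (a - 1) h1 l (bdef x)) differentiable (at x)"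
      by (rule smooth_fn_differentiable, rule smooth_fn_comp[OF smooth1_profile[OF h1(1) l] smooth_fn_bdef])
    have dc: "(\<lambda>x::real^'n. - 2 * x $ i) differentiable (at x)" for i
      by (intro smooth_fn_differentiable smooth_fn_mult smooth_fn_const smooth_fn_coord)
    have pc: "pd i (\<lambda>x::real^'n. - 2 * x $ i) x = - 2" for i
      using pd_mult[of "\<lambda>_. - 2" x "\<lambda>x. x $ i" i, OF differentiable_const smooth_fn_differentiable[OF smooth_fn_coord]]
      by (simp add: pd_coord)
    have p2: "pd i (pd i (test_fn a g l)) x = ?E1 * (- 2) + ?E2 * 4 * (x $ i * x $ i)" for i
      unfolding p1 pd_mult[OF dE dc] pc
      by (subst pd_profile[where h = h2]) (use h2(2) l in auto)
    have "lap0 (test_fn a g l) x = ?b^2 / 4 * (\<Sum>i\<in>UNIV. ?E1 * (- 2) + ?E2 * 4 * (x $ i * x $ i))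
      + (?n - 2) / 2 * ?b * (\<Sum>i\<in>UNIV. ?E1 * (- 2) * (x $ i * x $ i))"
      unfolding lap0_def p2 by (simp add: p1 algebra_simps)
    also have "\<dots> = ?b^2 / 4 * (?n * (?E1 * (- 2)) + ?E2 * 4 * (1 - ?b)) + (?n - 2) / 2 * ?b * (?E1 * (- 2) * (1 - ?b))"
      by (simp only: sum.distrib sum_distrib_left[symmetric] sum_coord_sq sum_constant) (simp add: algebra_simps)
    also have "\<dots> = (1 - ?b) * (?b * (?b * ?E2)) - (?n / 2) * ?b * (?b * ?E1) - (?n - 2) * (1 - ?b) * (?b * ?E1)"
      by (simp add: field_simps power2_eq_square)
    also have "?b * ?E1 = profile a h1 l ?b" by (rule profile_shift[OF l])
    also have "?b * ?E2 = profile (a - 1) h2 l ?b" by (rule profile_shift[OF l])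
    also have "?b * profile (a - 1) h2 l ?b = profile a h2 l ?b" by (rule profile_shift[OF l])
    also have "(1 - ?b) * profile a h2 l ?b - (?n / 2) * ?b * profile a h1 l ?b - (?n - 2) * (1 - ?b) * profile a h1 l ?b = test_fn a h l x"
      unfolding test_fn_def profile_def h_def by (auto simp: algebra_simps)
    finally show "hlap (test_fn a g l) x = test_fn a h l x" by (simp add: hlap_C0inf_eq[OF test_fn_C0inf[OF g l]])
  qed
  ultimately show ?thesis by (intro exI[of _ h]) simp
qed

lemma hlap_funpow_test_fn:
  "\<exists>g. amplitude g ((- (a * (real CARD('n) - 1 - a))) ^ k) \<and> (\<forall>l>1. (hlap ^^ k) (test_fn a (\<lambda>l v. 1) l :: real^'n \<Rightarrow> real) = test_fn a g l)"
proof (induction k)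
  case 0
  show ?case using amplitude.const[of 1] by (intro exI[of _ "\<lambda>l v. 1"]) simp
next
  case (Suc k)
  then obtain g where g: "amplitude g ((- (a * (real CARD('n) - 1 - a))) ^ k)" "\<forall>l>1. (hlap ^^ k) (test_fn a (\<lambda>l v. 1) l :: real^'n \<Rightarrow> real) = test_fn a g l"
    by (elim exE conjE)
  obtain h where h: "amplitude h (- (a * (real CARD('n) - 1 - a)) * (- (a * (real CARD('n) - 1 - a))) ^ k)" "\<forall>l>1. hlap (test_fn a g l :: real^'n \<Rightarrow> real) = test_fn a h l"
    using hlap_test_fn[OF g(1), where 'n='n, of a] by (elim exE conjE)
  show ?case by (rule exI[of _ h]) (use g(2) h in simp)
qed

text \<open>The choice of a makes a (n - 1 - a) equal to (n - 1)^2 / (p p'). For odd m the last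
  gradient multiplies the limit by a. The inequality comes from the factor |x| < 1 in the length of
  the gradient of a function of v.\<close>

lemma hnabla_test_fn:
  assumes p: "1 < p" and n: "2 \<le> CARD('n)"
  defines "a \<equiv> (real CARD('n) - 1) / p"
  shows "\<exists>g c. amplitude g c \<and> \<bar>c\<bar> = Cnmp CARD('n) m p \<and> (\<forall>l>1. \<forall>x::real^'n. hnabla m (test_fn a (\<lambda>l v. 1) l) x \<le> \<bar>test_fn a g l x\<bar>)"
proof -
  define \<kappa> where "\<kappa> = a * (real CARD('n) - 1 - a)"
  have a: "0 < a" using p n by (simp add: a_def)
  have k: "\<kappa> = (real CARD('n) - 1)^2 / (p * (p / (p - 1)))"
    using p by (simp add: \<kappa>_def a_def field_simps power2_eq_square)
  have k0: "0 \<le> \<kappa>" unfolding k using p by auto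
  obtain g where g: "amplitude g ((- \<kappa>) ^ (m div 2))" "\<forall>l>1. (hlap ^^ (m div 2)) (test_fn a (\<lambda>l v. 1) l :: real^'n \<Rightarrow> real) = test_fn a g l"
    using hlap_funpow_test_fn[where 'n='n, of a "m div 2"] unfolding \<kappa>_def by (elim exE conjE)
  show ?thesis
  proof (cases "even m")
    case True
    have "\<bar>(- \<kappa>) ^ (m div 2)\<bar> = Cnmp CARD('n) m p"
      unfolding Cnmp_def Let_def k[symmetric] using True k0 by (simp add: power_abs)
    then show ?thesis using g True by (intro exI[of _ g] exI[of _ "(- \<kappa>) ^ (m div 2)"]) (simp add: hnabla_def)
  next
    case False
    obtain h where h: "amplitude h (a * (- \<kappa>) ^ (m div 2))" "\<forall>l>1. \<forall>v. (profile a g l has_real_derivative profile (a - 1) h l v) (at v)"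
      using profile_deriv[OF g(1), of a] by (elim exE conjE)
    have "(m - 1) div 2 = m div 2" using False by (auto elim!: oddE)
    then have "\<bar>a * (- \<kappa>) ^ (m div 2)\<bar> = Cnmp CARD('n) m p"
      unfolding Cnmp_def Let_def k[symmetric] using False k0 a by (simp add: power_abs abs_mult a_def[symmetric])
    moreover have "hnabla m (test_fn a (\<lambda>l v. 1) l) x \<le> \<bar>test_fn a h l x\<bar>" if l: "1 < l" for l and x :: "real^'n"
    proof -
      have "egrad (test_fn a g l) x = (- 2 * profile (a - 1) h l (bdef x)) *\<^sub>R x"
        unfolding egrad_def test_fn_def[abs_def]
        by (subst pd_profile[where h = h]) (use h(2) l in \<open>auto simp: vec_eq_iff\<close>)
      then have "hnabla m (test_fn a (\<lambda>l v. 1) l) x = \<bar>bdef x\<bar> * \<bar>profile (a - 1) h l (bdef x)\<bar> * norm x"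
        using False g(2) l by (simp add: hnabla_def gnorm_hgrad abs_mult)
      also have "\<dots> = \<bar>profile a h l (bdef x)\<bar> * norm x"
        using profile_shift[OF l, of "bdef x" a h] by (metis abs_mult)
      also have "\<dots> \<le> \<bar>profile a h l (bdef x)\<bar>"
      proof (cases "1 < l * bdef x")
        case True
        then have "x \<in> ball 0 1" using profile_pos[OF True l] bdef_pos_iff by blast
        then show ?thesis by (simp add: mult_left_le)
      qed (simp add: profile_def)
      finally show ?thesis by (simp add: test_fn_def)
    qed
    ultimately show ?thesis using h(1) by (intro exI[of _ h] exI[of _ "a * (- \<kappa>) ^ (m div 2)"]) simp
  qed
qed

section \<open>Lorentz functionals of the test functions\<close>

lemma Vol_antimono: "w \<le> w' \<Longrightarrow> Vol TYPE('n::finite) w' \<le> Vol TYPE('n) w"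
  unfolding Vol_def by (intro emeasure_mono) auto

lemma Vol_fin: assumes "2 \<le> CARD('n::finite)" "0 < w" shows "Vol TYPE('n) w < \<infinity>"
proof -
  obtain K where K: "\<And>k. Vol TYPE('n) (1 / 2 ^ k) \<le> ennreal (K * (2 ^ k) ^ (CARD('n) - 1))"
    using Vol_dyadic[OF assms(1)] by blast
  obtain k where "(1 / 2 :: real) ^ k < w" using real_arch_pow_inv[OF assms(2), of "1/2"] by auto
  then have "Vol TYPE('n) w \<le> Vol TYPE('n) (1 / 2 ^ k)" by (intro Vol_antimono) (simp add: power_divide)
  also have "\<dots> < \<infinity>" using K[of k] by (simp add: le_less_trans)
  finally show ?thesis .
qed

lemma borel_measurable_Vol [measurable]: "Vol TYPE('n::finite) \<in> borel_measurable borel"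
proof -
  have "Vol TYPE('n) = (\<lambda>w. \<integral>\<^sup>+x. indicator {x::real^'n. w < bdef x} x \<partial>hvol)"
    unfolding Vol_def[abs_def] by (subst nn_integral_indicator) auto
  then show ?thesis by simp
qed

lemma nn_integral_scale:
  assumes [measurable]: "F \<in> borel_measurable borel" and D: "0 < D"
  shows "(\<integral>\<^sup>+s. ennreal (q * s powr (q - 1)) * indicator {0<..} s * F s \<partial>lborel)
    = ennreal (D powr q) * (\<integral>\<^sup>+s. ennreal (q * s powr (q - 1)) * indicator {0<..} s * F (D * s) \<partial>lborel)"
proof -
  have "(\<integral>\<^sup>+s. ennreal (q * s powr (q - 1)) * indicator {0<..} s * F s \<partial>lborel)
    = ennreal \<bar>D\<bar> * (\<integral>\<^sup>+s. ennreal (q * (0 + D * s) powr (q - 1)) * indicator {0<..} (0 + D * s) * F (0 + D * s) \<partial>lborel)"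
    by (rule nn_integral_real_affine) (use D in auto)
  also have "\<dots> = (\<integral>\<^sup>+s. ennreal D * (ennreal (q * (D * s) powr (q - 1)) * indicator {0<..} (D * s) * F (D * s)) \<partial>lborel)"
    using D by (simp add: nn_integral_cmult)
  also have "\<dots> = (\<integral>\<^sup>+s. ennreal (D powr q) * (ennreal (q * s powr (q - 1)) * indicator {0<..} s * F (D * s)) \<partial>lborel)"
  proof (rule nn_integral_cong)
    fix s :: real
    show "ennreal D * (ennreal (q * (D * s) powr (q - 1)) * indicator {0<..} (D * s) * F (D * s)) = ennreal (D powr q) * (ennreal (q * s powr (q - 1)) * indicator {0<..} s * F (D * s))"
    proof (cases "0 < s")
      case True
      have "D * (q * (D * s) powr (q - 1)) = D powr q * (q * s powr (q - 1))"
        using D True powr_mult_base[of D "q - 1"] by (simp add: powr_mult)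
      then have "ennreal D * ennreal (q * (D * s) powr (q - 1)) = ennreal (D powr q) * ennreal (q * s powr (q - 1))"
        using D by (simp only: ennreal_mult'[symmetric, OF less_imp_le] ennreal_mult'[symmetric, OF powr_ge_zero])
      then show ?thesis using True D by (simp add: mult.assoc[symmetric])
    qed (use D in \<open>simp add: zero_less_mult_iff\<close>)
  qed
  also have "\<dots> = ennreal (D powr q) * (\<integral>\<^sup>+s. ennreal (q * s powr (q - 1)) * indicator {0<..} s * F (D * s) \<partial>lborel)"
    by (rule nn_integral_cmult) measurable
  finally show ?thesis .
qed

lemma nn_integral_inverse:
  assumes "0 < \<alpha>" "\<alpha> < (\<beta>::real)"
  shows "(\<integral>\<^sup>+s. ennreal (1 / s) * indicator {\<alpha>..<\<beta>} s \<partial>lborel) = ennreal (ln \<beta> - ln \<alpha>)"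
proof -
  have "(\<integral>\<^sup>+s. ennreal (1 / s) * indicator {\<alpha>..\<beta>} s \<partial>lborel) = ennreal (ln \<beta> - ln \<alpha>)"
    by (rule nn_integral_FTC_Icc) (use assms in \<open>auto intro!: derivative_eq_intros\<close>)
  moreover have "(\<integral>\<^sup>+s. ennreal (1 / s) * indicator {\<alpha>..\<beta>} s \<partial>lborel) = (\<integral>\<^sup>+s. ennreal (1 / s) * indicator {\<alpha>..<\<beta>} s \<partial>lborel)"
  proof (rule nn_integral_cong_AE)
    show "AE s in lborel. ennreal (1 / s) * indicator {\<alpha>..\<beta>} s = ennreal (1 / s) * indicator {\<alpha>..<\<beta>} s"
      using AE_lborel_singleton[of \<beta>] by eventually_elim (auto simp: indicator_def)
  qed
  ultimately show ?thesis by simp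
qed

text \<open>The exponential tames the growth of g up to the cutoff, at the price of a constant that
  is not sharp.\<close>

lemma profile_crude:
  assumes "amplitude g c"
  shows "\<exists>K. 0 \<le> K \<and> (\<forall>l v. 0 < v \<longrightarrow> v \<le> 1 \<longrightarrow> 1 < l * v \<longrightarrow> \<bar>profile a g l v\<bar> \<le> K * v powr a)"
proof -
  obtain K j where K: "0 \<le> K \<and> (\<forall>l v. 0 < v \<longrightarrow> v \<le> 1 \<longrightarrow> 1 < l * v \<longrightarrow> \<bar>g l v\<bar> \<le> K * (1 + 1 / (l * v - 1)) ^ j)"
    using amplitude_bound[OF assms] by (elim exE)
  have "\<bar>profile a g l v\<bar> \<le> (K * real (j + 1) ^ (j + 1)) * v powr a" if v: "0 < v" "v \<le> 1" "1 < l * v" for l v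
  proof -
    define y where "y = 1 / (l * v - 1)"
    have y: "0 \<le> y" using v by (simp add: y_def)
    have "exp (- y) * \<bar>g l v\<bar> \<le> exp (- y) * (K * (1 + y) ^ j)"
      using K[THEN conjunct2, rule_format, OF v] by (intro mult_left_mono) (auto simp: y_def)
    also have "\<dots> \<le> exp (- y) * (K * (1 + y) ^ (j + 1))"
      using y K by (intro mult_left_mono power_increasing) auto
    also have "\<dots> = K * (exp (- y) * (1 + y) ^ (j + 1))" by simp
    also have "\<dots> \<le> K * real (j + 1) ^ (j + 1)" using K y by (intro mult_left_mono exp_power_bound) auto
    finally have "v powr a * (exp (- y) * \<bar>g l v\<bar>) \<le> v powr a * (K * real (j + 1) ^ (j + 1))" by (intro mult_left_mono) auto
    then show ?thesis using v by (simp add: profile_def abs_mult y_def mult_ac)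
  qed
  then show ?thesis using K by (intro exI[of _ "K * real (j + 1) ^ (j + 1)"]) simp
qed

text \<open>The level s of v powr a corresponds to v = s powr (1 / a) and, since a p = n - 1 in the
  application, to a volume of order s powr -p. The result is of order s powr -q, which against q s
  powr (q - 1) leaves 1 / s.\<close>

lemma Wint_lorw_scaled:
  assumes "0 < p" "0 < q" "0 \<le> K" "0 < s" "0 < a" "a * p = real k"
  shows "Wint (lorw p q) (ennreal (K * (1 / (s powr (1 / a))) ^ k)) = ennreal (p / q * K powr (q / p) * s powr (- q))"
proof -
  have "(1 / (s powr (1 / a))) ^ k = s powr (- p)"
  proof -
    have "(1 / (s powr (1 / a))) ^ k = (s powr (- (1 / a))) powr real k"
      using assms(4) by (simp add: powr_minus_divide powr_realpow)
    also have "\<dots> = s powr (- p)" using assms(5) by (simp add: powr_powr flip: assms(6))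
    finally show ?thesis .
  qed
  then have "Wint (lorw p q) (ennreal (K * (1 / (s powr (1 / a))) ^ k)) = ennreal (p / q * (K * s powr (- p)) powr (q / p))"
    using assms by (simp add: Wint_lorw)
  also have "(K * s powr (- p)) powr (q / p) = K powr (q / p) * s powr (- q)"
    using assms by (simp add: powr_mult powr_powr)
  finally show ?thesis by (simp add: mult.assoc)
qed

text \<open>\<open>J k\<close> is the contribution of the levels where both \<open>v\<close> and \<open>1 / (2\<^sup>k v - 1)\<close> are small. There the
  amplitude is within \<open>\<epsilon>\<close> of its limit \<open>c\<close>. As \<open>V{v > w}\<close> has order \<open>w powr - (n - 1)\<close> and \<open>a p = n - 1\<close>, \<open>J k\<close>
  grows like a logarithm of \<open>2\<^sup>k\<close> and dominates the rest.\<close>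
lemma sharp_estimate:
  assumes pq: "1 < p" "1 < q" and n: "2 \<le> CARD('n)" and a: "a = (real CARD('n) - 1) / p"
    and g: "amplitude g c" and C: "C = \<bar>c\<bar>" and e: "0 < \<epsilon>" "\<epsilon> < 1"
  shows "\<exists>K0\<ge>0. \<exists>J. (\<forall>k\<ge>1. lor p q (test_fn a g (2 ^ k) :: real^'n \<Rightarrow> real) \<le> ennreal K0 + ennreal ((C + \<epsilon>) powr q) * J k)
    \<and> (\<forall>k\<ge>1. ennreal ((1 - \<epsilon>) powr q) * J k \<le> lor p q (test_fn a (\<lambda>l v. 1) (2 ^ k) :: real^'n \<Rightarrow> real))
    \<and> (\<forall>B. \<exists>k\<ge>1. ennreal B \<le> J k)"
proof -
  let ?N = "CARD('n) - 1"
  have N: "real ?N = real CARD('n) - 1" using n by simp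
  have a0: "0 < a" using pq n by (simp add: a)
  have ap: "a * p = real ?N" using pq n by (simp add: a)
  have aq: "real ?N * (q / p) = a * q" using pq n by (simp add: a)
  obtain KE where KE: "0 \<le> KE \<and> (\<forall>l v. 0 < v \<longrightarrow> v \<le> 1 \<longrightarrow> 1 < l * v \<longrightarrow> \<bar>profile a g l v\<bar> \<le> KE * v powr a)"
    using profile_crude[OF g, of a] by (elim exE)
  define K1 where "K1 = max KE (C + 1)"
  have K1: "0 < K1" "C + \<epsilon> \<le> K1" using e C by (auto simp: K1_def max_def)
  have crude: "\<bar>profile a g l v\<bar> \<le> K1 * v powr a" if "0 < v" "v \<le> 1" "1 < l * v" for l v
    using KE[THEN conjunct2, rule_format, OF that] mult_right_mono[of KE K1 "v powr a"] by (simp add: K1_def)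
  obtain K2 where K2: "0 \<le> K2 \<and> (\<forall>l v. 0 < v \<longrightarrow> v \<le> 1 \<longrightarrow> 1 < l * v \<longrightarrow> 1 / (l * v - 1) \<le> 1 \<longrightarrow> \<bar>g l v - c\<bar> \<le> K2 * (v + 1 / (l * v - 1)))"
    using amplitude_asymptotic[OF g] by (elim exE)
  \<comment> \<open>The bound 1 / 4 serves \<open>Vol_lower\<close>, the bound \<epsilon> gives exp
    (- y) >= 1 - \<epsilon>, and the last one makes the error K2 (v + y) at most \<epsilon>.\<close>
  define \<eta> where "\<eta> = min (1 / 4) (min \<epsilon> (\<epsilon> / (2 * K2 + 1)))"
  have \<eta>: "0 < \<eta>" "\<eta> \<le> 1 / 4" "\<eta> \<le> \<epsilon>"
  proof -
    show "0 < \<eta>" using e K2 by (auto simp: \<eta>_def)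
    show "\<eta> \<le> 1 / 4" unfolding \<eta>_def by (rule min.cobounded1)
    show "\<eta> \<le> \<epsilon>" by (simp add: \<eta>_def)
  qed
  have K2\<eta>: "K2 * (2 * \<eta>) \<le> \<epsilon>"
  proof -
    have "\<eta> \<le> \<epsilon> / (2 * K2 + 1)" by (simp add: \<eta>_def)
    then have "\<eta> * (2 * K2 + 1) \<le> \<epsilon>" using K2 by (simp add: pos_le_divide_eq)
    then show ?thesis using \<eta>(1) by (simp add: algebra_simps)
  qed
  \<comment> \<open>The condition Z < l v ensures y <= \<eta>.\<close>
  define Z where "Z = 1 + 1 / \<eta>"
  have Z: "1 < Z" using \<eta> by (simp add: Z_def)
  have y_small: "1 < l * v \<and> 1 / (l * v - 1) \<le> \<eta>" if "Z < l * v" for l v :: real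
  proof -
    have "1 / \<eta> < l * v - 1" using that by (simp add: Z_def)
    moreover have "0 < 1 / \<eta>" using \<eta> by simp
    ultimately have "0 < l * v - 1" "1 < \<eta> * (l * v - 1)" using \<eta> by (linarith, simp add: field_simps)
    then show ?thesis by (simp add: divide_le_eq)
  qed
  have fine: "\<bar>profile a g l v\<bar> \<le> (C + \<epsilon>) * v powr a" if v: "0 < v" "v \<le> \<eta>" "Z < l * v" for l v
  proof -
    have y: "1 < l * v" "1 / (l * v - 1) \<le> \<eta>" using y_small[OF v(3)] by auto
    have "\<bar>g l v - c\<bar> \<le> K2 * (v + 1 / (l * v - 1))"
    proof -
      have "v \<le> 1" "1 / (l * v - 1) \<le> 1" using v(2) y(2) \<eta>(2) by linarith+
      then show ?thesis using K2[THEN conjunct2, rule_format, OF v(1) _ y(1)] by blast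
    qed
    also have "\<dots> \<le> K2 * (2 * \<eta>)" using K2 v y by (intro mult_left_mono) auto
    finally have "\<bar>g l v\<bar> \<le> C + \<epsilon>" using K2\<eta> C by linarith
    moreover have "exp (- (1 / (l * v - 1))) \<le> 1" using y by simp
    ultimately have "exp (- (1 / (l * v - 1))) * \<bar>g l v\<bar> \<le> 1 * (C + \<epsilon>)" by (intro mult_mono') auto
    then have "v powr a * (exp (- (1 / (l * v - 1))) * \<bar>g l v\<bar>) \<le> v powr a * (C + \<epsilon>)" by (intro mult_left_mono) auto
    then show ?thesis using y by (simp add: profile_def abs_mult mult_ac)
  qed
  have below: "(1 - \<epsilon>) * v powr a \<le> \<bar>profile a (\<lambda>l v. 1) l v\<bar>" if v: "0 < v" "Z < l * v" for l v
  proof -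
    have y: "1 < l * v" "1 / (l * v - 1) \<le> \<eta>" using y_small[OF v(2)] by auto
    have "1 - \<epsilon> \<le> 1 + - (1 / (l * v - 1))" using y \<eta> by linarith
    also have "\<dots> \<le> exp (- (1 / (l * v - 1)))" by (rule exp_ge_add_one_self)
    finally have "(1 - \<epsilon>) * v powr a \<le> exp (- (1 / (l * v - 1))) * v powr a" by (intro mult_right_mono) auto
    then show ?thesis using y by (simp add: profile_def mult_ac)
  qed
  have root: "s powr (1 / a) < v \<longleftrightarrow> s < v powr a" if "0 < s" "0 < v" for s v :: real
  proof
    assume "s powr (1 / a) < v"
    then have "(s powr (1 / a)) powr a < v powr a" using a0 that by (intro powr_less_mono2) auto
    then show "s < v powr a" using a0 that by (simp add: powr_powr)
  next
    assume "s < v powr a"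
    then have "s powr (1 / a) < (v powr a) powr (1 / a)" using a0 that by (intro powr_less_mono2) auto
    then show "s powr (1 / a) < v" using a0 that by (simp add: powr_powr)
  qed
  obtain KV where KV: "0 < KV" "\<And>k. Vol TYPE('n) (1 / 2 ^ k) \<le> ennreal (KV * (2 ^ k) ^ ?N)"
    using Vol_dyadic[OF n] by blast
  obtain \<kappa> where \<kappa>: "0 < \<kappa>" "\<And>w. 0 < w \<Longrightarrow> w \<le> 1 / 4 \<Longrightarrow> ennreal (\<kappa> * (1 / w) ^ ?N) \<le> Vol TYPE('n) w"
    using Vol_lower[OF n] by blast
  obtain v0 where v0: "Vol TYPE('n) \<eta> = ennreal v0" "0 \<le> v0" using Vol_fin[OF n \<eta>(1)] by (cases "Vol TYPE('n) \<eta>") auto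
  define W where "W s = Wint (lorw p q) (Vol TYPE('n) (s powr (1 / a)))" for s
  have [measurable]: "W \<in> borel_measurable borel" unfolding W_def by measurable
  \<comment> \<open>\<alpha> k and \<beta> are the values of v powr a at v = Z / 2^k and at v =
    \<eta>, the ends of the range where y and v are small.\<close>
  define \<alpha> where "\<alpha> k = (Z / 2 ^ k) powr a" for k :: nat
  define \<beta> where "\<beta> = \<eta> powr a"
  have \<alpha>0: "0 < \<alpha> k" for k using Z by (simp add: \<alpha>_def)
  define J where "J k = (\<integral>\<^sup>+s. ennreal (q * s powr (q - 1)) * indicator {0<..} s * (indicator {\<alpha> k..<\<beta>} s * W s) \<partial>lborel)" for k
  \<comment> \<open>The contributions outside that range. They are bounded in k: the powers of 2^k
    in \<alpha> k powr q and in the volume of the support cancel, since (n - 1) q / p = a q.\<close>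
  define K0 where "K0 = K1 powr q * Z powr (a * q) * (p / q * KV powr (q / p)) + K1 powr q * (p / q * v0 powr (q / p))"
  have K0: "0 \<le> K0" using pq K1 KV by (simp add: K0_def)
  have upper: "lor p q (test_fn a g (2 ^ k) :: real^'n \<Rightarrow> real) \<le> ennreal K0 + ennreal ((C + \<epsilon>) powr q) * J k" if k: "1 \<le> k" for k
  proof -
    define l where "l = (2 ^ k :: real)"
    have l: "1 < l" using k by (simp add: l_def)
    let ?f = "test_fn a g l :: real^'n \<Rightarrow> real"
    define D where "D = C + \<epsilon>"
    have D: "0 < D" using e C by (simp add: D_def add_nonneg_pos)
    have [measurable]: "?f \<in> borel_measurable borel" by (rule C0inf_measurable[OF test_fn_C0inf[OF g l]])
    have f_pos: "0 < bdef x \<and> bdef x \<le> 1 \<and> 1 < l * bdef x" if "s < \<bar>?f x\<bar>" "0 < s" for s and x :: "real^'n"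
      using that profile_pos[OF _ l, of "bdef x"] bdef_le_1[of x] by (auto simp: test_fn_def profile_def split: if_splits)
    \<comment> \<open>Above this level the crude bound already forces Z < l v.\<close>
    define s1 where "s1 = K1 * \<alpha> k"
    have s10: "0 < s1" using K1 \<alpha>0 by (simp add: s1_def)
    have c1: "dfun ?f s \<le> Vol TYPE('n) (1 / l)" if "0 < s" for s
      unfolding dfun_def Vol_def
    proof (intro emeasure_mono subsetI)
      fix x :: "real^'n" assume "x \<in> {x. s < \<bar>?f x\<bar>}"
      then have "1 < l * bdef x" using f_pos[of s x] that by auto
      then show "x \<in> {x. 1 / l < bdef x}" using l by (simp add: field_simps)
    qed auto
    have big: "Z < l * bdef x" if "s1 \<le> s" "s < \<bar>?f x\<bar>" for s and x :: "real^'n"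
    proof -
      have v: "0 < bdef x" "bdef x \<le> 1" "1 < l * bdef x" using f_pos[OF that(2)] that s10 by auto
      have "K1 * \<alpha> k < K1 * bdef x powr a" using crude[OF v] that by (simp add: s1_def test_fn_def)
      then have "(Z / l) powr a < bdef x powr a" using K1 by (simp add: \<alpha>_def l_def)
      then have "Z / l < bdef x" using v a0 by (metis less_imp_le not_le powr_mono2)
      then show ?thesis using l by (simp add: field_simps)
    qed
    have c2: "dfun ?f s \<le> Vol TYPE('n) ((s / D) powr (1 / a))" if s: "s1 \<le> s" "s < D * \<beta>" for s
      unfolding dfun_def Vol_def
    proof (intro emeasure_mono subsetI)
      fix x :: "real^'n" assume "x \<in> {x. s < \<bar>?f x\<bar>}"
      then have x: "s < \<bar>?f x\<bar>" by simp
      have v: "0 < bdef x" "bdef x \<le> 1" "1 < l * bdef x" using f_pos[OF x] s s10 by auto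
      have "s / D < bdef x powr a"
      proof (cases "bdef x \<le> \<eta>")
        case True
        have "s < D * bdef x powr a" using fine[OF v(1) True big[OF s(1) x]] x by (simp add: test_fn_def D_def)
        then show ?thesis using D by (simp add: field_simps)
      next
        case False
        then have "\<beta> \<le> bdef x powr a" unfolding \<beta>_def using \<eta> a0 by (intro powr_mono2) auto
        moreover have "s / D < \<beta>" using s D by (simp add: field_simps)
        ultimately show ?thesis by simp
      qed
      then show "x \<in> {x. (s / D) powr (1 / a) < bdef x}" using root[of "s / D" "bdef x"] v s s10 D by simp
    qed auto
    have c3: "dfun ?f s \<le> Vol TYPE('n) \<eta>" if s: "s1 \<le> s" "D * \<beta> \<le> s" for s
      unfolding dfun_def Vol_def
    proof (intro emeasure_mono subsetI)
      fix x :: "real^'n" assume "x \<in> {x. s < \<bar>?f x\<bar>}"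
      then have x: "s < \<bar>?f x\<bar>" by simp
      have v: "0 < bdef x" "bdef x \<le> 1" "1 < l * bdef x" using f_pos[OF x] s s10 by auto
      show "x \<in> {x. \<eta> < bdef x}"
      proof (rule ccontr)
        assume "x \<notin> {x. \<eta> < bdef x}"
        then have le: "bdef x \<le> \<eta>" by simp
        have "s < D * bdef x powr a" using fine[OF v(1) le big[OF s(1) x]] x by (simp add: test_fn_def D_def)
        also have "\<dots> \<le> D * \<beta>" unfolding \<beta>_def using le v a0 D by (intro mult_left_mono powr_mono2) auto
        finally show False using s by simp
      qed
    qed auto
    have c4: "dfun ?f s = 0" if "K1 \<le> s" for s
    proof -
      have "\<not> s < \<bar>?f x\<bar>" for x
      proof
        assume x: "s < \<bar>?f x\<bar>"
        have v: "0 < bdef x" "bdef x \<le> 1" "1 < l * bdef x" using f_pos[OF x] that K1 by auto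
        have "bdef x powr a \<le> 1 powr a" using v a0 by (intro powr_mono2) auto
        then have "K1 * bdef x powr a \<le> K1 * 1" using K1 by (intro mult_left_mono) auto
        then show False using crude[OF v] x that by (simp add: test_fn_def)
      qed
      then have "{x. s < \<bar>?f x\<bar>} = {}" by auto
      then show ?thesis by (simp add: dfun_def)
    qed
    have W0: "Wint w 0 = 0" for w by (simp add: Wint_def)
    \<comment> \<open>Low levels are bounded by the volume of the whole support, middle levels by
      the sharp asymptotics, and high levels by the fixed volume where v > \<eta>.\<close>
    let ?T1 = "\<lambda>s. ennreal (q * s powr (q - 1)) * indicator {0<..<s1} s * Wint (lorw p q) (Vol TYPE('n) (1 / l))"
    let ?F = "\<lambda>s. indicator {s1..<D * \<beta>} s * W (s / D)"
    let ?T2 = "\<lambda>s. ennreal (q * s powr (q - 1)) * indicator {0<..} s * ?F s"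
    let ?T3 = "\<lambda>s. ennreal (q * s powr (q - 1)) * indicator {0<..<K1} s * Wint (lorw p q) (Vol TYPE('n) \<eta>)"
    have "lor p q ?f \<le> (\<integral>\<^sup>+s. ?T1 s + (?T2 s + ?T3 s) \<partial>lborel)"
      unfolding lor_def
    proof (rule nn_integral_mono)
      fix s :: real
      let ?L = "ennreal (q * s powr (q - 1)) * indicator {0<..} s * Wint (lorw p q) (dfun ?f s)"
      consider "s \<le> 0" | "0 < s" "s < s1" | "s1 \<le> s" "s < D * \<beta>" | "s1 \<le> s" "D * \<beta> \<le> s" "s < K1" | "s1 \<le> s" "K1 \<le> s" by linarith
      then show "?L \<le> ?T1 s + (?T2 s + ?T3 s)"
      proof cases
        case 2
        then have "?L \<le> ?T1 s" using c1 by (auto intro!: mult_left_mono Wint_mono)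
        then show ?thesis by (rule order_trans) simp
      next
        case 3
        then have "?L \<le> ?T2 s" using c2 s10 by (auto simp: W_def intro!: mult_left_mono Wint_mono)
        then show ?thesis by (rule order_trans) (simp add: add_increasing)
      next
        case 4
        then have "?L \<le> ?T3 s" using c3 s10 by (auto intro!: mult_left_mono Wint_mono)
        then show ?thesis by (rule order_trans) (simp add: add_increasing)
      next
        case 5
        then show ?thesis by (simp add: c4 W0)
      qed simp
    qed
    also have "\<dots> = integral\<^sup>N lborel ?T1 + (integral\<^sup>N lborel ?T2 + integral\<^sup>N lborel ?T3)"
      by (simp add: nn_integral_add)
    also have "integral\<^sup>N lborel ?T1 = ennreal (s1 powr q) * Wint (lorw p q) (Vol TYPE('n) (1 / l))"
      using s10 pq by (subst nn_integral_multc) (auto simp: nn_integral_powr)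
    also have "integral\<^sup>N lborel ?T3 = ennreal (K1 powr q) * Wint (lorw p q) (Vol TYPE('n) \<eta>)"
      using K1 pq by (subst nn_integral_multc) (auto simp: nn_integral_powr)
    also have "integral\<^sup>N lborel ?T2 = ennreal (D powr q) * (\<integral>\<^sup>+s. ennreal (q * s powr (q - 1)) * indicator {0<..} s * ?F (D * s) \<partial>lborel)"
      by (rule nn_integral_scale[OF _ D]) measurable
    also have "ennreal (s1 powr q) * Wint (lorw p q) (Vol TYPE('n) (1 / l)) + (ennreal (D powr q) * (\<integral>\<^sup>+s. ennreal (q * s powr (q - 1)) * indicator {0<..} s * ?F (D * s) \<partial>lborel)
        + ennreal (K1 powr q) * Wint (lorw p q) (Vol TYPE('n) \<eta>))
      \<le> ennreal (K1 powr q * Z powr (a * q) * (p / q * KV powr (q / p))) + (ennreal (D powr q) * J k + ennreal (K1 powr q * (p / q * v0 powr (q / p))))"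
    proof (intro add_mono)
      have "Wint (lorw p q) (Vol TYPE('n) (1 / l)) \<le> Wint (lorw p q) (ennreal (KV * l ^ ?N))"
        using KV(2)[of k] by (intro Wint_mono) (simp add: l_def)
      also have "\<dots> = ennreal (p / q * (KV * l ^ ?N) powr (q / p))" by (rule Wint_lorw) (use pq KV l in auto)
      finally have "ennreal (s1 powr q) * Wint (lorw p q) (Vol TYPE('n) (1 / l)) \<le> ennreal (s1 powr q) * ennreal (p / q * (KV * l ^ ?N) powr (q / p))"
        by (rule mult_left_mono) simp
      also have "\<dots> = ennreal (s1 powr q * (p / q * (KV * l ^ ?N) powr (q / p)))" by (rule ennreal_mult'[symmetric]) simp
      also have "s1 powr q * (p / q * (KV * l ^ ?N) powr (q / p)) = K1 powr q * Z powr (a * q) * (p / q * KV powr (q / p))"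
      proof -
        have "(l ^ ?N) powr (q / p) = l powr (a * q)"
        proof -
          have "(l ^ ?N) powr (q / p) = (l powr real ?N) powr (q / p)" using l by (simp only: powr_realpow)
          also have "\<dots> = l powr (real ?N * (q / p))" by (rule powr_powr)
          finally show ?thesis by (simp only: aq)
        qed
        moreover have "s1 powr q = K1 powr q * (Z powr (a * q) / l powr (a * q))"
          using K1 Z l by (simp add: s1_def \<alpha>_def powr_mult powr_powr powr_divide flip: l_def)
        ultimately show ?thesis using KV l by (simp add: powr_mult)
      qed
      finally show "ennreal (s1 powr q) * Wint (lorw p q) (Vol TYPE('n) (1 / l)) \<le> ennreal (K1 powr q * Z powr (a * q) * (p / q * KV powr (q / p)))" .
      have "ennreal (K1 powr q) * Wint (lorw p q) (Vol TYPE('n) \<eta>) = ennreal (K1 powr q) * ennreal (p / q * v0 powr (q / p))"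
        unfolding v0(1) by (subst Wint_lorw) (use pq v0 in auto)
      also have "\<dots> = ennreal (K1 powr q * (p / q * v0 powr (q / p)))" by (rule ennreal_mult'[symmetric]) simp
      finally show "ennreal (K1 powr q) * Wint (lorw p q) (Vol TYPE('n) \<eta>) \<le> ennreal (K1 powr q * (p / q * v0 powr (q / p)))" by simp
      show "ennreal (D powr q) * (\<integral>\<^sup>+s. ennreal (q * s powr (q - 1)) * indicator {0<..} s * ?F (D * s) \<partial>lborel) \<le> ennreal (D powr q) * J k"
      proof (intro mult_left_mono)
        show "(\<integral>\<^sup>+s. ennreal (q * s powr (q - 1)) * indicator {0<..} s * ?F (D * s) \<partial>lborel) \<le> J k"
          unfolding J_def
        proof (intro nn_integral_mono mult_left_mono)
          fix s :: real
          have "\<alpha> k * D \<le> s1" unfolding s1_def using K1 \<alpha>0[of k] by (simp add: D_def mult.commute mult_left_mono)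
          then have ab: "\<alpha> k \<le> s \<and> s < \<beta>" if "s1 \<le> D * s" "D * s < D * \<beta>"
            using that D by (simp add: mult.commute) (metis mult_le_cancel_left_pos order_trans)
          have Ds: "D * s / D = s" using D by simp
          show "?F (D * s) \<le> indicator {\<alpha> k..<\<beta>} s * W s"
          proof (cases "s1 \<le> D * s \<and> D * s < D * \<beta>")
            case True
            then have "indicator {s1..<D * \<beta>} (D * s) = (1 :: ennreal)" "indicator {\<alpha> k..<\<beta>} s = (1 :: ennreal)" using ab by auto
            then show ?thesis by (simp only: Ds order_refl)
          next
            case False
            then have "indicator {s1..<D * \<beta>} (D * s) = (0 :: ennreal)" by auto
            then show ?thesis by (simp only: mult_zero_left zero_le)
          qed
        qed auto
      qed simp
    qed
    also have "\<dots> = ennreal K0 + ennreal (D powr q) * J k"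
    proof -
      have "ennreal K0 = ennreal (K1 powr q * Z powr (a * q) * (p / q * KV powr (q / p))) + ennreal (K1 powr q * (p / q * v0 powr (q / p)))"
        unfolding K0_def using pq KV by (intro ennreal_plus) auto
      then show ?thesis by (simp add: add_ac)
    qed
    finally show ?thesis by (simp add: l_def D_def)
  qed
  have lower: "ennreal ((1 - \<epsilon>) powr q) * J k \<le> lor p q (test_fn a (\<lambda>l v. 1) (2 ^ k) :: real^'n \<Rightarrow> real)" if k: "1 \<le> k" for k
  proof -
    define l where "l = (2 ^ k :: real)"
    have l: "1 < l" using k by (simp add: l_def)
    let ?u = "test_fn a (\<lambda>l v. 1) l :: real^'n \<Rightarrow> real"
    have [measurable]: "?u \<in> borel_measurable borel" by (rule C0inf_measurable[OF test_fn_C0inf[OF amplitude.const l]])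
    have D: "0 < 1 - \<epsilon>" using e by simp
    have "lor p q ?u = ennreal ((1 - \<epsilon>) powr q) * (\<integral>\<^sup>+s. ennreal (q * s powr (q - 1)) * indicator {0<..} s * Wint (lorw p q) (dfun ?u ((1 - \<epsilon>) * s)) \<partial>lborel)"
      unfolding lor_def by (rule nn_integral_scale[OF _ D]) measurable
    moreover have "J k \<le> (\<integral>\<^sup>+s. ennreal (q * s powr (q - 1)) * indicator {0<..} s * Wint (lorw p q) (dfun ?u ((1 - \<epsilon>) * s)) \<partial>lborel)"
      unfolding J_def
    proof (intro nn_integral_mono mult_left_mono)
      fix s :: real
      show "indicator {\<alpha> k..<\<beta>} s * W s \<le> Wint (lorw p q) (dfun ?u ((1 - \<epsilon>) * s))"
      proof (cases "\<alpha> k \<le> s \<and> s < \<beta>")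
        case True
        have s0: "0 < s" using True \<alpha>0[of k] by linarith
        have "Vol TYPE('n) (s powr (1 / a)) \<le> dfun ?u ((1 - \<epsilon>) * s)"
          unfolding dfun_def Vol_def
        proof (intro emeasure_mono subsetI)
          fix x :: "real^'n" assume "x \<in> {x. s powr (1 / a) < bdef x}"
          then have x: "s powr (1 / a) < bdef x" by simp
          have v: "0 < bdef x" using x powr_ge_zero[of s "1 / a"] by linarith
          have sv: "s < bdef x powr a" using root[OF s0 v] x by simp
          then have "(Z / l) powr a < bdef x powr a" using True by (simp add: \<alpha>_def l_def)
          then have "Z / l < bdef x" using v a0 by (metis less_imp_le not_le powr_mono2)
          then have "Z < l * bdef x" using l by (simp add: field_simps)
          then have "(1 - \<epsilon>) * bdef x powr a \<le> \<bar>?u x\<bar>" using below[OF v] by (simp add: test_fn_def)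
          moreover have "(1 - \<epsilon>) * s < (1 - \<epsilon>) * bdef x powr a" using sv D by simp
          ultimately show "x \<in> {x. (1 - \<epsilon>) * s < \<bar>?u x\<bar>}" by simp
        qed auto
        then show ?thesis using True by (simp add: W_def Wint_mono)
      qed auto
    qed auto
    ultimately show ?thesis by (simp add: mult_left_mono l_def)
  qed
  have unb: "\<exists>k\<ge>1. ennreal B \<le> J k" for B
  proof -
    \<comment> \<open>On the range defining J k the integrand is at least c0 / s, so J k is at least
      c0 a (ln \<eta> - ln (Z / 2^k)), which grows linearly in k.\<close>
    define c0 where "c0 = p * \<kappa> powr (q / p)"
    have c0: "0 < c0" using pq \<kappa> by (simp add: c0_def)
    have "\<exists>k::nat. max (B / (c0 * a) + ln Z - ln \<eta>) (ln Z - ln \<eta>) + 1 < real k * ln 2"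
      using reals_Archimedean3[of "ln 2 :: real"] by simp
    then obtain k :: nat where k: "max (B / (c0 * a) + ln Z - ln \<eta>) (ln Z - ln \<eta>) + 1 < real k * ln 2" by blast
    have k1: "1 \<le> k"
    proof (rule ccontr)
      assume "\<not> 1 \<le> k"
      then have "k = 0" by simp
      moreover have "0 \<le> ln Z - ln \<eta>" using Z \<eta> by simp
      ultimately show False using k by simp
    qed
    have lk: "ln (Z / 2 ^ k) = ln Z - real k * ln 2" using Z by (simp add: ln_div ln_realpow)
    have lt: "Z / 2 ^ k < \<eta>"
    proof -
      have "ln (Z / 2 ^ k) < ln \<eta>" using k unfolding lk by linarith
      then show ?thesis using Z \<eta> by simp
    qed
    have ab: "\<alpha> k < \<beta>" unfolding \<alpha>_def \<beta>_def using lt Z a0 by (intro powr_less_mono2) auto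
    have "ennreal B \<le> ennreal (c0 * (ln \<beta> - ln (\<alpha> k)))"
    proof (rule ennreal_leI)
      have "ln \<beta> - ln (\<alpha> k) = a * (ln \<eta> - ln (Z / 2 ^ k))" unfolding \<alpha>_def \<beta>_def using Z \<eta> by (simp add: ln_powr algebra_simps)
      moreover have "B / (c0 * a) \<le> ln \<eta> - ln (Z / 2 ^ k)" using k unfolding lk by linarith
      then have "B \<le> (c0 * a) * (ln \<eta> - ln (Z / 2 ^ k))" using c0 a0 by (simp add: divide_le_eq mult.commute)
      ultimately show "B \<le> c0 * (ln \<beta> - ln (\<alpha> k))" by (simp add: mult.assoc)
    qed
    also have "\<dots> = ennreal c0 * (\<integral>\<^sup>+s. ennreal (1 / s) * indicator {\<alpha> k..<\<beta>} s \<partial>lborel)"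
      unfolding nn_integral_inverse[OF \<alpha>0 ab] by (rule ennreal_mult') (use c0 in simp)
    also have "\<dots> = (\<integral>\<^sup>+s. ennreal c0 * (ennreal (1 / s) * indicator {\<alpha> k..<\<beta>} s) \<partial>lborel)"
      by (rule nn_integral_cmult[symmetric]) measurable
    also have "\<dots> \<le> J k" unfolding J_def
    proof (rule nn_integral_mono)
      fix s :: real
      show "ennreal c0 * (ennreal (1 / s) * indicator {\<alpha> k..<\<beta>} s) \<le> ennreal (q * s powr (q - 1)) * indicator {0<..} s * (indicator {\<alpha> k..<\<beta>} s * W s)"
      proof (cases "\<alpha> k \<le> s \<and> s < \<beta>")
        case True
        have s0: "0 < s" using True \<alpha>0[of k] by linarith
        have "s powr (1 / a) < \<eta>" using root[OF s0 \<eta>(1)] True by (simp add: \<beta>_def)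
        then have "ennreal (\<kappa> * (1 / (s powr (1 / a))) ^ ?N) \<le> Vol TYPE('n) (s powr (1 / a))"
          using \<eta> s0 by (intro \<kappa>(2)) auto
        then have "Wint (lorw p q) (ennreal (\<kappa> * (1 / (s powr (1 / a))) ^ ?N)) \<le> W s" unfolding W_def by (rule Wint_mono)
        moreover have "Wint (lorw p q) (ennreal (\<kappa> * (1 / (s powr (1 / a))) ^ ?N)) = ennreal (p / q * \<kappa> powr (q / p) * s powr (- q))"
          by (rule Wint_lorw_scaled) (use pq \<kappa> s0 a0 ap in auto)
        ultimately have "ennreal (q * s powr (q - 1)) * ennreal (p / q * \<kappa> powr (q / p) * s powr (- q)) \<le> ennreal (q * s powr (q - 1)) * W s"
          by (intro mult_left_mono) auto
        moreover have "ennreal (q * s powr (q - 1)) * ennreal (p / q * \<kappa> powr (q / p) * s powr (- q)) = ennreal c0 * ennreal (1 / s)"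
        proof -
          have ss: "s powr (q - 1) * s powr (- q) = 1 / s" using s0 by (simp add: powr_diff powr_minus_divide)
          have "q * s powr (q - 1) * (p / q * \<kappa> powr (q / p) * s powr (- q)) = p * \<kappa> powr (q / p) * (s powr (q - 1) * s powr (- q))"
            using pq by simp
          then have "q * s powr (q - 1) * (p / q * \<kappa> powr (q / p) * s powr (- q)) = c0 * (1 / s)"
            by (simp only: ss c0_def)
          then show ?thesis using pq c0 by (subst (1 2) ennreal_mult'[symmetric]) auto
        qed
        ultimately show ?thesis using True s0 by simp
      qed auto
    qed
    finally show ?thesis using k1 by blast
  qed
  show ?thesis using K0 upper lower unb by blast
qed

text \<open>A small \<epsilon> brings the ratio of the main terms below C powr q + \<delta> / 2; a
  large k then makes J k so large that the bounded term K0 costs at most another \<delta> /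
  2.\<close>

lemma sharp_test_functions:
  assumes pq: "1 < p" "1 < q" and n: "2 \<le> CARD('n)" and \<delta>: "0 < \<delta>"
  shows "\<exists>u::real^'n \<Rightarrow> real. u \<in> C0inf \<and> lor p q u \<noteq> 0 \<and> lor p q (hnabla m u) \<le> ennreal (Cnmp CARD('n) m p powr q + \<delta>) * lor p q u"
proof -
  define a where "a = (real CARD('n) - 1) / p"
  define C where "C = Cnmp CARD('n) m p"
  have C: "0 < C" unfolding C_def by (rule Cnmp_pos[OF n pq(1)])
  obtain g c where g: "amplitude g c" "\<bar>c\<bar> = C" "\<forall>l>1. \<forall>x::real^'n. hnabla m (test_fn a (\<lambda>l v. 1) l) x \<le> \<bar>test_fn a g l x\<bar>"
    using hnabla_test_fn[OF pq(1) n, of m] unfolding a_def C_def by (elim exE conjE)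
  have "((\<lambda>\<epsilon>. ((C + \<epsilon>) / (1 - \<epsilon>)) powr q) \<longlongrightarrow> ((C + 0) / (1 - 0)) powr q) (at_right 0)"
    by (intro tendsto_intros) (use C in auto)
  then have "\<forall>\<^sub>F \<epsilon> in at_right 0. ((C + \<epsilon>) / (1 - \<epsilon>)) powr q < C powr q + \<delta> / 2"
    by (rule order_tendstoD) (use \<delta> in simp)
  moreover have "\<forall>\<^sub>F \<epsilon> in at_right 0. 0 < (\<epsilon>::real)" by (auto simp: eventually_at_right_less)
  moreover have "\<forall>\<^sub>F \<epsilon> in at_right 0. (\<epsilon>::real) < 1" by (rule eventually_at_right_real[of 0 1, THEN eventually_mono]) auto
  ultimately have "\<forall>\<^sub>F \<epsilon> in at_right 0. ((C + \<epsilon>) / (1 - \<epsilon>)) powr q < C powr q + \<delta> / 2 \<and> 0 < \<epsilon> \<and> \<epsilon> < 1"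
    by (intro eventually_conj)
  then obtain \<epsilon> where e: "((C + \<epsilon>) / (1 - \<epsilon>)) powr q < C powr q + \<delta> / 2" "0 < \<epsilon>" "\<epsilon> < 1"
    using eventually_happens'[OF trivial_limit_at_right_real] by blast
  obtain K0 J where K0: "0 \<le> K0" and up: "\<forall>k\<ge>1. lor p q (test_fn a g (2 ^ k) :: real^'n \<Rightarrow> real) \<le> ennreal K0 + ennreal ((C + \<epsilon>) powr q) * J k"
    and lo: "\<forall>k\<ge>1. ennreal ((1 - \<epsilon>) powr q) * J k \<le> lor p q (test_fn a (\<lambda>l v. 1) (2 ^ k) :: real^'n \<Rightarrow> real)"
    and unb: "\<forall>B. \<exists>k\<ge>1. ennreal B \<le> J k"
    using sharp_estimate[OF pq n a_def g(1) g(2)[symmetric] e(2,3)] by (elim exE conjE)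
  define D1 where "D1 = (C + \<epsilon>) powr q"
  define D2 where "D2 = (1 - \<epsilon>) powr q"
  have D2: "0 < D2" using e by (simp add: D2_def)
  have D12: "D1 \<le> (C powr q + \<delta> / 2) * D2"
  proof -
    have "D1 / D2 < C powr q + \<delta> / 2" using e C by (simp add: D1_def D2_def powr_divide)
    then show ?thesis using D2 by (simp add: field_simps)
  qed
  define B where "B = K0 / (\<delta> / 2 * D2) + 1"
  have B: "0 < B" using K0 \<delta> D2 by (simp add: B_def add_nonneg_pos)
  obtain k where k: "1 \<le> k" "ennreal B \<le> J k" using unb by blast
  define u where "u = (test_fn a (\<lambda>l v. 1) (2 ^ k) :: real^'n \<Rightarrow> real)"
  have l: "1 < (2::real) ^ k" using k by simp
  have u: "u \<in> C0inf" unfolding u_def by (rule test_fn_C0inf[OF amplitude.const l])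
  have gC: "(test_fn a g (2 ^ k) :: real^'n \<Rightarrow> real) \<in> C0inf" by (rule test_fn_C0inf[OF g(1) l])
  note [measurable] = C0inf_measurable(1)[OF gC]
  have lou: "ennreal D2 * J k \<le> lor p q u" using lo k(1) by (simp add: u_def D2_def)
  have "lor p q u \<noteq> 0"
  proof -
    have "0 < ennreal D2 * ennreal B" using D2 B by (simp add: ennreal_zero_less_mult_iff)
    also have "\<dots> \<le> ennreal D2 * J k" by (intro mult_left_mono k(2)) simp
    finally show ?thesis using lou by auto
  qed
  moreover have "lor p q (hnabla m u) \<le> ennreal (C powr q + \<delta>) * lor p q u"
  proof -
    have "lor p q (hnabla m u) \<le> lor p q (test_fn a g (2 ^ k) :: real^'n \<Rightarrow> real)"
    proof (rule lor_mono)
      fix s :: real assume "0 < s"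
      have "hnabla m u x \<le> \<bar>test_fn a g (2 ^ k) x\<bar>" for x unfolding u_def using g(3) l by blast
      then show "dfun (hnabla m u) s \<le> dfun (test_fn a g (2 ^ k) :: real^'n \<Rightarrow> real) s"
        unfolding dfun_def by (intro emeasure_mono) (auto simp: hnabla_nonneg intro: less_le_trans)
    qed
    also have "\<dots> \<le> ennreal K0 + ennreal D1 * J k" using up k(1) by (simp add: D1_def)
    also have "\<dots> \<le> ennreal (\<delta> / 2 * D2) * J k + ennreal ((C powr q + \<delta> / 2) * D2) * J k"
    proof (intro add_mono mult_right_mono ennreal_leI D12)
      have "K0 \<le> \<delta> / 2 * D2 * B" using \<delta> D2 by (simp add: B_def field_simps)
      then have "ennreal K0 \<le> ennreal (\<delta> / 2 * D2 * B)" by (rule ennreal_leI)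
      also have "\<dots> = ennreal (\<delta> / 2 * D2) * ennreal B" using \<delta> D2 by (intro ennreal_mult') auto
      also have "\<dots> \<le> ennreal (\<delta> / 2 * D2) * J k" by (intro mult_left_mono k(2)) simp
      finally show "ennreal K0 \<le> ennreal (\<delta> / 2 * D2) * J k" .
    qed simp
    also have "\<dots> = ennreal (C powr q + \<delta>) * (ennreal D2 * J k)"
    proof -
      have "ennreal (\<delta> / 2 * D2) + ennreal ((C powr q + \<delta> / 2) * D2) = ennreal (\<delta> / 2 * D2 + (C powr q + \<delta> / 2) * D2)"
        using \<delta> D2 by (intro ennreal_plus[symmetric]) auto
      also have "\<delta> / 2 * D2 + (C powr q + \<delta> / 2) * D2 = (C powr q + \<delta>) * D2" by (simp add: algebra_simps)
      also have "ennreal ((C powr q + \<delta>) * D2) = ennreal (C powr q + \<delta>) * ennreal D2" using \<delta> by (intro ennreal_mult') auto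
      finally show ?thesis by (simp add: distrib_right[symmetric] mult.assoc)
    qed
    also have "\<dots> \<le> ennreal (C powr q + \<delta>) * lor p q u" by (intro mult_left_mono lou) simp
    finally show ?thesis .
  qed
  ultimately show ?thesis using u unfolding C_def by blast
qed

theorem theorem1p1:
  fixes m :: nat and p q :: real
  assumes "CARD('n::finite) \<ge> 2" and "m \<ge> 1" and "1 < p"
    and "if even m then 1 < q else 1 < q \<and> q \<le> p"
  shows "(\<forall>(u::real^'n \<Rightarrow> real) N. WmLpq m p q u N \<longrightarrow>
            N \<ge> ennreal (Cnmp CARD('n) m p powr q) * lorentz_qpow p q u)
       \<and> (INF uN \<in> {(u::real^'n \<Rightarrow> real, N). WmLpq m p q u N \<and> \<not> (AE x in hvol. u x = 0)}.
            snd uN / lorentz_qpow p q (fst uN)) = ennreal (Cnmp CARD('n) m p powr q)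
       \<and> (\<forall>(u::real^'n \<Rightarrow> real) N. WmLpq m p q u N \<and> \<not> (AE x in hvol. u x = 0) \<longrightarrow>
            N \<noteq> ennreal (Cnmp CARD('n) m p powr q) * lorentz_qpow p q u)"
proof -
  have q: "1 < q" and qp: "odd m \<Longrightarrow> q \<le> p" using assms(4) by (auto split: if_splits)
  define C where "C = Cnmp CARD('n) m p powr q"
  note W = WmLpq_Poincare[where 'n='n, OF _ assms(1,2,3) q qp, folded C_def]
  have ineq: "ennreal C * lorentz_qpow p q u \<le> N" if "WmLpq m p q u N" for u :: "real^'n \<Rightarrow> real" and N
    using W(3,4)[OF that] by simp
  have strict: "N \<noteq> ennreal C * lorentz_qpow p q u" if u: "WmLpq m p q u N" "\<not> (AE x in hvol. u x = 0)" for u :: "real^'n \<Rightarrow> real" and N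
  proof
    assume N: "N = ennreal C * lorentz_qpow p q u"
    obtain \<epsilon> where e: "0 < \<epsilon>" "ennreal C * lor p q u + ennreal \<epsilon> \<le> N" using W(5)[OF u(1) _ u(2)] by blast
    have "N + ennreal \<epsilon> \<le> N + 0" using e(2) N W(3)[OF that(1)] by simp
    \<comment> \<open>Finiteness of N allows it to be cancelled, which leaves \<epsilon> <=
      0.\<close>
    moreover have "N \<noteq> top" using W(1)[OF that(1)] by simp
    ultimately have "ennreal \<epsilon> \<le> 0" by (simp only: ennreal_add_left_cancel_le) simp
    then show False using e(1) by simp
  qed
  let ?S = "{(u::real^'n \<Rightarrow> real, N). WmLpq m p q u N \<and> \<not> (AE x in hvol. u x = 0)}"
  have "(INF uN \<in> ?S. snd uN / lorentz_qpow p q (fst uN)) = ennreal C"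
  proof (rule antisym)
    show "ennreal C \<le> (INF uN \<in> ?S. snd uN / lorentz_qpow p q (fst uN))"
    proof (rule INF_greatest)
      fix uN assume "uN \<in> ?S"
      then obtain u N where uN: "uN = (u, N)" and u: "WmLpq m p q u N" "\<not> (AE x in hvol. u x = 0)" by auto
      have m: "u \<in> borel_measurable borel" using u(1) by (simp add: WmLpq_def)
      have "lor p q u \<noteq> 0" using lor_eq_0[OF assms(3) q m] u(2) by blast
      moreover have "lor p q u \<noteq> top" using W(2)[OF u(1)] by simp
      ultimately have "ennreal C = ennreal C * lor p q u / lor p q u" by (simp add: ennreal_mult_divide_eq)
      also have "\<dots> \<le> N / lor p q u" using W(4)[OF u(1)] by (rule divide_right_mono_ennreal)
      finally show "ennreal C \<le> snd uN / lorentz_qpow p q (fst uN)" using W(3)[OF u(1)] uN by simp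
    qed
    show "(INF uN \<in> ?S. snd uN / lorentz_qpow p q (fst uN)) \<le> ennreal C"
    proof (rule ennreal_le_epsilon)
      fix \<delta> :: real assume \<delta>: "0 < \<delta>"
      obtain u :: "real^'n \<Rightarrow> real" where u: "u \<in> C0inf" "lor p q u \<noteq> 0" "lor p q (hnabla m u) \<le> ennreal (C + \<delta>) * lor p q u"
        using sharp_test_functions[where 'n='n, OF assms(3) q assms(1) \<delta>, of m] unfolding C_def by blast
      have Wu: "WmLpq m p q u (lor p q (hnabla m u))" by (rule WmLpq_C0inf[OF u(1) assms(3) q])
      have nz: "\<not> (AE x in hvol. u x = 0)"
      proof
        assume ae: "AE x in hvol. u x = 0"
        have "dfun u s = 0" if "0 < s" for s
        proof -
          have "AE x in hvol. \<not> s < \<bar>u x\<bar>" using ae by eventually_elim (use that in simp)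
          then show ?thesis unfolding dfun_def
            using C0inf_measurable(1)[OF u(1)] by (subst (asm) AE_iff_measurable[OF _ refl]) auto
        qed
        then have "lor p q u = (\<integral>\<^sup>+s. 0 \<partial>(lborel :: real measure))"
          unfolding lor_def by (intro nn_integral_cong) (auto simp: indicator_def Wint_def)
        then show False using u(2) by simp
      qed
      have fin: "lor p q u \<noteq> top" using W(2)[OF Wu] by simp
      have "(INF uN \<in> ?S. snd uN / lorentz_qpow p q (fst uN)) \<le> lor p q (hnabla m u) / lor p q u"
        by (rule INF_lower2[of "(u, lor p q (hnabla m u))"]) (use Wu nz W(3)[OF Wu] in auto)
      also have "\<dots> \<le> ennreal (C + \<delta>) * lor p q u / lor p q u" by (rule divide_right_mono_ennreal[OF u(3)])
      also have "\<dots> = ennreal (C + \<delta>)" using u(2) fin by (simp add: ennreal_mult_divide_eq)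
      also have "\<dots> = ennreal C + ennreal \<delta>" using \<delta> by (simp add: C_def)
      finally show "(INF uN \<in> ?S. snd uN / lorentz_qpow p q (fst uN)) \<le> ennreal C + ennreal \<delta>" .
    qed
  qed
  then show ?thesis using ineq strict unfolding C_def by blast
qed

end
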